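(* Let $\lambda\in\mathbb R$ and let $\mathbf F\subset\mathcal P_2(\mathsf{TX})$ be a $\lambda$-dissipative MPVF such that for every $\mu\in\mathrm D(\mathbf F)$ there exist constants $M,\varepsilon>0$ such that $$\forall\,\varphi\in\mathrm{Cyl}(\mathsf X):\quad\sup_{\mathsf X}|\nabla\varphi|\le\varepsilon\ \Longrightarrow\ \exp^{\varphi}_\sharp\mu\in\mathrm D(\mathbf F),\quad|\mathbf F|_2(\exp^{\varphi}_\sharp\mu)<M.$$ Let $\mathcal I\subset\mathbb R$ be an interval. If $\mu:\mathcal I\to\mathrm D(\mathbf F)$ is a locally absolutely continuous $\lambda$-EVI solution for $\mathbf F$, with Wasserstein velocity field $\boldsymbol v$ and associated set $A(\mu)\subset\mathcal I$ of full Lebesgue measure (as in the context), then for every $t\in A(\mu)$ there exists $\Phi_t\in\overline{\mathrm{co}}(\overline{\mathbf F}[\mu_t])$ such that $$\boldsymbol v_t=\mathrm{pr}_{\mu_t}(\boldsymbol b_{\Phi_t}).$$ In particular, $\mu$ satisfies the relaxed barycentric property: for a.e. $t\in\mathcal I$ there exists $\Phi_t\in\overline{\mathrm{co}}(\overline{\mathbf F}[\mu_t])$ such that $$\frac{d}{dt}\int_{\mathsf X}\varphi\,d\mu_t=\int_{\mathsf{TX}}\langle\nabla\varphi(x),v\rangle\,d\Phi_t(x,v)\qquad\forall\,\varphi\in\mathrm{Cyl}(\mathsf X).\tag{$*$}$$ If moreover $\overline{\mathbf F}=\mathbf F$ and for every $\nu\in\mathrm D(\mathbf F)$ the section $\mathbf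 F[\nu]$ is a convex subset of $\mathcal P_2(\mathsf{TX})$, then $\mu$ satisfies the barycentric property: for a.e. $t\in\mathcal I$ there exists $\Phi_t\in\mathbf F[\mu_t]$ such that $( * )$ holds.
   Context: $\mathsf X$ is a separable real Hilbert space (possibly infinite dimensional) with norm $|\cdot|$ and scalar product $\langle\cdot,\cdot\rangle$. $\mathcal P_2(\mathsf X)$ is the set of Borel probability measures on $\mathsf X$ with finite second moment, endowed with the $L^2$-Wasserstein distance $W_2$. $\mathsf{TX}:=\mathsf X\times\mathsf X$ with points $(x,v)$; $\mathsf x(x,v):=x$, $\exp^t(x,v):=x+tv$ for $t\in\mathbb R$. $\mathcal P_2(\mathsf{TX})$ is the set of Borel probability measures $\Phi$ on $\mathsf{TX}$ with $\int(|x|^2+|v|^2)\,d\Phi<\infty$, and $|\Phi|_2^2:=\int|v|^2\,d\Phi(x,v)$. $\mathcal P_2^{sw}(\mathsf{TX})$ is $\mathcal P_2(\mathsf{TX})$ with the coarsest topology making $\Phi\mapsto\int\zeta\,d\Phi$ continuous for every $\zeta:\mathsf X\times\mathsf X\to\mathbb R$ which is sequentially continuous for (strong topology) $\times$ (weak topology) and such that for all $\varepsilon>0$ there is $A_\varepsilon\ge0$ with $|\zeta(x,v)|\le A_\varepsilon(1+|x|^2)+\varepsilon|v|^2$ for all $(x,v)$. Pairings: for $\Phi,\Psi\in\mathcal P_2(\mathsf{TX})$ and $\nu\in\mathcal P_2(\mathsf X)$ (the limits exist), $$[\Phi,\nu]_r:=\lim_{s\downarrow0}\frac{W_2^2(\exp^s_\sharp\Phi,\nu)-W_2^2(\mathsf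 x_\sharp\Phi,\nu)}{2s},\qquad [\Phi,\Psi]_r:=\lim_{s\downarrow0}\frac{W_2^2(\exp^s_\sharp\Phi,\exp^s_\sharp\Psi)-W_2^2(\mathsf x_\sharp\Phi,\mathsf x_\sharp\Psi)}{2s}.$$ A multivalued probability vector field (MPVF) is a nonempty subset $\mathbf F\subset\mathcal P_2(\mathsf{TX})$; $\mathrm D(\mathbf F):=\{\mathsf x_\sharp\Phi:\Phi\in\mathbf F\}$, $\mathbf F[\mu]:=\{\Phi\in\mathbf F:\mathsf x_\sharp\Phi=\mu\}$, $|\mathbf F|_2(\mu):=\inf\{|\Phi|_2:\Phi\in\mathbf F[\mu]\}$; $\overline{\mathrm D(\mathbf F)}$ is the closure in $(\mathcal P_2(\mathsf X),W_2)$. $\mathbf F$ is $\lambda$-dissipative if $[\Phi_0,\Phi_1]_r\le\lambda W_2^2(\mathsf x_\sharp\Phi_0,\mathsf x_\sharp\Phi_1)$ for all $\Phi_0,\Phi_1\in\mathbf F$. A $\lambda$-EVI solution for $\mathbf F$ on an interval $\mathcal I$ is a continuous curve $\mu:\mathcal I\to\overline{\mathrm D(\mathbf F)}$ such that for every $\Phi\in\mathbf F$, with $\nu=\mathsf x_\sharp\Phi$, one has $\frac12\frac{d}{dt}W_2^2(\mu_t,\nu)\le\lambda W_2^2(\mu_t,\nu)-[\Phi,\mu_t]_r$ in the sense of distributions in the interior of $\mathcal I$. $\mathrm{Cyl}(\mathsf X)$ is the set of functions $\psi\circ\pi$ with $\pi(x)=(\langle x,e_1\rangle,\dots,\langle x,e_d\rangle)$,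 $\{e_1,\dots,e_d\}$ orthonormal in $\mathsf X$, $\psi\in C_c^\infty(\mathbb R^d)$. For $\varphi\in\mathrm{Cyl}(\mathsf X)$, $\exp^{\varphi}:\mathsf X\to\mathsf X$ is the map $\exp^\varphi(x):=x+\nabla\varphi(x)$. Directional closure: $\overline{\mathbf F}[\mu]$ is the set of $\Phi\in\mathcal P_2(\mathsf{TX})$ for which there exist $\varphi\in\mathrm{Cyl}(\mathsf X)$, a sequence $r_n\in[0,+\infty)$, $r_n\downarrow0$, and $\Phi_n\in\mathbf F[\exp^{r_n\varphi}_\sharp\mu]$ with $\Phi_n\to\Phi$ in $\mathcal P_2^{sw}(\mathsf{TX})$. $\overline{\mathrm{co}}(\overline{\mathbf F}[\mu])$ is the set of limits in $\mathcal P_2^{sw}(\mathsf{TX})$ of sequences in the convex hull of $\overline{\mathbf F}[\mu]$. $\mathrm{Tan}_\mu\mathcal P_2(\mathsf X)$ is the closure of $\{\nabla\varphi:\varphi\in\mathrm{Cyl}(\mathsf X)\}$ in $L^2_\mu(\mathsf X;\mathsf X)$ and $\mathrm{pr}_\mu$ is the orthogonal projection of $L^2_\mu(\mathsf X;\mathsf X)$ onto it. The barycenter $\boldsymbol b_\Phi\in L^2_\mu(\mathsf X;\mathsf X)$ of $\Phi\in\mathcal P_2(\mathsf{TX})$ with $\mathsf x_\sharp\Phi=\mu$ is $\boldsymbol b_\Phi(x):=\int v\,d\Phi_x(v)$, where $(\Phi_x)_x$ is the disintegration of $\Phi$ with respect to $\mu$. For a locally absolutely continuous curve $\mu$ in $\mathcal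 P_2(\mathsf X)$, the Wasserstein velocity field is the Borel vector field $\boldsymbol v$, with $A(\mu)\subset\mathcal I$ a set of full Lebesgue measure, such that for every $t\in A(\mu)$: $\boldsymbol v_t\in\mathrm{Tan}_{\mu_t}\mathcal P_2(\mathsf X)$, $\int|\boldsymbol v_t|^2d\mu_t=\lim_{h\to0}W_2^2(\mu_{t+h},\mu_t)/h^2$, $\lim_{h\to0}W_2((\boldsymbol i_{\mathsf X}+h\boldsymbol v_t)_\sharp\mu_t,\mu_{t+h})/|h|=0$ ($\boldsymbol i_{\mathsf X}$ the identity map), and $\partial_t\mu_t+\nabla\cdot(\boldsymbol v_t\mu_t)=0$ in the sense of distributions; such $\boldsymbol v$ and $A(\mu)$ exist and $\boldsymbol v_t$ is unique in $L^2_{\mu_t}$ for $t\in A(\mu)$. *)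

theory Defs
  imports "HOL-Probability.Probability"
begin

text \<open>
  Throughout, the separable real Hilbert space \<open>X\<close> is a type of sort
  \<open>{real_inner, polish_space}\<close>, and \<open>TX = X \<times> X\<close> is the product type.
\<close>

section \<open>Probability measures, Wasserstein distance\<close>

definition P2 :: "'x::{real_inner, polish_space} measure set" where
  "P2 = {\<mu>. prob_space \<mu> \<and> sets \<mu> = sets borel \<and> integrable \<mu> (\<lambda>x. (norm x)\<^sup>2)}"

definition TP2 :: "('x::{real_inner, polish_space} \<times> 'x) measure set" where
  "TP2 = {\<Phi>. prob_space \<Phi> \<and> sets \<Phi> = sets borel \<and>
              integrable \<Phi> (\<lambda>(x, v). (norm x)\<^sup>2 + (norm v)\<^sup>2)}"

definition couplings ::
  "'x::{real_inner, polish_space} measure \<Rightarrow> 'x measure \<Rightarrow> ('x \<times> 'x) measure set" where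
  "couplings \<mu> \<nu> = {\<gamma>. prob_space \<gamma> \<and> sets \<gamma> = sets borel \<and>
                       distr \<gamma> borel fst = \<mu> \<and> distr \<gamma> borel snd = \<nu>}"

text \<open>Only used for measures in \<open>P2\<close>, where all the integrals below are finite.\<close>

definition W2 :: "'x::{real_inner, polish_space} measure \<Rightarrow> 'x measure \<Rightarrow> real" where
  "W2 \<mu> \<nu> = sqrt (INF \<gamma>\<in>couplings \<mu> \<nu>. \<integral>(x, y). (dist x y)\<^sup>2 \<partial>\<gamma>)"

definition base :: "('x::{real_inner, polish_space} \<times> 'x) measure \<Rightarrow> 'x measure" where
  "base \<Phi> = distr \<Phi> borel fst"

definition push_exp :: "real \<Rightarrow> ('x::{real_inner, polish_space} \<times> 'x) measure \<Rightarrow> 'x measure" where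
  "push_exp t \<Phi> = distr \<Phi> borel (\<lambda>(x, v). x + t *\<^sub>R v)"

definition vel_norm :: "('x::{real_inner, polish_space} \<times> 'x) measure \<Rightarrow> real" where
  "vel_norm \<Phi> = sqrt (\<integral>(x, v). (norm v)\<^sup>2 \<partial>\<Phi>)"

definition pairing_meas ::
  "('x::{real_inner, polish_space} \<times> 'x) measure \<Rightarrow> 'x measure \<Rightarrow> real" where
  "pairing_meas \<Phi> \<nu> =
     Lim (at_right 0) (\<lambda>s. ((W2 (push_exp s \<Phi>) \<nu>)\<^sup>2 - (W2 (base \<Phi>) \<nu>)\<^sup>2) / (2 * s))"

definition pairing ::
  "('x::{real_inner, polish_space} \<times> 'x) measure \<Rightarrow> ('x \<times> 'x) measure \<Rightarrow> real" where
  "pairing \<Phi> \<Psi> =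
     Lim (at_right 0) (\<lambda>s. ((W2 (push_exp s \<Phi>) (push_exp s \<Psi>))\<^sup>2
                           - (W2 (base \<Phi>) (base \<Psi>))\<^sup>2) / (2 * s))"


section \<open>The strong-weak topology\<close>

definition weak_lim :: "(nat \<Rightarrow> 'x::real_inner) \<Rightarrow> 'x \<Rightarrow> bool" where
  "weak_lim V v \<longleftrightarrow> (\<forall>w. (\<lambda>n. V n \<bullet> w) \<longlonglongrightarrow> v \<bullet> w)"

definition sw_test :: "('x::{real_inner, polish_space} \<times> 'x \<Rightarrow> real) set" where
  "sw_test = {\<zeta>.
     (\<forall>X V x v. X \<longlonglongrightarrow> x \<longrightarrow> weak_lim V v \<longrightarrow> (\<lambda>n. \<zeta> (X n, V n)) \<longlonglongrightarrow> \<zeta> (x, v)) \<and>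
     (\<forall>\<epsilon>>0. \<exists>A\<ge>0. \<forall>x v. \<bar>\<zeta> (x, v)\<bar> \<le> A * (1 + (norm x)\<^sup>2) + \<epsilon> * (norm v)\<^sup>2)}"

definition sw_topology :: "('x::{real_inner, polish_space} \<times> 'x) measure topology" where
  "sw_topology = topology_generated_by
     {{\<Phi> \<in> TP2. integral\<^sup>L \<Phi> \<zeta> \<in> U} | \<zeta> U. \<zeta> \<in> sw_test \<and> open U}"

lemma topspace_sw_topology [simp]: "topspace sw_topology = TP2"
proof -
  have "(\<lambda>_. 0) \<in> sw_test"
    by (auto simp: sw_test_def intro!: exI[of _ 0])
  then have "TP2 \<in> {{\<Phi> \<in> TP2. integral\<^sup>L \<Phi> \<zeta> \<in> U} | \<zeta> U. \<zeta> \<in> sw_test \<and> open U}"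
    by (intro CollectI exI[of _ "\<lambda>_. 0"] exI[of _ UNIV]) auto
  then show ?thesis
    unfolding sw_topology_def topology_generated_by_topspace by blast
qed


section \<open>Convexity of sets of measures\<close>

definition mix :: "real \<Rightarrow> 'a measure \<Rightarrow> 'a measure \<Rightarrow> 'a measure" where
  "mix t M N = measure_of (space M) (sets M)
     (\<lambda>A. ennreal (1 - t) * emeasure M A + ennreal t * emeasure N A)"

lemma emeasure_mix:
  assumes "sets M = sets N" "A \<in> sets M"
  shows "emeasure (mix t M N) A = ennreal (1 - t) * emeasure M A + ennreal t * emeasure N A"
  unfolding mix_def
proof (rule emeasure_measure_of_sigma)
  show "countably_additive (sets M)
          (\<lambda>A. ennreal (1 - t) * emeasure M A + ennreal t * emeasure N A)"
    using assms(1)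
    by (intro countably_additiveI)
       (simp add: suminf_add[symmetric] ennreal_suminf_cmult suminf_emeasure)
next
  show "sigma_algebra (space M) (sets M)" by (rule sets.sigma_algebra_axioms)
qed (use assms in \<open>auto simp: positive_def\<close>)

definition convex_measures :: "'a measure set \<Rightarrow> bool" where
  "convex_measures S \<longleftrightarrow> (\<forall>M\<in>S. \<forall>N\<in>S. \<forall>t. 0 \<le> t \<and> t \<le> 1 \<longrightarrow> mix t M N \<in> S)"

definition sw_closed_hull ::
  "('x::{real_inner, polish_space} \<times> 'x) measure set \<Rightarrow> ('x \<times> 'x) measure set" where
  "sw_closed_hull S =
     {\<Phi>. \<exists>\<Psi>. (\<forall>n. \<Psi> n \<in> convex_measures hull S) \<and> limitin sw_topology \<Psi> \<Phi> sequentially}"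


section \<open>Smooth cylindrical functions\<close>

text \<open>
  The dimension \<open>d\<close> of the space carrying the profile \<open>\<psi>\<close> is quantified inside the definition
  of cylindrical functions, so a function on \<open>\<real>\<^sup>d\<close> is encoded as a function on
  \<open>nat \<Rightarrow> real\<close> that depends only on the coordinates \<open>i < d\<close>; for such functions continuity in
  the product topology is continuity on \<open>\<real>\<^sup>d\<close>.  \<open>C\<^sup>\<infinity>\<close> means that all iterated partial
  derivatives exist and are continuous.
\<close>

definition pderiv_coord :: "nat \<Rightarrow> ((nat \<Rightarrow> real) \<Rightarrow> real) \<Rightarrow> (nat \<Rightarrow> real) \<Rightarrow> real" where
  "pderiv_coord i \<psi> y = deriv (\<lambda>s. \<psi> (y(i := s))) (y i)"

definition Cc_smooth :: "nat \<Rightarrow> ((nat \<Rightarrow> real) \<Rightarrow> real) set" where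
  "Cc_smooth d = {\<psi>.
     (\<forall>y z. (\<forall>i<d. y i = z i) \<longrightarrow> \<psi> y = \<psi> z) \<and>
     (\<forall>is\<in>lists {..<d}.
        continuous_on UNIV (foldr pderiv_coord is \<psi>) \<and>
        (\<forall>i<d. \<forall>y. (\<lambda>s. foldr pderiv_coord is \<psi> (y(i := s))) field_differentiable at (y i))) \<and>
     (\<exists>R. \<forall>y. \<psi> y \<noteq> 0 \<longrightarrow> (\<forall>i<d. \<bar>y i\<bar> \<le> R))}"

definition orthonormal_upto :: "nat \<Rightarrow> (nat \<Rightarrow> 'x::real_inner) \<Rightarrow> bool" where
  "orthonormal_upto d e \<longleftrightarrow> (\<forall>i<d. \<forall>j<d. e i \<bullet> e j = (if i = j then 1 else 0))"

definition Cyl :: "('x::{real_inner, polish_space} \<Rightarrow> real) set" where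
  "Cyl = {\<phi>. \<exists>d e \<psi>. orthonormal_upto d e \<and> \<psi> \<in> Cc_smooth d \<and>
                   \<phi> = (\<lambda>x. \<psi> (\<lambda>i. if i < d then x \<bullet> e i else 0))}"

definition grad :: "('x::real_inner \<Rightarrow> real) \<Rightarrow> 'x \<Rightarrow> 'x" where
  "grad \<phi> x = (THE D. GDERIV \<phi> x :> D)"

definition exp_cyl :: "('x::{real_inner, polish_space} \<Rightarrow> real) \<Rightarrow> 'x \<Rightarrow> 'x" where
  "exp_cyl \<phi> x = x + grad \<phi> x"

definition test_fun :: "real set \<Rightarrow> (real \<Rightarrow> real) set" where
  "test_fun J = {\<eta>. (\<forall>n t. (deriv ^^ n) \<eta> field_differentiable at t) \<and>
                    (\<exists>K. compact K \<and> K \<subseteq> J \<and> (\<forall>t. \<eta> t \<noteq> 0 \<longrightarrow> t \<in> K))}"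

text \<open>
  Test functions for the continuity equation on \<open>J \<times> X\<close>, \<open>J\<close> open: the last of the \<open>d + 1\<close>
  coordinates of the profile is time.
\<close>

definition Cyl_time :: "real set \<Rightarrow> (real \<Rightarrow> 'x::{real_inner, polish_space} \<Rightarrow> real) set" where
  "Cyl_time J = {\<zeta>. \<exists>d e \<psi>. orthonormal_upto d e \<and> \<psi> \<in> Cc_smooth (Suc d) \<and>
     (\<exists>K. compact K \<and> K \<subseteq> J \<and> (\<forall>y. \<psi> y \<noteq> 0 \<longrightarrow> y d \<in> K)) \<and>
     \<zeta> = (\<lambda>t x. \<psi> (\<lambda>i. if i < d then x \<bullet> e i else if i = d then t else 0))}"


section \<open>Multivalued probability vector fields\<close>

definition mpvf :: "('x::{real_inner, polish_space} \<times> 'x) measure set \<Rightarrow> bool" where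
  "mpvf F \<longleftrightarrow> F \<noteq> {} \<and> F \<subseteq> TP2"

definition mpvf_dom :: "('x::{real_inner, polish_space} \<times> 'x) measure set \<Rightarrow> 'x measure set" where
  "mpvf_dom F = base ` F"

definition mpvf_section ::
  "('x::{real_inner, polish_space} \<times> 'x) measure set \<Rightarrow> 'x measure \<Rightarrow> ('x \<times> 'x) measure set" where
  "mpvf_section F \<mu> = {\<Phi> \<in> F. base \<Phi> = \<mu>}"

text \<open>Only meaningful for \<open>\<mu>\<close> in the domain of \<open>F\<close>, so that the infimum is over a nonempty set.\<close>

definition mpvf_norm ::
  "('x::{real_inner, polish_space} \<times> 'x) measure set \<Rightarrow> 'x measure \<Rightarrow> real" where
  "mpvf_norm F \<mu> = (INF \<Phi>\<in>mpvf_section F \<mu>. vel_norm \<Phi>)"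

definition mpvf_dom_closure ::
  "('x::{real_inner, polish_space} \<times> 'x) measure set \<Rightarrow> 'x measure set" where
  "mpvf_dom_closure F = {\<mu> \<in> P2. \<forall>\<epsilon>>0. \<exists>\<nu>\<in>mpvf_dom F. W2 \<mu> \<nu> < \<epsilon>}"

definition dissipative ::
  "real \<Rightarrow> ('x::{real_inner, polish_space} \<times> 'x) measure set \<Rightarrow> bool" where
  "dissipative lam F \<longleftrightarrow>
     (\<forall>\<Phi>\<in>F. \<forall>\<Psi>\<in>F. pairing \<Phi> \<Psi> \<le> lam * (W2 (base \<Phi>) (base \<Psi>))\<^sup>2)"

definition dir_closure_at ::
  "('x::{real_inner, polish_space} \<times> 'x) measure set \<Rightarrow> 'x measure \<Rightarrow> ('x \<times> 'x) measure set" where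
  "dir_closure_at F \<mu> = {\<Phi> \<in> TP2. \<exists>\<phi>\<in>Cyl. \<exists>r \<Psi>.
     (\<forall>n. 0 \<le> r n) \<and> decseq r \<and> r \<longlonglongrightarrow> 0 \<and>
     (\<forall>n. \<Psi> n \<in> mpvf_section F (distr \<mu> borel (exp_cyl (\<lambda>x. r n * \<phi> x)))) \<and>
     limitin sw_topology \<Psi> \<Phi> sequentially}"

definition dir_closure ::
  "('x::{real_inner, polish_space} \<times> 'x) measure set \<Rightarrow> ('x \<times> 'x) measure set" where
  "dir_closure F = (\<Union>\<mu>\<in>P2. dir_closure_at F \<mu>)"


section \<open>Tangent space, projection, barycenter\<close>

text \<open>
  Elements of \<open>L\<^sup>2\<^sub>\<mu>(X;X)\<close> are represented by Borel functions; equality in \<open>L\<^sup>2\<^sub>\<mu>\<close> is equality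
  \<open>\<mu>\<close>-almost everywhere.
\<close>

definition L2_fields :: "'x::{real_inner, polish_space} measure \<Rightarrow> ('x \<Rightarrow> 'x) set" where
  "L2_fields \<mu> = {f \<in> borel_measurable borel. integrable \<mu> (\<lambda>x. (norm (f x))\<^sup>2)}"

definition Tan :: "'x::{real_inner, polish_space} measure \<Rightarrow> ('x \<Rightarrow> 'x) set" where
  "Tan \<mu> = {f \<in> L2_fields \<mu>. \<forall>\<epsilon>>0. \<exists>\<phi>\<in>Cyl. sqrt (\<integral>x. (norm (f x - grad \<phi> x))\<^sup>2 \<partial>\<mu>) < \<epsilon>}"

definition tan_proj ::
  "'x::{real_inner, polish_space} measure \<Rightarrow> ('x \<Rightarrow> 'x) \<Rightarrow> 'x \<Rightarrow> 'x" where
  "tan_proj \<mu> w = (SOME u. u \<in> Tan \<mu> \<and> (\<forall>\<xi>\<in>Tan \<mu>. (\<integral>x. (w x - u x) \<bullet> \<xi> x \<partial>\<mu>) = 0))"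

definition is_disintegration ::
  "('x::{real_inner, polish_space} \<times> 'x) measure \<Rightarrow> ('x \<Rightarrow> 'x measure) \<Rightarrow> bool" where
  "is_disintegration \<Phi> \<kappa> \<longleftrightarrow> \<kappa> \<in> borel \<rightarrow>\<^sub>M prob_algebra borel \<and>
     (\<forall>A\<in>sets borel. \<forall>B\<in>sets borel.
        emeasure \<Phi> (A \<times> B) = (\<integral>\<^sup>+x\<in>A. emeasure (\<kappa> x) B \<partial>base \<Phi>))"

definition barycenter :: "('x::{real_inner, polish_space} \<times> 'x) measure \<Rightarrow> 'x \<Rightarrow> 'x" where
  "barycenter \<Phi> x = (\<integral>v. v \<partial>(SOME \<kappa>. is_disintegration \<Phi> \<kappa>) x)"


section \<open>Curves of measures\<close>

definition W2_continuous :: "real set \<Rightarrow> (real \<Rightarrow> 'x::{real_inner, polish_space} measure) \<Rightarrow> bool" where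
  "W2_continuous I \<mu> \<longleftrightarrow> (\<forall>t\<in>I. ((\<lambda>s. W2 (\<mu> s) (\<mu> t)) \<longlongrightarrow> 0) (at t within I))"

definition loc_abs_cont :: "real set \<Rightarrow> (real \<Rightarrow> 'x::{real_inner, polish_space} measure) \<Rightarrow> bool" where
  "loc_abs_cont I \<mu> \<longleftrightarrow> \<mu> ` I \<subseteq> P2 \<and>
     (\<exists>m::real \<Rightarrow> real. \<forall>a\<in>I. \<forall>b\<in>I. a \<le> b \<longrightarrow>
        set_integrable lborel {a..b} m \<and> W2 (\<mu> a) (\<mu> b) \<le> (LBINT t:{a..b}. m t))"

definition EVI_solution ::
  "real \<Rightarrow> ('x::{real_inner, polish_space} \<times> 'x) measure set \<Rightarrow> real set \<Rightarrow>
   (real \<Rightarrow> 'x measure) \<Rightarrow> bool" where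
  "EVI_solution lam F I \<mu> \<longleftrightarrow>
     \<mu> ` I \<subseteq> mpvf_dom_closure F \<and> W2_continuous I \<mu> \<and>
     (\<forall>\<Phi>\<in>F. \<forall>\<eta>\<in>test_fun (interior I). (\<forall>t. 0 \<le> \<eta> t) \<longrightarrow>
        - (LBINT t:interior I. (1/2) * (W2 (\<mu> t) (base \<Phi>))\<^sup>2 * deriv \<eta> t)
        \<le> (LBINT t:interior I. (lam * (W2 (\<mu> t) (base \<Phi>))\<^sup>2 - pairing_meas \<Phi> (\<mu> t)) * \<eta> t))"

definition continuity_equation ::
  "real set \<Rightarrow> (real \<Rightarrow> 'x::{real_inner, polish_space} measure) \<Rightarrow> (real \<Rightarrow> 'x \<Rightarrow> 'x) \<Rightarrow> bool" where
  "continuity_equation I \<mu> v \<longleftrightarrow> (\<forall>\<zeta>\<in>Cyl_time (interior I).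
     (LBINT t:interior I. (\<integral>x. deriv (\<lambda>s. \<zeta> s x) t + v t x \<bullet> grad (\<zeta> t) x \<partial>\<mu> t)) = 0)"

text \<open>
  Limits for \<open>h \<rightarrow> 0\<close> are taken along those \<open>h\<close> with \<open>t + h \<in> I\<close>.  Thus an endpoint of \<open>I\<close> may
  belong to \<open>A\<close>, with one-sided limits; \<open>t islimpt I\<close> excludes the only case in which the limits
  would be over a trivial filter, namely that \<open>I\<close> is a single point.
\<close>

definition velocity_field ::
  "real set \<Rightarrow> (real \<Rightarrow> 'x::{real_inner, polish_space} measure) \<Rightarrow> (real \<Rightarrow> 'x \<Rightarrow> 'x) \<Rightarrow>
   real set \<Rightarrow> bool" where
  "velocity_field I \<mu> v A \<longleftrightarrow>
     (\<lambda>(t, x). v t x) \<in> borel_measurable (restrict_space borel (I \<times> UNIV)) \<and>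
     A \<subseteq> I \<and> (AE t in lborel. t \<in> I \<longrightarrow> t \<in> A) \<and>
     continuity_equation I \<mu> v \<and>
     (\<forall>t\<in>A. t islimpt I \<and> v t \<in> Tan (\<mu> t) \<and>
        ((\<lambda>h. (W2 (\<mu> (t + h)) (\<mu> t))\<^sup>2 / h\<^sup>2) \<longlongrightarrow> (\<integral>x. (norm (v t x))\<^sup>2 \<partial>\<mu> t))
          (at 0 within {h. t + h \<in> I}) \<and>
        ((\<lambda>h. W2 (distr (\<mu> t) borel (\<lambda>x. x + h *\<^sub>R v t x)) (\<mu> (t + h)) / \<bar>h\<bar>) \<longlongrightarrow> 0)
          (at 0 within {h. t + h \<in> I}))"

text \<open>
  The barycentric property with respect to the sections \<open>G\<close>: the plain property is obtained for
  \<open>G = mpvf_section F\<close>, the relaxed one for the closed convex hulls of the directional closure.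
\<close>

definition barycentric ::
  "('x::{real_inner, polish_space} measure \<Rightarrow> ('x \<times> 'x) measure set) \<Rightarrow> real set \<Rightarrow>
   (real \<Rightarrow> 'x measure) \<Rightarrow> bool" where
  "barycentric G I \<mu> \<longleftrightarrow> (AE t in lborel. t \<in> I \<longrightarrow>
     (\<exists>\<Phi>\<in>G (\<mu> t). \<forall>\<phi>\<in>Cyl.
        ((\<lambda>s. \<integral>x. \<phi> x \<partial>\<mu> s) has_real_derivative (\<integral>(x, v). grad \<phi> x \<bullet> v \<partial>\<Phi>)) (at t within I)))"

end

theory Submission
  imports Defs
begin

text \<open>
  Fix a time \<open>t\<close> and a cylindrical function \<open>\<phi>\<close>. For small \<open>r\<close>, the push-forward \<open>\<nu>\<^sub>r\<close> of \<open>\<mu> t\<close>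
  under \<open>x \<mapsto> x + r \<nabla>\<phi>(x)\<close> belongs to the domain of \<open>F\<close> and carries a plan \<open>\<Phi>\<^sub>r \<in> F\<close> whose velocity
  norm is below a bound independent of \<open>\<phi>\<close> and \<open>r\<close>. The evolution variational inequality for \<open>\<Phi>\<^sub>r\<close>
  bounds the slope of \<open>s \<mapsto> W2(\<mu> s, \<nu>\<^sub>r)\<^sup>2/2\<close> at \<open>t\<close> from above by \<open>lam W2(\<mu> t, \<nu>\<^sub>r)\<^sup>2\<close> minus the pairing of
  \<open>\<Phi>\<^sub>r\<close> with \<open>\<mu> t\<close>. Both sides can be estimated up to \<open>O(r\<^sup>2)\<close>, since \<open>r\<phi>\<close> and its Moreau envelope are
  explicit Kantorovich potentials for \<open>\<mu> t\<close> and \<open>\<nu>\<^sub>r\<close>: the slope is at least \<open>- r L(\<phi>)\<close>, where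
  \<open>L(\<phi>) = \<integral>\<langle>v t, \<nabla>\<phi>\<rangle> d\<mu> t\<close> or \<open>L(\<phi>) = d/dt \<integral>\<phi> d\<mu> t\<close>, and the pairing is at least
  \<open>r \<integral>\<langle>\<nabla>\<phi>(x), v\<rangle> d\<Phi>\<^sub>r - O(r\<^sup>2)\<close>. Dividing by \<open>r\<close> and letting \<open>r\<close> tend to 0, strong-weak compactness
  (\<open>sw_compactness\<close>) gives a plan in the directional closure at \<open>\<mu> t\<close> with
  \<open>\<integral>\<langle>\<nabla>\<phi>(x), v\<rangle> d\<Phi> \<le> L(\<phi>)\<close> and bounded velocity norm (\<open>dir_closure_velocity\<close>).

  This plan depends on \<open>\<phi>\<close>. For finitely many \<open>\<phi>\<^sub>k\<close>, the vectors of the numbers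
  \<open>\<integral>\<langle>\<nabla>\<phi>\<^sub>k(x), v\<rangle> d\<Phi>\<close>, for \<open>\<Phi>\<close> in the convex hull, form a convex set; by the one-sided bound it meets
  every half-space that contains the vector of the \<open>L(\<phi>\<^sub>k)\<close> in its interior, so this vector is in its
  closure (\<open>convex_family_attains\<close>). Exhausting a countable family with dense gradients and using
  compactness again yields one plan in the closed convex hull with equality for all \<open>\<phi>\<close>
  (\<open>velocity_plan_selection\<close>).

  Equality with the first choice of \<open>L\<close> says that \<open>v t\<close> is the tangential projection of the barycenter
  (\<open>tan_proj_barycenter\<close>). For the second choice, the observables \<open>t \<mapsto> \<integral>\<phi> d\<mu> t\<close> are absolutely
  continuous, hence differentiable almost everywhere; a countable family and a bound of difference
  quotients by the \<open>L\<^sup>2\<close> norm of the gradient make the exceptional set independent of \<open>\<phi>\<close>. If \<open>F\<close> is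
  directionally closed with convex sections, then the closed convex hull lies in the section, because
  a convergent sequence in the section is a directional approximation along \<open>\<phi> = 0\<close>.

  Couplings are handled as random variables: by noise outsourcing a coupling is a function of one
  marginal and of independent uniform noise.
\<close>

abbreviation (input) LIMSEQ_arrow (infixr "---->" 60) where "X ----> l \<equiv> X \<longlonglongrightarrow> l"

abbreviation (input) tendsto_arrow (infixr "--->" 55) where "f ---> l \<equiv> f \<longlongrightarrow> l"

section \<open>Coding countably many events in one real number\<close>

definition clamp01 :: "real => real" where
 "clamp01 t = max 0 (min 1 t)"

text \<open>
 Ternary digits 0 and 2, as for points of the Cantor set: the gap between them makes every digit a continuous
 function of the code, so that digits pass to limits of codes. \<open>tern_digit\<close> extends that function
 continuously to all reals.
\<close>
definition tern_code :: "(nat => 'a => bool) => 'a => real" where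
 "tern_code E z = (\<Sum>m. of_bool (E m z) * 2 / 3 ^ Suc m)"

definition tern_shift :: "real => real" where
 "tern_shift y = 3 * y - 2 * clamp01 (3 * y - 1)"

definition tern_digit :: "nat => real => real" where
 "tern_digit m y = clamp01 (3 * (tern_shift ^^ m) y - 1)"

lemma summable_tern: "summable (%m. of_bool (E m z) * 2 / 3 ^ Suc m :: real)"
proof (rule summable_comparison_test)
 show "\<exists>N. \<forall>n\<ge>N. norm (of_bool (E n z) * 2 / 3 ^ Suc n :: real) <= 2 * (1/3) ^ Suc n"
  by (auto simp: field_simps power_one_over)
 show "summable (%n. 2 * (1/3::real) ^ Suc n)"
  by (intro summable_mult summable_Suc_iff[THEN iffD2] summable_geometric) auto
qed

lemma tern_code_nonneg: "0 <= tern_code E z"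
 unfolding tern_code_def by (rule suminf_nonneg[OF summable_tern]) auto

lemma tern_code_le_1: "tern_code E z <= 1"
proof -
 have "(%n. (1/3::real) ^ n) sums (1 / (1 - 1/3))"
  by (rule geometric_sums) auto
 then have "(%n. (2/3) * (1/3::real) ^ n) sums ((2/3) * (1 / (1 - 1/3)))"
  by (rule sums_mult)
 then have s: "(%n. (2/3) * (1/3::real) ^ n) sums 1" by simp
 have "tern_code E z <= (\<Sum>n. (2/3) * (1/3::real) ^ n)"
  unfolding tern_code_def
  by (rule suminf_le[OF _ summable_tern sums_summable[OF s]]) (auto simp: field_simps power_one_over)
 then show ?thesis using s by (simp add: sums_unique[symmetric])
qed

lemma tern_code_rec:
 "tern_code E z = (2 * of_bool (E 0 z) + tern_code (%m. E (Suc m)) z) / 3"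
proof -
 have "tern_code E z = (\<Sum>m. of_bool (E (Suc m) z) * 2 / 3 ^ Suc (Suc m)) + of_bool (E 0 z) * 2 / 3"
  unfolding tern_code_def using suminf_split_head[OF summable_tern[of E z]] by simp
 also have "(\<Sum>m. of_bool (E (Suc m) z) * 2 / 3 ^ Suc (Suc m) :: real)
   = (\<Sum>m. (1/3) * (of_bool (E (Suc m) z) * 2 / 3 ^ Suc m))"
  by (intro suminf_cong) simp
 also have "\<dots> = (1/3) * tern_code (%m. E (Suc m)) z"
  unfolding tern_code_def
  by (rule suminf_mult[OF summable_tern[of "%m. E (Suc m)"]])
 finally show ?thesis by (simp add: field_simps)
qed

lemma clamp_tern_code: "clamp01 (3 * tern_code E z - 1) = of_bool (E 0 z)"
 using tern_code_rec[of E z] tern_code_nonneg[of "%m. E (Suc m)" z]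
  tern_code_le_1[of "%m. E (Suc m)" z]
 by (cases "E 0 z") (auto simp: clamp01_def)

lemma tern_shift_code: "tern_shift (tern_code E z) = tern_code (%m. E (Suc m)) z"
 unfolding tern_shift_def clamp_tern_code using tern_code_rec[of E z] by simp

lemma tern_digit_code: "tern_digit m (tern_code E z) = of_bool (E m z)"
proof -
 have "(tern_shift ^^ m) (tern_code E z) = tern_code (%k. E (m + k)) z"
 proof (induction m arbitrary: E)
  case (Suc m)
  show ?case unfolding funpow_Suc_right o_apply tern_shift_code Suc.IH by simp
 qed simp
 then show ?thesis unfolding tern_digit_def by (simp add: clamp_tern_code)
qed

lemma continuous_tern_digit: "continuous_on UNIV (tern_digit m)"
proof -
 have s: "continuous_on UNIV tern_shift"
  unfolding tern_shift_def clamp01_def by (intro continuous_intros)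
 have "continuous_on UNIV (tern_shift ^^ m)"
 proof (induction m)
  case (Suc m)
  then show ?case using continuous_on_compose[OF Suc continuous_on_subset[OF s]] by simp
 qed (simp add: continuous_on_id)
 then show ?thesis unfolding tern_digit_def clamp01_def by (intro continuous_intros)
qed

lemma measurable_tern_digit [measurable]: "tern_digit m \<in> borel_measurable borel"
 by (rule borel_measurable_continuous_onI[OF continuous_tern_digit])

lemma measurable_tern_code [measurable (raw)]:
 assumes "!!m. Measurable.pred M (E m)"
 shows "tern_code E \<in> borel_measurable M"
 unfolding tern_code_def[abs_def] using assms by measurable

section \<open>Points of a Polish space from the balls that contain them\<close>

definition dense_seq :: "(nat => 'x::metric_space) => bool" where
 "dense_seq q \<longleftrightarrow> (\<forall>x. \<forall>\<epsilon>>0. \<exists>i. dist (q i) x < \<epsilon>)"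

lemma dense_seq_exists: "\<exists>q :: nat => 'x::polish_space. dense_seq q"
proof -
 obtain D :: "'x set" where D: "countable D" "!!X. open X ==> X ~= {} ==> \<exists>d\<in>D. d \<in> X"
  by (rule countable_dense_setE) blast
 then have "D ~= {}" using D(2)[of UNIV] by auto
 then have q: "D = range (from_nat_into D)" using D(1) by (simp add: range_from_nat_into)
 define q where "q = from_nat_into D"
 have q: "D = range q" unfolding q_def by (rule q)
 have "\<exists>i. dist (q i) x < \<epsilon>" if \<epsilon>: "\<epsilon> > 0" for x \<epsilon>
 proof -
  obtain d where "d \<in> D" "d \<in> ball x \<epsilon>" using D(2)[OF open_ball, of x \<epsilon>] \<epsilon> by fastforce
  then show ?thesis using q by (metis dist_commute imageE mem_ball)
 qed
 then show ?thesis unfolding dense_seq_def by auto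
qed

definition approx_point :: "(nat => 'x) => (nat => nat => bool) => nat => 'x" where
 "approx_point q D p = q (LEAST i. D i p)"

text \<open>
 A point is rebuilt from the balls that contain it. Data whose approximations do not converge give \<open>q
 0\<close>, which keeps the map total and measurable.
\<close>
definition ball_point :: "(nat => 'x::polish_space) => (nat => nat => bool) => 'x" where
 "ball_point q D = (if Cauchy (approx_point q D) then lim (approx_point q D) else q 0)"

lemma ball_point_eq:
 assumes "dense_seq q" "!!i p. D i p \<longleftrightarrow> dist (q i) x < 1 / 2 ^ p"
 shows "ball_point q D = x"
proof -
 have d: "dist (approx_point q D p) x < 1 / 2 ^ p" for p
 proof -
  have "\<exists>i. D i p" using assms by (auto simp: dense_seq_def)
  then have "D (LEAST i. D i p) p" by (rule LeastI_ex)
  then show ?thesis using assms(2) unfolding approx_point_def by blast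
 qed
 have "(%p. dist (approx_point q D p) x) ----> 0"
 proof (rule Lim_null_comparison)
  show "\<forall>\<^sub>F p in sequentially. norm (dist (approx_point q D p) x) <= (1/2) ^ p"
   by (intro always_eventually allI) (use d in "simp add: less_imp_le power_one_over")
  show "(%p. (1/2::real) ^ p) ----> 0" by (rule LIMSEQ_power_zero) simp
 qed
 then have "approx_point q D ----> x" by (simp add: tendsto_dist_iff[symmetric])
 then show ?thesis unfolding ball_point_def
  by (auto simp: LIMSEQ_imp_Cauchy limI)
qed

lemma measurable_ball_point:
 fixes q :: "nat => 'x::polish_space"
 assumes [measurable]: "!!i p. Measurable.pred M (%z. D z i p)"
 shows "(%z. ball_point q (D z)) \<in> borel_measurable M"
proof -
 have [measurable]: "(%z. approx_point q (D z) p) \<in> borel_measurable M" for p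
  unfolding approx_point_def
  by (rule measurable_compose[where g=q and N="count_space UNIV"]) measurable
 define f where "f p z = (if Cauchy (approx_point q (D z)) then approx_point q (D z) p else q 0)" for p z
 have [measurable]: "Measurable.pred M (%z. Cauchy (approx_point q (D z)))"
  using sets_Collect_Cauchy[of "%p z. approx_point q (D z) p" M] by (simp add: pred_def)
 show ?thesis
 proof (rule borel_measurable_LIMSEQ_metric[where f=f])
  show "f p \<in> borel_measurable M" for p unfolding f_def by measurable
  fix z
  show "(%p. f p z) ----> ball_point q (D z)"
   by (auto simp: f_def ball_point_def convergent_LIMSEQ_iff Cauchy_convergent_iff)
 qed
qed

text \<open>
 Recording the balls of a countable family that contain a point embeds a Polish space measurably into the unit
 interval, so that statements on Polish spaces reduce to the real line.
\<close>
lemma polish_real_code: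
 "\<exists>(c :: 'x::polish_space => real) R. c \<in> borel_measurable borel \<and> R \<in> borel_measurable borel \<and>
  (\<forall>x. R (c x) = x) \<and> (\<forall>x. 0 <= c x \<and> c x <= 1)"
proof -
 obtain q :: "nat => 'x" where q: "dense_seq q" using dense_seq_exists by blast
 define E where "E m x \<longleftrightarrow> dist (q (fst (prod_decode m))) x < 1 / 2 ^ snd (prod_decode m)" for m x
 have [measurable]: "Measurable.pred borel (E m)" for m
  unfolding E_def by measurable
 define R where "R y = ball_point q (%i p. 1/2 < tern_digit (prod_encode (i, p)) y)" for y
 have "R (tern_code E x) = x" for x
  unfolding R_def by (rule ball_point_eq[OF q]) (simp add: tern_digit_code E_def)
 moreover have "R \<in> borel_measurable borel"
  unfolding R_def by (rule measurable_ball_point) measurable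
 moreover have "tern_code E \<in> borel_measurable borel" by measurable
 ultimately show ?thesis using tern_code_nonneg[of E] tern_code_le_1[of E] by blast
qed

section \<open>Noise outsourcing\<close>

abbreviation unif :: "real measure" where "unif \<equiv> uniform_measure lborel {0..1}"

abbreviation (input) noised :: "'a measure => ('a \<times> real) measure" where "noised P \<equiv> P \<Otimes>\<^sub>M unif"

lemma prob_space_unif: "prob_space unif"
 by (rule prob_space_uniform_measure) auto

lemma emeasure_unif_cut:
 fixes f :: ennreal
 shows "emeasure unif {u. 0 < u \<and> ennreal u <= f} = min 1 f"
proof (cases "f \<ge> 1")
 case True
 have [measurable]: "{u::real. 0 < u \<and> ennreal u <= f} \<in> sets borel" by measurable
 have "{0<..1} \<subseteq> {0..1} \<inter> {u. 0 < u \<and> ennreal u <= f}"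
  using True by (auto intro!: order_trans[OF _ True])
 then have "emeasure lborel {0<..1::real} <= emeasure lborel ({0..1} \<inter> {u. 0 < u \<and> ennreal u <= f})"
  by (intro emeasure_mono) auto
 moreover have "emeasure lborel ({0..1} \<inter> {u. 0 < u \<and> ennreal u <= f}) <= emeasure lborel {0..1::real}"
  by (intro emeasure_mono) auto
 ultimately show ?thesis using True by (simp add: min_absorb1)
next
 case False
 then obtain r where r: "f = ennreal r" "0 <= r" "r < 1"
  by (cases f) (auto simp: ennreal_ge_1 not_le)
 have [measurable]: "{u::real. 0 < u \<and> ennreal u <= f} \<in> sets borel" by measurable
 have "{0..1} \<inter> {u. 0 < u \<and> ennreal u <= f} = {0<..r}"
  using r by (auto simp: ennreal_le_iff)
 moreover have "ennreal r / 1 = ennreal r" using divide_ennreal[of r 1] r by simp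
 ultimately show ?thesis using r by (simp add: min_absorb2 ennreal_le_1)
qed

lemma AE_le_from_set_integrals:
 assumes [measurable]: "F \<in> borel_measurable M" "G \<in> borel_measurable M"
  and le: "!!A. A \<in> sets M ==> (nn_integral M (%x. F x * indicator A x)) <= (nn_integral M (%x. G x * indicator A x))"
  and fin: "(nn_integral M (%x. G x)) ~= \<infinity>"
 shows "AE x in M. F x <= (G x :: ennreal)"
proof -
 define A where "A = {x\<in>space M. G x < F x}"
 have [measurable]: "A \<in> sets M" unfolding A_def by measurable
 have "(nn_integral M (%x. G x * indicator A x)) <= (nn_integral M (%x. G x))"
  by (intro nn_integral_mono) (auto split: split_indicator)
 then have fin': "(nn_integral M (%x. G x * indicator A x)) ~= \<infinity>" using fin by (auto simp: top_unique)
 have "(nn_integral M (%x. F x * indicator A x - G x * indicator A x))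
  = (nn_integral M (%x. F x * indicator A x)) - (nn_integral M (%x. G x * indicator A x))"
  by (rule nn_integral_diff) (use fin' in "auto simp: A_def less_imp_le split: split_indicator")
 also have "\<dots> = 0" using le_less_trans[OF le[of A]] le[of A] fin' by (auto simp: diff_eq_0_iff_ennreal less_top)
 finally have "AE x in M. F x * indicator A x - G x * indicator A x = 0"
  by (subst (asm) nn_integral_0_iff_AE) auto
 then show ?thesis
 proof (rule AE_mp, intro AE_I2 impI)
  fix x assume x: "x \<in> space M" "F x * indicator A x - G x * indicator A x = 0"
  show "F x <= G x"
  proof (rule ccontr)
   assume "\<not> F x <= G x"
   then have "x \<in> A" using x by (auto simp: A_def)
   with x \<open>\<not> F x <= G x\<close> show False by (simp add: diff_eq_0_iff_ennreal top_unique not_le)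
  qed
 qed
qed

text \<open>
 \<open>Q\<close> is the conditional quantile function, evaluated at uniform noise. The conditional tails
 \<open>F r\<close>, obtained by the Radon-Nikodym theorem, are monotone in \<open>r\<close> only outside a
 null set; restricting to rational levels \<open>r\<close> leaves countably many null sets.
\<close>
lemma noise_outsourcing_real:
 fixes \<gamma> :: "('a \<times> real) measure"
 assumes "prob_space \<gamma>" and sg [measurable_cong]: "sets \<gamma> = sets (M \<Otimes>\<^sub>M borel)"
  and bd: "AE z in \<gamma>. 0 <= snd z \<and> snd z <= 1"
 shows "\<exists>Q \<in> borel_measurable (M \<Otimes>\<^sub>M borel).
  \<gamma> = distr (distr \<gamma> M fst \<Otimes>\<^sub>M unif) (M \<Otimes>\<^sub>M borel) (%(y, u). (y, Q (y, u)))"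
proof -
 interpret \<gamma>: prob_space \<gamma> by fact
 interpret U: prob_space unif by (rule prob_space_unif)
 define \<rho> where "\<rho> = distr \<gamma> M fst"
 have [measurable_cong]: "sets \<rho> = sets M" unfolding \<rho>_def by simp
 interpret \<rho>: prob_space \<rho> unfolding \<rho>_def by (rule \<gamma>.prob_space_distr) simp
 have em\<rho>: "emeasure \<rho> A = emeasure \<gamma> {z\<in>space \<gamma>. fst z \<in> A}" if "A \<in> sets M" for A
  unfolding \<rho>_def using that by (subst emeasure_distr) (auto intro!: arg_cong2[where f=emeasure])
 have "\<exists>F \<in> borel_measurable M. \<forall>A\<in>sets M.
   emeasure \<gamma> {z\<in>space \<gamma>. fst z \<in> A \<and> r < snd z} = (nn_integral \<rho> (%y. F y * indicator A y))" for r :: real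
 proof -
  define \<nu> where "\<nu> = distr (density \<gamma> (%z. indicator {r<..} (snd z))) M fst"
  have \<nu>: "emeasure \<nu> A = emeasure \<gamma> {z\<in>space \<gamma>. fst z \<in> A \<and> r < snd z}" if [measurable]: "A \<in> sets M" for A
  proof -
   have "emeasure \<nu> A = (nn_integral \<gamma> (%z. indicator {r<..} (snd z) * indicator (fst -` A \<inter> space \<gamma>) z))"
    unfolding \<nu>_def by (subst emeasure_distr, simp, simp, subst emeasure_density) auto
   also have "\<dots> = (nn_integral \<gamma> (%z. indicator {z\<in>space \<gamma>. fst z \<in> A \<and> r < snd z} z))"
    by (intro nn_integral_cong) (auto split: split_indicator)
   finally show ?thesis by simp
  qed
  have "absolutely_continuous \<rho> \<nu>" unfolding absolutely_continuous_def
  proof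
   fix A assume A: "A \<in> null_sets \<rho>"
   then have [measurable]: "A \<in> sets M" unfolding \<rho>_def by auto
   have "emeasure \<nu> A <= emeasure \<rho> A" unfolding \<nu>[OF \<open>A \<in> sets M\<close>] em\<rho>[OF \<open>A \<in> sets M\<close>]
    by (intro emeasure_mono) auto
   then show "A \<in> null_sets \<nu>" using A by (auto simp: \<nu>_def null_sets_def)
  qed
  then obtain F where F: "F \<in> borel_measurable \<rho>" "density \<rho> F = \<nu>"
   using \<rho>.Radon_Nikodym[of \<nu>] by (auto simp: \<nu>_def \<rho>_def)
  have F1 [measurable]: "F \<in> borel_measurable M" using F(1) by (simp add: \<rho>_def)
  show ?thesis
  proof (intro bexI[of _ F] ballI)
   fix A assume [measurable]: "A \<in> sets M"
   show "emeasure \<gamma> {z\<in>space \<gamma>. fst z \<in> A \<and> r < snd z} = (nn_integral \<rho> (%y. F y * indicator A y))"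
    unfolding \<nu>[symmetric, OF \<open>A \<in> sets M\<close>] F(2)[symmetric] by (subst emeasure_density) auto
  qed (rule F1)
 qed
 then have "\<exists>F. \<forall>r. F r \<in> borel_measurable M \<and> (\<forall>A\<in>sets M.
   emeasure \<gamma> {z\<in>space \<gamma>. fst z \<in> A \<and> r < snd z} = (nn_integral \<rho> (%y. F r y * indicator A y)))"
  by (intro choice) blast
 then obtain F where F [measurable]: "!!r::real. F r \<in> borel_measurable M"
  and FI: "!!r A. A \<in> sets M ==>
   emeasure \<gamma> {z\<in>space \<gamma>. fst z \<in> A \<and> r < snd z} = (nn_integral \<rho> (%y. F r y * indicator A y))"
  by blast
 have F1: "AE y in \<rho>. F r y <= 1" for r
 proof (rule AE_le_from_set_integrals)
  fix A assume "A \<in> sets \<rho>"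
  then have [measurable]: "A \<in> sets M" by (simp add: \<rho>_def)
  have "(nn_integral \<rho> (%y. F r y * indicator A y)) <= emeasure \<rho> A"
   unfolding FI[OF \<open>A \<in> sets M\<close>, symmetric] em\<rho>[OF \<open>A \<in> sets M\<close>] by (intro emeasure_mono) auto
  then show "(nn_integral \<rho> (%y. F r y * indicator A y)) <= (nn_integral \<rho> (%y. 1 * indicator A y))"
   by simp
 qed (auto simp: \<rho>.emeasure_space_1)
 have Fmono: "AE y in \<rho>. F r' y <= F r y" if "r <= r'" for r r'
 proof (rule AE_le_from_set_integrals)
  fix A assume "A \<in> sets \<rho>"
  then have [measurable]: "A \<in> sets M" by (simp add: \<rho>_def)
  show "(nn_integral \<rho> (%y. F r' y * indicator A y)) <= (nn_integral \<rho> (%y. F r y * indicator A y))"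
   unfolding FI[OF \<open>A \<in> sets M\<close>, symmetric] using that by (intro emeasure_mono) auto
 next
  have "(nn_integral \<rho> (%y. F r y)) <= (nn_integral \<rho> (%y. 1))" using F1[of r] by (intro nn_integral_mono_AE) auto
  then show "(nn_integral \<rho> (%y. F r y)) ~= \<infinity>" by (auto simp: \<rho>.emeasure_space_1 top_unique)
 qed auto
 define S where "S = \<rat> \<inter> {0..1::real}"
 have Sc: "countable S" unfolding S_def by (intro countable_Int1 countable_rat)
 define Q where "Q = (%(y, u). Sup (insert 0 {r\<in>S. 0 < u \<and> ennreal u <= F r y}))"
 have Qgt: "x < Q (y, u) \<longleftrightarrow> x < 0 \<or> (\<exists>r\<in>S. x < r \<and> 0 < u \<and> ennreal u <= F r y)" for x y u
 proof -
  have "bdd_above (insert 0 {r\<in>S. 0 < u \<and> ennreal u <= F r y})"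
   by (rule bdd_aboveI[of _ 1]) (auto simp: S_def)
  then show ?thesis unfolding Q_def prod.case by (subst less_cSup_iff) auto
 qed
 have Q [measurable]: "Q \<in> borel_measurable (M \<Otimes>\<^sub>M borel)"
 proof (rule borel_measurable_iff_greater[THEN iffD2], rule allI)
  fix x
  have "{w \<in> space (M \<Otimes>\<^sub>M borel). x < Q w} = (\<Union>r\<in>S. {w \<in> space (M \<Otimes>\<^sub>M borel). 
   x < 0 \<or> x < r \<and> 0 < snd w \<and> ennreal (snd w) <= F r (fst w)})"
  proof (cases "x < 0")
   case True
   have "(0::real) \<in> S" by (simp add: S_def)
   with True show ?thesis using Qgt[of x] by auto
  next
   case False
   then show ?thesis using Qgt[of x] by auto
  qed
  also have "\<dots> \<in> sets (M \<Otimes>\<^sub>M borel)"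
   by (intro sets.countable_UN'' Sc) measurable
  finally show "{w \<in> space (M \<Otimes>\<^sub>M borel). x < Q w} \<in> sets (M \<Otimes>\<^sub>M borel)" .
 qed
 define \<gamma>' where "\<gamma>' = distr (noised \<rho>) (M \<Otimes>\<^sub>M borel) (%(y, u). (y, Q (y, u)))"
 interpret pair: pair_prob_space \<rho> unif ..
 have meas: "(%(y, u). (y, Q (y, u))) \<in> (noised \<rho>) \<rightarrow>\<^sub>M (M \<Otimes>\<^sub>M borel)" by measurable
 interpret \<gamma>': prob_space \<gamma>' unfolding \<gamma>'_def by (rule pair.prob_space_distr[OF meas])
 have key: "emeasure \<gamma>' (A \<times> {r<..}) = emeasure \<gamma> (A \<times> {r<..})" if A [measurable]: "A \<in> sets M" for A r
 proof -
  have Asp: "A \<subseteq> space M" using A by (rule sets.sets_into_space)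
  have sp: "space \<gamma> = space M \<times> UNIV" using sets_eq_imp_space_eq[OF sg] by (simp add: space_pair_measure)
  have 1: "emeasure \<gamma>' (A \<times> {r<..}) = (nn_integral \<rho> (%y. emeasure unif {u. r < Q (y, u)} * indicator A y))"
  proof -
   have "emeasure \<gamma>' (A \<times> {r<..}) = emeasure (noised \<rho>) {w\<in>space (noised \<rho>). fst w \<in> A \<and> r < Q w}"
    unfolding \<gamma>'_def by (subst emeasure_distr[OF meas])
     (auto intro!: arg_cong2[where f=emeasure])
   also have "\<dots> = (nn_integral \<rho> (%y. emeasure unif (Pair y -` {w\<in>space (noised \<rho>). fst w \<in> A \<and> r < Q w})))"
    by (rule U.emeasure_pair_measure_alt) measurable
   also have "\<dots> = (nn_integral \<rho> (%y. emeasure unif {u. r < Q (y, u)} * indicator A y))"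
    using Asp by (intro nn_integral_cong)
     (auto simp: space_pair_measure \<rho>_def vimage_def split: split_indicator intro!: arg_cong2[where f=emeasure])
   finally show ?thesis .
  qed
  have 2: "emeasure \<gamma> (A \<times> {r<..}) = emeasure \<gamma> {z\<in>space \<gamma>. fst z \<in> A \<and> r < snd z}" for r
   using Asp by (auto intro!: arg_cong2[where f=emeasure] simp: sp)
  consider "r < 0" | "1 <= r" | "0 <= r" "r < 1" by linarith
  then show ?thesis
  proof cases
   case 1
   then have "emeasure unif {u. r < Q (y, u)} = 1" for y
    using U.emeasure_space_1 by (simp add: Qgt)
   then have "emeasure \<gamma>' (A \<times> {r<..}) = emeasure \<rho> A" unfolding \<open>emeasure \<gamma>' (A \<times> {r<..}) = _\<close> by simp
   also have "\<dots> = emeasure \<gamma> {z\<in>space \<gamma>. fst z \<in> A \<and> r < snd z}"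
    unfolding em\<rho>[OF A] using bd 1 by (intro emeasure_eq_AE) auto
   finally show ?thesis using 2 by simp
  next
   case r: 2
   then have e: "{u. r < Q (y, u)} = {}" for y by (auto simp: Qgt S_def)
   have "emeasure \<gamma> {z\<in>space \<gamma>. fst z \<in> A \<and> r < snd z} = emeasure \<gamma> {}"
    using bd r by (intro emeasure_eq_AE) auto
   then show ?thesis unfolding 2 1 e by simp
  next
   case r: 3
   have nxt: "\<exists>y. (y \<in> S \<and> r < y \<and> y < r + 1 / real (Suc n)) \<and> y <= x" if "r < x" for n x
   proof -
    have "r < Min {x, 1, r + 1 / real (Suc n)}" using r that by simp
    from Rats_dense_in_real[OF this]
    obtain y where "y \<in> \<rat>" "r < y" "y < Min {x, 1, r + 1 / real (Suc n)}" by blast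
    then show ?thesis using r by (intro exI[of _ y]) (auto simp: S_def)
   qed
   have "\<exists>s. \<forall>n. (s n \<in> S \<and> r < s n \<and> s n < r + 1 / real (Suc n)) \<and> s (Suc n) <= s n"
    by (rule dependent_nat_choice) (use nxt[of 1 0] nxt r in blast)+
   then obtain s where sS: "s n \<in> S" and sr: "r < s n" and su: "s n < r + 1 / real (Suc n)" and sdec: "s (Suc n) <= s n" for n by blast
   have slim: "\<exists>n. s n < r'" if lt: "r < r'" for r'
   proof -
    obtain n where "1 / real (Suc n) < r' - r" using nat_approx_posE[of "r' - r"] lt by auto
    then show ?thesis using su[of n] by (intro exI[of _ n]) linarith
   qed
   have ae1: "AE y in \<rho>. \<forall>r'\<in>S. \<forall>n. s n <= r' --> F r' y <= F (s n) y"
    using Fmono by (subst AE_ball_countable[OF Sc]) (auto simp: AE_all_countable)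
   have ae2: "AE y in \<rho>. \<forall>n. F (s n) y <= 1" using F1 by (auto simp: AE_all_countable)
   have ae: "AE y in \<rho>. emeasure unif {u. r < Q (y, u)} * indicator A y = (SUP n. F (s n) y * indicator A y)"
    using ae1 ae2
   proof eventually_elim
    fix y assume m: "\<forall>r'\<in>S. \<forall>n. s n <= r' --> F r' y <= F (s n) y" and l: "\<forall>n. F (s n) y <= 1"
    have "{u. r < Q (y, u)} = (\<Union>n. {u. 0 < u \<and> ennreal u <= F (s n) y})"
    proof (intro equalityI subsetI)
     fix u assume "u \<in> {u. r < Q (y, u)}"
     then obtain r' where r': "r' \<in> S" "r < r'" "0 < u" "ennreal u <= F r' y"
      using Qgt[of r y u] r by auto
     obtain n where "s n < r'" using slim r' by blast
     then have "F r' y <= F (s n) y" using m r' by auto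
     then show "u \<in> (\<Union>n. {u. 0 < u \<and> ennreal u <= F (s n) y})" using r' by (auto intro: order_trans)
    qed (use Qgt[of r y] sS sr in auto)
    moreover have "emeasure unif (\<Union>n. {u. 0 < u \<and> ennreal u <= F (s n) y})
      = (SUP n. emeasure unif {u. 0 < u \<and> ennreal u <= F (s n) y})"
    proof (rule SUP_emeasure_incseq[symmetric])
     show "range (%n. {u. 0 < u \<and> ennreal u <= F (s n) y}) \<subseteq> sets unif" by auto
     have "F (s n) y <= F (s (Suc n)) y" for n using m sS sdec by blast
     then show "incseq (%n. {u. 0 < u \<and> ennreal u <= F (s n) y})"
      by (intro incseq_SucI) (auto intro: order_trans)
    qed
    ultimately have "emeasure unif {u. r < Q (y, u)} = (SUP n. F (s n) y)"
     using l by (simp add: emeasure_unif_cut min_absorb2)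
    then show "emeasure unif {u. r < Q (y, u)} * indicator A y = (SUP n. F (s n) y * indicator A y)"
     by (simp split: split_indicator)
   qed
   have "emeasure \<gamma>' (A \<times> {r<..}) = (nn_integral \<rho> (%y. (SUP n. F (s n) y * indicator A y)))"
    unfolding 1 using ae by (rule nn_integral_cong_AE)
   also have "\<dots> = (SUP n. \<integral>\<^sup>+y. F (s n) y * indicator A y \<partial>\<rho>)"
   proof (rule nn_integral_monotone_convergence_SUP_AE)
    show "AE y in \<rho>. F (s n) y * indicator A y <= F (s (Suc n)) y * indicator A y" for n
     using Fmono[OF sdec[of n]] by eventually_elim (auto split: split_indicator)
   qed measurable
   also have "\<dots> = (SUP n. emeasure \<gamma> (A \<times> {s n<..}))"
    unfolding 2 FI[OF A] ..
   also have "\<dots> = emeasure \<gamma> (\<Union>n. A \<times> {s n<..})"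
   proof (rule SUP_emeasure_incseq)
    show "range (%n. A \<times> {s n<..}) \<subseteq> sets \<gamma>" unfolding sg using A by auto
    show "incseq (%n. A \<times> {s n<..})" using sdec by (intro incseq_SucI) (auto intro: le_less_trans)
   qed
   also have "(\<Union>n. A \<times> {s n<..}) = A \<times> {r<..}"
    using slim sr by (auto intro: less_trans)
   finally show ?thesis .
  qed
 qed
 have key2: "emeasure \<gamma> (A \<times> B) = emeasure \<gamma>' (A \<times> B)" if A [measurable]: "A \<in> sets M" and B: "B \<in> sets borel" for A B
 proof -
  define f where "f N = distr (density N (%z. indicator A (fst z))) borel snd" for N :: "('a \<times> real) measure"
  have f: "emeasure (f N) B = emeasure N (A \<times> B)"
   if N [measurable_cong]: "sets N = sets (M \<Otimes>\<^sub>M borel)" and B [measurable]: "B \<in> sets borel" for N B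
  proof -
   have sp: "space N = space M \<times> UNIV" using sets_eq_imp_space_eq[OF N] by (simp add: space_pair_measure)
   have "emeasure (f N) B = (nn_integral N (%z. indicator A (fst z) * indicator (snd -` B \<inter> space N) z))"
    unfolding f_def by (subst emeasure_distr, simp, simp, subst emeasure_density) auto
   also have "\<dots> = (nn_integral N (%z. indicator (A \<times> B) z))"
    using sp by (intro nn_integral_cong) (auto split: split_indicator)
   finally show ?thesis using N A B by simp
  qed
  have sg': "sets \<gamma>' = sets (M \<Otimes>\<^sub>M borel)" unfolding \<gamma>'_def by simp
  have "f \<gamma> = f \<gamma>'"
  proof (rule measure_eqI_lessThan)
   fix x
   show "emeasure (f \<gamma>) {x<..} = emeasure (f \<gamma>') {x<..}"
    by (simp add: f[OF sg] f[OF sg'] key[OF A])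
   show "emeasure (f \<gamma>) {x<..} < \<infinity>" by (simp add: f[OF sg] \<gamma>.emeasure_eq_measure)
  qed (simp_all add: f_def)
  then show ?thesis using f[OF sg B] f[OF sg' B] by simp
 qed
 have "\<gamma> = \<gamma>'"
 proof (rule measure_eqI_generator_eq[OF Int_stable_pair_measure_generator[of M borel], where A="%_. space M \<times> space borel" and \<Omega>="space M \<times> space borel"])
  show "{a \<times> b |a b. a \<in> sets M \<and> b \<in> sets borel} \<subseteq> Pow (space M \<times> space borel)"
   using sets.space_closed[of M] by auto
  show "range (%_. space M \<times> space borel) \<subseteq> {a \<times> b |a b. a \<in> sets M \<and> b \<in> sets borel}"
   using sets.top[of M] sets.top[of "borel :: real measure"] by blast
  show "emeasure \<gamma> (space M \<times> space borel) ~= \<infinity>" by (simp add: \<gamma>.emeasure_eq_measure)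
 qed (use key2 in "auto simp: sg \<gamma>'_def sets_pair_measure")
 then show ?thesis unfolding \<gamma>'_def \<rho>_def using Q by blast
qed

text \<open>This does the work of disintegrations: a coupling becomes a function of one marginal and noise.\<close>
theorem noise_outsourcing:
 fixes \<gamma> :: "('a \<times> 'b::polish_space) measure"
 assumes "prob_space \<gamma>" and sg [measurable_cong]: "sets \<gamma> = sets (M \<Otimes>\<^sub>M borel)"
 shows "\<exists>Q \<in> borel_measurable (M \<Otimes>\<^sub>M borel).
  \<gamma> = distr (distr \<gamma> M fst \<Otimes>\<^sub>M unif) (M \<Otimes>\<^sub>M borel) (%(y, u). (y, Q (y, u)))"
proof -
 interpret \<gamma>: prob_space \<gamma> by fact
 obtain c :: "'b => real" and R where c [measurable]: "c \<in> borel_measurable borel"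
  and R [measurable]: "R \<in> borel_measurable borel" and Rc: "!!x. R (c x) = x" and cb: "!!x. 0 <= c x \<and> c x <= 1"
  using polish_real_code by metis
 define \<delta> where "\<delta> = distr \<gamma> (M \<Otimes>\<^sub>M borel) (%z. (fst z, c (snd z)))"
 have "prob_space \<delta>" unfolding \<delta>_def by (rule \<gamma>.prob_space_distr) measurable
 moreover have "AE z in \<delta>. 0 <= snd z \<and> snd z <= 1"
  unfolding \<delta>_def using cb by (subst AE_distr_iff) auto
 moreover have \<delta>1: "distr \<delta> M fst = distr \<gamma> M fst"
  unfolding \<delta>_def by (subst distr_distr) (auto simp: comp_def)
 ultimately obtain Q where Q [measurable]: "Q \<in> borel_measurable (M \<Otimes>\<^sub>M borel)"
  and eq: "\<delta> = distr (distr \<gamma> M fst \<Otimes>\<^sub>M unif) (M \<Otimes>\<^sub>M borel) (%(y, u). (y, Q (y, u)))"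
  using noise_outsourcing_real[of \<delta> M] by (auto simp: \<delta>_def)
 have "\<gamma> = distr \<delta> (M \<Otimes>\<^sub>M borel) (%z. (fst z, R (snd z)))"
  unfolding \<delta>_def by (subst distr_distr) (auto simp: comp_def Rc distr_id2 sg)
 also have "\<dots> = distr (distr \<gamma> M fst \<Otimes>\<^sub>M unif) (M \<Otimes>\<^sub>M borel) (%(y, u). (y, (R \<circ> Q) (y, u)))"
  unfolding eq by (subst distr_distr) (auto simp: comp_def split_beta')
 finally show ?thesis by (intro bexI[of _ "R \<circ> Q"]) auto
qed

section \<open>Square-integrable functions\<close>

lemma integrable_mult_of_squares:
 fixes f g :: "'a => real"
 assumes [measurable]: "f \<in> borel_measurable M" "g \<in> borel_measurable M"
  and "integrable M (%x. (f x)^2)" "integrable M (%x. (g x)^2)"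
 shows "integrable M (%x. f x * g x)"
proof (rule Bochner_Integration.integrable_bound)
 show "integrable M (%x. (f x)^2 + (g x)^2)" using assms by simp
 have "abs (a * b) <= a^2 + b^2" for a b :: real
 proof -
  have "0 <= abs a * abs b" by simp
  then have "abs a * abs b <= \<bar>a\<bar>^2 + \<bar>b\<bar>^2" using sum_squares_bound[of "abs a" "abs b"] by linarith
  then show ?thesis by (simp add: abs_mult)
 qed
 then show "AE x in M. norm (f x * g x) <= norm ((f x)^2 + (g x)^2)" by (simp add: abs_mult)
qed measurable

lemma integral_cauchy_schwarz:
 fixes f g :: "'a => real"
 assumes [measurable]: "f \<in> borel_measurable M" "g \<in> borel_measurable M"
  and f: "integrable M (%x. (f x)^2)" and g: "integrable M (%x. (g x)^2)"
 shows "abs (LINT x|M. f x * g x) <= sqrt (LINT x|M. (f x)^2) * sqrt (LINT x|M. (g x)^2)"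
proof -
 define A B C where "A = (LINT x|M. (f x)^2)" and "B = (LINT x|M. (g x)^2)" and "C = (LINT x|M. f x * g x)"
 have fg: "integrable M (%x. f x * g x)" by (rule integrable_mult_of_squares) fact+
 have q: "0 <= A + 2 * t * C + t^2 * B" for t
 proof -
  have "0 <= (LINT x|M. (f x + t * g x)^2)" by simp
  also have "\<dots> = (LINT x|M. (f x)^2 + (2 * t) * (f x * g x) + t^2 * (g x)^2)"
   by (intro Bochner_Integration.integral_cong) (auto simp: power2_eq_square algebra_simps)
  also have "\<dots> = A + 2 * t * C + t^2 * B" unfolding A_def B_def C_def using f g fg by simp
  finally show ?thesis .
 qed
 have AB: "0 <= A" "0 <= B" by (auto simp: A_def B_def)
 have "C^2 <= A * B"
 proof (cases "B = 0")
  case True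
  have "C = 0"
  proof (rule ccontr)
   assume "C ~= 0"
   then show False using q[of "- (A + 1) / (2 * C)"] True AB by (simp add: field_simps)
  qed
  then show ?thesis using AB by simp
 next
  case False
  then show ?thesis using q[of "- C / B"] AB by (simp add: field_simps power2_eq_square)
 qed
 then have "sqrt (C^2) <= sqrt (A * B)" by (rule real_sqrt_le_mono)
 then show ?thesis unfolding A_def[symmetric] B_def[symmetric] C_def[symmetric] by (simp add: real_sqrt_mult)
qed

lemma integral_minkowski:
 fixes f g :: "'a => real"
 assumes [measurable]: "f \<in> borel_measurable M" "g \<in> borel_measurable M"
  and f: "integrable M (%x. (f x)^2)" and g: "integrable M (%x. (g x)^2)"
 shows "(LINT x|M. (f x + g x)^2) <= (sqrt (LINT x|M. (f x)^2) + sqrt (LINT x|M. (g x)^2))^2"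
proof -
 have fg: "integrable M (%x. f x * g x)" by (rule integrable_mult_of_squares) fact+
 have "(LINT x|M. (f x + g x)^2) = (LINT x|M. (f x)^2 + 2 * (f x * g x) + (g x)^2)"
  by (intro Bochner_Integration.integral_cong) (auto simp: power2_eq_square algebra_simps)
 also have "\<dots> = (LINT x|M. (f x)^2) + 2 * (LINT x|M. f x * g x) + (LINT x|M. (g x)^2)"
  using f g fg by simp
 also have "\<dots> <= (sqrt (LINT x|M. (f x)^2) + sqrt (LINT x|M. (g x)^2))^2"
  using integral_cauchy_schwarz[OF assms] by (simp add: power2_sum)
 finally show ?thesis .
qed

lemma norm_sum_sq_bound: "(norm (x + y))^2 <= 2 * (norm x)^2 + 2 * (norm (y::'x::real_inner))^2"
proof -
 have "2 * (x \<bullet> y) <= (norm x)^2 + (norm y)^2"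
  using norm_cauchy_schwarz[of x y] sum_squares_bound[of "norm x" "norm y"] by linarith
 then show ?thesis by (simp add: power2_norm_eq_inner inner_add inner_commute)
qed

lemma integrable_norm_add_sq:
 fixes f g :: "'a => 'x::{real_inner, polish_space}"
 assumes [measurable]: "f \<in> borel_measurable M" "g \<in> borel_measurable M"
  and "integrable M (%x. (norm (f x))^2)" "integrable M (%x. (norm (g x))^2)"
 shows "integrable M (%x. (norm (f x + g x))^2)"
proof (rule Bochner_Integration.integrable_bound)
 show "integrable M (%x. 2 * (norm (f x))^2 + 2 * (norm (g x))^2)" using assms by simp
qed (auto simp: norm_sum_sq_bound)

lemma integrable_norm_diff_sq:
 fixes f g :: "'a => 'x::{real_inner, polish_space}"
 assumes [measurable]: "f \<in> borel_measurable M" "g \<in> borel_measurable M"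
  and "integrable M (%x. (norm (f x))^2)" "integrable M (%x. (norm (g x))^2)"
 shows "integrable M (%x. (norm (f x - g x))^2)"
 using integrable_norm_add_sq[of f M "%x. - g x"] assms by simp

lemma norm_minkowski:
 fixes f g :: "'a => 'x::{real_inner, polish_space}"
 assumes [measurable]: "f \<in> borel_measurable M" "g \<in> borel_measurable M"
  and f: "integrable M (%x. (norm (f x))^2)" and g: "integrable M (%x. (norm (g x))^2)"
 shows "sqrt (LINT x|M. (norm (f x + g x))^2) <= sqrt (LINT x|M. (norm (f x))^2) + sqrt (LINT x|M. (norm (g x))^2)"
proof -
 have i: "integrable M (%x. (norm (f x) + norm (g x))^2)"
  using f g integrable_mult_of_squares[of "%x. norm (f x)" M "%x. norm (g x)"]
  by (simp add: power2_sum mult.assoc)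
 have "(LINT x|M. (norm (f x + g x))^2) <= (LINT x|M. (norm (f x) + norm (g x))^2)"
  using i integrable_norm_add_sq[OF assms] by (intro integral_mono) (auto intro!: power_mono norm_triangle_ineq)
 also have "\<dots> <= (sqrt (LINT x|M. (norm (f x))^2) + sqrt (LINT x|M. (norm (g x))^2))^2"
  by (rule integral_minkowski) (use f g in auto)
 finally show ?thesis by (intro real_le_lsqrt) auto
qed

lemma inner_cauchy_schwarz_integral:
 fixes f g :: "'a => 'x::{real_inner, polish_space}"
 assumes [measurable]: "f \<in> borel_measurable M" "g \<in> borel_measurable M"
  and f: "integrable M (%x. (norm (f x))^2)" and g: "integrable M (%x. (norm (g x))^2)"
 shows "integrable M (%x. f x \<bullet> g x)"
  and "abs (LINT x|M. f x \<bullet> g x) <= sqrt (LINT x|M. (norm (f x))^2) * sqrt (LINT x|M. (norm (g x))^2)"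
proof -
 have i: "integrable M (%x. norm (f x) * norm (g x))"
  by (rule integrable_mult_of_squares) (use f g in auto)
 show i2: "integrable M (%x. f x \<bullet> g x)"
  by (rule Bochner_Integration.integrable_bound[OF i]) (auto simp: Cauchy_Schwarz_ineq2)
 have "abs (LINT x|M. f x \<bullet> g x) <= (LINT x|M. abs (f x \<bullet> g x))" by (rule integral_abs_bound)
 also have "\<dots> <= (LINT x|M. norm (f x) * norm (g x))"
  using i i2 by (intro integral_mono) (auto simp: Cauchy_Schwarz_ineq2)
 also have "\<dots> <= sqrt (LINT x|M. (norm (f x))^2) * sqrt (LINT x|M. (norm (g x))^2)"
  using integral_cauchy_schwarz[of "%x. norm (f x)" M "%x. norm (g x)"] f g by simp
 finally show "abs (LINT x|M. f x \<bullet> g x) <= sqrt (LINT x|M. (norm (f x))^2) * sqrt (LINT x|M. (norm (g x))^2)" .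
qed

section \<open>The Wasserstein distance through random variables\<close>

lemma measurable_fst_snd_borel [measurable]:
 fixes M :: "('x::second_countable_topology \<times> 'y::second_countable_topology) measure"
 shows "fst \<in> borel_measurable (borel :: ('x \<times> 'y) measure)" "snd \<in> borel_measurable (borel :: ('x \<times> 'y) measure)"
 by (auto intro!: borel_measurable_continuous_onI continuous_intros)

lemma P2D:
 assumes "\<mu> \<in> P2"
 shows "prob_space \<mu>" "sets \<mu> = sets borel" "space \<mu> = UNIV" "integrable \<mu> (%x. (norm x)^2)"
 using assms sets_eq_imp_space_eq[of \<mu> borel] by (auto simp: P2_def)

lemma P2_distr:
 assumes "prob_space P" and a [measurable]: "a \<in> borel_measurable P" and "integrable P (%w. (norm (a w))^2)"
 shows "distr P borel a \<in> P2"
 using assms by (auto simp: P2_def prob_space.prob_space_distr integrable_distr_eq)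

lemma couplings_distr:
 fixes a b :: "'a => 'x::{real_inner, polish_space}"
 assumes "prob_space P" and [measurable]: "a \<in> borel_measurable P" "b \<in> borel_measurable P"
 shows "distr P borel (%w. (a w, b w)) \<in> couplings (distr P borel a) (distr P borel b)"
 using assms by (auto simp: couplings_def prob_space.prob_space_distr distr_distr comp_def)

lemma couplings_cost_nonneg: "0 <= (LINT (x, y)|\<gamma>. (dist x y)^2)"
 by (rule integral_nonneg_AE) auto

lemma couplings_bdd: "bdd_below ((%\<gamma>. \<integral>(x, y). (dist x y)^2 \<partial>\<gamma>) ` C)"
 using couplings_cost_nonneg by (intro bdd_belowI[of _ 0]) auto

lemma couplings_nonempty:
 assumes "\<mu> \<in> P2" "\<nu> \<in> P2"
 shows "couplings \<mu> \<nu> ~= {}"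
proof -
 interpret \<mu>: prob_space \<mu> using P2D assms by blast
 interpret \<nu>: prob_space \<nu> using P2D assms by blast
 interpret pair: pair_prob_space \<mu> \<nu> ..
 have [measurable_cong]: "sets \<mu> = sets borel" "sets \<nu> = sets borel" using P2D assms by auto
 have "distr (\<mu> \<Otimes>\<^sub>M \<nu>) borel fst = \<mu>"
 proof (rule measure_eqI)
  fix A assume "A \<in> sets (distr (\<mu> \<Otimes>\<^sub>M \<nu>) borel fst)"
  then have [measurable]: "A \<in> sets borel" and [measurable]: "A \<in> sets \<mu>" using P2D assms by auto
  have "emeasure (distr (\<mu> \<Otimes>\<^sub>M \<nu>) borel fst) A = emeasure (\<mu> \<Otimes>\<^sub>M \<nu>) (A \<times> space \<nu>)"
   using sets.sets_into_space[of A \<mu>]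
   by (subst emeasure_distr) (auto simp: space_pair_measure intro!: arg_cong2[where f=emeasure])
  then show "emeasure (distr (\<mu> \<Otimes>\<^sub>M \<nu>) borel fst) A = emeasure \<mu> A"
   by (simp add: \<nu>.emeasure_pair_measure_Times \<nu>.emeasure_space_1)
 qed (simp add: P2D assms)
 moreover have "distr (\<mu> \<Otimes>\<^sub>M \<nu>) borel snd = \<nu>"
 proof (rule measure_eqI)
  fix A assume "A \<in> sets (distr (\<mu> \<Otimes>\<^sub>M \<nu>) borel snd)"
  then have [measurable]: "A \<in> sets borel" and [measurable]: "A \<in> sets \<nu>" using P2D assms by auto
  have "emeasure (distr (\<mu> \<Otimes>\<^sub>M \<nu>) borel snd) A = emeasure (\<mu> \<Otimes>\<^sub>M \<nu>) (space \<mu> \<times> A)"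
   using sets.sets_into_space[of A \<nu>]
   by (subst emeasure_distr) (auto simp: space_pair_measure intro!: arg_cong2[where f=emeasure])
  then show "emeasure (distr (\<mu> \<Otimes>\<^sub>M \<nu>) borel snd) A = emeasure \<nu> A"
   by (simp add: \<nu>.emeasure_pair_measure_Times \<mu>.emeasure_space_1)
 qed (simp add: P2D assms)
 ultimately show ?thesis
  using couplings_distr[of "\<mu> \<Otimes>\<^sub>M \<nu>" fst snd] pair.prob_space_axioms by auto
qed

lemma W2_sq:
 assumes "\<mu> \<in> P2" "\<nu> \<in> P2"
 shows "(W2 \<mu> \<nu>)^2 = (INF \<gamma>\<in>couplings \<mu> \<nu>. \<integral>(x, y). (dist x y)^2 \<partial>\<gamma>)"
 unfolding W2_def by (rule real_sqrt_pow2, rule cINF_greatest[OF couplings_nonempty[OF assms]])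
  (rule couplings_cost_nonneg)

lemma W2_nonneg: "\<mu> \<in> P2 ==> \<nu> \<in> P2 ==> 0 <= W2 \<mu> \<nu>"
 unfolding W2_def by (intro real_sqrt_ge_zero cINF_greatest couplings_nonempty couplings_cost_nonneg)

lemma W2_sq_le:
 fixes a b :: "'a => 'x::{real_inner, polish_space}"
 assumes P: "prob_space P" and [measurable]: "a \<in> borel_measurable P" "b \<in> borel_measurable P"
  and "distr P borel a = \<mu>" "distr P borel b = \<nu>" and "\<mu> \<in> P2" "\<nu> \<in> P2"
 shows "(W2 \<mu> \<nu>)^2 <= (LINT w|P. (norm (a w - b w))^2)"
proof -
 have "(W2 \<mu> \<nu>)^2 <= (\<integral>(x, y). (dist x y)^2 \<partial>(distr P borel (%w. (a w, b w))))"
  unfolding W2_sq[OF assms(6,7)]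
  using couplings_distr[OF assms(1-3)] assms(4,5) by (intro cINF_lower couplings_bdd) auto
 also have "\<dots> = (LINT w|P. (norm (a w - b w))^2)"
  by (subst integral_distr) (auto simp: dist_norm split_beta')
 finally show ?thesis .
qed

lemma prob_space_noise: "prob_space P ==> prob_space (noised P)"
 by (intro prob_space_pair prob_space_unif)

lemma distr_noise_fst:
 assumes "prob_space P" and [measurable]: "f \<in> P \<rightarrow>\<^sub>M N"
 shows "distr (noised P) N (%w. f (fst w)) = distr P N f"
proof -
 interpret P: prob_space P by fact
 interpret U: prob_space unif by (rule prob_space_unif)
 show ?thesis
 proof (rule measure_eqI)
  fix A assume "A \<in> sets (distr (noised P) N (%w. f (fst w)))"
  then have [measurable]: "A \<in> sets N" by simp
  have "emeasure (distr (noised P) N (%w. f (fst w))) A = emeasure (noised P) ((f -` A \<inter> space P) \<times> space unif)"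
   by (subst emeasure_distr) (auto simp: space_pair_measure intro!: arg_cong2[where f=emeasure])
  also have "\<dots> = emeasure P (f -` A \<inter> space P)"
   by (subst U.emeasure_pair_measure_Times) auto
  finally show "emeasure (distr (noised P) N (%w. f (fst w))) A = emeasure (distr P N f) A"
   by (simp add: emeasure_distr)
 qed simp
qed

lemma noise_integral_fst:
 fixes f :: "'a => real"
 assumes "prob_space P" and [measurable]: "f \<in> borel_measurable P"
 shows "(LINT w|(noised P). f (fst w)) = (LINT w|P. f w)"
  and "integrable (noised P) (%w. f (fst w)) \<longleftrightarrow> integrable P f"
proof -
 note d = distr_noise_fst[OF assms]
 have "(LINT w|(noised P). f (fst w)) = (\<integral>y. y \<partial>(distr (noised P) borel (%w. f (fst w))))"
  by (subst integral_distr) auto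
 also have "\<dots> = (LINT w|P. f w)" unfolding d by (subst integral_distr) auto
 finally show "(LINT w|(noised P). f (fst w)) = (LINT w|P. f w)" .
 have "integrable (noised P) (%w. f (fst w)) \<longleftrightarrow> integrable (distr (noised P) borel (%w. f (fst w))) (%y. y)"
  by (subst integrable_distr_eq) auto
 also have "\<dots> \<longleftrightarrow> integrable P f" unfolding d by (subst integrable_distr_eq) auto
 finally show "integrable (noised P) (%w. f (fst w)) \<longleftrightarrow> integrable P f" .
qed

text \<open>
 Every representation of \<open>\<mu>\<close> by a random variable extends, after adding noise, to a nearly
 optimal coupling with \<open>\<nu>\<close>. Using it twice with the same \<open>a\<close> glues two couplings.
\<close>
lemma W2_near_optimal:
 fixes a :: "'a => 'x::{real_inner, polish_space}"
 assumes P: "prob_space P" and a [measurable]: "a \<in> borel_measurable P"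
  and \<mu>: "distr P borel a = \<mu>" "\<mu> \<in> P2" and \<nu>: "\<nu> \<in> P2" and "0 < \<epsilon>"
 obtains b where "b \<in> borel_measurable (noised P)" "distr (noised P) borel b = \<nu>"
  "(LINT w|(noised P). (norm (a (fst w) - b w))^2) < (W2 \<mu> \<nu>)^2 + \<epsilon>"
proof -
 have "(INF \<gamma>\<in>couplings \<mu> \<nu>. \<integral>(x, y). (dist x y)^2 \<partial>\<gamma>) < (W2 \<mu> \<nu>)^2 + \<epsilon>"
  using W2_sq[OF \<mu>(2) \<nu>] \<open>0 < \<epsilon>\<close> by simp
 then obtain \<gamma> where \<gamma>: "\<gamma> \<in> couplings \<mu> \<nu>" and cost: "(LINT (x, y)|\<gamma>. (dist x y)^2) < (W2 \<mu> \<nu>)^2 + \<epsilon>"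
  using cINF_less_iff[OF couplings_nonempty[OF \<mu>(2) \<nu>] couplings_bdd] by blast
 have sg: "sets \<gamma> = sets borel" using \<gamma> by (auto simp: couplings_def)
 have g: "prob_space \<gamma>" "sets \<gamma> = sets (borel \<Otimes>\<^sub>M borel)" "distr \<gamma> borel fst = \<mu>" "distr \<gamma> borel snd = \<nu>"
  unfolding borel_prod using sg \<gamma> unfolding couplings_def by blast+
 from noise_outsourcing[OF g(1,2), unfolded g(3)]
 obtain Q where Q [measurable]: "Q \<in> borel_measurable (borel \<Otimes>\<^sub>M borel)"
  and eq: "\<gamma> = distr (noised \<mu>) (borel \<Otimes>\<^sub>M borel) (%(y, u). (y, Q (y, u)))"
  by blast
 interpret P: prob_space P by fact
 interpret U: prob_space unif by (rule prob_space_unif)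
 interpret \<mu>: prob_space \<mu> using \<mu> P2D by blast
 define b where "b = (%w. Q (a (fst w), snd w))"
 have [measurable_cong]: "sets \<mu> = sets borel" using P2D \<mu> by blast
 have b [measurable]: "b \<in> borel_measurable (noised P)" unfolding b_def by measurable
 have pu: "distr P borel a \<Otimes>\<^sub>M distr unif borel (%u. u) = distr (noised P) (borel \<Otimes>\<^sub>M borel) (%(w, u). (a w, u))"
  by (rule pair_measure_distr) (auto simp: U.sigma_finite_measure_axioms distr_id2)
 have "distr unif borel (%u. u) = unif" by (rule distr_id2) simp
 then have eq2: "\<gamma> = distr (noised P) (borel \<Otimes>\<^sub>M borel) (%w. (a (fst w), b w))"
  using pu unfolding eq \<mu>(1) by (simp add: distr_distr comp_def split_beta' b_def)
 have d: "distr (noised P) borel b = \<nu>"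
  unfolding g(4)[symmetric] eq2 by (subst distr_distr) (auto simp: comp_def)
 have c: "(LINT (x, y)|\<gamma>. (dist x y)^2) = (LINT w|(noised P). (norm (a (fst w) - b w))^2)"
  unfolding eq2 by (subst integral_distr) (auto simp: dist_norm split_beta')
 show ?thesis by (rule that[OF b d]) (use cost c in simp)
qed

lemma W2_commute: "W2 \<mu> \<nu> = W2 \<nu> (\<mu> :: 'x::{real_inner, polish_space} measure)"
proof -
 have *: "\<exists>\<delta>\<in>couplings \<nu> \<mu>. (LINT (x, y)|\<gamma>. (dist x y)^2) = (LINT (x, y)|\<delta>. (dist x y)^2)"
  if "\<gamma> \<in> couplings \<mu> \<nu>" for \<gamma> and \<mu> \<nu> :: "'x measure"
 proof
  have [measurable_cong]: "sets \<gamma> = sets borel" and p: "prob_space \<gamma>" and m: "distr \<gamma> borel fst = \<mu>" "distr \<gamma> borel snd = \<nu>"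
   using that by (auto simp: couplings_def)
  show "distr \<gamma> borel (%w. (snd w, fst w)) \<in> couplings \<nu> \<mu>"
   using couplings_distr[OF p, of snd fst] m by simp
  show "(LINT (x, y)|\<gamma>. (dist x y)^2) = (\<integral>(x, y). (dist x y)^2 \<partial>(distr \<gamma> borel (%w. (snd w, fst w))))"
   by (subst integral_distr) (auto simp: dist_commute split_beta')
 qed
 have "(%\<gamma>. \<integral>(x, y). (dist x y)^2 \<partial>\<gamma>) ` couplings \<mu> \<nu> = (%\<gamma>. \<integral>(x, y). (dist x y)^2 \<partial>\<gamma>) ` couplings \<nu> \<mu>"
  using *[of _ \<mu> \<nu>] *[of _ \<nu> \<mu>] by (auto simp: image_iff) 
 then show ?thesis unfolding W2_def by simp
qed

lemma P2_random:
 assumes "distr P borel a = \<mu>" "\<mu> \<in> P2" and [measurable]: "a \<in> borel_measurable P"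
 shows "integrable P (%w. (norm (a w))^2)"
 using P2D(4)[OF assms(2)] unfolding assms(1)[symmetric] by (subst (asm) integrable_distr_eq) auto

lemma W2_triangle:
 fixes \<mu> \<nu> \<rho> :: "'x::{real_inner, polish_space} measure"
 assumes \<mu>: "\<mu> \<in> P2" and \<nu>: "\<nu> \<in> P2" and \<rho>: "\<rho> \<in> P2"
 shows "W2 \<mu> \<rho> <= W2 \<mu> \<nu> + W2 \<nu> \<rho>"
proof -
 have step: "W2 \<mu> \<rho> <= sqrt ((W2 \<mu> \<nu>)^2 + \<epsilon>) + sqrt ((W2 \<nu> \<rho>)^2 + \<epsilon>)" if \<epsilon>: "0 < \<epsilon>" for \<epsilon>
 proof -
  have [measurable_cong]: "sets \<mu> = sets borel" and p: "prob_space \<mu>" using P2D \<mu> by auto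
  have "distr \<mu> borel (%x. x) = \<mu>" by (rule distr_id2) (use P2D \<mu> in auto)
  then obtain b where b [measurable]: "b \<in> borel_measurable (noised \<mu>)" and bd: "distr (noised \<mu>) borel b = \<nu>"
   and bc: "(LINT w|(noised \<mu>). (norm (fst w - b w))^2) < (W2 \<mu> \<nu>)^2 + \<epsilon>"
   using W2_near_optimal[OF p _ _ \<mu> \<nu> \<epsilon>, of "%x. x"] by auto
  define P where "P = \<mu> \<Otimes>\<^sub>M unif"
  have P: "prob_space P" unfolding P_def by (intro prob_space_noise p)
  have [measurable]: "b \<in> borel_measurable P" unfolding P_def by (rule b)
  obtain c where c [measurable]: "c \<in> borel_measurable (noised P)" and cd: "distr (noised P) borel c = \<rho>"
   and cc: "(LINT w|(noised P). (norm (b (fst w) - c w))^2) < (W2 \<nu> \<rho>)^2 + \<epsilon>"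
   using W2_near_optimal[OF P _ bd[folded P_def] \<nu> \<rho> \<epsilon>] by auto
  let ?R = "noised P"
  have R: "prob_space ?R" by (intro prob_space_noise P)
  have [measurable]: "fst \<in> borel_measurable P" unfolding P_def by measurable
  define a where "a w = fst (fst w)" for w :: "('x \<times> real) \<times> real"
  define b' where "b' w = b (fst w)" for w :: "('x \<times> real) \<times> real"
  have [measurable]: "a \<in> borel_measurable ?R" "b' \<in> borel_measurable ?R" unfolding a_def b'_def by measurable
  have ad: "distr ?R borel a = \<mu>"
   unfolding a_def using distr_noise_fst[OF P, of fst borel] distr_noise_fst[OF p, of "%x. x" borel]
   by (simp add: P_def distr_id2 P2D \<mu>)
  have b'd: "distr ?R borel b' = \<nu>"
   unfolding b'_def using distr_noise_fst[OF P, of b borel] bd by (simp add: P_def)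
  have i: "integrable ?R (%w. (norm (a w))^2)" "integrable ?R (%w. (norm (b' w))^2)" "integrable ?R (%w. (norm (c w))^2)"
   using P2_random[OF ad \<mu>] P2_random[OF b'd \<nu>] P2_random[OF cd \<rho>] by auto
  have bc': "(LINT w|?R. (norm (a w - b' w))^2) < (W2 \<mu> \<nu>)^2 + \<epsilon>"
   using noise_integral_fst(1)[OF P, of "%w. (norm (fst w - b w))^2"] bc unfolding a_def b'_def P_def by simp
  have "(W2 \<mu> \<rho>)^2 <= (LINT w|?R. (norm (a w - c w))^2)"
   by (rule W2_sq_le[OF R _ c ad cd \<mu> \<rho>]) simp
  then have "W2 \<mu> \<rho> <= sqrt (LINT w|?R. (norm (a w - c w))^2)" by (rule real_le_rsqrt)
  also have "\<dots> <= sqrt (LINT w|?R. (norm (a w - b' w))^2) + sqrt (LINT w|?R. (norm (b' w - c w))^2)"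
   using norm_minkowski[of "%w. a w - b' w" ?R "%w. b' w - c w"] i
   by (simp add: integrable_norm_diff_sq)
  also have "\<dots> <= sqrt ((W2 \<mu> \<nu>)^2 + \<epsilon>) + sqrt ((W2 \<nu> \<rho>)^2 + \<epsilon>)"
   using bc' cc by (intro add_mono real_sqrt_le_mono) (auto simp: b'_def)
  finally show ?thesis .
 qed
 have "((%\<epsilon>. sqrt ((W2 \<mu> \<nu>)^2 + \<epsilon>) + sqrt ((W2 \<nu> \<rho>)^2 + \<epsilon>)) ---> sqrt ((W2 \<mu> \<nu>)^2 + 0) + sqrt ((W2 \<nu> \<rho>)^2 + 0)) (at_right 0)"
  by (intro tendsto_intros)
 then have "W2 \<mu> \<rho> <= sqrt ((W2 \<mu> \<nu>)^2 + 0) + sqrt ((W2 \<nu> \<rho>)^2 + 0)"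
  by (rule tendsto_lowerbound) (auto simp: eventually_at_right_less step intro: eventually_mono[OF eventually_at_right_less])
 then show ?thesis using W2_nonneg[OF \<mu> \<nu>] W2_nonneg[OF \<nu> \<rho>] by simp
qed

text \<open>
 A first-order expansion of \<open>\<psi>\<close> with local slope \<open>G\<close> becomes an expansion of its
 integral in the Wasserstein distance.
\<close>
lemma integral_diff_le_W2:
 assumes \<mu>: "\<mu> \<in> P2" and \<nu>: "\<nu> \<in> P2"
  and [measurable]: "\<psi> \<in> borel_measurable borel" "G \<in> borel_measurable borel"
  and i\<mu>: "integrable \<mu> \<psi>" and i\<nu>: "integrable \<nu> \<psi>" and iG: "integrable \<mu> (%x. (G x)^2)"
  and le: "!!x y. abs (\<psi> y - \<psi> x) <= G x * norm (y - x) + K * (norm (y - x))^2" and "0 <= K"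
 shows "abs ((LINT x|\<nu>. \<psi> x) - (LINT x|\<mu>. \<psi> x)) <= sqrt (LINT x|\<mu>. (G x)^2) * W2 \<mu> \<nu> + K * (W2 \<mu> \<nu>)^2"
proof -
 let ?A = "abs ((LINT x|\<nu>. \<psi> x) - (LINT x|\<mu>. \<psi> x))"
 let ?G = "sqrt (LINT x|\<mu>. (G x)^2)"
 have step: "?A <= ?G * sqrt ((W2 \<mu> \<nu>)^2 + \<epsilon>) + K * ((W2 \<mu> \<nu>)^2 + \<epsilon>)" if \<epsilon>: "0 < \<epsilon>" for \<epsilon>
 proof -
  have [measurable_cong]: "sets \<mu> = sets borel" and p: "prob_space \<mu>" using P2D \<mu> by auto
  let ?P = "noised \<mu>"
  have "distr \<mu> borel (%x. x) = \<mu>" by (rule distr_id2) (use P2D \<mu> in auto)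
  then obtain b where b [measurable]: "b \<in> borel_measurable ?P" and bd: "distr ?P borel b = \<nu>"
   and bc: "(LINT w|?P. (norm (fst w - b w))^2) < (W2 \<mu> \<nu>)^2 + \<epsilon>"
   using W2_near_optimal[OF p _ _ \<mu> \<nu> \<epsilon>, of "%x. x"] by auto
  have P: "prob_space ?P" by (intro prob_space_noise p)
  have bc': "(LINT w|?P. (norm (b w - fst w))^2) < (W2 \<mu> \<nu>)^2 + \<epsilon>" using bc by (simp add: norm_minus_commute)
  have ib: "integrable ?P (%w. (norm (b w))^2)" by (rule P2_random[OF bd \<nu>]) simp
  have ia: "integrable ?P (%w. (norm (fst w))^2)"
   using noise_integral_fst(2)[OF p, of "%x. (norm x)^2"] P2D(4)[OF \<mu>] by simp
  have id: "integrable ?P (%w. (norm (b w - fst w))^2)"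
   by (rule integrable_norm_diff_sq) (use ia ib in auto)
  have iG': "integrable ?P (%w. (G (fst w))^2)" and GG: "(LINT w|?P. (G (fst w))^2) = (LINT x|\<mu>. (G x)^2)"
   using noise_integral_fst[OF p, of "%x. (G x)^2"] iG by simp_all
  have i1: "integrable ?P (%w. \<psi> (fst w))" and e1: "(LINT w|?P. \<psi> (fst w)) = (LINT x|\<mu>. \<psi> x)"
   using noise_integral_fst[OF p, of \<psi>] i\<mu> by simp_all
  have i2: "integrable ?P (%w. \<psi> (b w))" using i\<nu> unfolding bd[symmetric] by (subst (asm) integrable_distr_eq) auto
  have e2: "(LINT w|?P. \<psi> (b w)) = (LINT x|\<nu>. \<psi> x)" unfolding bd[symmetric] by (subst integral_distr) auto
  have iGm: "integrable ?P (%w. G (fst w) * norm (b w - fst w))"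
   by (rule integrable_mult_of_squares) (use iG' id in auto)
  have "?A = abs (LINT w|?P. \<psi> (b w) - \<psi> (fst w))" using i1 i2 e1 e2 by simp
  also have "\<dots> <= (LINT w|?P. abs (\<psi> (b w) - \<psi> (fst w)))" by (rule integral_abs_bound)
  also have "\<dots> <= (LINT w|?P. G (fst w) * norm (b w - fst w) + K * (norm (b w - fst w))^2)"
   using i1 i2 iGm id le by (intro integral_mono) auto
  also have "\<dots> = (LINT w|?P. G (fst w) * norm (b w - fst w)) + K * (LINT w|?P. (norm (b w - fst w))^2)"
   using iGm id by simp
  also have "\<dots> <= ?G * sqrt (LINT w|?P. (norm (b w - fst w))^2) + K * (LINT w|?P. (norm (b w - fst w))^2)"
   using integral_cauchy_schwarz[of "%w. G (fst w)" ?P "%w. norm (b w - fst w)"] iG' id GG by simp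
  also have "\<dots> <= ?G * sqrt ((W2 \<mu> \<nu>)^2 + \<epsilon>) + K * ((W2 \<mu> \<nu>)^2 + \<epsilon>)"
   using bc' \<open>0 <= K\<close> by (intro add_mono mult_left_mono real_sqrt_le_mono) auto
  finally show ?thesis .
 qed
 have "((%\<epsilon>. ?G * sqrt ((W2 \<mu> \<nu>)^2 + \<epsilon>) + K * ((W2 \<mu> \<nu>)^2 + \<epsilon>)) ---> ?G * sqrt ((W2 \<mu> \<nu>)^2 + 0) + K * ((W2 \<mu> \<nu>)^2 + 0)) (at_right 0)"
  by (intro tendsto_intros)
 then have "?A <= ?G * sqrt ((W2 \<mu> \<nu>)^2 + 0) + K * ((W2 \<mu> \<nu>)^2 + 0)"
  by (rule tendsto_lowerbound) (auto simp: step intro: eventually_mono[OF eventually_at_right_less])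
 then show ?thesis using W2_nonneg[OF \<mu> \<nu>] by simp
qed

section \<open>The derivative of the distance along exponential curves\<close>

lemma TP2D:
 assumes "\<Phi> \<in> TP2"
 shows "prob_space \<Phi>" "sets \<Phi> = sets borel" "space \<Phi> = UNIV"
  "integrable \<Phi> (%z. (norm (fst z))^2)" "integrable \<Phi> (%z. (norm (snd z))^2)"
proof -
 show "prob_space \<Phi>" and s [measurable_cong]: "sets \<Phi> = sets borel" using assms by (auto simp: TP2_def)
 show "space \<Phi> = UNIV" using sets_eq_imp_space_eq[OF s] by simp
 have i: "integrable \<Phi> (%z. (norm (fst z))^2 + (norm (snd z))^2)"
  using assms by (simp add: TP2_def split_beta')
 show "integrable \<Phi> (%z. (norm (fst z))^2)" "integrable \<Phi> (%z. (norm (snd z))^2)"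
  by (rule Bochner_Integration.integrable_bound[OF i]; simp)+
qed

lemma vel_norm_sq: "(vel_norm \<Phi>)^2 = (LINT z|\<Phi>. (norm (snd z))^2)"
 unfolding vel_norm_def by (simp add: split_beta')

lemma vel_norm_nonneg: "0 <= vel_norm \<Phi>"
 unfolding vel_norm_def by (simp add: split_beta')

lemma push_exp_alt: "push_exp s \<Phi> = distr \<Phi> borel (%z. fst z + s *\<^sub>R snd z)"
 unfolding push_exp_def by (simp add: split_beta')

lemma push_exp_0: "push_exp 0 \<Phi> = base \<Phi>"
 unfolding push_exp_alt base_def by simp

lemma push_exp_P2:
 assumes "\<Phi> \<in> TP2" shows "push_exp s \<Phi> \<in> P2"
proof -
 note T = TP2D[OF assms]
 have [measurable_cong]: "sets \<Phi> = sets borel" by (rule T)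
 have "integrable \<Phi> (%z. (norm (s *\<^sub>R snd z))^2)" using T(5) by (simp add: power_mult_distrib)
 then have "integrable \<Phi> (%z. (norm (fst z + s *\<^sub>R snd z))^2)"
  by (intro integrable_norm_add_sq T(4)) measurable
 then show ?thesis unfolding push_exp_alt by (intro P2_distr T(1)) measurable
qed

lemma base_P2: "\<Phi> \<in> TP2 ==> base \<Phi> \<in> P2"
 using push_exp_P2[of \<Phi> 0] by (simp add: push_exp_0)

lemma norm_diff_add_scaled_sq:
 fixes x v b :: "'x::real_inner"
 shows "(norm (x + s *\<^sub>R v - b))^2 = (norm (x - b))^2 + (2 * s) * ((x - b) \<bullet> v) + s^2 * (norm v)^2"
 unfolding power2_norm_eq_inner power2_eq_square[of s] by (simp add: inner_diff inner_add inner_commute algebra_simps)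

text \<open>
 The coupling that is nearly optimal at the time \<open>s\<close> is admissible at all other times, where its
 cost is the same quadratic polynomial.
\<close>
lemma push_exp_quadratic:
 assumes \<Phi>: "\<Phi> \<in> TP2" and \<nu>: "\<nu> \<in> P2" and \<epsilon>: "0 < \<epsilon>"
 obtains \<alpha> \<beta> where "!!s'. (W2 (push_exp s' \<Phi>) \<nu>)^2 <= \<alpha> + 2 * s' * \<beta> + s'^2 * (vel_norm \<Phi>)^2"
  "\<alpha> + 2 * s * \<beta> + s^2 * (vel_norm \<Phi>)^2 < (W2 (push_exp s \<Phi>) \<nu>)^2 + \<epsilon>"
proof -
 note T = TP2D[OF \<Phi>]
 have [measurable_cong]: "sets \<Phi> = sets borel" by (rule T)
 let ?e = "%s z. fst z + s *\<^sub>R snd z"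
 let ?P = "noised \<Phi>"
 have e [measurable]: "?e s \<in> borel_measurable \<Phi>" for s by measurable
 obtain b where b [measurable]: "b \<in> borel_measurable ?P" and bd: "distr ?P borel b = \<nu>"
  and bc: "(LINT w|?P. (norm (?e s (fst w) - b w))^2) < (W2 (push_exp s \<Phi>) \<nu>)^2 + \<epsilon>"
  by (rule W2_near_optimal[OF T(1) e[of s] push_exp_alt[symmetric] push_exp_P2[OF \<Phi>] \<nu> \<epsilon>]) (rule that)
 have P: "prob_space ?P" by (intro prob_space_noise T)
 have [measurable]: "fst \<in> ?P \<rightarrow>\<^sub>M (borel \<Otimes>\<^sub>M borel)" by (simp add: borel_prod) 
 have ib: "integrable ?P (%w. (norm (b w))^2)" by (rule P2_random[OF bd \<nu>]) simp
 have ix: "integrable ?P (%w. (norm (fst (fst w)))^2)"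
  and iv: "integrable ?P (%w. (norm (snd (fst w)))^2)"
  and ev: "(LINT w|?P. (norm (snd (fst w)))^2) = (vel_norm \<Phi>)^2"
  using noise_integral_fst[OF T(1), of "%z. (norm (fst z))^2"] noise_integral_fst[OF T(1), of "%z. (norm (snd z))^2"] T(4,5)
  by (simp_all add: vel_norm_sq)
 have id: "integrable ?P (%w. (norm (fst (fst w) - b w))^2)"
  by (rule integrable_norm_diff_sq) (use ix ib in auto)
 define \<alpha> where "\<alpha> = (LINT w|?P. (norm (fst (fst w) - b w))^2)"
 define \<beta> where "\<beta> = (LINT w|?P. (fst (fst w) - b w) \<bullet> snd (fst w))"
 have ii: "integrable ?P (%w. (fst (fst w) - b w) \<bullet> snd (fst w))"
  by (rule inner_cauchy_schwarz_integral; use id iv in simp)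
 have q: "(LINT w|?P. (norm (?e s (fst w) - b w))^2) = \<alpha> + 2 * s * \<beta> + s^2 * (vel_norm \<Phi>)^2" for s
 proof -
  have "(LINT w|?P. (norm (?e s (fst w) - b w))^2) =
   (LINT w|?P. (norm (fst (fst w) - b w))^2 + (2 * s) * ((fst (fst w) - b w) \<bullet> snd (fst w)) + s^2 * (norm (snd (fst w)))^2)"
   by (intro Bochner_Integration.integral_cong refl) (rule norm_diff_add_scaled_sq)
  also have "\<dots> = \<alpha> + 2 * s * \<beta> + s^2 * (vel_norm \<Phi>)^2"
   using id iv ii by (simp add: \<alpha>_def \<beta>_def ev)
  finally show ?thesis .
 qed
 have up: "(W2 (push_exp s' \<Phi>) \<nu>)^2 <= \<alpha> + 2 * s' * \<beta> + s'^2 * (vel_norm \<Phi>)^2" for s'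
 proof -
  have "distr ?P borel (%w. ?e s' (fst w)) = push_exp s' \<Phi>"
   unfolding push_exp_alt by (rule distr_noise_fst[OF T(1)]) simp
  then show ?thesis unfolding q[symmetric]
   by (intro W2_sq_le[OF P _ b _ bd push_exp_P2[OF \<Phi>] \<nu>]) simp_all
 qed
 show ?thesis
  by (rule that[of \<alpha> \<beta>]) (use up bc q[of s] in auto)
qed

text \<open>
 The difference quotient of the pairing, corrected by the quadratic term that makes it monotone in
 \<open>s\<close>. The pairing is therefore a supremum of functions that are continuous in
 \<open>\<nu>\<close>.
\<close>
definition exp_slope ::
 "real => ('x::{real_inner, polish_space} \<times> 'x) measure => 'x measure => real" where
 "exp_slope s \<Phi> \<nu> = ((W2 (push_exp s \<Phi>) \<nu>)^2 - (W2 (base \<Phi>) \<nu>)^2) / (2 * s) - s * (vel_norm \<Phi>)^2 / 2"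

lemma exp_slope_antimono:
 assumes \<Phi>: "\<Phi> \<in> TP2" and \<nu>: "\<nu> \<in> P2" and s: "0 < s" "s <= S"
 shows "exp_slope S \<Phi> \<nu> <= exp_slope s \<Phi> \<nu>"
proof -
 define f where "f s = (W2 (push_exp s \<Phi>) \<nu>)^2" for s
 define m where "m = (vel_norm \<Phi>)^2"
 have "s * (f S) + (S - s) * f 0 - s * S * (S - s) * m <= S * f s + S * \<epsilon>" if \<epsilon>: "0 < \<epsilon>" for \<epsilon>
 proof -
  obtain \<alpha> \<beta> where u: "!!s'. f s' <= \<alpha> + 2 * s' * \<beta> + s'^2 * m" and l: "\<alpha> + 2 * s * \<beta> + s^2 * m < f s + \<epsilon>"
   by (rule push_exp_quadratic[OF \<Phi> \<nu> \<epsilon>, of s, folded m_def f_def]) (rule that)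
  have "s * f S <= s * (\<alpha> + 2 * S * \<beta> + S^2 * m)" using u[of S] s by (intro mult_left_mono) auto
  moreover have "(S - s) * f 0 <= (S - s) * \<alpha>" using u[of 0] s by (intro mult_left_mono) auto
  moreover have "S * (\<alpha> + 2 * s * \<beta> + s^2 * m) <= S * (f s + \<epsilon>)" using l s by (intro mult_left_mono) auto
  ultimately show ?thesis by (simp add: algebra_simps power2_eq_square)
 qed
 from this[of "\<delta> / S" for \<delta>]
 have "s * (f S) + (S - s) * f 0 - s * S * (S - s) * m <= S * f s + \<delta>" if "0 < \<delta>" for \<delta>
  using s that by simp
 then have *: "s * (f S) + (S - s) * f 0 - s * S * (S - s) * m <= S * f s" by (rule field_le_epsilon)
 have "(f S - f 0) / (2 * S) - S * m / 2 = (s * (f S - f 0) - s * S * S * m) / (2 * s * S)"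
  using s by (simp add: field_simps)
 also have "\<dots> <= (S * (f s - f 0) - S * s * s * m) / (2 * s * S)"
  using * s by (intro divide_right_mono) (auto simp: algebra_simps)
 also have "\<dots> = (f s - f 0) / (2 * s) - s * m / 2" using s by (simp add: field_simps)
 finally show ?thesis unfolding exp_slope_def f_def m_def push_exp_0 .
qed

lemma exp_slope_upper:
 assumes \<Phi>: "\<Phi> \<in> TP2" and \<nu>: "\<nu> \<in> P2" and s: "0 < s"
 shows "exp_slope s \<Phi> \<nu> <= vel_norm \<Phi> * W2 (base \<Phi>) \<nu>"
proof -
 note TD = TP2D[OF \<Phi>]
 have [measurable_cong]: "sets \<Phi> = sets borel" by (rule TD)
 have "(W2 (push_exp s \<Phi>) (base \<Phi>))^2 <= (LINT z|\<Phi>. (norm ((fst z + s *\<^sub>R snd z) - fst z))^2)"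
  by (rule W2_sq_le[OF TD(1) _ _ push_exp_alt[symmetric] base_def[symmetric] push_exp_P2[OF \<Phi>] base_P2[OF \<Phi>]]) auto
 also have "\<dots> = (s * vel_norm \<Phi>)^2" by (simp add: power_mult_distrib vel_norm_sq)
 finally have "W2 (push_exp s \<Phi>) (base \<Phi>) <= s * vel_norm \<Phi>"
  by (rule power2_le_imp_le) (simp add: s less_imp_le vel_norm_nonneg)
 then have "W2 (push_exp s \<Phi>) \<nu> <= W2 (base \<Phi>) \<nu> + s * vel_norm \<Phi>"
  using W2_triangle[OF push_exp_P2[OF \<Phi>] base_P2[OF \<Phi>] \<nu>, of s] by linarith
 then have "(W2 (push_exp s \<Phi>) \<nu>)^2 <= (W2 (base \<Phi>) \<nu> + s * vel_norm \<Phi>)^2"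
  by (rule power_mono[OF _ W2_nonneg[OF push_exp_P2[OF \<Phi>] \<nu>]])
 then have "((W2 (push_exp s \<Phi>) \<nu>)^2 - (W2 (base \<Phi>) \<nu>)^2) / (2 * s) <= (2 * s * (vel_norm \<Phi> * W2 (base \<Phi>) \<nu>) + s^2 * (vel_norm \<Phi>)^2) / (2 * s)"
  using s by (intro divide_right_mono) (auto simp: power2_eq_square algebra_simps)
 also have "\<dots> = vel_norm \<Phi> * W2 (base \<Phi>) \<nu> + s * (vel_norm \<Phi>)^2 / 2" using s by (simp add: field_simps power2_eq_square)
 finally show ?thesis unfolding exp_slope_def by simp
qed

lemma exp_slope_pairing_meas:
 assumes \<Phi>: "\<Phi> \<in> TP2" and \<nu>: "\<nu> \<in> P2"
 shows "((%s. exp_slope s \<Phi> \<nu>) ---> pairing_meas \<Phi> \<nu>) (at_right 0)"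
  and "!!s. 0 < s ==> exp_slope s \<Phi> \<nu> <= pairing_meas \<Phi> \<nu>"
  and "pairing_meas \<Phi> \<nu> <= vel_norm \<Phi> * W2 (base \<Phi>) \<nu>"
proof -
 define h where "h s = exp_slope s \<Phi> \<nu>" for s
 have mono: "h S <= h s" if "0 < s" "s <= S" for s S
  unfolding h_def by (rule exp_slope_antimono[OF \<Phi> \<nu> that])
 have bd: "h s <= vel_norm \<Phi> * W2 (base \<Phi>) \<nu>" if "0 < s" for s
  unfolding h_def by (rule exp_slope_upper[OF \<Phi> \<nu> that])
 define L where "L = (SUP s\<in>{0<..}. h s)"
 have bdd: "bdd_above (h ` {0<..})" using bd by (intro bdd_aboveI[of _ "vel_norm \<Phi> * W2 (base \<Phi>) \<nu>"]) auto
 have le: "h s <= L" if "0 < s" for s unfolding L_def using that by (intro cSUP_upper bdd) auto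
 have Lb: "L <= vel_norm \<Phi> * W2 (base \<Phi>) \<nu>" unfolding L_def using bd by (intro cSUP_least) auto
 have hL: "(h ---> L) (at_right 0)"
 proof (rule order_tendstoI)
  fix l assume "l < L"
  then obtain S where S: "0 < S" "l < h S" unfolding L_def using less_cSUP_iff[OF _ bdd] by auto
  then have "\<forall>s>0. s < S --> l < h s" using mono by (meson less_imp_le less_le_trans)
  then show "\<forall>\<^sub>F s in at_right 0. l < h s" unfolding eventually_at_right_field using S by auto
 next
  fix l assume "L < l"
  then show "\<forall>\<^sub>F s in at_right 0. h s < l"
   using le by (intro eventually_mono[OF eventually_at_right_less]) (metis le_less_trans)
 qed
 then have "((%s. h s + s * (vel_norm \<Phi>)^2 / 2) ---> L + 0 * (vel_norm \<Phi>)^2 / 2) (at_right 0)"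
  by (intro tendsto_intros) auto
 then have "pairing_meas \<Phi> \<nu> = L"
  unfolding pairing_meas_def h_def exp_slope_def by (intro tendsto_Lim) auto
 then show "((%s. exp_slope s \<Phi> \<nu>) ---> pairing_meas \<Phi> \<nu>) (at_right 0)"
  and "!!s. 0 < s ==> exp_slope s \<Phi> \<nu> <= pairing_meas \<Phi> \<nu>"
  and "pairing_meas \<Phi> \<nu> <= vel_norm \<Phi> * W2 (base \<Phi>) \<nu>"
  using hL le Lb unfolding h_def by auto
qed

section \<open>Almost everywhere differentiability of absolutely continuous functions\<close>

lemma negligible_iff_null_lborel:
 "A \<in> sets borel ==> negligible A \<longleftrightarrow> A \<in> null_sets lborel"
 by (simp add: negligible_iff_null_sets null_sets_completion_iff)

lemma limit_from_thresholds:
 fixes a :: "'a => real"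
 assumes F: "F ~= bot" and thr: "!!p q. p \<in> \<rat> ==> q \<in> \<rat> ==> p < q ==> (\<forall>\<^sub>F x in F. a x <= q) \<or> (\<forall>\<^sub>F x in F. p <= a x)"
  and bd: "\<forall>\<^sub>F x in F. abs (a x) <= B"
 shows "\<exists>l. (a ---> l) F"
proof -
 define S where "S = {r. \<forall>\<^sub>F x in F. r <= a x}"
 have "r <= B" if "r \<in> S" for r
 proof -
  have "\<forall>\<^sub>F x in F. r <= a x" using that by (simp add: S_def)
  with bd have "\<forall>\<^sub>F x in F. r <= B" by eventually_elim linarith
  then show ?thesis using F by simp
 qed
 then have bdd: "bdd_above S" by (rule bdd_aboveI)
 have "- B \<in> S" using bd unfolding S_def mem_Collect_eq by eventually_elim linarith
 then have ne: "S ~= {}" by blast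
 have "(a ---> Sup S) F"
 proof (rule order_tendstoI)
  fix y assume "y < Sup S"
  then obtain r where r: "r \<in> S" "y < r" using less_cSup_iff[OF ne bdd] by blast
  then have "\<forall>\<^sub>F x in F. r <= a x" by (simp add: S_def)
  then show "\<forall>\<^sub>F x in F. y < a x" by eventually_elim (use r in simp)
 next
  fix y assume "Sup S < y"
  then obtain q where q: "q \<in> \<rat>" "Sup S < q" "q < y" using Rats_dense_in_real by blast
  obtain p where p: "p \<in> \<rat>" "Sup S < p" "p < q" using Rats_dense_in_real[OF q(2)] by blast
  have "p \<notin> S" using cSup_upper[OF _ bdd] p(2) by force
  then have "\<forall>\<^sub>F x in F. a x <= q" using thr[OF p(1) q(1) p(3)] by (auto simp: S_def)
  then show "\<forall>\<^sub>F x in F. a x < y" by eventually_elim (use q in simp)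
 qed
 then show ?thesis by blast
qed

text \<open>
 Vitali covering exhausts \<open>S\<close>, up to a null set, by disjoint intervals on which the measures
 compare.
\<close>
lemma vitali_comparison:
 fixes \<alpha> \<beta> :: "real measure" and S :: "real set"
 assumes \<alpha>: "finite_measure \<alpha>" "sets \<alpha> = sets borel" and \<alpha>0: "!!N. N \<in> null_sets lborel ==> emeasure \<alpha> N = 0"
  and \<beta>: "finite_measure \<beta>" "sets \<beta> = sets borel"
  and S: "S \<in> sets borel"
  and small: "!!x d. x \<in> S ==> 0 < d ==>
    \<exists>a b. a < b \<and> b - a < d \<and> x \<in> {a..b} \<and> emeasure \<alpha> {a..b} <= emeasure \<beta> {a..b}"
 shows "emeasure \<alpha> S <= emeasure \<beta> S"
proof (rule ennreal_le_epsilon)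
 fix e :: real assume e: "0 < e"
 interpret \<alpha>: finite_measure \<alpha> by fact
 interpret \<beta>: finite_measure \<beta> by fact
 have S\<beta>: "S \<in> sets \<beta>" using S \<beta> by simp
 obtain U where U: "S \<subseteq> U" "open U" "emeasure \<beta> U < emeasure \<beta> S + e"
 proof -
  have "emeasure \<beta> S = (INF U\<in>{U. S \<subseteq> U \<and> open U}. emeasure \<beta> U)"
   by (rule outer_regular) (use \<beta> S in "auto simp: \<beta>.emeasure_eq_measure")
  moreover have "emeasure \<beta> S < emeasure \<beta> S + e" using e by (simp add: \<beta>.emeasure_eq_measure ennreal_less_iff flip: ennreal_plus)
  ultimately show ?thesis using that by (metis (no_types, lifting) INF_less_iff mem_Collect_eq)
 qed
 define K where "K = {(a, b). a < b \<and> {a..b} \<subseteq> U \<and> emeasure \<alpha> {a..b} <= emeasure \<beta> {a..b}}"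
 define c r where "c i = (fst i + snd i) / 2" and "r i = (snd i - fst i) / 2" for i :: "real \<times> real"
 have cb: "cball (c i) (r i) = {fst i..snd i}" for i
  by (auto simp: c_def r_def cball_def dist_real_def abs_le_iff field_simps)
 have "\<exists>i. i \<in> K \<and> x \<in> cball (c i) (r i) \<and> r i < d" if x: "x \<in> S" and d: "0 < d" for x d
 proof -
  obtain \<delta> where \<delta>: "0 < \<delta>" "cball x \<delta> \<subseteq> U" using U x open_contains_cball by blast
  obtain a b where ab: "a < b" "b - a < min \<delta> d" "x \<in> {a..b}" "emeasure \<alpha> {a..b} <= emeasure \<beta> {a..b}"
   using small[OF x, of "min \<delta> d"] \<delta> d by auto
  have "{a..b} \<subseteq> cball x \<delta>" using ab by (auto simp: dist_real_def)
  then have "(a, b) \<in> K" using ab \<delta> by (auto simp: K_def)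
  then show ?thesis using ab by (intro exI[of _ "(a, b)"]) (simp add: cb, simp add: r_def)
 qed
 moreover have "0 < r i" if "i \<in> K" for i using that by (auto simp: K_def r_def)
 ultimately obtain C where C: "countable C" "C \<subseteq> K"
  "pairwise (%i j. disjnt (cball (c i) (r i)) (cball (c j) (r j))) C"
  "negligible (S - (\<Union>i\<in>C. cball (c i) (r i)))"
  using Vitali_covering_theorem_cballs[of K r S c] by blast
 let ?B = "\<Union>i\<in>C. {fst i..snd i}"
 have B: "?B \<in> sets borel" using C(1) by (intro sets.countable_UN') auto
 have disj: "disjoint_family_on (%i. {fst i..snd i}) C"
  using C(3) unfolding cb by (auto simp: disjoint_family_on_def pairwise_def disjnt_def)
 have "S - ?B \<in> null_sets lborel"
  using C(4) S B unfolding cb by (subst negligible_iff_null_lborel[symmetric]) auto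
 then have "emeasure \<alpha> (S - ?B) = 0" by (rule \<alpha>0)
 moreover have "emeasure \<alpha> S <= emeasure \<alpha> ((S - ?B) \<union> ?B)"
  using S B \<alpha> by (intro emeasure_mono) auto
 moreover have "\<dots> <= emeasure \<alpha> (S - ?B) + emeasure \<alpha> ?B"
  using S B \<alpha> by (intro emeasure_subadditive) auto
 ultimately have "emeasure \<alpha> S <= emeasure \<alpha> ?B" by simp
 also have "emeasure \<alpha> ?B = (nn_integral (count_space C) (%i. emeasure \<alpha> {fst i..snd i}))"
  using C(1) disj \<alpha> by (intro emeasure_UN_countable) auto
 also have "\<dots> <= (nn_integral (count_space C) (%i. emeasure \<beta> {fst i..snd i}))"
  using C(2) by (intro nn_integral_mono) (auto simp: K_def)
 also have "\<dots> = emeasure \<beta> ?B"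
  using C(1) disj \<beta> by (intro emeasure_UN_countable[symmetric]) auto
 also have "\<dots> <= emeasure \<beta> U"
 proof (rule emeasure_mono)
  show "?B \<subseteq> U" using C(2) unfolding K_def by fastforce
 qed (use U(2) \<beta> in auto)
 also have "\<dots> <= emeasure \<beta> S + e" using U(3) by simp
 finally show "emeasure \<alpha> S <= emeasure \<beta> S + ennreal e" .
qed

text \<open>
 On the set where the lower derivative is below \<open>p\<close> and the upper one above \<open>q > p\<close>,
 the Vitali comparison makes the measure of \<open>G\<close> at most \<open>p\<close> and at least
 \<open>q\<close> times Lebesgue measure, so that the set is null.
\<close>
lemma monotone_ac_differentiable:
 assumes mono: "!!x y. x <= y ==> G x <= G y" and cont: "continuous_on UNIV G"
  and fin: "finite_measure (interval_measure G)"
  and null: "!!N. N \<in> null_sets lborel ==> emeasure (interval_measure G) N = 0"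
 shows "AE t in lborel. \<exists>D. (G has_real_derivative D) (at t)"
proof -
 let ?\<alpha> = "interval_measure G"
 interpret \<alpha>: finite_measure ?\<alpha> by (rule fin)
 define Q where "Q h t = (G (t + h) - G t) / h" for h t
 have Q0: "0 <= Q h t" for h t
  unfolding Q_def using mono[of t "t + h"] mono[of "t + h" t] by (cases "0 <= h") (auto simp: divide_nonpos_nonpos)
 have \<alpha>Q: "emeasure ?\<alpha> {min t (t+h)..max t (t+h)} = ennreal (Q h t * abs h)" if "h ~= 0" for t h
 proof -
  have "emeasure ?\<alpha> {min t (t+h)..max t (t+h)} = G (max t (t+h)) - G (min t (t+h))"
   by (rule emeasure_interval_measure_Icc[OF _ mono cont]) auto
  also have "G (max t (t+h)) - G (min t (t+h)) = Q h t * abs h"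
   using that by (cases "0 < h") (auto simp: Q_def max_def min_def)
  finally show ?thesis .
 qed
 define Lo where "Lo p k = (\<Union>h\<in>{h. 0 < abs h \<and> abs h < 1 / real (Suc k)}. {t. Q h t < p})" for p k
 define Hi where "Hi q k = (\<Union>h\<in>{h. 0 < abs h \<and> abs h < 1 / real (Suc k)}. {t. q < Q h t})" for q k
 have cQ: "continuous_on UNIV (Q h)" for h
  unfolding Q_def
  by (cases "h = 0") (auto intro!: continuous_intros continuous_on_compose2[OF cont])
 have [measurable]: "Lo p k \<in> sets borel" "Hi q k \<in> sets borel" for p q k
  unfolding Lo_def Hi_def by (intro borel_open open_UN ballI open_Collect_less cQ continuous_intros)+
 define LO where "LO p = (\<Inter>k. Lo p k)" for p
 define HI where "HI q = (\<Inter>k. Hi q k)" for q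
 have [measurable]: "LO p \<in> sets borel" "HI q \<in> sets borel" for p q
  unfolding LO_def HI_def by measurable
 have LOD: "\<exists>h. h ~= 0 \<and> abs h < d \<and> Q h t < p" if t: "t \<in> LO p" and d: "0 < d" for t p d
 proof -
  obtain k where "1 / real (Suc k) < d" using d nat_approx_posE by blast
  moreover have "t \<in> Lo p k" using t by (auto simp: LO_def)
  ultimately show ?thesis by (auto simp: Lo_def intro: less_trans)
 qed
 have HID: "\<exists>h. h ~= 0 \<and> abs h < d \<and> q < Q h t" if t: "t \<in> HI q" and d: "0 < d" for t q d
 proof -
  obtain k where "1 / real (Suc k) < d" using d nat_approx_posE by blast
  moreover have "t \<in> Hi q k" using t by (auto simp: HI_def)
  ultimately show ?thesis by (auto simp: Hi_def intro: less_trans)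
 qed
 define wL where "wL p (N::real) = density lborel (%t. ennreal p * indicator {-N..N} t)" for p N
 have emwL: "emeasure (wL p N) A = ennreal p * emeasure lborel (A \<inter> {-N..N})" if [measurable]: "A \<in> sets borel" for A p N
  unfolding wL_def
  by (subst emeasure_density, measurable, subst nn_integral_cmult_indicator[symmetric], measurable)
   (auto intro!: nn_integral_cong split: split_indicator)
 have finwL: "finite_measure (wL p N)" for p N
 proof
  have "emeasure (wL p N) UNIV < \<infinity>"
   by (subst emwL) (auto simp: ennreal_mult_less_top emeasure_lborel_Icc_eq)
  then show "emeasure (wL p N) (space (wL p N)) ~= \<infinity>" by (simp add: wL_def)
 qed
 have HI_le: "ennreal q * emeasure lborel (S \<inter> {-N..N}) <= emeasure ?\<alpha> S"
  if S: "S \<subseteq> HI q" and [measurable]: "S \<in> sets borel" and q: "0 <= q" for S q N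
 proof -
  have "emeasure (wL q N) S <= emeasure ?\<alpha> S"
  proof (rule vitali_comparison[OF finwL _ _ fin])
   fix x d :: real assume "x \<in> S" and d: "0 < d"
   then obtain h where h: "h ~= 0" "abs h < d" "q < Q h x" using HID[of x q d] S by auto
   let ?J = "{min x (x+h)..max x (x+h)}"
   have "emeasure (wL q N) ?J <= ennreal q * emeasure lborel ?J"
    unfolding emwL[OF borel_closed[OF closed_atLeastAtMost]] by (intro mult_left_mono emeasure_mono) auto
   also have "\<dots> = ennreal (q * abs h)" using q by (auto simp: ennreal_mult max_def min_def)
   also have "\<dots> <= emeasure ?\<alpha> ?J" unfolding \<alpha>Q[OF h(1)] using h by (intro ennreal_leI mult_right_mono) auto
   finally show "\<exists>a b. a < b \<and> b - a < d \<and> x \<in> {a..b} \<and> emeasure (wL q N) {a..b} <= emeasure ?\<alpha> {a..b}"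
    using h by (intro exI[of _ "min x (x+h)"] exI[of _ "max x (x+h)"]) (auto simp: max_def min_def)
  next
   fix A :: "real set" assume A: "A \<in> null_sets lborel"
   have "emeasure lborel (A \<inter> {-N..N}) <= emeasure lborel A" using A by (intro emeasure_mono) auto
   moreover have "emeasure lborel A = 0" "A \<in> sets borel" using A by auto
   ultimately show "emeasure (wL q N) A = 0" by (simp add: emwL)
  qed (auto simp: wL_def)
  then show ?thesis by (subst (asm) emwL) auto
 qed
 have LO_le: "emeasure ?\<alpha> S <= ennreal p * emeasure lborel S"
  if S: "S \<subseteq> LO p \<inter> {-N..N}" and [measurable]: "S \<in> sets borel" and p: "0 <= p" for S p N
 proof -
  have "emeasure ?\<alpha> S <= emeasure (wL p (N + 1)) S"
  proof (rule vitali_comparison[OF fin _ _ finwL])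
   fix x d :: real assume x: "x \<in> S" and d: "0 < d"
   then obtain h where h: "h ~= 0" "abs h < min d 1" "Q h x < p" using LOD[of x p "min d 1"] S by auto
   then have h': "abs h < d" "abs h < 1" by auto
   let ?J = "{min x (x+h)..max x (x+h)}"
   have "x \<in> {-N..N}" using x S by auto
   then have J: "?J \<inter> {-(N+1)..N+1} = ?J" using h' by auto
   have "emeasure ?\<alpha> ?J <= ennreal (p * abs h)" unfolding \<alpha>Q[OF h(1)] using h by (intro ennreal_leI mult_right_mono) auto
   also have "\<dots> = ennreal p * emeasure lborel ?J" using p by (auto simp: ennreal_mult max_def min_def)
   also have "\<dots> = emeasure (wL p (N + 1)) ?J"
    unfolding emwL[OF borel_closed[OF closed_atLeastAtMost]] J ..
   finally show "\<exists>a b. a < b \<and> b - a < d \<and> x \<in> {a..b} \<and> emeasure ?\<alpha> {a..b} <= emeasure (wL p (N + 1)) {a..b}"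
    using h(1) h'(1) by (intro exI[of _ "min x (x+h)"] exI[of _ "max x (x+h)"]) (auto simp: max_def min_def)
  qed (auto simp: wL_def null)
  also have "\<dots> <= ennreal p * emeasure lborel S"
   by (subst emwL) (auto intro!: mult_left_mono emeasure_mono)
  finally show ?thesis .
 qed
 have bdd_null: "S \<in> null_sets lborel" if [measurable]: "S \<in> sets borel" and "!!N::nat. emeasure lborel (S \<inter> {-real N..real N}) = 0" for S
 proof -
  have "(\<Union>N::nat. S \<inter> {-real N..real N}) \<in> null_sets lborel" using that by (intro null_sets_UN) auto
  moreover have "S = (\<Union>N::nat. S \<inter> {-real N..real N})"
  proof -
   have "\<exists>N::nat. - real N <= x \<and> x <= real N" for x :: real
   proof -
    obtain n :: nat where "abs x <= real n" using real_arch_simple by blast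
    then show ?thesis by (intro exI[of _ n]) auto
   qed
   then show ?thesis by auto
  qed
  ultimately show ?thesis by simp
 qed
 have ae1: "AE t in lborel. t \<notin> LO p \<inter> HI q" if pq: "p < q" for p q
 proof (rule AE_not_in, rule bdd_null)
  fix N :: nat
  let ?S = "LO p \<inter> HI q \<inter> {-real N..real N}"
  have fS: "emeasure lborel ?S < \<infinity>"
   by (rule le_less_trans[OF emeasure_mono[of _ "{-real N..real N}"]]) auto
  have "emeasure lborel ?S = 0"
  proof (cases "0 <= p")
   case True
   have "ennreal q * emeasure lborel (?S \<inter> {-real N..real N}) <= emeasure ?\<alpha> ?S"
    using True pq by (intro HI_le) auto
   also have "\<dots> <= ennreal p * emeasure lborel ?S" using True by (intro LO_le[of _ _ "real N"]) auto
   finally have le: "ennreal q * emeasure lborel ?S <= ennreal p * emeasure lborel ?S" by (simp add: Int_assoc)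
   obtain x where x: "emeasure lborel ?S = ennreal x" "0 <= x"
    using fS by (cases "emeasure lborel ?S") auto
   have "q * x <= p * x"
    using le True pq x(2) unfolding x(1) by (simp add: ennreal_mult[symmetric])
   then have "(q - p) * x <= 0" by (simp add: algebra_simps)
   then have "x = 0" using pq x(2) by (simp add: mult_le_0_iff)
   then show ?thesis using x by simp
  next
   case False
   have "LO p = {}"
   proof (rule equals0I)
    fix t assume "t \<in> LO p"
    then obtain h where "Q h t < p" using LOD[of t p 1] by auto
    with Q0[of h t] False show False by simp
   qed
   then show ?thesis by simp
  qed
  then show "emeasure lborel (LO p \<inter> HI q \<inter> {-real N..real N}) = 0" .
 qed simp
 have ae2: "AE t in lborel. t \<notin> (\<Inter>n::nat. HI (real n))"
 proof (rule AE_not_in, rule bdd_null)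
  fix N :: nat
  let ?S = "\<Inter>n::nat. HI (real n)"
  obtain C where C: "emeasure ?\<alpha> ?S = ennreal C" "0 <= C" by (metis \<alpha>.emeasure_eq_measure measure_nonneg)
  have le: "ennreal (real n) * emeasure lborel (?S \<inter> {-real N..real N}) <= ennreal C" for n
   unfolding C(1)[symmetric] by (rule HI_le) auto
  have "emeasure lborel (?S \<inter> {-real N..real N}) < \<infinity>"
   by (rule le_less_trans[OF emeasure_mono[of _ "{-real N..real N}"]]) auto
  then obtain x where x: "emeasure lborel (?S \<inter> {-real N..real N}) = ennreal x" "0 <= x"
   by (cases "emeasure lborel (?S \<inter> {-real N..real N})") auto
  have le': "real n * x <= C" for n
   using le[of n] C(2) x(2) unfolding x(1) by (simp add: ennreal_mult[symmetric])
  have "x = 0"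
  proof (rule ccontr)
   assume "x ~= 0"
   then obtain n where "C < real n * x" using reals_Archimedean3[of x] x(2) by auto
   with le'[of n] show False by simp
  qed
  then show "emeasure lborel (?S \<inter> {-real N..real N}) = 0" using x by simp
 qed simp
 have "AE t in lborel. \<forall>p\<in>\<rat>. \<forall>q\<in>\<rat>. p < q --> t \<notin> LO p \<inter> HI q"
  using ae1 by (simp add: AE_ball_countable countable_rat)
 with ae2 show ?thesis
 proof eventually_elim
  fix t assume inf: "t \<notin> (\<Inter>n::nat. HI (real n))" and osc: "\<forall>p\<in>\<rat>. \<forall>q\<in>\<rat>. p < q --> t \<notin> LO p \<inter> HI q"
  have LOI: "t \<in> LO p" if "\<exists>\<^sub>F h in at 0. Q h t < p" for p
  proof -
   have "\<exists>h. 0 < abs h \<and> abs h < 1 / real (Suc k) \<and> Q h t < p" for k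
    using that unfolding frequently_at by (auto dest!: spec[of _ "1 / real (Suc k)"] simp: dist_real_def)
   then show ?thesis unfolding LO_def Lo_def by blast
  qed
  have HII: "t \<in> HI p" if "\<exists>\<^sub>F h in at 0. p < Q h t" for p
  proof -
   have "\<exists>h. 0 < abs h \<and> abs h < 1 / real (Suc k) \<and> p < Q h t" for k
    using that unfolding frequently_at by (auto dest!: spec[of _ "1 / real (Suc k)"] simp: dist_real_def)
   then show ?thesis unfolding HI_def Hi_def by blast
  qed
  obtain n :: nat where n: "t \<notin> HI (real n)" using inf by auto
  then have Qn: "\<forall>\<^sub>F h in at 0. Q h t <= real n"
   using HII[of "real n"] by (auto simp: frequently_def not_less)
  have "\<exists>D. ((%h. Q h t) ---> D) (at 0)"
  proof (rule limit_from_thresholds[where B = "real n"])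
   show "(\<forall>\<^sub>F h in at 0. Q h t <= q) \<or> (\<forall>\<^sub>F h in at 0. p <= Q h t)" if "p \<in> \<rat>" "q \<in> \<rat>" "p < q" for p q
    using osc that LOI[of p] HII[of q] by (auto simp: frequently_def not_less)
   show "\<forall>\<^sub>F h in at 0. abs (Q h t) <= real n" using Qn by (rule eventually_mono) (simp add: Q0)
  qed simp
  then show "\<exists>D. (G has_real_derivative D) (at t)" by (auto simp: Q_def DERIV_def)
 qed
qed

lemma ennreal_half_sum:
 assumes "0 <= u" "0 <= v"
 shows "ennreal (1/2) * ennreal u + ennreal (1/2) * ennreal v = ennreal ((1/2) * u + (1/2) * v)"
proof -
 have "ennreal ((1/2) * u) = ennreal (1/2) * ennreal u" "ennreal ((1/2) * v) = ennreal (1/2) * ennreal v"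
  using assms by (intro ennreal_mult; simp)+
 moreover have "ennreal ((1/2) * u + (1/2) * v) = ennreal ((1/2) * u) + ennreal ((1/2) * v)"
  by (rule ennreal_plus) (use assms in auto)
 ultimately show ?thesis by simp
qed

text \<open>
 With \<open>M\<close> the primitive of \<open>m\<close>, both \<open>g + M\<close> and \<open>M - g\<close>
 increase, and the mean of their measures has density \<open>m\<close>.
\<close>
lemma ac_differentiable:
 assumes m: "integrable lborel m" and m0: "!!t. 0 <= m t"
  and g: "!!a b. a <= b ==> abs (g b - g a) <= (LBINT t:{a..b}. m t)"
 shows "AE t in lborel. \<exists>D. (g has_real_derivative D) (at t)"
proof -
 define \<nu> where "\<nu> = density lborel m"
 have [measurable]: "m \<in> borel_measurable borel" using m by simp
 have \<nu>e: "emeasure \<nu> A = ennreal (LBINT t:A. m t)" if [measurable]: "A \<in> sets borel" for A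
 proof -
  have "emeasure \<nu> A = (nn_integral lborel (%t. ennreal (indicator A t * m t)))"
   unfolding \<nu>_def by (subst emeasure_density) (auto intro!: nn_integral_cong split: split_indicator)
  also have "\<dots> = ennreal (LBINT t:A. m t)"
   unfolding set_lebesgue_integral_def real_scaleR_def
   by (rule nn_integral_eq_integral) (auto simp: m0 intro!: integrable_mult_indicator[where 'b=real, simplified] m)
  finally show ?thesis .
 qed
 have [measurable_cong]: "sets \<nu> = sets borel" by (simp add: \<nu>_def)
 interpret \<nu>: finite_measure \<nu>
  by standard (use \<nu>e[of UNIV] in "simp add: \<nu>_def")
 define M where "M t = measure \<nu> {..t}" for t
 have \<nu>m: "measure \<nu> A = (LBINT t:A. m t)" if "A \<in> sets borel" for A
  using \<nu>e[OF that] unfolding measure_def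
  by (simp add: set_lebesgue_integral_def integral_nonneg_AE m0)
 have \<nu>0: "emeasure \<nu> N = 0" if "N \<in> null_sets lborel" for N
  using that absolutely_continuousI_density[of m lborel] by (auto simp: absolutely_continuous_def \<nu>_def null_sets_def)
 have Mdiff: "M b - M a = measure \<nu> {a<..b}" if "a <= b" for a b
 proof -
  have "{..b} = {..a} \<union> {a<..b}" using that by auto
  then have "M b = measure \<nu> ({..a} \<union> {a<..b})" unfolding M_def by simp
  also have "\<dots> = M a + measure \<nu> {a<..b}" unfolding M_def by (intro \<nu>.finite_measure_Union) auto
  finally show ?thesis by simp
 qed
 have pt: "measure \<nu> {a} = 0" for a
  using \<nu>0[of "{a}"] countable_imp_null_set_lborel[of "{a}"] by (simp add: measure_def)
 have IccIoc: "measure \<nu> {a..b} = measure \<nu> {a<..b}" if "a <= b" for a b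
 proof -
  have "{a..b} = {a} \<union> {a<..b}" using that by auto
  then have "measure \<nu> {a..b} = measure \<nu> ({a} \<union> {a<..b})" by simp
  also have "\<dots> = measure \<nu> {a} + measure \<nu> {a<..b}" by (intro \<nu>.finite_measure_Union) auto
  finally show ?thesis using pt by simp
 qed
 have gM: "abs (g b - g a) <= M b - M a" if "a <= b" for a b
  using g[OF that] \<nu>m[of "{a..b}"] that by (simp add: Mdiff IccIoc)
 have "finite_borel_measure \<nu>" by standard (simp_all add: \<nu>_def)
 have Mmono: "M a <= M b" if "a <= b" for a b using gM[OF that] by simp
 have Mcont: "isCont M t" for t
 proof -
  have "isCont (cdf \<nu>) t" using \<open>finite_borel_measure \<nu>\<close> pt by (simp add: finite_borel_measure.isCont_cdf)
  then show ?thesis by (simp add: M_def[abs_def] cdf_def[abs_def])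
 qed
 have Ioc_pi: "Int_stable (range (%(a, b). {a<..b::real}))"
  by (force simp: Int_stable_def)
 have AC: "AE t in lborel. \<exists>D. ((%t. f t + M t) has_real_derivative D) (at t)"
  if f: "!!a b. a <= b ==> abs (f b - f a) <= M b - M a" for f
 proof -
  have fM: "abs (f x - f t) <= abs (M x - M t)" for x t
   using f[of x t] f[of t x] by (cases "x <= t") auto
  have fc: "continuous_on UNIV f" unfolding continuous_on_def
  proof
   fix t
   have "((%x. abs (M x - M t)) ---> abs (M t - M t)) (at t)"
    using Mcont[of t] unfolding isCont_def by (intro tendsto_intros)
   then have l0: "((%x. abs (M x - M t)) ---> 0) (at t)" by simp
   have "((%x. f x - f t) ---> 0) (at t)"
    by (rule Lim_null_comparison[OF _ l0]) (simp add: fM)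
   then show "(f ---> f t) (at t)" by (simp add: LIM_zero_iff)
  qed
  have Mc: "continuous_on UNIV M" using Mcont by (simp add: continuous_at_imp_continuous_on)
  have c1: "continuous_on UNIV (%t. f t + M t)" and c2: "continuous_on UNIV (%t. M t - f t)"
   by (intro continuous_intros fc Mc)+
  have m1: "f x + M x <= f y + M y" and m2: "M x - f x <= M y - f y" if "x <= y" for x y
   using f[OF that] by auto
  have r: "continuous (at_right a) h" if "continuous_on UNIV h" for h :: "real => real" and a
   using that by (simp add: continuous_on_eq_continuous_at continuous_at_imp_continuous_at_within)
  let ?A = "interval_measure (%t. f t + M t)" and ?B = "interval_measure (%t. M t - f t)"
  have eA: "emeasure ?A {a<..b} = ennreal (if a <= b then f b + M b - (f a + M a) else 0)" for a b
   by (rule emeasure_interval_measure_Ioc_eq[OF m1 r[OF c1]])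
  have eB: "emeasure ?B {a<..b} = ennreal (if a <= b then M b - f b - (M a - f a) else 0)" for a b
   by (rule emeasure_interval_measure_Ioc_eq[OF m2 r[OF c2]])
  have mixAB: "mix (1/2) ?A ?B = \<nu>"
  proof (rule measure_eqI_generator_eq[OF Ioc_pi, where \<Omega>=UNIV and A="%n. {- real n<..real n}"])
   fix X assume "X \<in> range (%(a, b). {a<..b::real})"
   then obtain a b where X: "X = {a<..b}" by auto
   have e: "emeasure (mix (1/2) ?A ?B) X = ennreal (1 - 1/2) * emeasure ?A X + ennreal (1/2) * emeasure ?B X"
    by (rule emeasure_mix) (auto simp: X)
   show "emeasure (mix (1/2) ?A ?B) X = emeasure \<nu> X"
   proof (cases "a <= b")
    case True
    have "emeasure (mix (1/2) ?A ?B) X = ennreal (1/2) * ennreal (f b + M b - (f a + M a)) + ennreal (1/2) * ennreal (M b - f b - (M a - f a))"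
     using e True by (simp add: X eA eB)
    also have "\<dots> = ennreal ((1/2) * (f b + M b - (f a + M a)) + (1/2) * (M b - f b - (M a - f a)))"
     using m1[OF True] m2[OF True] by (intro ennreal_half_sum) auto
    also have "(1/2) * (f b + M b - (f a + M a)) + (1/2) * (M b - f b - (M a - f a)) = M b - M a"
     by (simp add: field_simps)
    finally show ?thesis using Mdiff[OF True] by (simp add: X \<nu>.emeasure_eq_measure)
   next
    case False
    then show ?thesis unfolding e X eA eB by simp
   qed
  next
   have "\<exists>n::nat. - real n < x \<and> x <= real n" for x :: real
   proof -
    obtain n :: nat where "abs x < real n" using reals_Archimedean2 by blast
    then show ?thesis by (intro exI[of _ n]) auto
   qed
   then show "(\<Union>n. {- real n<..real n}) = UNIV" by auto
   fix n
   have "emeasure (mix (1/2) ?A ?B) {- real n<..real n} = ennreal (1 - 1/2) * emeasure ?A {- real n<..real n} + ennreal (1/2) * emeasure ?B {- real n<..real n}"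
    by (rule emeasure_mix) auto
   then show "emeasure (mix (1/2) ?A ?B) {- real n<..real n} ~= \<infinity>"
    by (simp add: eA eB ennreal_mult_eq_top_iff)
  next
   have sb: "sets borel = sigma_sets UNIV (range (%(a, b). {a<..b::real}))"
    by (subst borel_sigma_sets_Ioc) simp
   show "sets (mix (1/2) ?A ?B) = sigma_sets UNIV (range (%(a, b). {a<..b::real}))"
    "sets \<nu> = sigma_sets UNIV (range (%(a, b). {a<..b::real}))"
    unfolding sb[symmetric] using sets.sigma_sets_eq[of "borel :: real measure"] by (simp_all add: mix_def \<nu>_def)
  qed auto
  have half: "ennreal (1/2) * emeasure ?A X <= emeasure \<nu> X" if "X \<in> sets borel" for X
   unfolding mixAB[symmetric] by (subst emeasure_mix) (use that in auto)
  show ?thesis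
  proof (rule monotone_ac_differentiable[OF m1 c1])
   show "finite_measure ?A"
   proof
    have "ennreal (1/2) * emeasure ?A UNIV < \<infinity>"
     by (rule le_less_trans[OF half]) (auto simp: \<nu>.emeasure_eq_measure)
    then show "emeasure ?A (space ?A) ~= \<infinity>" by (auto simp: ennreal_mult_less_top)
   qed
   fix N :: "real set" assume N: "N \<in> null_sets lborel"
   then have "ennreal (1/2) * emeasure ?A N <= 0" using half[of N] \<nu>0[OF N] by auto
   then show "emeasure ?A N = 0" by (simp add: ennreal_zero_less_mult_iff mult_eq_0_iff)
  qed
 qed
 from AC[of g, OF gM] AC[of "%_. 0"] Mmono
 have "AE t in lborel. \<exists>D. ((%t. g t + M t) has_real_derivative D) (at t)"
  and "AE t in lborel. \<exists>D. (M has_real_derivative D) (at t)" by auto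
 then show ?thesis
 proof eventually_elim
  fix t assume "\<exists>D. ((%t. g t + M t) has_real_derivative D) (at t)" "\<exists>D. (M has_real_derivative D) (at t)"
  then obtain D E where "((%t. g t + M t) has_real_derivative D) (at t)" "(M has_real_derivative E) (at t)" by blast
  from DERIV_diff[OF this] show "\<exists>D. (g has_real_derivative D) (at t)" by auto
 qed
qed

lemma AE_interior_differentiable:
 fixes f m :: "real => real" and I :: "real set"
 assumes m: "!!a b. a \<in> I ==> b \<in> I ==> a <= b ==> set_integrable lborel {a..b} m"
  and f: "!!a b. a \<in> I ==> b \<in> I ==> a <= b ==> abs (f b - f a) <= (LBINT t:{a..b}. m t)"
  and I: "is_interval I"
 shows "AE t in lborel. t \<in> interior I --> (\<exists>D. (f has_real_derivative D) (at t))"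
proof -
 have local: "AE t in lborel. c < t \<and> t < d --> (\<exists>D. (f has_real_derivative D) (at t))"
  if cd: "c \<in> I" "d \<in> I" "c < d" for c d
 proof -
  define m' where "m' t = indicator {c..d} t * abs (m t)" for t
  define g where "g t = f (max c (min d t))" for t
  have sub: "x \<in> I" if "c <= x" "x <= d" for x
   using mem_is_interval_1_I[OF I cd(1,2)] that by blast
  have si: "set_integrable lborel {c..d} (%t. abs (m t))"
   using m[OF cd(1,2)] cd(3) by (intro set_integrable_abs) auto
  have im': "integrable lborel m'"
   using si unfolding m'_def set_integrable_def by simp
  have "AE t in lborel. \<exists>D. (g has_real_derivative D) (at t)"
  proof (rule ac_differentiable[OF im'])
   show "0 <= m' t" for t by (simp add: m'_def)
   fix a b :: real assume ab: "a <= b"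
   let ?a = "max c (min d a)" and ?b = "max c (min d b)"
   have ab': "?a <= ?b" "?a \<in> I" "?b \<in> I" using ab cd sub by auto
   have "abs (g b - g a) <= (LBINT t:{?a..?b}. m t)" unfolding g_def using f ab' by simp
   also have "\<dots> <= (LBINT t:{?a..?b}. abs (m t))"
   proof -
    have si: "set_integrable lborel {?a..?b} m" by (rule m[OF ab'(2,3,1)])
    show ?thesis by (rule set_integral_mono[OF si set_integrable_abs[OF si]]) simp
   qed
   also have "\<dots> <= (LBINT t:{a..b}. m' t)"
   proof (cases "b < c \<or> d < a")
    case True
    then have "?a = ?b" using cd ab by auto
    then have "(LBINT t:{?a..?b}. abs (m t)) = 0"
     unfolding set_lebesgue_integral_def
     by (intro integral_eq_zero_AE AE_I[where N="{?a}"]) (auto simp: indicator_def)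
    then show ?thesis unfolding set_lebesgue_integral_def by (simp add: m'_def integral_nonneg_AE)
   next
    case False
    then have e: "{?a..?b} = {a..b} \<inter> {c..d}" using cd ab by auto
    show ?thesis unfolding e set_lebesgue_integral_def m'_def real_scaleR_def
     by (rule eq_refl, rule Bochner_Integration.integral_cong) (auto split: split_indicator)
   qed
   finally show "abs (g b - g a) <= (LBINT t:{a..b}. m' t)" .
  qed
  then show ?thesis
  proof eventually_elim
   fix t assume "\<exists>D. (g has_real_derivative D) (at t)"
   then obtain D where D: "(g has_real_derivative D) (at t)" by blast
   show "c < t \<and> t < d --> (\<exists>D. (f has_real_derivative D) (at t))"
   proof
    assume t: "c < t \<and> t < d"
    have "(f has_real_derivative D) (at t)"
     by (rule has_field_derivative_transform_within_open[OF D, of "{c<..<d}"]) (use t in "auto simp: g_def")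
    then show "\<exists>D. (f has_real_derivative D) (at t)" by blast
   qed
  qed
 qed
 have "AE t in lborel. \<forall>c\<in>\<rat>. \<forall>d\<in>\<rat>. c \<in> I \<and> d \<in> I \<and> c < t \<and> t < d --> (\<exists>D. (f has_real_derivative D) (at t))"
 proof (intro AE_ball_countable' countable_rat)
  fix c d :: real
  show "AE t in lborel. c \<in> I \<and> d \<in> I \<and> c < t \<and> t < d --> (\<exists>D. (f has_real_derivative D) (at t))"
  proof (cases "c \<in> I \<and> d \<in> I \<and> c < d")
   case True
   then show ?thesis using local[of c d] by auto
  qed auto
 qed
 then show ?thesis
 proof eventually_elim
  fix t assume H: "\<forall>c\<in>\<rat>. \<forall>d\<in>\<rat>. c \<in> I \<and> d \<in> I \<and> c < t \<and> t < d --> (\<exists>D. (f has_real_derivative D) (at t))"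
  show "t \<in> interior I --> (\<exists>D. (f has_real_derivative D) (at t))"
  proof
   assume "t \<in> interior I"
   then obtain e where e: "0 < e" "ball t e \<subseteq> I" using mem_interior by blast
   obtain c where c: "c \<in> \<rat>" "t - e < c" "c < t" using Rats_dense_in_real[of "t - e" t] e by auto
   obtain d where d: "d \<in> \<rat>" "t < d" "d < t + e" using Rats_dense_in_real[of t "t + e"] e by auto
   have "c \<in> ball t e" "d \<in> ball t e" using c d by (auto simp: dist_real_def)
   then show "\<exists>D. (f has_real_derivative D) (at t)" using H c d e by blast
  qed
 qed
qed

text \<open>
 The primitive of \<open>m\<close> is differentiable almost everywhere, and its increments dominate
 \<open>w\<close>.
\<close>
lemma AE_interior_quotient_bounded:
 fixes m :: "real => real" and I :: "real set"
 assumes m: "!!a b. a \<in> I ==> b \<in> I ==> a <= b ==> set_integrable lborel {a..b} m"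
  and d: "!!a b. a \<in> I ==> b \<in> I ==> a <= b ==> 0 <= w a b \<and> w a b = w b a \<and> w a b <= (LBINT t:{a..b}. m t)"
  and I: "is_interval I"
 shows "AE t in lborel. t \<in> interior I --> (\<exists>C. \<forall>\<^sub>F h in at 0. w t (t + h) <= C * abs h)"
proof (cases "interior I = {}")
 case False
 then obtain c where c: "c \<in> I" using interior_subset by blast
 define P where "P t = (if c <= t then (LBINT s:{c..t}. m s) else - (LBINT s:{t..c}. m s))" for t
 have P: "P b - P a = (LBINT t:{a..b}. m t)" if ab: "a \<in> I" "b \<in> I" "a <= b" for a b
 proof -
  have split: "(LBINT t:{x..z}. m t) = (LBINT t:{x..y}. m t) + (LBINT t:{y..z}. m t)"
   if "x \<in> I" "y \<in> I" "z \<in> I" "x <= y" "y <= z" for x y z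
  proof -
   have "{x..z} = {x..y} \<union> {y..z}" using that by auto
   moreover have "(LBINT t:{x..y} \<union> {y..z}. m t) = (LBINT t:{x..y}. m t) + (LBINT t:{y..z}. m t)"
    using that m by (intro set_integral_Un_AE) (auto intro!: AE_I[where N="{y}"])
   ultimately show ?thesis by simp
  qed
  have "P b - P a = (LBINT t:{a..b}. m t)"
   using split[of c a b] split[of a c b] split[of a b c] ab c by (auto simp: P_def)
  then show ?thesis .
 qed
 have "AE t in lborel. t \<in> interior I --> (\<exists>D. (P has_real_derivative D) (at t))"
 proof (rule AE_interior_differentiable[OF m _ I])
  fix a b assume ab: "a \<in> I" "b \<in> I" "a <= b"
  then show "abs (P b - P a) <= (LBINT t:{a..b}. m t)" using P[OF ab] d[OF ab] by auto
 qed
 then show ?thesis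
 proof eventually_elim
  fix t assume H: "t \<in> interior I --> (\<exists>D. (P has_real_derivative D) (at t))"
  show "t \<in> interior I --> (\<exists>C. \<forall>\<^sub>F h in at 0. w t (t + h) <= C * abs h)"
  proof
   assume t: "t \<in> interior I"
   then obtain D where "(P has_real_derivative D) (at t)" using H by blast
   then have lim: "((%h. (P (t + h) - P t) / h) ---> D) (at 0)" by (simp add: DERIV_def)
   then have ev1: "\<forall>\<^sub>F h in at 0. (P (t + h) - P t) / h < D + 1"
    by (rule order_tendstoD) simp
   obtain e where e: "0 < e" "ball t e \<subseteq> I" using t mem_interior by blast
   have ev2: "\<forall>\<^sub>F h in at (0::real). abs h < e" using e by (auto simp: eventually_at dist_real_def)
   have ev3: "\<forall>\<^sub>F h in at (0::real). h ~= 0" by (simp add: eventually_at_filter)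
   have "\<forall>\<^sub>F h in at 0. w t (t + h) <= (D + 1) * abs h"
    using ev1 ev2 ev3
   proof eventually_elim
    fix h :: real assume h: "(P (t + h) - P t) / h < D + 1" "abs h < e" "h ~= 0"
    have I': "t + h \<in> I" "t \<in> I" using e h by (auto simp: dist_real_def subset_eq)
    show "w t (t + h) <= (D + 1) * abs h"
    proof (cases "0 < h")
     case True
     then have "P (t + h) - P t < (D + 1) * h" using h by (simp add: divide_less_eq)
     then show ?thesis using P[of t "t+h"] d[of t "t+h"] I' True by simp
    next
     case False
     then have "P t - P (t + h) < (D + 1) * (- h)" using h by (simp add: divide_less_eq algebra_simps)
     then show ?thesis using P[of "t+h" t] d[of "t+h" t] I' False by simp
    qed
   qed
   then show "\<exists>C. \<forall>\<^sub>F h in at 0. w t (t + h) <= C * abs h" by blast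
  qed
 qed
qed simp

section \<open>Smooth cutoff functions on the line\<close>

text \<open>
 Polynomials in \<open>1 / t\<close> are included because the derivative of \<open>exp (- 1 / t)\<close> then
 has the same form.
\<close>
definition flat_exp :: "real poly => real => real" where
 "flat_exp p t = (if 0 < t then poly p (1 / t) * exp (- 1 / t) else 0)"

lemma poly_exp_tendsto_0:
 fixes p :: "real poly"
 shows "((%u. poly p u * exp (- u)) ---> (0::real)) at_top"
proof -
 have "((%u. \<Sum>i\<le>degree p. coeff p i * (u ^ i / exp u)) ---> (\<Sum>i\<le>degree p. coeff p i * 0)) at_top"
  by (intro tendsto_sum tendsto_mult_left tendsto_power_div_exp_0)
 then show ?thesis by (simp add: poly_altdef sum_distrib_right exp_minus divide_inverse mult.assoc)
qed

lemma flat_tendsto_0: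
 fixes p :: "real poly"
 shows "((%t. poly p (1 / t) * exp (- 1 / t)) ---> 0) (at_right 0)"
 using filterlim_compose[OF poly_exp_tendsto_0[of p] filterlim_inverse_at_top_right]
 by (simp add: divide_inverse)

lemma DERIV_flat: "(flat_exp p has_real_derivative flat_exp ([:0,0,1:] * (p - pderiv p)) t) (at t)"
proof -
 consider "0 < t" | "t < 0" | "t = 0" by linarith
 then show ?thesis
 proof cases
  case 1
  have "((%t. poly p (1 / t) * exp (- 1 / t)) has_real_derivative flat_exp ([:0,0,1:] * (p - pderiv p)) t) (at t)"
   using 1 by (auto intro!: derivative_eq_intros DERIV_chain'[where g="poly p", OF _ poly_DERIV]
     simp: flat_exp_def field_simps power2_eq_square)
  then show ?thesis
   by (rule has_field_derivative_transform_within_open[of _ _ _ "{0<..}"]) (use 1 in "auto simp: flat_exp_def")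
 next
  case 2
  have "((%t. 0) has_real_derivative flat_exp ([:0,0,1:] * (p - pderiv p)) t) (at t)"
   using 2 by (simp add: flat_exp_def)
  then show ?thesis
   by (rule has_field_derivative_transform_within_open[of _ _ _ "{..<0}"]) (use 2 in "auto simp: flat_exp_def")
 next
  case 3
  have "((%h. flat_exp p h / h) ---> 0) (at_right 0)"
  proof (rule Lim_transform_eventually[OF flat_tendsto_0[of "pCons 0 p"]])
   show "\<forall>\<^sub>F t in at_right 0. poly (pCons 0 p) (1 / t) * exp (- 1 / t) = flat_exp p t / t"
    using eventually_at_right_less[of 0] by eventually_elim (simp add: flat_exp_def)
  qed
  moreover have "((%h. flat_exp p h / h) ---> 0) (at_left 0)"
  proof (rule Lim_transform_eventually[OF tendsto_const])
   show "\<forall>\<^sub>F t in at_left 0. 0 = flat_exp p t / t"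
    unfolding eventually_at_left_field by (intro exI[of _ "-1"]) (simp add: flat_exp_def)
  qed
  ultimately have "((%h. flat_exp p h / h) ---> 0) (at 0)" by (rule filterlim_split_at[rotated])
  then show ?thesis using 3 by (simp add: DERIV_def flat_exp_def)
 qed
qed

definition bump :: "real => real" where
 "bump t = flat_exp 1 t * flat_exp 1 (1 - t)"

lemma bump_nonneg: "0 <= bump t" by (simp add: bump_def flat_exp_def)
lemma bump_zero: "t <= 0 \<or> 1 <= t ==> bump t = 0" by (auto simp: bump_def flat_exp_def)
lemma bump_pos: "0 < t ==> t < 1 ==> 0 < bump t" by (simp add: bump_def flat_exp_def)

lemma continuous_flat: "continuous_on S (flat_exp p)"
 using DERIV_flat by (meson DERIV_continuous continuous_at_imp_continuous_on)

lemma continuous_bump: "continuous_on S bump"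
 unfolding bump_def
 by (intro continuous_intros continuous_flat continuous_on_compose2[OF continuous_flat[of UNIV]]) auto

definition bump_mass :: real where "bump_mass = integral {0..1} bump"

lemma bump_mass_pos: "0 < bump_mass"
proof -
 have "0 <= bump_mass" unfolding bump_mass_def
  by (intro integral_nonneg integrable_continuous_real continuous_bump bump_nonneg)
 moreover have "bump_mass ~= 0"
 proof
  assume "bump_mass = 0"
  then have "(bump has_integral 0) (cbox 0 1)"
   unfolding bump_mass_def using integrable_integral[OF integrable_continuous_real[OF continuous_bump, of 0 1]] by simp
  then have "bump (1/2) = 0"
   by (rule has_integral_0_cbox_imp_0[OF continuous_bump bump_nonneg]) (auto simp: box_real)
  then show False using bump_pos[of "1/2"] by simp
 qed
 ultimately show ?thesis by simp
qed

definition smooth_step :: "real => real" where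
 "smooth_step t = (if t <= 0 then 0 else integral {0..t} bump / bump_mass)"

lemma bump_integral_split: "0 <= s ==> s <= t ==> integral {0..t} bump = integral {0..s} bump + integral {s..t} bump"
 by (rule Henstock_Kurzweil_Integration.integral_combine[symmetric]) (auto intro!: integrable_continuous_real continuous_bump)

lemma smooth_step_eq_1: "1 <= t ==> smooth_step t = 1"
proof -
 assume t: "1 <= t"
 have "integral {1..t} bump = integral {1..t} (%_. 0)"
  by (intro Henstock_Kurzweil_Integration.integral_cong) (auto intro!: bump_zero)
 then show ?thesis
  using bump_integral_split[of 1 t] t bump_mass_pos by (simp add: smooth_step_def bump_mass_def)
qed

lemma smooth_step_eq_0: "t <= 0 ==> smooth_step t = 0"
 by (simp add: smooth_step_def)

lemma DERIV_smooth_step: "(smooth_step has_real_derivative bump t / bump_mass) (at t)"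
proof -
 consider "0 < t" | "t < 0" | "t = 0" by linarith
 then show ?thesis
 proof cases
  case 1
  have "((%u. integral {0..u} bump) has_vector_derivative bump t) (at t within {0..t+1})"
   by (rule integral_has_vector_derivative) (use 1 continuous_bump in auto)
  then have "((%u. integral {0..u} bump) has_real_derivative bump t) (at t)"
   using 1 by (simp add: has_real_derivative_iff_has_vector_derivative at_within_Icc_at)
  then have "((%u. integral {0..u} bump / bump_mass) has_real_derivative bump t / bump_mass) (at t)"
   by (rule DERIV_cdivide)
  then show ?thesis
   by (rule has_field_derivative_transform_within_open[of _ _ _ "{0<..}"]) (use 1 in "auto simp: smooth_step_def")
 next
  case 2
  have "((%t. 0) has_real_derivative bump t / bump_mass) (at t)"
   using 2 bump_zero[of t] by simp
  then show ?thesis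
   by (rule has_field_derivative_transform_within_open[of _ _ _ "{..<0}"]) (use 2 in "auto simp: smooth_step_def")
 next
  case 3
  have "((%u. integral {0..u} bump) has_vector_derivative bump 0) (at 0 within {0..1})"
   by (rule integral_has_vector_derivative) (use continuous_bump in auto)
  then have "((%u. integral {0..u} bump) has_real_derivative bump 0) (at_right 0)"
   by (simp add: has_real_derivative_iff_has_vector_derivative at_within_Icc_at_right)
  then have "((%h. integral {0..h} bump / h / bump_mass) ---> 0 / bump_mass) (at_right 0)"
   using bump_mass_pos by (intro tendsto_divide tendsto_const) (auto simp: has_field_derivative_iff bump_zero)
  then have l0: "((%h. integral {0..h} bump / h / bump_mass) ---> 0) (at_right 0)" by simp
  have "((%h. smooth_step h / h) ---> 0) (at_right 0)"
  proof (rule Lim_transform_eventually[OF l0])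
   show "\<forall>\<^sub>F h in at_right 0. integral {0..h} bump / h / bump_mass = smooth_step h / h"
    using eventually_at_right_less[of 0] by eventually_elim (simp add: smooth_step_def)
  qed
  moreover have "((%h. smooth_step h / h) ---> 0) (at_left 0)"
  proof (rule Lim_transform_eventually[OF tendsto_const])
   show "\<forall>\<^sub>F t in at_left 0. 0 = smooth_step t / t"
    unfolding eventually_at_left_field by (intro exI[of _ "-1"]) (simp add: smooth_step_def)
  qed
  ultimately have "((%h. smooth_step h / h) ---> 0) (at 0)" by (rule filterlim_split_at[rotated])
  then show ?thesis using 3 by (simp add: DERIV_def smooth_step_def bump_zero)
 qed
qed

lemma smooth_step_mono: "s <= t ==> smooth_step s <= smooth_step t"
 using DERIV_smooth_step bump_nonneg bump_mass_pos
 by (intro DERIV_nonneg_imp_nondecreasing[of s t smooth_step]) (auto intro!: exI divide_nonneg_pos)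

lemma smooth_step_bounds: "0 <= smooth_step t" "smooth_step t <= 1"
 using smooth_step_mono[of "min t 0" t] smooth_step_mono[of t "max t 1"]
  smooth_step_eq_0[of "min t 0"] smooth_step_eq_1[of "max t 1"] by auto

text \<open>
 A class of functions that is closed under differentiation and therefore consists of smooth functions.
\<close>
inductive_set smooth_line :: "(real => real) set" where
 flat_exp: "(%t. flat_exp p (a * t + b)) \<in> smooth_line"
| step: "(%t. smooth_step (a * t + b)) \<in> smooth_line"
| const: "(%t. c) \<in> smooth_line"
| add: "f \<in> smooth_line ==> g \<in> smooth_line ==> (%t. f t + g t) \<in> smooth_line"
| mult: "f \<in> smooth_line ==> g \<in> smooth_line ==> (%t. f t * g t) \<in> smooth_line"

lemma smooth_line_deriv:
 "f \<in> smooth_line ==> \<exists>f'\<in>smooth_line. \<forall>t. (f has_real_derivative f' t) (at t)"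
proof (induction rule: smooth_line.induct)
 case (flat_exp p a b)
 have "((%t. flat_exp p (a * t + b)) has_real_derivative flat_exp ([:0,0,1:] * (p - pderiv p)) (a * t + b) * a) (at t)" for t
  by (rule DERIV_chain'[where g="flat_exp p", OF _ DERIV_flat]) (auto intro!: derivative_eq_intros)
 then show ?case
  by (intro bexI[of _ "%t. flat_exp ([:0,0,1:] * (p - pderiv p)) (a * t + b) * a"]) (auto intro: smooth_line.intros)
next
 case (step a b)
 have "((%t. smooth_step (a * t + b)) has_real_derivative bump (a * t + b) / bump_mass * a) (at t)" for t
  by (rule DERIV_chain'[where g=smooth_step, OF _ DERIV_smooth_step]) (auto intro!: derivative_eq_intros)
 moreover have e: "(%t. bump (a * t + b) / bump_mass * a) = (%t. flat_exp 1 (a * t + b) * flat_exp 1 ((- a) * t + (1 - b)) * (a / bump_mass))"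
  by (auto simp: bump_def algebra_simps)
 moreover have "(%t. bump (a * t + b) / bump_mass * a) \<in> smooth_line"
  unfolding e by (intro smooth_line.intros)
 ultimately show ?case by (intro bexI[of _ "%t. bump (a * t + b) / bump_mass * a"] allI)
next
 case (const c)
 then show ?case by (intro bexI[of _ "%t. 0"]) (auto intro: smooth_line.intros)
next
 case (add f g)
 then obtain f' g' where "f' \<in> smooth_line" "g' \<in> smooth_line" "!!t. (f has_real_derivative f' t) (at t)" "!!t. (g has_real_derivative g' t) (at t)"
  by blast
 then show ?case by (intro bexI[of _ "%t. f' t + g' t"]) (auto intro: smooth_line.intros DERIV_add)
next
 case (mult f g)
 then obtain f' g' where "f' \<in> smooth_line" "g' \<in> smooth_line" "!!t. (f has_real_derivative f' t) (at t)" "!!t. (g has_real_derivative g' t) (at t)"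
  by blast
 with mult show ?case by (intro bexI[of _ "%t. f' t * g t + g' t * f t"]) (auto intro: smooth_line.intros DERIV_mult)
qed

lemma smooth_line_deriv_in: "f \<in> smooth_line ==> deriv f \<in> smooth_line"
proof -
 assume "f \<in> smooth_line"
 then obtain f' where f': "f' \<in> smooth_line" "!!t. (f has_real_derivative f' t) (at t)" using smooth_line_deriv by blast
 then have "deriv f = f'" using DERIV_imp_deriv by blast
 then show ?thesis using f' by simp
qed

lemma smooth_line_iterated:
 assumes "f \<in> smooth_line"
 shows "(deriv ^^ n) f field_differentiable at t"
proof -
 have "(deriv ^^ n) f \<in> smooth_line"
  by (induction n) (auto simp: assms smooth_line_deriv_in)
 then show ?thesis using smooth_line_deriv unfolding field_differentiable_def by blast
qed

lemma smooth_line_continuous: "f \<in> smooth_line ==> continuous_on S f"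
 using smooth_line_deriv by (meson DERIV_continuous continuous_at_imp_continuous_on)

definition cutoff :: "real => real" where
 "cutoff t = smooth_step (t + 2) - smooth_step (t - 1)"

lemma cutoff_smooth_line: "cutoff \<in> smooth_line"
proof -
 have "cutoff = (%t. smooth_step (1 * t + 2) + (- 1) * smooth_step (1 * t + (- 1)))"
  by (auto simp: cutoff_def)
 also have "\<dots> \<in> smooth_line" by (intro smooth_line.intros)
 finally show ?thesis .
qed

lemma cutoff_eq_1: "abs t <= 1 ==> cutoff t = 1"
 by (simp add: cutoff_def smooth_step_eq_1 smooth_step_eq_0)

lemma cutoff_eq_0: "2 <= abs t ==> cutoff t = 0"
 by (cases "0 <= t") (simp_all add: cutoff_def smooth_step_eq_1 smooth_step_eq_0)

lemma cutoff_bound: "abs (cutoff t) <= 1"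
 using smooth_step_bounds[of "t + 2"] smooth_step_bounds[of "t - 1"] by (auto simp: cutoff_def abs_le_iff)

lemma trapezoid_test_fun:
 assumes "a <= b" "0 < \<delta>" "{a..b + \<delta>} \<subseteq> J"
 shows "(%t. smooth_step ((t - a) / \<delta>) - smooth_step ((t - b) / \<delta>)) \<in> test_fun J"
proof -
 let ?\<eta> = "%t. smooth_step ((t - a) / \<delta>) - smooth_step ((t - b) / \<delta>)"
 have "?\<eta> = (%t. smooth_step ((1/\<delta>) * t + (- a / \<delta>)) + (- 1) * smooth_step ((1/\<delta>) * t + (- b / \<delta>)))"
  by (auto simp: diff_divide_distrib)
 also have "\<dots> \<in> smooth_line" by (intro smooth_line.intros)
 finally have s: "?\<eta> \<in> smooth_line" .
 have "?\<eta> t = 0" if "t \<notin> {a..b + \<delta>}" for t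
 proof (cases "t < a")
  case True
  then show ?thesis using assms by (simp add: smooth_step_eq_0 divide_nonpos_pos)
 next
  case False
  then have "b + \<delta> < t" using that by auto
  then show ?thesis using assms by (simp add: smooth_step_eq_1 le_divide_eq)
 qed
 then have supp: "\<forall>t. ?\<eta> t ~= 0 --> t \<in> {a..b + \<delta>}" by blast
 show ?thesis unfolding test_fun_def
  using smooth_line_iterated[OF s] supp assms(3) compact_Icc[of a "b + \<delta>"] by blast
qed

section \<open>Calculus for smooth profiles\<close>

lemma Cc_smoothD:
 assumes "\<psi> \<in> Cc_smooth d"
 shows "!!y z. (!!i. i < d ==> y i = z i) ==> \<psi> y = \<psi> z"
  and "continuous_on UNIV \<psi>"
  and "!!i y. i < d ==> ((%s. \<psi> (y(i := s))) has_real_derivative pderiv_coord i \<psi> (y(i := s0))) (at s0)"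
  and "\<exists>R\<ge>0. \<forall>y. \<psi> y ~= 0 --> (\<forall>i<d. abs (y i) <= R)"
proof -
 show "!!y z. (!!i. i < d ==> y i = z i) ==> \<psi> y = \<psi> z"
  using assms unfolding Cc_smooth_def by blast
 have "\<forall>is\<in>lists {..<d}. continuous_on UNIV (foldr pderiv_coord is \<psi>) \<and>
    (\<forall>i<d. \<forall>y. (%s. foldr pderiv_coord is \<psi> (y(i := s))) field_differentiable at (y i))"
  using assms unfolding Cc_smooth_def by blast
 from bspec[OF this, of "[]"] have c: "continuous_on UNIV \<psi>" and f: "!!i y. i < d ==> (%s. \<psi> (y(i := s))) field_differentiable at (y i)"
  by auto
 show "continuous_on UNIV \<psi>" by (rule c)
 show "((%s. \<psi> (y(i := s))) has_real_derivative pderiv_coord i \<psi> (y(i := s0))) (at s0)" if "i < d" for i y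
  using f[OF that, of "y(i := s0)"] by (auto simp: pderiv_coord_def intro: field_differentiable_derivI)
 obtain R where R: "\<forall>y. \<psi> y ~= 0 --> (\<forall>i<d. abs (y i) <= R)" using assms unfolding Cc_smooth_def by blast
 then have "\<forall>y. \<psi> y ~= 0 --> (\<forall>i<d. abs (y i) <= max R 0)" by (meson max.cobounded1 order_trans)
 then show "\<exists>R\<ge>0. \<forall>y. \<psi> y ~= 0 --> (\<forall>i<d. abs (y i) <= R)" by (meson max.cobounded2)
qed

text \<open>
 A class closed under partial derivatives replaces explicit formulas for the iterated derivatives.
\<close>
lemma Cc_smoothI:
 assumes dep: "!!y z. (!!i. i < d ==> y i = z i) ==> \<psi> y = \<psi> z"
  and supp: "!!y. \<psi> y ~= 0 ==> (\<forall>i<d. abs (y i) <= R)"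
  and \<psi>: "\<psi> \<in> C" and cont: "!!g. g \<in> C ==> continuous_on UNIV g"
  and der: "!!g i. g \<in> C ==> i < d ==>
   \<exists>g'\<in>C. \<forall>y. ((%s. g (y(i := s))) has_real_derivative g' y) (at (y i))"
 shows "\<psi> \<in> Cc_smooth d"
proof -
 have pd: "pderiv_coord i g \<in> C" if g: "g \<in> C" "i < d" for g i
 proof -
  obtain g' where g': "g' \<in> C" "!!y. ((%s. g (y(i := s))) has_real_derivative g' y) (at (y i))"
   using der[OF g] by blast
  have "pderiv_coord i g = g'"
   unfolding pderiv_coord_def using DERIV_imp_deriv[OF g'(2)] by blast
  then show ?thesis using g' by simp
 qed
 have it: "foldr pderiv_coord is \<psi> \<in> C" if "is \<in> lists {..<d}" for "is"
  using that by (induction "is") (auto simp: \<psi> pd)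
 have "(%s. g (y(i := s))) field_differentiable at (y i)" if "g \<in> C" "i < d" for g i y
  using der[OF that] unfolding field_differentiable_def by blast
 then show ?thesis unfolding Cc_smooth_def using dep supp it cont by (intro CollectI conjI) blast+
qed

lemma Cc_smooth_pderiv:
 assumes \<psi>: "\<psi> \<in> Cc_smooth d" and i: "i < d"
 shows "pderiv_coord i \<psi> \<in> Cc_smooth d"
proof -
 note D = Cc_smoothD[OF \<psi>]
 obtain R where R: "0 <= R" "!!y j. \<psi> y ~= 0 ==> j < d ==> abs (y j) <= R" using D(4) by blast
 define C where "C = (%is. foldr pderiv_coord is \<psi>) ` lists {..<d}"
 have *: "\<forall>is\<in>lists {..<d}. continuous_on UNIV (foldr pderiv_coord is \<psi>) \<and>
    (\<forall>i<d. \<forall>y. (%s. foldr pderiv_coord is \<psi> (y(i := s))) field_differentiable at (y i))"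
  using \<psi> unfolding Cc_smooth_def by blast
 show ?thesis
 proof (rule Cc_smoothI)
  fix y z :: "nat => real" assume yz: "!!j. j < d ==> y j = z j"
  have "\<psi> (y(i := s)) = \<psi> (z(i := s))" for s by (rule D(1)) (use yz in auto)
  then show "pderiv_coord i \<psi> y = pderiv_coord i \<psi> z" unfolding pderiv_coord_def using yz[OF i] by simp
 next
  fix y :: "nat => real" assume nz: "pderiv_coord i \<psi> y ~= 0"
  show "\<forall>j<d. abs (y j) <= R"
  proof (intro allI impI, rule ccontr)
   fix j assume j: "j < d" "\<not> abs (y j) <= R"
   have "((%s. \<psi> (y(i := s))) has_real_derivative 0) (at (y i))"
   proof (cases "i = j")
    case True
    have "\<psi> (y(i := s)) = 0" if "s \<in> - {-R..R}" for s
    proof (rule ccontr)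
     assume "\<psi> (y(i := s)) ~= 0"
     from R(2)[OF this i] that show False by (auto simp: abs_le_iff)
    qed
    then show ?thesis
     by (intro has_field_derivative_transform_within_open[OF DERIV_const, of "- {-R..R}" _ 0])
      (use j True in "auto simp: open_Compl abs_le_iff")
   next
    case False
    then have "\<psi> (y(i := s)) = 0" for s using R(2)[of "y(i := s)" j] j by auto
    then show ?thesis by simp
   qed
   then have "pderiv_coord i \<psi> y = 0" unfolding pderiv_coord_def by (rule DERIV_imp_deriv)
   with nz show False by simp
  qed
 next
  show "pderiv_coord i \<psi> \<in> C" unfolding C_def by (rule image_eqI[of _ _ "[i]"]) (use i in simp_all)
 next
  fix g assume "g \<in> C" then show "continuous_on UNIV g" using * by (auto simp: C_def)
 next
  fix g k assume "g \<in> C" and k: "k < d"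
  then obtain "is" where g: "g = foldr pderiv_coord is \<psi>" "is \<in> lists {..<d}" by (auto simp: C_def)
  have "foldr pderiv_coord (k # is) \<psi> \<in> C" unfolding C_def using g k by (intro imageI) auto
  moreover have "((%s. g (y(k := s))) has_real_derivative foldr pderiv_coord (k # is) \<psi> y) (at (y k))" for y
   using * g k by (auto simp: pderiv_coord_def intro!: field_differentiable_derivI)
  ultimately show "\<exists>g'\<in>C. \<forall>y. ((%s. g (y(k := s))) has_real_derivative g' y) (at (y k))" by blast
 qed
qed

lemma Cc_smooth_bounded:
 assumes \<psi>: "\<psi> \<in> Cc_smooth d"
 shows "\<exists>B\<ge>0. \<forall>y. abs (\<psi> y) <= B"
proof -
 note D = Cc_smoothD[OF \<psi>]
 obtain R where R: "0 <= R" "!!y j. \<psi> y ~= 0 ==> j < d ==> abs (y j) <= R" using D(4) by blast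
 let ?K = "PiE UNIV (%i. if i < d then {-R..R} else {0::real})"
 have "compactin (product_topology (%i. euclidean) UNIV) ?K"
  by (subst compactin_PiE) auto
 then have "compact ?K" by (simp add: euclidean_product_topology)
 then have "compact (\<psi> ` ?K)" by (intro compact_continuous_image continuous_on_subset[OF D(2)]) auto
 then obtain B where B: "!!y. y \<in> ?K ==> abs (\<psi> y) <= B"
  using compact_imp_bounded bounded_iff by (metis image_eqI real_norm_def)
 have "abs (\<psi> y) <= max B 0" for y
 proof (cases "\<psi> y = 0")
  case False
  let ?z = "%i. if i < d then y i else 0"
  have "?z \<in> ?K" using R(2)[OF False] by (auto simp: abs_le_iff minus_le_iff)
  moreover have "\<psi> y = \<psi> ?z" by (rule D(1)) simp
  ultimately show ?thesis using B[of ?z] by simp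
 qed simp
 then show ?thesis by (meson max.cobounded2)
qed

text \<open>Change the coordinates one at a time and apply the mean value theorem to each change.\<close>
lemma Cc_smooth_telescope:
 assumes \<psi>: "\<psi> \<in> Cc_smooth d"
 shows "\<exists>\<xi>. \<psi> z - \<psi> y = (\<Sum>k<d. pderiv_coord k \<psi> (\<xi> k) * (z k - y k)) \<and> (\<forall>k i. abs (\<xi> k i - y i) <= abs (z i - y i))"
proof -
 note D = Cc_smoothD[OF \<psi>]
 define w where "w k i = (if i < k then z i else y i)" for k i
 have "\<exists>\<xi>. \<psi> (w (Suc k)) - \<psi> (w k) = pderiv_coord k \<psi> \<xi> * (z k - y k) \<and> (\<forall>i. abs (\<xi> i - y i) <= abs (z i - y i))"
  if k: "k < d" for k
 proof -
  let ?f = "%s. \<psi> ((w k)(k := s))"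
  have der: "(?f has_real_derivative pderiv_coord k \<psi> ((w k)(k := s))) (at s)" for s by (rule D(3)[OF k])
  have w1: "w (Suc k) = (w k)(k := z k)" and w0: "w k = (w k)(k := y k)" by (auto simp: w_def fun_eq_iff)
  have "\<exists>s. ?f (z k) - ?f (y k) = pderiv_coord k \<psi> ((w k)(k := s)) * (z k - y k) \<and> abs (s - y k) <= abs (z k - y k)"
  proof (cases "y k" "z k" rule: linorder_cases)
   case less
   then obtain s where "y k < s" "s < z k" "?f (z k) - ?f (y k) = (z k - y k) * pderiv_coord k \<psi> ((w k)(k := s))"
    using MVT2[of "y k" "z k" ?f "%s. pderiv_coord k \<psi> ((w k)(k := s))"] der by blast
   then show ?thesis by (intro exI[of _ s]) (auto simp: mult.commute)
  next
   case greater
   then obtain s where "z k < s" "s < y k" "?f (y k) - ?f (z k) = (y k - z k) * pderiv_coord k \<psi> ((w k)(k := s))"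
    using MVT2[of "z k" "y k" ?f "%s. pderiv_coord k \<psi> ((w k)(k := s))"] der by blast
   then show ?thesis by (intro exI[of _ s]) (auto simp: algebra_simps)
  qed (auto intro: exI[of _ "y k"])
  then obtain s where s: "\<psi> (w (Suc k)) - \<psi> (w k) = pderiv_coord k \<psi> ((w k)(k := s)) * (z k - y k)" "abs (s - y k) <= abs (z k - y k)"
   using w1 w0 by metis
  then show ?thesis by (intro exI[of _ "(w k)(k := s)"]) (auto simp: w_def)
 qed
 then obtain \<xi> where \<xi>: "!!k. k < d ==> \<psi> (w (Suc k)) - \<psi> (w k) = pderiv_coord k \<psi> (\<xi> k) * (z k - y k)"
  "!!k i. k < d ==> abs (\<xi> k i - y i) <= abs (z i - y i)" by metis
 define \<xi>' where "\<xi>' k = (if k < d then \<xi> k else y)" for k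
 have "\<psi> z = \<psi> (w d)" "\<psi> y = \<psi> (w 0)" by (auto intro!: D(1) simp: w_def)
 then have "\<psi> z - \<psi> y = (\<Sum>k<d. \<psi> (w (Suc k)) - \<psi> (w k))" using sum_lessThan_telescope[of "%k. \<psi> (w k)" d] by simp
 also have "\<dots> = (\<Sum>k<d. pderiv_coord k \<psi> (\<xi>' k) * (z k - y k))" by (intro sum.cong) (auto simp: \<xi> \<xi>'_def)
 finally show ?thesis using \<xi>(2) by (intro exI[of _ \<xi>']) (auto simp: \<xi>'_def)
qed

lemma Cc_smooth_lipschitz:
 assumes \<psi>: "\<psi> \<in> Cc_smooth d"
 shows "\<exists>K\<ge>0. \<forall>y z r. (\<forall>i<d. abs (z i - y i) <= r) --> abs (\<psi> z - \<psi> y) <= K * r"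
proof -
 have "\<forall>k\<in>{..<d}. \<exists>B\<ge>0. \<forall>y. abs (pderiv_coord k \<psi> y) <= B" using Cc_smooth_bounded[OF Cc_smooth_pderiv[OF \<psi>]] by auto
 then obtain B where B: "!!k. k < d ==> 0 <= B k" "!!k y. k < d ==> abs (pderiv_coord k \<psi> y) <= B k"
  by (metis lessThan_iff)
 have "abs (\<psi> z - \<psi> y) <= (\<Sum>k<d. B k) * r" if r: "\<forall>i<d. abs (z i - y i) <= r" for y z r
 proof -
  obtain \<xi> where \<xi>: "\<psi> z - \<psi> y = (\<Sum>k<d. pderiv_coord k \<psi> (\<xi> k) * (z k - y k))"
   using Cc_smooth_telescope[OF \<psi>] by blast
  have "abs (\<psi> z - \<psi> y) <= (\<Sum>k<d. abs (pderiv_coord k \<psi> (\<xi> k) * (z k - y k)))" unfolding \<xi> by (rule sum_abs)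
  also have "\<dots> <= (\<Sum>k<d. B k * r)" using B r by (intro sum_mono) (auto simp: abs_mult intro!: mult_mono)
  finally show ?thesis by (simp add: sum_distrib_right)
 qed
 then show ?thesis using B by (intro exI[of _ "\<Sum>k<d. B k"]) (auto intro: sum_nonneg)
qed

lemma Cc_smooth_taylor:
 assumes \<psi>: "\<psi> \<in> Cc_smooth d"
 shows "\<exists>K\<ge>0. \<forall>y z r. (\<forall>i<d. abs (z i - y i) <= r) -->
  \<bar>\<psi> z - \<psi> y - (\<Sum>k<d. pderiv_coord k \<psi> y * (z k - y k))\<bar> <= K * r^2"
proof -
 have "\<forall>k\<in>{..<d}. \<exists>K\<ge>0. \<forall>y z r. (\<forall>i<d. abs (z i - y i) <= r) --> abs (pderiv_coord k \<psi> z - pderiv_coord k \<psi> y) <= K * r"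
  using Cc_smooth_lipschitz[OF Cc_smooth_pderiv[OF \<psi>]] by auto
 then obtain K where K: "!!k. k < d ==> 0 <= K k"
  "!!k y z r. k < d ==> (\<forall>i<d. abs (z i - y i) <= r) ==> abs (pderiv_coord k \<psi> z - pderiv_coord k \<psi> y) <= K k * r"
  by (metis lessThan_iff)
 have "abs (\<psi> z - \<psi> y - (\<Sum>k<d. pderiv_coord k \<psi> y * (z k - y k))) <= (\<Sum>k<d. K k) * r^2"
  if r: "\<forall>i<d. abs (z i - y i) <= r" for y z r
 proof -
  obtain \<xi> where \<xi>: "\<psi> z - \<psi> y = (\<Sum>k<d. pderiv_coord k \<psi> (\<xi> k) * (z k - y k))" "!!k i. abs (\<xi> k i - y i) <= abs (z i - y i)"
   using Cc_smooth_telescope[OF \<psi>] by blast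
  have "abs (\<psi> z - \<psi> y - (\<Sum>k<d. pderiv_coord k \<psi> y * (z k - y k))) = abs (\<Sum>k<d. (pderiv_coord k \<psi> (\<xi> k) - pderiv_coord k \<psi> y) * (z k - y k))"
   unfolding \<xi> by (simp add: sum_subtractf left_diff_distrib)
  also have "\<dots> <= (\<Sum>k<d. abs ((pderiv_coord k \<psi> (\<xi> k) - pderiv_coord k \<psi> y) * (z k - y k)))" by (rule sum_abs)
  also have "\<dots> <= (\<Sum>k<d. (K k * r) * r)"
  proof (rule sum_mono)
   fix k assume k: "k \<in> {..<d}"
   have "abs (pderiv_coord k \<psi> (\<xi> k) - pderiv_coord k \<psi> y) <= K k * r"
    using k r \<xi>(2) by (intro K(2)) (auto intro: order_trans)
   moreover have "0 <= r" using r k abs_ge_zero order_trans by (metis lessThan_iff)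
   ultimately show "abs ((pderiv_coord k \<psi> (\<xi> k) - pderiv_coord k \<psi> y) * (z k - y k)) <= (K k * r) * r"
    using k r K(1) unfolding abs_mult by (intro mult_mono) auto
  qed
  finally show ?thesis by (simp add: sum_distrib_right power2_eq_square mult.assoc)
 qed
 then show ?thesis using K by (intro exI[of _ "\<Sum>k<d. K k"]) (auto intro: sum_nonneg)
qed

section \<open>Cylindrical functions\<close>

definition coords :: "nat => (nat => 'x::real_inner) => 'x => nat => real" where
 "coords d e x = (%i. if i < d then x \<bullet> e i else 0)"

lemma orthonormal_norm: "orthonormal_upto d e ==> i < d ==> norm (e i) = 1"
 unfolding orthonormal_upto_def by (auto simp: norm_eq_sqrt_inner)

lemma coords_diff_le: "orthonormal_upto d e ==> i < d ==> abs (coords d e y i - coords d e x i) <= norm (y - x)"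
 using Cauchy_Schwarz_ineq2[of "y - x" "e i"] orthonormal_norm[of d e i]
 by (simp add: coords_def inner_diff_left)

lemma GDERIV_unique: "GDERIV f x :> D ==> GDERIV f x :> E ==> D = E"
proof -
 assume "GDERIV f x :> D" "GDERIV f x :> E"
 then have "(%h. h \<bullet> D) = (%h. h \<bullet> E)" unfolding gderiv_def by (rule has_derivative_unique)
 then have "(D - E) \<bullet> D = (D - E) \<bullet> E" by metis
 then show "D = E" by (metis inner_diff_right inner_eq_zero_iff right_minus_eq)
qed

lemma gradI: "GDERIV f x :> D ==> grad f x = D"
 unfolding grad_def using GDERIV_unique by blast

lemma GDERIV_quadratic:
 fixes f :: "'x::real_inner => real"
 assumes "!!y. abs (f y - f x - D \<bullet> (y - x)) <= K * (norm (y - x))^2" and K: "0 <= K"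
 shows "GDERIV f x :> D"
 unfolding gderiv_def has_derivative_iff_norm
proof
 show "bounded_linear (%h. h \<bullet> D)" by (rule bounded_linear_inner_left)
 show "((%y. norm (f y - f x - (y - x) \<bullet> D) / norm (y - x)) ---> 0) (at x)"
 proof (rule Lim_null_comparison)
  show "\<forall>\<^sub>F y in at x. norm (norm (f y - f x - (y - x) \<bullet> D) / norm (y - x)) <= K * norm (y - x)"
   unfolding eventually_at_filter
  proof (intro always_eventually allI impI)
   fix y assume "y ~= x"
   then show "norm (norm (f y - f x - (y - x) \<bullet> D) / norm (y - x)) <= K * norm (y - x)"
    using assms(1)[of y] by (simp add: inner_commute divide_le_eq power2_eq_square mult.assoc)
  qed
  have "((%y. K * norm (y - x)) ---> K * norm (x - x)) (at x)" by (intro tendsto_intros)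
  then show "((%y. K * norm (y - x)) ---> 0) (at x)" by simp
 qed
qed

lemma CylE:
 assumes "\<phi> \<in> Cyl"
 obtains d e \<psi> where "orthonormal_upto d e" "\<psi> \<in> Cc_smooth d" "\<phi> = (%x. \<psi> (coords d e x))"
 using assms unfolding Cyl_def coords_def by blast

lemma CylI: "orthonormal_upto d e ==> \<psi> \<in> Cc_smooth d ==> (%x. \<psi> (coords d e x)) \<in> Cyl"
 unfolding Cyl_def coords_def by blast

text \<open>One constant for all the regularity of cylindrical functions that enters the estimates.\<close>
definition c11_bound :: "real => ('x::real_inner => real) => bool" where
 "c11_bound B \<phi> \<longleftrightarrow> 0 < B \<and> (\<forall>x. abs (\<phi> x) <= B) \<and> (\<forall>x. norm (grad \<phi> x) <= B) \<and>
  (\<forall>x y. norm (grad \<phi> y - grad \<phi> x) <= B * norm (y - x)) \<and>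
  (\<forall>x y. abs (\<phi> y - \<phi> x - grad \<phi> x \<bullet> (y - x)) <= B * (norm (y - x))^2)"

lemma Cyl_c11_bound:
 assumes "\<phi> \<in> Cyl" shows "\<exists>B. c11_bound B \<phi>"
proof -
 obtain d e \<psi> where e: "orthonormal_upto d e" and \<psi>: "\<psi> \<in> Cc_smooth d" and \<phi>: "\<phi> = (%x. \<psi> (coords d e x))"
  using CylE[OF assms] .
 define G where "G x = (\<Sum>k<d. pderiv_coord k \<psi> (coords d e x) *\<^sub>R e k)" for x
 obtain K where K: "0 <= K" "!!y z r. (\<forall>i<d. abs (z i - y i) <= r) ==>
  \<bar>\<psi> z - \<psi> y - (\<Sum>k<d. pderiv_coord k \<psi> y * (z k - y k))\<bar> <= K * r^2" using Cc_smooth_taylor[OF \<psi>] by blast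
 have taylor: "abs (\<phi> y - \<phi> x - G x \<bullet> (y - x)) <= K * (norm (y - x))^2" for x y
 proof -
  have "G x \<bullet> (y - x) = (\<Sum>k<d. pderiv_coord k \<psi> (coords d e x) * (coords d e y k - coords d e x k))"
   unfolding G_def inner_sum_left by (intro sum.cong) (auto simp: coords_def inner_diff_right inner_commute)
  then show ?thesis using K(2)[of "coords d e y" "coords d e x" "norm (y - x)"] coords_diff_le[OF e] by (simp add: \<phi>)
 qed
 have grad: "grad \<phi> x = G x" for x
  by (rule gradI, rule GDERIV_quadratic[OF taylor K(1)])
 have "\<forall>k\<in>{..<d}. \<exists>K\<ge>0. \<forall>y z r. (\<forall>i<d. abs (z i - y i) <= r) --> abs (pderiv_coord k \<psi> z - pderiv_coord k \<psi> y) <= K * r"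
  using Cc_smooth_lipschitz[OF Cc_smooth_pderiv[OF \<psi>]] by auto
 then obtain L where L: "!!k. k < d ==> 0 <= L k"
  "!!k y z r. k < d ==> (\<forall>i<d. abs (z i - y i) <= r) ==> abs (pderiv_coord k \<psi> z - pderiv_coord k \<psi> y) <= L k * r"
  by (metis lessThan_iff)
 have lip: "norm (G y - G x) <= (\<Sum>k<d. L k) * norm (y - x)" for x y
 proof -
  have "norm (G y - G x) = norm (\<Sum>k<d. (pderiv_coord k \<psi> (coords d e y) - pderiv_coord k \<psi> (coords d e x)) *\<^sub>R e k)"
   unfolding G_def by (simp add: sum_subtractf scaleR_left_diff_distrib)
  also have "\<dots> <= (\<Sum>k<d. L k * norm (y - x))"
   using L(2)[of _ "coords d e y" "coords d e x" "norm (y - x)"] coords_diff_le[OF e] orthonormal_norm[OF e]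
   by (intro sum_norm_le) auto
  finally show ?thesis by (simp add: sum_distrib_right)
 qed
 have "\<forall>k\<in>{..<d}. \<exists>B\<ge>0. \<forall>y. abs (pderiv_coord k \<psi> y) <= B" using Cc_smooth_bounded[OF Cc_smooth_pderiv[OF \<psi>]] by auto
 then obtain B where B: "!!k. k < d ==> 0 <= B k" "!!k y. k < d ==> abs (pderiv_coord k \<psi> y) <= B k"
  by (metis lessThan_iff)
 have bd: "norm (G x) <= (\<Sum>k<d. B k)" for x
  unfolding G_def using B orthonormal_norm[OF e] by (intro sum_norm_le) auto
 obtain A where A: "!!y. abs (\<psi> y) <= A" using Cc_smooth_bounded[OF \<psi>] by blast
 define M where "M = 1 + K + (\<Sum>k<d. L k) + (\<Sum>k<d. B k) + abs A"
 have "0 <= (\<Sum>k<d. L k)" "0 <= (\<Sum>k<d. B k)" using L(1) B(1) by (auto intro!: sum_nonneg)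
 then have M: "1 <= M" "K <= M" "(\<Sum>k<d. L k) <= M" "(\<Sum>k<d. B k) <= M" "A <= M"
  unfolding M_def using K(1) by linarith+
 have "c11_bound M \<phi>" unfolding c11_bound_def grad
 proof (intro conjI allI)
  show "0 < M" using M by simp
  show "abs (\<phi> x) <= M" for x unfolding \<phi> using A[of "coords d e x"] M(5) by linarith
  show "norm (G x) <= M" for x using bd[of x] M(4) by linarith
  show "norm (G y - G x) <= M * norm (y - x)" for x y
   by (rule order_trans[OF lip]) (intro mult_right_mono M; simp)
  show "abs (\<phi> y - \<phi> x - G x \<bullet> (y - x)) <= M * (norm (y - x))^2" for x y
   by (rule order_trans[OF taylor]) (intro mult_right_mono M; simp)
 qed
 then show ?thesis by blast
qed

lemma c11_GDERIV: "c11_bound B \<phi> ==> GDERIV \<phi> x :> grad \<phi> x"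
 unfolding c11_bound_def by (intro GDERIV_quadratic[of _ _ _ B]) auto

lemma c11_lipschitz:
 assumes "c11_bound B \<phi>" shows "abs (\<phi> y - \<phi> x) <= B * norm (y - x)"
proof -
 have "norm (\<phi> y - \<phi> x) <= B * norm (y - x)"
 proof (rule differentiable_bound[of UNIV \<phi> "%x h. h \<bullet> grad \<phi> x"])
  show "(\<phi> has_derivative (%h. h \<bullet> grad \<phi> x)) (at x within UNIV)" for x
   using c11_GDERIV[OF assms, of x] by (simp add: gderiv_def)
  show "onorm (%h. h \<bullet> grad \<phi> x) <= B" for x
  proof (rule onorm_bound)
   show "0 <= B" using assms by (simp add: c11_bound_def)
   fix h
   have "norm (h \<bullet> grad \<phi> x) <= norm h * norm (grad \<phi> x)" by (simp add: Cauchy_Schwarz_ineq2)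
   also have "\<dots> <= norm h * B" using assms by (intro mult_left_mono) (auto simp: c11_bound_def)
   finally show "norm (h \<bullet> grad \<phi> x) <= B * norm h" by (simp add: mult.commute)
  qed
 qed auto
 then show ?thesis by simp
qed

lemma c11_continuous_grad: "c11_bound B \<phi> ==> continuous_on UNIV (grad \<phi>)"
 by (rule lipschitz_on_continuous_on[of B]) (auto simp: c11_bound_def lipschitz_on_def dist_norm)

lemma c11_continuous: "c11_bound B \<phi> ==> continuous_on UNIV \<phi>"
 using c11_lipschitz[of B \<phi>]
 by (intro lipschitz_on_continuous_on[of B]) (auto simp: c11_bound_def lipschitz_on_def dist_norm)

lemma Cyl_measurable [measurable_dest]:
 "\<phi> \<in> Cyl ==> \<phi> \<in> borel_measurable borel"
 and Cyl_grad_measurable: "\<phi> \<in> Cyl ==> grad \<phi> \<in> borel_measurable borel"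
 using Cyl_c11_bound c11_continuous c11_continuous_grad borel_measurable_continuous_onI by blast+

lemma grad_norm_le_lipschitz:
 assumes D: "GDERIV f x :> D" and lip: "!!y. abs (f y - f x) <= K * norm (y - x)" and K: "0 <= K"
 shows "norm D <= K"
proof (cases "D = 0")
 case False
 have "((%s. f (x + s *\<^sub>R D)) has_derivative (%s. (s *\<^sub>R D) \<bullet> D)) (at 0)"
 proof (rule has_derivative_compose[where g=f and f="%s. x + s *\<^sub>R D"])
  show "((%s. x + s *\<^sub>R D) has_derivative (%s. s *\<^sub>R D)) (at 0)" by (auto intro!: derivative_eq_intros)
  show "(f has_derivative (%h. h \<bullet> D)) (at (x + 0 *\<^sub>R D))" using D by (simp add: gderiv_def)
 qed
 then have "((%s. f (x + s *\<^sub>R D)) has_real_derivative (D \<bullet> D)) (at 0)"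
  by (simp add: has_field_derivative_def mult_commute_abs)
 then have "((%s. (f (x + s *\<^sub>R D) - f x) / s) ---> D \<bullet> D) (at 0)" by (simp add: DERIV_def)
 then have "D \<bullet> D <= K * norm D"
 proof (rule tendsto_upperbound)
  show "\<forall>\<^sub>F s in at 0. (f (x + s *\<^sub>R D) - f x) / s <= K * norm D"
   unfolding eventually_at_filter
  proof (intro always_eventually allI impI)
   fix s :: real assume s: "s ~= 0"
   have "abs ((f (x + s *\<^sub>R D) - f x) / s) <= (K * (abs s * norm D)) / abs s"
    unfolding abs_divide using lip[of "x + s *\<^sub>R D"] by (intro divide_right_mono) auto
   then show "(f (x + s *\<^sub>R D) - f x) / s <= K * norm D"
    using s abs_ge_self[of "(f (x + s *\<^sub>R D) - f x) / s"] by simp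
  qed
 qed simp
 then have "norm D * norm D <= K * norm D" by (simp add: power2_norm_eq_inner[symmetric] power2_eq_square)
 then show ?thesis using False by simp
qed (use K in simp)

section \<open>Sums of cylindrical functions\<close>

text \<open>
 Profiles of functions that are cylindrical for different orthonormal systems differ by a linear change of
 coordinates; this class contains such compositions and is closed under partial derivatives.
\<close>
inductive_set smooth_profiles :: "nat => ((nat => real) => real) set" for d where
 comp: "\<psi> \<in> Cc_smooth k ==> (%y. \<psi> (%j. if j < k then \<Sum>i<d. A j i * y i else 0)) \<in> smooth_profiles d"
| const: "(%y. c) \<in> smooth_profiles d"
| add: "f \<in> smooth_profiles d ==> g \<in> smooth_profiles d ==> (%y. f y + g y) \<in> smooth_profiles d"
| mult: "f \<in> smooth_profiles d ==> g \<in> smooth_profiles d ==> (%y. f y * g y) \<in> smooth_profiles d"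

lemma smooth_profiles_sum:
 fixes n :: nat
 shows "(!!k. k < n ==> f k \<in> smooth_profiles d) ==> (%y. \<Sum>k<n. f k y) \<in> smooth_profiles d"
 by (induction n) (auto intro: smooth_profiles.intros)

lemma smooth_profiles_prod:
 fixes n :: nat
 shows "(!!k. k < n ==> f k \<in> smooth_profiles d) ==> (%y. \<Prod>k<n. f k y) \<in> smooth_profiles d"
 by (induction n) (auto intro: smooth_profiles.intros)

lemma smooth_profiles_continuous: "f \<in> smooth_profiles d ==> continuous_on UNIV f"
proof (induction rule: smooth_profiles.induct)
 case (comp \<psi> k A)
 have "continuous_on UNIV (%(y::nat=>real) j. if j < k then \<Sum>i<d. A j i * y i else 0)"
 proof (rule continuous_on_coordinatewise_then_product)
  show "continuous_on UNIV (%y::nat=>real. if j < k then \<Sum>i<d. A j i * y i else 0)" for j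
   by (cases "j < k") (auto intro!: continuous_intros continuous_on_product_coordinates)
 qed
 then show ?case by (rule continuous_on_compose2[OF Cc_smoothD(2)[OF comp]]) auto
qed (auto intro: continuous_intros)

lemma smooth_profiles_dep: "f \<in> smooth_profiles d ==> (!!i. i < d ==> y i = z i) ==> f y = f z"
proof (induction rule: smooth_profiles.induct)
 case (comp \<psi> k A)
 then have *: "(\<Sum>i<d. A j i * y i) = (\<Sum>i<d. A j i * z i)" for j by (intro sum.cong) auto
 show ?case by (simp only: *)
qed auto

lemma DERIV_quadratic:
 fixes f :: "real => real"
 assumes "!!s. abs (f s - f s0 - D * (s - s0)) <= K * (s - s0)^2" and "0 <= K"
 shows "(f has_real_derivative D) (at s0)"
 using GDERIV_quadratic[of f s0 D K] assms by simp

lemma smooth_profiles_deriv: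
 "f \<in> smooth_profiles d ==> i < d ==>
 \<exists>f'\<in>smooth_profiles d. \<forall>y. ((%s. f (y(i := s))) has_real_derivative f' y) (at (y i))"
proof (induction rule: smooth_profiles.induct)
 case (comp \<psi> k A)
 define T where "T y = (%j. if j < k then \<Sum>i<d. A j i * y i else 0)" for y :: "nat => real"
 define f' where "f' y = (\<Sum>j<k. A j i * pderiv_coord j \<psi> (T y))" for y
 have "f' \<in> smooth_profiles d"
  unfolding f'_def[abs_def] T_def
  by (intro smooth_profiles_sum smooth_profiles.mult smooth_profiles.const smooth_profiles.comp Cc_smooth_pderiv comp(1)) auto
 moreover have "((%s. \<psi> (T (y(i := s)))) has_real_derivative f' y) (at (y i))" for y
 proof -
  obtain K where K: "0 <= K" "!!y z r. (\<forall>i<k. abs (z i - y i) <= r) ==>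
   \<bar>\<psi> z - \<psi> y - (\<Sum>j<k. pderiv_coord j \<psi> y * (z j - y j))\<bar> <= K * r^2" using Cc_smooth_taylor[OF comp(1)] by blast
  define m where "m = (\<Sum>j<k. abs (A j i))"
  have Td: "T (y(i := s)) j - T y j = (if j < k then A j i * (s - y i) else 0)" for s j
  proof -
   have "(\<Sum>l<d. A j l * (y(i := s)) l) - (\<Sum>l<d. A j l * y l) = (\<Sum>l<d. if l = i then A j i * (s - y i) else 0)"
    unfolding sum_subtractf[symmetric] by (intro sum.cong) (auto simp: algebra_simps)
   also have "\<dots> = A j i * (s - y i)" using comp(2) by simp
   finally show ?thesis by (simp add: T_def)
  qed
  show ?thesis
  proof (rule DERIV_quadratic)
   fix s
   have "abs (T (y(i := s)) j - T y j) <= m * abs (s - y i)" if "j < k" for j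
   proof -
    have "abs (A j i) <= m" unfolding m_def using that by (intro member_le_sum) auto
    then show ?thesis using that by (simp add: Td abs_mult mult_right_mono)
   qed
   then have "abs (\<psi> (T (y(i := s))) - \<psi> (T y) - (\<Sum>j<k. pderiv_coord j \<psi> (T y) * (T (y(i := s)) j - T y j))) <= K * (m * abs (s - y i))^2"
    by (intro K(2)) auto
   moreover have "(\<Sum>j<k. pderiv_coord j \<psi> (T y) * (T (y(i := s)) j - T y j)) = f' y * (s - y i)"
    unfolding f'_def sum_distrib_right by (intro sum.cong) (auto simp: Td)
   ultimately show "abs (\<psi> (T (y(i := s))) - \<psi> (T (y(i := y i))) - f' y * (s - y i)) <= (K * m^2) * (s - y i)^2"
    by (simp add: power_mult_distrib mult.assoc)
  qed (use K in simp)
 qed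
 ultimately show ?case unfolding T_def by blast
next
 case (const c)
 then show ?case by (intro bexI[of _ "%y. 0"]) (auto intro: smooth_profiles.intros)
next
 case (add f g)
 then obtain f' g' where "f' \<in> smooth_profiles d" "g' \<in> smooth_profiles d"
  "!!y. ((%s. f (y(i := s))) has_real_derivative f' y) (at (y i))" "!!y. ((%s. g (y(i := s))) has_real_derivative g' y) (at (y i))"
  by blast
 note fg = this
 show ?case
 proof (intro bexI allI)
  show "((%s. f (y(i := s)) + g (y(i := s))) has_real_derivative f' y + g' y) (at (y i))" for y
   by (rule DERIV_add[OF fg(3,4)])
  show "(%y. f' y + g' y) \<in> smooth_profiles d" by (rule smooth_profiles.add[OF fg(1,2)])
 qed
next
 case (mult f g)
 then obtain f' g' where f': "f' \<in> smooth_profiles d" "g' \<in> smooth_profiles d"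
  "!!y. ((%s. f (y(i := s))) has_real_derivative f' y) (at (y i))" "!!y. ((%s. g (y(i := s))) has_real_derivative g' y) (at (y i))"
  by blast
 have "((%s. f (y(i := s)) * g (y(i := s))) has_real_derivative (f' y * g y + g' y * f y)) (at (y i))" for y
  using DERIV_mult[OF f'(3)[of y] f'(4)[of y]] by simp
 then show ?case
 proof (intro bexI allI)
  show "(%y. f' y * g y + g' y * f y) \<in> smooth_profiles d"
   by (intro smooth_profiles.add smooth_profiles.mult f' mult)
 qed
qed

lemma smooth_profiles_Cc_smooth:
 assumes "f \<in> smooth_profiles d" "!!y. f y ~= 0 ==> (\<forall>i<d. abs (y i) <= R)"
 shows "f \<in> Cc_smooth d"
 by (rule Cc_smoothI[where C="smooth_profiles d" and R=R])
  (use assms smooth_profiles_dep smooth_profiles_continuous smooth_profiles_deriv in blast)+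

lemma smooth_line_Cc_smooth:
 assumes "f \<in> smooth_line" "!!t. f t ~= 0 ==> abs t <= R"
 shows "(%y. f (y 0)) \<in> Cc_smooth 1"
proof (rule Cc_smoothI[where C="(%g y. g (y 0)) ` smooth_line" and R=R])
 fix g :: "(nat => real) => real" and i :: nat
 assume "g \<in> (%g y. g (y 0)) ` smooth_line" and i: "i < 1"
 then obtain h where h: "h \<in> smooth_line" "g = (%y. h (y 0))" by auto
 obtain h' where h': "h' \<in> smooth_line" "!!t. (h has_real_derivative h' t) (at t)" using smooth_line_deriv[OF h(1)] by blast
 show "\<exists>g'\<in>(%g y. g (y 0)) ` smooth_line. \<forall>y. ((%s. g (y(i := s))) has_real_derivative g' y) (at (y i))"
  using i h h' by (intro bexI[of _ "%y. h' (y 0)"]) auto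
next
 fix g :: "(nat => real) => real" assume "g \<in> (%g y. g (y 0)) ` smooth_line"
 then obtain h where h: "h \<in> smooth_line" "g = (%y. h (y 0))" by auto
 show "continuous_on UNIV g" unfolding h(2)
  by (rule continuous_on_compose2[OF smooth_line_continuous[OF h(1), of UNIV] continuous_on_product_coordinates]) simp
qed (use assms in auto)

lemma cutoff_Cc_smooth: "(%y. cutoff (y 0)) \<in> Cc_smooth 1"
 by (rule smooth_line_Cc_smooth[OF cutoff_smooth_line, of 2]) (use cutoff_eq_0 in "metis linear")

lemma Cyl_scale:
 assumes "\<phi> \<in> Cyl" shows "(%x. c * \<phi> x) \<in> Cyl" "grad (%x. c * \<phi> x) = (%x. c *\<^sub>R grad \<phi> x)"
proof -
 obtain d e \<psi> where e: "orthonormal_upto d e" and \<psi>: "\<psi> \<in> Cc_smooth d" and \<phi>: "\<phi> = (%x. \<psi> (coords d e x))"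
  using CylE[OF assms] .
 obtain R where R: "!!y. \<psi> y ~= 0 ==> (\<forall>i<d. abs (y i) <= R)" using Cc_smoothD(4)[OF \<psi>] by blast
 have \<psi>e: "\<psi> y = \<psi> (%j. if j < d then \<Sum>i<d. of_bool (i = j) * y i else 0)" for y
  by (rule Cc_smoothD(1)[OF \<psi>]) (simp add: of_bool_def if_distrib[of "%a. a * _"] cong: if_cong)
 have "(%y. c * \<psi> y) \<in> smooth_profiles d"
  by (subst \<psi>e) (intro smooth_profiles.intros \<psi>)
 then have "(%y. c * \<psi> y) \<in> Cc_smooth d" by (rule smooth_profiles_Cc_smooth) (use R in auto)
 from CylI[OF e this] show "(%x. c * \<phi> x) \<in> Cyl" by (simp add: \<phi>)
 obtain B where B: "c11_bound B \<phi>" using Cyl_c11_bound[OF assms] by blast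
 show "grad (%x. c * \<phi> x) = (%x. c *\<^sub>R grad \<phi> x)"
 proof
  fix x
  have "GDERIV (%x. c * \<phi> x) x :> c *\<^sub>R grad \<phi> x"
   using GDERIV_mult[OF GDERIV_const c11_GDERIV[OF B], of c x] by simp
  then show "grad (%x. c * \<phi> x) x = c *\<^sub>R grad \<phi> x" by (rule gradI)
 qed
qed

lemma common_orthonormal_system:
 fixes B :: "'x::real_inner set"
 assumes "finite B"
 obtains d e where "orthonormal_upto d e" "!!b x. b \<in> B ==> x \<bullet> b = (\<Sum>i<d. (b \<bullet> e i) * (x \<bullet> e i))"
proof -
 obtain C where C: "finite C" "span C = span B" "pairwise orthogonal C"
  using basis_orthogonal[OF assms] by blast
 define E where "E = (%c. (1 / norm c) *\<^sub>R c) ` (C - {0})"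
 have finE: "finite E" using C by (simp add: E_def)
 have E1: "v \<bullet> v = 1" if v: "v \<in> E" for v
 proof -
  obtain c where "c ~= 0" "v = (1 / norm c) *\<^sub>R c" using v by (auto simp: E_def)
  then show ?thesis by (simp add: dot_square_norm power2_eq_square)
 qed
 have E0: "v \<bullet> w = 0" if vw: "v \<in> E" "w \<in> E" "v ~= w" for v w
 proof -
  obtain c c' where c: "c \<in> C" "c' \<in> C" "v = (1 / norm c) *\<^sub>R c" "w = (1 / norm c') *\<^sub>R c'"
   using vw(1,2) by (auto simp: E_def)
  then have "c ~= c'" using vw(3) by auto
  then have "c \<bullet> c' = 0" using C(3) c by (auto simp: pairwise_def orthogonal_def)
  then show ?thesis using c by simp
 qed
 have "C \<subseteq> span E"
 proof
  fix c assume c: "c \<in> C"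
  show "c \<in> span E"
  proof (cases "c = 0")
   case False
   then have "(1 / norm c) *\<^sub>R c \<in> span E" using c by (intro span_base) (auto simp: E_def)
   then have "norm c *\<^sub>R ((1 / norm c) *\<^sub>R c) \<in> span E" by (rule span_scale)
   then show ?thesis using False by simp
  qed (simp add: span_zero)
 qed
 then have BE: "B \<subseteq> span E" using C(2) span_superset span_mono span_span by (metis subset_trans)
 obtain e where e: "bij_betw e {..<card E} E" using ex_bij_betw_nat_finite[OF finE] by (auto simp: atLeast0LessThan)
 have "orthonormal_upto (card E) e" unfolding orthonormal_upto_def
 proof (intro allI impI)
  fix i j assume ij: "i < card E" "j < card E"
  then have "e i \<in> E" "e j \<in> E" "e i = e j \<longleftrightarrow> i = j" using e by (auto simp: bij_betw_def inj_on_def)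
  then show "e i \<bullet> e j = (if i = j then 1 else 0)" using E1 E0 by auto
 qed
 moreover have "x \<bullet> b = (\<Sum>i<card E. (b \<bullet> e i) * (x \<bullet> e i))" if b: "b \<in> span E" for b x
  using b
 proof (induction rule: span_induct_alt)
  case base then show ?case by simp
 next
  case (step c v y)
  obtain k where k: "k < card E" "v = e k" using step(1) e by (metis bij_betw_def imageE lessThan_iff)
  have ek: "e k \<bullet> e i = (if i = k then 1 else 0)" if "i < card E" for i
   using \<open>orthonormal_upto (card E) e\<close> k that unfolding orthonormal_upto_def by auto
  have "(\<Sum>i<card E. (e k \<bullet> e i) * (x \<bullet> e i)) = (\<Sum>i<card E. if i = k then x \<bullet> e k else 0)"
   by (intro sum.cong) (auto simp: ek)
  also have "\<dots> = x \<bullet> e k" using k by simp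
  finally have "x \<bullet> (c *\<^sub>R v + y) = c * (\<Sum>i<card E. (e k \<bullet> e i) * (x \<bullet> e i)) + (\<Sum>i<card E. (y \<bullet> e i) * (x \<bullet> e i))"
   using step k by (simp add: inner_add_right)
  also have "\<dots> = (\<Sum>i<card E. ((c *\<^sub>R v + y) \<bullet> e i) * (x \<bullet> e i))"
   by (simp add: k inner_add_left sum.distrib sum_distrib_left algebra_simps)
  finally show ?case .
 qed
 ultimately show ?thesis using BE that by blast
qed

text \<open>
 A sum of cylindrical functions need not be cylindrical: in a common orthonormal system its profile may fail to
 have compact support. Cutting off at radius \<open>n\<close> repairs this, keeps the gradients bounded, and
 changes nothing near a given point once \<open>n\<close> is large.
\<close>
lemma Cyl_add_approx:
 fixes \<phi>1 \<phi>2 :: "'x::{real_inner, polish_space} => real"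
 assumes 1: "\<phi>1 \<in> Cyl" and 2: "\<phi>2 \<in> Cyl"
 shows "\<exists>\<Phi> K. (\<forall>n. \<Phi> n \<in> Cyl) \<and> (\<forall>n x. norm (grad (\<Phi> n) x) <= K) \<and>
  (\<forall>x. \<forall>\<^sub>F n in sequentially. grad (\<Phi> n) x = grad \<phi>1 x + grad \<phi>2 x)"
proof -
 obtain d1 e1 \<psi>1 where e1: "orthonormal_upto d1 e1" and \<psi>1: "\<psi>1 \<in> Cc_smooth d1" and \<phi>1: "\<phi>1 = (%x. \<psi>1 (coords d1 e1 x))"
  using CylE[OF 1] .
 obtain d2 e2 \<psi>2 where e2: "orthonormal_upto d2 e2" and \<psi>2: "\<psi>2 \<in> Cc_smooth d2" and \<phi>2: "\<phi>2 = (%x. \<psi>2 (coords d2 e2 x))"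
  using CylE[OF 2] .
 obtain d and e :: "nat => 'x" where e: "orthonormal_upto d e"
  and rep: "!!b x. b \<in> e1 ` {..<d1} \<union> e2 ` {..<d2} ==> x \<bullet> b = (\<Sum>i<d. (b \<bullet> e i) * (x \<bullet> e i))"
  by (rule common_orthonormal_system[of "e1 ` {..<d1} \<union> e2 ` {..<d2}"]) auto
 define \<Psi>1 where "\<Psi>1 y = \<psi>1 (%j. if j < d1 then \<Sum>i<d. (e1 j \<bullet> e i) * y i else 0)" for y
 define \<Psi>2 where "\<Psi>2 y = \<psi>2 (%j. if j < d2 then \<Sum>i<d. (e2 j \<bullet> e i) * y i else 0)" for y
 have \<Psi>c: "\<Psi>1 (coords d e x) = \<phi>1 x" "\<Psi>2 (coords d e x) = \<phi>2 x" for x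
  unfolding \<Psi>1_def \<Psi>2_def \<phi>1 \<phi>2
  by (intro arg_cong[where f=\<psi>1] arg_cong[where f=\<psi>2]; auto simp: coords_def rep fun_eq_iff intro!: sum.cong)+
 define c where "c n y = (\<Prod>i<d. cutoff (y i / real (Suc n)))" for n :: nat and y :: "nat => real"
 define g where "g n y = (\<Psi>1 y + \<Psi>2 y) * c n y" for n y
 have cS: "c n \<in> smooth_profiles d" for n
  unfolding c_def[abs_def]
 proof (rule smooth_profiles_prod)
  fix k assume k: "k < d"
  have "(%y::nat=>real. cutoff (y k / real (Suc n))) = (%y. (%y. cutoff (y (0::nat))) (%j. if j < 1 then \<Sum>i<d. (of_bool (i = k) / real (Suc n)) * y i else 0))"
   using k by (auto simp: of_bool_def if_distrib[of "%a. a / _"] if_distrib[of "%a. a * _"] cong: if_cong)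
  also have "\<dots> \<in> smooth_profiles d" by (rule smooth_profiles.comp[OF cutoff_Cc_smooth])
  finally show "(%y. cutoff (y k / real (Suc n))) \<in> smooth_profiles d" .
 qed
 have gS: "g n \<in> smooth_profiles d" for n
  unfolding g_def[abs_def] \<Psi>1_def \<Psi>2_def
  by (intro smooth_profiles.mult smooth_profiles.add smooth_profiles.comp \<psi>1 \<psi>2) (use cS[of n] in "simp add: eta_contract_eq")
 have gC: "g n \<in> Cc_smooth d" for n
 proof (rule smooth_profiles_Cc_smooth[OF gS, of _ "2 * real (Suc n)"])
  fix y assume "g n y ~= 0"
  then have "\<forall>i<d. cutoff (y i / real (Suc n)) ~= 0" by (auto simp: g_def c_def)
  then have "\<forall>i<d. abs (y i / real (Suc n)) <= 2" using cutoff_eq_0 by (meson linear)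
  then show "\<forall>i<d. abs (y i) <= 2 * real (Suc n)" by (simp add: abs_divide divide_le_eq)
 qed
 define \<Phi> where "\<Phi> n x = g n (coords d e x)" for n x
 have \<Phi>C: "\<Phi> n \<in> Cyl" for n unfolding \<Phi>_def[abs_def] by (rule CylI[OF e gC])
 obtain B1 where B1: "c11_bound B1 \<phi>1" using Cyl_c11_bound[OF 1] by blast
 obtain B2 where B2: "c11_bound B2 \<phi>2" using Cyl_c11_bound[OF 2] by blast
 obtain Lc where Lc: "0 <= Lc" "!!s t. abs (cutoff s - cutoff t) <= Lc * abs (s - t)"
 proof -
  obtain K where "0 <= K" "!!y z r. (\<forall>i<1. abs (z i - y i) <= r) ==> abs (cutoff (z (0::nat)) - cutoff (y 0)) <= K * r"
   using Cc_smooth_lipschitz[OF cutoff_Cc_smooth] by blast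
  from this(1) this(2)[of "%_. s" "%_. t" "abs (s - t)" for s t] show ?thesis by (intro that[of K]) auto
 qed
 have cb: "abs (c n y) <= 1" for n y
  unfolding c_def abs_prod by (rule prod_le_1) (auto simp: cutoff_bound)
 have clip: "abs (c n (coords d e x) - c n (coords d e z)) <= (real d * Lc) * norm (x - z)" for n x z
 proof -
  have "abs (c n (coords d e x) - c n (coords d e z)) <= (\<Sum>i<d. abs (cutoff (coords d e x i / real (Suc n)) - cutoff (coords d e z i / real (Suc n))))"
   unfolding c_def using norm_prod_diff[of "{..<d}" "%i. cutoff (coords d e x i / real (Suc n))" "%i. cutoff (coords d e z i / real (Suc n))"]
   by (simp add: cutoff_bound)
  also have "\<dots> <= (\<Sum>i<d. Lc * norm (x - z))"
  proof (rule sum_mono)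
   fix i assume i: "i \<in> {..<d}"
   have "abs (coords d e x i / real (Suc n) - coords d e z i / real (Suc n)) = abs (coords d e x i - coords d e z i) / real (Suc n)"
    by (simp add: diff_divide_distrib[symmetric] abs_divide)
   also have "\<dots> <= norm (x - z) / 1" using coords_diff_le[OF e, of i x z] i by (intro frac_le) auto
   finally have "abs (coords d e x i / real (Suc n) - coords d e z i / real (Suc n)) <= norm (x - z)" by simp
   then show "abs (cutoff (coords d e x i / real (Suc n)) - cutoff (coords d e z i / real (Suc n))) <= Lc * norm (x - z)"
    using Lc by (meson mult_left_mono order_trans)
  qed
  finally show ?thesis by simp
 qed
 define K where "K = (B1 + B2) + (B1 + B2) * (real d * Lc)"
 have B0: "0 < B1" "0 < B2" using B1 B2 by (auto simp: c11_bound_def)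
 have K0: "0 <= K" using B0 Lc by (auto simp: K_def)
 have \<Phi>lip: "abs (\<Phi> n z - \<Phi> n x) <= K * norm (z - x)" for n x z
 proof -
  let ?h = "%x. \<phi>1 x + \<phi>2 x" and ?c = "%x. c n (coords d e x)"
  have "\<Phi> n z - \<Phi> n x = (?h z - ?h x) * ?c z + ?h x * (?c z - ?c x)"
   by (simp add: \<Phi>_def g_def \<Psi>c algebra_simps)
  then have "abs (\<Phi> n z - \<Phi> n x) <= abs (?h z - ?h x) * abs (?c z) + abs (?h x) * abs (?c z - ?c x)"
   by (metis abs_mult abs_triangle_ineq)
  also have "\<dots> <= ((B1 + B2) * norm (z - x)) * 1 + (B1 + B2) * ((real d * Lc) * norm (z - x))"
  proof (intro add_mono mult_mono cb clip)
   show "abs (?h z - ?h x) <= (B1 + B2) * norm (z - x)"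
    using c11_lipschitz[OF B1, of z x] c11_lipschitz[OF B2, of z x] by (simp add: algebra_simps)
   show "abs (?h x) <= B1 + B2" using B1 B2 abs_triangle_ineq[of "\<phi>1 x" "\<phi>2 x"] unfolding c11_bound_def
    by (meson add_mono order_trans)
  qed (use B0 in auto)
  finally show ?thesis by (simp add: K_def algebra_simps)
 qed
 have \<Phi>G: "GDERIV (\<Phi> n) x :> grad (\<Phi> n) x" for n x
  using Cyl_c11_bound[OF \<Phi>C] c11_GDERIV by blast
 have "norm (grad (\<Phi> n) x) <= K" for n x
  by (rule grad_norm_le_lipschitz[OF \<Phi>G \<Phi>lip K0])
 moreover have "\<forall>\<^sub>F n in sequentially. grad (\<Phi> n) x = grad \<phi>1 x + grad \<phi>2 x" for x
 proof -
  obtain n0 :: nat where n0: "norm x + 1 < real n0" using reals_Archimedean2 by blast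
  have "grad (\<Phi> n) x = grad \<phi>1 x + grad \<phi>2 x" if n: "n0 <= n" for n
  proof (rule gradI)
   have "GDERIV (%x. \<phi>1 x + \<phi>2 x) x :> grad \<phi>1 x + grad \<phi>2 x"
    by (intro GDERIV_add c11_GDERIV[OF B1] c11_GDERIV[OF B2])
   then have "((%x. \<phi>1 x + \<phi>2 x) has_derivative (%h. h \<bullet> (grad \<phi>1 x + grad \<phi>2 x))) (at x)" by (simp add: gderiv_def)
   then have "(\<Phi> n has_derivative (%h. h \<bullet> (grad \<phi>1 x + grad \<phi>2 x))) (at x)"
   proof (rule has_derivative_transform_within_open[where s="ball x 1"])
    fix z assume "z \<in> ball x 1"
    then have "norm z <= norm x + 1" using norm_triangle_ineq2[of z x] by (simp add: dist_norm norm_minus_commute)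
    then have zn: "norm z <= real (Suc n)" using n0 n by linarith
    have "cutoff (coords d e z i / real (Suc n)) = 1" if "i < d" for i
    proof (rule cutoff_eq_1)
     have "abs (coords d e z i) <= norm z" using coords_diff_le[OF e that, of z 0] that by (simp add: coords_def)
     then show "abs (coords d e z i / real (Suc n)) <= 1" using zn by (simp add: abs_divide divide_le_eq)
    qed
    then show "\<phi>1 z + \<phi>2 z = \<Phi> n z" by (simp add: \<Phi>_def g_def c_def \<Psi>c)
   qed auto
   then show "GDERIV (\<Phi> n) x :> grad \<phi>1 x + grad \<phi>2 x" by (simp add: gderiv_def)
  qed
  then show ?thesis unfolding eventually_sequentially by blast
 qed
 ultimately show ?thesis using \<Phi>C by blast
qed

section \<open>A countable family of cylindrical functions with dense gradients\<close>

lemma countable_dense_subset: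
 fixes S :: "'a::{first_countable_topology, second_countable_topology} set"
 shows "\<exists>D. countable D \<and> D \<subseteq> S \<and> (\<forall>x\<in>S. \<exists>u. (\<forall>n. u n \<in> D) \<and> u ----> x)"
proof -
 obtain B :: "'a set set" where B: "countable B" "topological_basis B" using ex_countable_basis by blast
 define D where "D = (%b. SOME x. x \<in> b \<inter> S) ` {b \<in> B. b \<inter> S ~= {}}"
 have pick: "(SOME x. x \<in> b \<inter> S) \<in> b \<inter> S" if "b \<inter> S ~= {}" for b using that by (metis ex_in_conv someI_ex)
 have "D \<subseteq> S" using pick by (auto simp: D_def)
 moreover have "countable D" unfolding D_def using B by (intro countable_image countable_subset[OF _ B(1)]) auto
 moreover have "\<exists>u. (\<forall>n. u n \<in> D) \<and> u ----> x" if x: "x \<in> S" for x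
 proof -
  have "x \<in> closure D" unfolding closure_iff_nhds_not_empty
  proof (intro allI impI)
   fix A U assume "U \<subseteq> A" "open U" "x \<in> U"
   then obtain b where b: "b \<in> B" "x \<in> b" "b \<subseteq> U" using topological_basisE[OF B(2)] by metis
   then have "b \<inter> S ~= {}" using x by blast
   then have "(SOME x. x \<in> b \<inter> S) \<in> D \<inter> A" using pick b \<open>U \<subseteq> A\<close> by (auto simp: D_def)
   then show "D \<inter> A ~= {}" by blast
  qed
  then show ?thesis unfolding closure_sequential .
 qed
 ultimately show ?thesis by blast
qed

text \<open>
 Gradients with a common Lipschitz bound converge everywhere if they converge on a dense sequence, and the
 space of their values along that sequence is second countable.
\<close>
lemma Cyl_countable_dense:
 "\<exists>D :: ('x::{real_inner, polish_space} => real) set. countable D \<and> D \<subseteq> Cyl \<and>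
  (\<forall>\<phi>\<in>Cyl. \<exists>\<Phi> K. (\<forall>n. \<Phi> n \<in> D) \<and> (\<forall>n x. norm (grad (\<Phi> n) x) <= K) \<and> (\<forall>x. (%n. grad (\<Phi> n) x) ----> grad \<phi> x))"
proof -
 obtain q :: "nat => 'x" where q: "dense_seq q" using dense_seq_exists by blast
 define C where "C N = {\<phi>\<in>(Cyl :: ('x => real) set). c11_bound (real N) \<phi>}" for N :: nat
 define J where "J \<phi> k = grad \<phi> (q k)" for \<phi> :: "'x => real" and k :: nat
 have "\<forall>N. \<exists>D. countable D \<and> D \<subseteq> J ` C N \<and> (\<forall>x\<in>J ` C N. \<exists>u. (\<forall>n. u n \<in> D) \<and> u ----> x)"
  by (intro allI countable_dense_subset)
 then obtain D where D: "!!N. countable (D N)" "!!N. D N \<subseteq> J ` C N"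
  "!!N x. x \<in> J ` C N ==> \<exists>u. (\<forall>n. u n \<in> D N) \<and> u ----> x"
  by metis
 define E where "E = (\<Union>N. inv_into (C N) J ` D N)"
 have "countable E" unfolding E_def using D(1) by auto
 moreover have "E \<subseteq> Cyl" 
 proof
  fix f assume "f \<in> E"
  then obtain N w where w: "w \<in> D N" "f = inv_into (C N) J w" unfolding E_def by blast
  then have "f \<in> C N" using D(2)[of N] inv_into_into[of w J "C N"] by blast
  then show "f \<in> Cyl" by (simp add: C_def)
 qed
 moreover have "\<exists>\<Phi> K. (\<forall>n. \<Phi> n \<in> E) \<and> (\<forall>n x. norm (grad (\<Phi> n) x) <= K) \<and> (\<forall>x. (%n. grad (\<Phi> n) x) ----> grad \<phi> x)"
  if \<phi>: "\<phi> \<in> Cyl" for \<phi>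
 proof -
  obtain B where B: "c11_bound B \<phi>" using Cyl_c11_bound[OF \<phi>] by blast
  obtain N :: nat where N: "B <= real N" using real_arch_simple by blast
  have "c11_bound (real N) \<phi>" using B N unfolding c11_bound_def
   by (auto intro: order_trans less_le_trans mult_right_mono) (meson mult_right_mono norm_ge_zero order_trans zero_le_power2)+
  then have \<phi>N: "\<phi> \<in> C N" using \<phi> by (simp add: C_def)
  then obtain u where u: "!!n. u n \<in> D N" "u ----> J \<phi>" using D(3)[of "J \<phi>" N] by blast
  define \<Phi> where "\<Phi> n = inv_into (C N) J (u n)" for n
  have uJ: "u n \<in> J ` C N" for n using u(1) D(2) by blast
  have \<Phi>N: "\<Phi> n \<in> C N" for n unfolding \<Phi>_def by (rule inv_into_into[OF uJ])
  have J\<Phi>: "J (\<Phi> n) = u n" for n unfolding \<Phi>_def by (rule f_inv_into_f[OF uJ])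
  have lip: "norm (grad f y - grad f x) <= real N * norm (y - x)" if "f \<in> C N" for f x y
   using that by (auto simp: C_def c11_bound_def)
  have lim: "(%n. grad (\<Phi> n) (q k)) ----> grad \<phi> (q k)" for k
  proof -
   have "continuous_on UNIV (%f :: nat => 'x. f k)" by (rule continuous_on_product_coordinates)
   from continuous_on_tendsto_compose[OF this u(2)] have l: "(%n. u n k) ----> J \<phi> k" by simp
   have "grad (\<Phi> n) (q k) = u n k" for n using J\<Phi>[of n] unfolding J_def by (metis (no_types))
   then show ?thesis using l by (simp add: J_def)
  qed
  have "(%n. grad (\<Phi> n) x) ----> grad \<phi> x" for x
  proof (rule metric_LIMSEQ_I)
   fix r :: real assume r: "0 < r"
   have N0: "0 < real N" using \<phi>N by (auto simp: C_def c11_bound_def)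
   have "0 < r / (3 * real N)" using r N0 by simp
   then obtain k where k: "dist (q k) x < r / (3 * real N)" using q unfolding dense_seq_def by blast
   then have k': "real N * norm (x - q k) < r / 3" using N0 by (simp add: dist_norm norm_minus_commute field_simps)
   obtain n0 where n0: "!!n. n \<ge> n0 ==> dist (grad (\<Phi> n) (q k)) (grad \<phi> (q k)) < r / 3"
    using metric_LIMSEQ_D[OF lim, of "r / 3" k] r by auto
   have "dist (grad (\<Phi> n) x) (grad \<phi> x) < r" if "n \<ge> n0" for n
   proof -
    have "dist (grad (\<Phi> n) x) (grad \<phi> x) <= dist (grad (\<Phi> n) x) (grad (\<Phi> n) (q k)) + dist (grad (\<Phi> n) (q k)) (grad \<phi> (q k)) + dist (grad \<phi> (q k)) (grad \<phi> x)"
     using dist_triangle[of "grad (\<Phi> n) x" "grad \<phi> x" "grad (\<Phi> n) (q k)"] dist_triangle[of "grad (\<Phi> n) (q k)" "grad \<phi> x" "grad \<phi> (q k)"] by linarith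
    moreover have "dist (grad (\<Phi> n) x) (grad (\<Phi> n) (q k)) <= real N * norm (x - q k)"
     using lip[OF \<Phi>N] by (simp add: dist_norm)
    moreover have "dist (grad \<phi> (q k)) (grad \<phi> x) <= real N * norm (x - q k)"
     using lip[OF \<phi>N, of x "q k"] by (simp add: dist_norm norm_minus_commute)
    ultimately show ?thesis using k' n0[OF that] by linarith
   qed
   then show "\<exists>no. \<forall>n\<ge>no. dist (grad (\<Phi> n) x) (grad \<phi> x) < r" by blast
  qed
  moreover have "\<Phi> n \<in> E" for n unfolding E_def \<Phi>_def using u(1) by blast
  moreover have "norm (grad (\<Phi> n) x) <= real N" for n x using \<Phi>N[of n] by (auto simp: C_def c11_bound_def)
  ultimately show ?thesis by blast
 qed
 ultimately show ?thesis by blast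
qed

section \<open>Weak convergence in Hilbert space\<close>

text \<open>
 The representing vector minimizes \<open>\<bar>w\<bar>\<^sup>2 - 2 l(w)\<close>; minimizing sequences are
 Cauchy by the parallelogram law.
\<close>
lemma riesz_representation:
 fixes l :: "'x::{real_inner, complete_space} => real"
 assumes add: "!!x y. l (x + y) = l x + l y" and scale: "!!c x. l (c *\<^sub>R x) = c * l x"
  and bd: "!!x. abs (l x) <= C * norm x"
 shows "\<exists>v. \<forall>x. l x = v \<bullet> x"
proof -
 define J where "J w = (norm w)^2 - 2 * l w" for w
 have Jb: "- C\<^sup>2 <= J w" for w
 proof -
  have "2 * l w <= 2 * C * norm w" using bd[of w] by linarith
  moreover have "2 * C * norm w <= C^2 + (norm w)^2" by (rule sum_squares_bound)
  ultimately show ?thesis unfolding J_def by linarith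
 qed
 have bdd: "bdd_below (range J)" using Jb by (intro bdd_belowI[of _ "- C\<^sup>2"]) auto
 define m where "m = (INF w. J w)"
 have mJ: "m <= J w" for w unfolding m_def by (intro cINF_lower bdd) simp
 have "\<exists>w. J w < m + 1 / real (Suc n)" for n
  using cINF_less_iff[OF _ bdd, of "m + 1 / real (Suc n)"] by (auto simp: m_def)
 then obtain w where w: "!!n. J (w n) < m + 1 / real (Suc n)" by metis
 have par: "(norm (a - b))^2 = 2 * J a + 2 * J b - 4 * J ((1/2) *\<^sub>R (a + b))" for a b
  unfolding J_def scale add power2_norm_eq_inner
  by (simp add: inner_add inner_diff inner_commute algebra_simps)
 have Cau: "Cauchy w"
 proof (rule metric_CauchyI)
  fix e :: real assume e: "0 < e"
  obtain N where N: "1 / real (Suc N) < e^2 / 4" using nat_approx_posE[of "e^2 / 4"] e by auto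
  have "dist (w i) (w j) < e" if ij: "N <= i" "N <= j" for i j
  proof -
   have "1 / real (Suc i) <= 1 / real (Suc N)" "1 / real (Suc j) <= 1 / real (Suc N)"
    using ij by (auto intro!: divide_left_mono)
   then have "(norm (w i - w j))^2 < e^2"
    using par[of "w i" "w j"] w[of i] w[of j] mJ[of "(1/2) *\<^sub>R (w i + w j)"] N by linarith
   then show ?thesis using e by (simp add: dist_norm power_less_imp_less_base[of _ 2])
  qed
  then show "\<exists>M. \<forall>i\<ge>M. \<forall>j\<ge>M. dist (w i) (w j) < e" by blast
 qed
 then obtain v where v: "w ----> v" using Cauchy_convergent convergent_def by blast
 have lcont: "(%n. l (w n)) ----> l v"
 proof -
  have "(%n. l (w n) - l v) ----> 0"
  proof (rule Lim_null_comparison)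
   have "l (w n) - l v = l (w n - v)" for n using add[of "w n - v" v] by simp
   then show "\<forall>\<^sub>F n in sequentially. norm (l (w n) - l v) <= C * norm (w n - v)" using bd by simp
   have "(%n. C * norm (w n - v)) ----> C * norm (v - v)" by (intro tendsto_intros v)
   then show "(%n. C * norm (w n - v)) ----> 0" by simp
  qed
  then show ?thesis by (simp add: LIM_zero_iff)
 qed
 have "(%n. J (w n)) ----> J v" unfolding J_def by (intro tendsto_intros v lcont)
 moreover have "(%n. m + 1 / real (Suc n)) ----> m + 0"
  by (intro tendsto_intros LIMSEQ_Suc lim_1_over_n)
 ultimately have "J v <= m + 0" by (rule LIMSEQ_le) (use w less_imp_le in blast)
 then have Jv: "J v <= J u" for u using mJ[of u] by simp
 have "l x = v \<bullet> x" for x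
 proof -
  have "((%t. t^2 * (norm x)^2 + 2 * t * (v \<bullet> x - l x) + J v) has_real_derivative 2 * (v \<bullet> x - l x)) (at 0)"
   by (auto intro!: derivative_eq_intros)
  moreover have "t^2 * (norm x)^2 + 2 * t * (v \<bullet> x - l x) + J v = J (v + t *\<^sub>R x)" for t
   unfolding J_def add scale power2_norm_eq_inner
   by (simp add: inner_add inner_commute algebra_simps power2_eq_square)
  ultimately have "2 * (v \<bullet> x - l x) = 0" by (elim DERIV_local_min[of _ _ _ 1]) (simp_all add: Jv)
  then show ?thesis by simp
 qed
 then show ?thesis by blast
qed

lemma bounded_weak_limit:
 fixes V :: "nat => 'x::{real_inner, polish_space}"
 assumes q: "dense_seq q" and bd: "!!n. norm (V n) <= C" and lim: "!!i. convergent (%n. V n \<bullet> q i)"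
 shows "\<exists>v. weak_lim V v"
proof -
 have C0: "0 <= C" using bd[of 0] norm_ge_zero order_trans by blast
 have conv: "convergent (%n. V n \<bullet> w)" for w
 proof (subst Cauchy_convergent_iff[symmetric], rule metric_CauchyI)
  fix e :: real assume e: "0 < e"
  have "0 < e / (3 * (C + 1))" using e C0 by simp
  then obtain i where i: "dist (q i) w < e / (3 * (C + 1))" using q unfolding dense_seq_def by blast
  have t: "abs (V n \<bullet> (w - q i)) <= e / 3" for n
  proof -
   have "abs (V n \<bullet> (w - q i)) <= norm (V n) * norm (w - q i)" by (rule Cauchy_Schwarz_ineq2)
   also have "\<dots> <= (C + 1) * (e / (3 * (C + 1)))"
    using bd[of n] i C0 by (intro mult_mono) (auto simp: dist_norm norm_minus_commute)
   also have "\<dots> = e / 3"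
   proof -
    have "K * (e / (3 * K)) = e / 3" if "0 < K" for K :: real using that by simp
    from this[of "C + 1"] C0 show ?thesis by simp
   qed
   finally show ?thesis .
  qed
  have "Cauchy (%n. V n \<bullet> q i)" using lim[of i] by (simp add: Cauchy_convergent_iff)
  then obtain N where N: "!!m n. m \<ge> N ==> n \<ge> N ==> dist (V m \<bullet> q i) (V n \<bullet> q i) < e / 3"
   using e metric_CauchyD[of "%n. V n \<bullet> q i" "e / 3"] by auto
  have "dist (V m \<bullet> w) (V n \<bullet> w) < e" if "m \<ge> N" "n \<ge> N" for m n
  proof -
   have "V m \<bullet> w - V n \<bullet> w = V m \<bullet> (w - q i) - V n \<bullet> (w - q i) + (V m \<bullet> q i - V n \<bullet> q i)"
    by (simp add: inner_diff_right)
   then show ?thesis using t[of m] t[of n] N[OF that] unfolding dist_real_def by linarith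
  qed
  then show "\<exists>M. \<forall>m\<ge>M. \<forall>n\<ge>M. dist (V m \<bullet> w) (V n \<bullet> w) < e" by blast
 qed
 define l where "l w = lim (%n. V n \<bullet> w)" for w
 have l: "(%n. V n \<bullet> w) ----> l w" for w using conv[of w] unfolding l_def by (simp add: convergent_LIMSEQ_iff)
 have "\<exists>v. \<forall>x. l x = v \<bullet> x"
 proof (rule riesz_representation)
  fix x y
  have "(%n. V n \<bullet> (x + y)) ----> l x + l y" unfolding inner_add_right by (intro tendsto_add l)
  then show "l (x + y) = l x + l y" using LIMSEQ_unique[OF l] by blast
 next
  fix c x
  have "(%n. V n \<bullet> (c *\<^sub>R x)) ----> c * l x" unfolding inner_scaleR_right by (intro tendsto_mult_left l)
  then show "l (c *\<^sub>R x) = c * l x" using LIMSEQ_unique[OF l] by blast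
 next
  fix x
  have "(%n. abs (V n \<bullet> x)) ----> abs (l x)" by (intro tendsto_rabs l)
  then show "abs (l x) <= C * norm x"
  proof (rule LIMSEQ_le_const2)
   have "abs (V n \<bullet> x) <= C * norm x" for n
    by (rule order_trans[OF Cauchy_Schwarz_ineq2]) (intro mult_right_mono bd norm_ge_zero)
   then show "\<exists>N. \<forall>n\<ge>N. abs (V n \<bullet> x) <= C * norm x" by blast
  qed
 qed
 then obtain v where "!!x. l x = v \<bullet> x" by blast
 then show ?thesis using l unfolding weak_lim_def by auto
qed

text \<open>Closed balls are countable intersections of half-spaces.\<close>
lemma measurable_weakly:
 fixes f :: "'a => 'x::{real_inner, polish_space}"
 assumes q: "dense_seq q" and m [measurable]: "!!i. (%w. f w \<bullet> q i) \<in> borel_measurable M"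
 shows "f \<in> borel_measurable M"
proof (rule borel_measurableI)
 have ball: "norm x <= r \<longleftrightarrow> (\<forall>i. x \<bullet> q i <= r * norm (q i))" if "0 <= r" for x r
 proof
  assume "norm x <= r"
  then show "\<forall>i. x \<bullet> q i <= r * norm (q i)"
   by (meson mult_right_mono norm_cauchy_schwarz norm_ge_zero order_trans)
 next
  assume H: "\<forall>i. x \<bullet> q i <= r * norm (q i)"
  have "closed {y. x \<bullet> y <= r * norm y}" by (intro closed_Collect_le continuous_intros)
  then have "x \<in> {y. x \<bullet> y <= r * norm y}"
   by (rule closed_approachable[THEN iffD1]) (use H q in "unfold dense_seq_def, blast")
  then have "x \<bullet> x <= r * norm x" by simp
  then have "norm x * norm x <= r * norm x" by (simp add: power2_norm_eq_inner[symmetric] power2_eq_square)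
  then show "norm x <= r" using that by (cases "x = 0") auto
 qed
 have cb: "{w\<in>space M. f w \<in> cball (q j) r} \<in> sets M" if r: "0 <= r" for j r
 proof -
  have "f w \<in> cball (q j) r \<longleftrightarrow> (\<forall>i. f w \<bullet> q i - q j \<bullet> q i <= r * norm (q i))" for w
   using ball[OF r, of "f w - q j"] by (simp add: dist_norm norm_minus_commute inner_diff_left)
  then have "{w\<in>space M. f w \<in> cball (q j) r} = {w\<in>space M. \<forall>i. f w \<bullet> q i - q j \<bullet> q i <= r * norm (q i)}" by simp
  also have "\<dots> \<in> sets M" by measurable
  finally show ?thesis .
 qed
 fix S :: "'x set" assume S: "open S"
 have "f -` S \<inter> space M = (\<Union>(j, p)\<in>{(j, p). cball (q j) (1 / 2 ^ p) \<subseteq> S}. {w\<in>space M. f w \<in> cball (q j) (1 / 2 ^ p)})"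
 proof (intro equalityI subsetI)
  fix w assume w: "w \<in> f -` S \<inter> space M"
  then obtain e where e: "0 < e" "ball (f w) e \<subseteq> S" using S open_contains_ball by blast
  obtain p where p: "(1/2::real) ^ p < e / 2" using real_arch_pow_inv[of "e/2" "1/2"] e by auto
  obtain j where j: "dist (q j) (f w) < (1/2) ^ p" using q unfolding dense_seq_def by (metis half_gt_zero_iff zero_less_one zero_less_power)
  have "cball (q j) (1 / 2 ^ p) \<subseteq> ball (f w) e"
  proof
   fix z assume "z \<in> cball (q j) (1 / 2 ^ p)"
   then have "dist (q j) z <= (1/2) ^ p" by (simp add: power_one_over)
   then show "z \<in> ball (f w) e" using dist_triangle3[of "f w" z "q j"] j p by (simp add: dist_commute)
  qed
  then have "(j, p) \<in> {(j, p). cball (q j) (1 / 2 ^ p) \<subseteq> S}" using e by auto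
  moreover have "f w \<in> cball (q j) (1 / 2 ^ p)" using j by (simp add: power_one_over)
  ultimately show "w \<in> (\<Union>(j, p)\<in>{(j, p). cball (q j) (1 / 2 ^ p) \<subseteq> S}. {w\<in>space M. f w \<in> cball (q j) (1 / 2 ^ p)})" using w by blast
 qed auto
 also have "\<dots> \<in> sets M"
  by (intro sets.countable_UN'') (auto intro!: cb countableI_type simp del: mem_cball)
 finally show "f -` S \<inter> space M \<in> sets M" .
qed

lemma measure_eqI_continuous:
 fixes \<mu> \<nu> :: "'x::{real_inner, polish_space} measure"
 assumes \<mu>: "prob_space \<mu>" "sets \<mu> = sets borel" and \<nu>: "prob_space \<nu>" "sets \<nu> = sets borel"
  and eq: "!!f :: 'x => real. continuous_on UNIV f ==> (!!x. abs (f x) <= 1) ==> integral\<^sup>L \<mu> f = integral\<^sup>L \<nu> f"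
 shows "\<mu> = \<nu>"
proof -
 interpret \<mu>: prob_space \<mu> by fact
 interpret \<nu>: prob_space \<nu> by fact
 note [measurable_cong] = \<mu>(2) \<nu>(2)
 have closed: "emeasure \<mu> X = emeasure \<nu> X" if X: "closed X" for X
 proof (cases "X = {}")
  case False
  have [measurable]: "X \<in> sets borel" using X by simp
  define f where "f n x = max 0 (1 - real n * infdist x X)" for n :: nat and x
  have cf: "continuous_on UNIV (f n)" for n unfolding f_def by (intro continuous_intros)
  have [measurable]: "f n \<in> borel_measurable borel" for n by (rule borel_measurable_continuous_onI[OF cf])
  have fb: "abs (f n x) <= 1" for n x using infdist_nonneg[of x X] by (auto simp: f_def)
  have lim: "(%n. f n x) ----> indicator X x" for x
  proof (cases "x \<in> X")
   case True
   then show ?thesis by (simp add: f_def)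
  next
   case nx: False
   then have pos: "0 < infdist x X" using infdist_pos_not_in_closed[OF X False] by blast
   obtain N :: nat where N: "1 < real N * infdist x X" using reals_Archimedean3[OF pos] by blast
   have "f n x = 0" if "n \<ge> N" for n
   proof -
    have "real N * infdist x X <= real n * infdist x X" using that pos by (intro mult_right_mono) auto
    then show ?thesis using N by (simp add: f_def)
   qed
   then have "\<forall>\<^sub>F n in sequentially. f n x = indicator X x" using nx by (auto simp: eventually_sequentially)
   then show ?thesis by (rule tendsto_eventually)
  qed
  have l: "(%n. integral\<^sup>L M (f n)) ----> integral\<^sup>L M (indicator X)" if M: "prob_space M" and [measurable_cong]: "sets M = sets borel" for M :: "'x measure"
  proof (rule integral_dominated_convergence[where w="%_. 1"])
   interpret prob_space M by fact
   show "integrable M (%_. 1::real)" by simp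
  qed (use lim fb in auto)
  have "integral\<^sup>L \<mu> (f n) = integral\<^sup>L \<nu> (f n)" for n by (rule eq[OF cf fb])
  then have "integral\<^sup>L \<mu> (indicator X) = (integral\<^sup>L \<nu> (indicator X) :: real)"
   using LIMSEQ_unique[OF l[OF \<mu>]] l[OF \<nu>] by simp
  then show ?thesis by (simp add: \<mu>.emeasure_eq_measure \<nu>.emeasure_eq_measure)
 qed simp
 show ?thesis
 proof (rule measure_eqI_generator_eq[where E="Collect closed" and \<Omega>=UNIV and A="%_. UNIV"])
  show "Int_stable (Collect closed :: 'x set set)" by (auto simp: Int_stable_def)
  show "sets \<mu> = sigma_sets UNIV (Collect closed)" "sets \<nu> = sigma_sets UNIV (Collect closed)"
   unfolding \<mu>(2) \<nu>(2) by (subst borel_eq_closed, simp)+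
 qed (use closed in "auto simp: \<mu>.emeasure_eq_measure")
qed

section \<open>The strong-weak topology\<close>

lemma sw_test_continuous: "\<zeta> \<in> sw_test ==> continuous_on UNIV \<zeta>"
proof -
 assume z: "\<zeta> \<in> sw_test"
 show ?thesis unfolding continuous_on_sequentially
 proof (intro allI ballI impI)
  fix u and a :: "'a \<times> 'a" assume H: "(\<forall>n. u n \<in> UNIV) \<and> u ----> a"
  have "(%n. fst (u n)) ----> fst a" "(%n. snd (u n)) ----> snd a" using H by (auto intro: tendsto_fst tendsto_snd)
  moreover from this(2) have "weak_lim (%n. snd (u n)) (snd a)" unfolding weak_lim_def by (intro allI tendsto_inner tendsto_const)
  ultimately have "(%n. \<zeta> (fst (u n), snd (u n))) ----> \<zeta> (fst a, snd a)" using z unfolding sw_test_def by blast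
  then show "(\<zeta> \<circ> u) ----> \<zeta> a" by (simp add: comp_def)
 qed
qed

lemma sw_test_measurable: "\<zeta> \<in> sw_test ==> \<zeta> \<in> borel_measurable borel"
 using sw_test_continuous borel_measurable_continuous_onI by blast

lemma sw_test_growth: "\<zeta> \<in> sw_test ==> 0 < \<epsilon> ==> \<exists>A\<ge>0. \<forall>z. abs (\<zeta> z) <= A * (1 + (norm (fst z))^2) + \<epsilon> * (norm (snd z))^2"
 unfolding sw_test_def by (auto simp: split_paired_all)

lemma sw_test_integrable:
 assumes z: "\<zeta> \<in> sw_test" and \<Phi>: "\<Phi> \<in> TP2" shows "integrable \<Phi> \<zeta>"
proof -
 note T = TP2D[OF \<Phi>]
 interpret prob_space \<Phi> by (rule T)
 obtain A where A: "!!z. abs (\<zeta> z) <= A * (1 + (norm (fst z))^2) + 1 * (norm (snd z))^2"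
  using sw_test_growth[OF z zero_less_one] by blast
 have [measurable]: "\<zeta> \<in> borel_measurable \<Phi>" using sw_test_measurable[OF z] T(2) measurable_cong_sets by blast
 show ?thesis
 proof (rule Bochner_Integration.integrable_bound)
  show "integrable \<Phi> (%z. A * (1 + (norm (fst z))^2) + 1 * (norm (snd z))^2)" using T(4,5) by simp
  show "AE z in \<Phi>. norm (\<zeta> z) <= norm (A * (1 + (norm (fst z))^2) + 1 * (norm (snd z))^2)"
   using A by (intro AE_I2) (metis abs_ge_self order_trans real_norm_def)
 qed simp
qed

lemma sw_test_uminus: "\<zeta> \<in> sw_test ==> (%z. - \<zeta> z) \<in> sw_test"
 unfolding sw_test_def by (auto intro: tendsto_minus)

lemma limitin_sw_iff:
 assumes \<Psi>: "!!n. \<Psi> n \<in> TP2"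
 shows "limitin sw_topology \<Psi> \<Phi> sequentially \<longleftrightarrow>
  \<Phi> \<in> TP2 \<and> (\<forall>\<zeta>\<in>sw_test. (%n. integral\<^sup>L (\<Psi> n) \<zeta>) ----> integral\<^sup>L \<Phi> \<zeta>)"
proof safe
 assume L: "limitin sw_topology \<Psi> \<Phi> sequentially"
 then show T: "\<Phi> \<in> TP2" unfolding limitin_def by simp
 fix \<zeta> :: "'a \<times> 'a => real" assume z: "\<zeta> \<in> sw_test"
 show "(%n. integral\<^sup>L (\<Psi> n) \<zeta>) ----> integral\<^sup>L \<Phi> \<zeta>"
 proof (rule topological_tendstoI)
  fix S assume S: "open S" "integral\<^sup>L \<Phi> \<zeta> \<in> S"
  have "openin sw_topology {\<Phi> \<in> TP2. integral\<^sup>L \<Phi> \<zeta> \<in> S}"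
   unfolding sw_topology_def using z S by (intro topology_generated_by_Basis) blast
  then have "\<forall>\<^sub>F n in sequentially. \<Psi> n \<in> {\<Phi> \<in> TP2. integral\<^sup>L \<Phi> \<zeta> \<in> S}"
   using L T S unfolding limitin_def by blast
  then show "\<forall>\<^sub>F n in sequentially. integral\<^sup>L (\<Psi> n) \<zeta> \<in> S" by eventually_elim simp
 qed
next
 assume T: "\<Phi> \<in> TP2" and z: "\<forall>\<zeta>\<in>sw_test. (%n. integral\<^sup>L (\<Psi> n) \<zeta>) ----> integral\<^sup>L \<Phi> \<zeta>"
 show "limitin sw_topology \<Psi> \<Phi> sequentially"
  unfolding limitin_def
 proof (intro conjI allI impI)
  show "\<Phi> \<in> topspace sw_topology" using T by simp
  fix U assume "openin sw_topology U \<and> \<Phi> \<in> U"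
  then have "generate_topology_on {{\<Phi> \<in> TP2. integral\<^sup>L \<Phi> \<zeta> \<in> U} | \<zeta> U. \<zeta> \<in> sw_test \<and> open U} U" "\<Phi> \<in> U"
   unfolding sw_topology_def by (auto simp: openin_topology_generated_by_iff)
  then show "\<forall>\<^sub>F n in sequentially. \<Psi> n \<in> U"
  proof (induction rule: generate_topology_on.induct)
   case Empty then show ?case by simp
  next
   case (Int a b) then show ?case by (auto intro: eventually_conj)
  next
   case (UN K)
   then obtain k where "k \<in> K" "\<Phi> \<in> k" by blast
   with UN have "\<forall>\<^sub>F n in sequentially. \<Psi> n \<in> k" by blast
   then show ?case by eventually_elim (use \<open>k \<in> K\<close> in blast)
  next
   case (Basis s)
   then obtain \<zeta> V where s: "s = {\<Phi> \<in> TP2. integral\<^sup>L \<Phi> \<zeta> \<in> V}" "\<zeta> \<in> sw_test" "open V" by blast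
   then have "\<forall>\<^sub>F n in sequentially. integral\<^sup>L (\<Psi> n) \<zeta> \<in> V"
    using z Basis.prems by (intro topological_tendstoD[of _ "integral\<^sup>L \<Phi> \<zeta>"]) auto
   then show ?case by eventually_elim (use s \<Psi> in simp)
  qed
 qed
qed

text \<open>The uniform boundedness principle, by the Baire category theorem.\<close>
lemma weakly_convergent_bounded:
 fixes V :: "nat => 'x::{real_inner, complete_space}"
 assumes V: "weak_lim V v" shows "\<exists>K. \<forall>n. norm (V n) <= K"
proof -
 define E where "E k = {w. \<forall>n. abs (V n \<bullet> w) <= real k}" for k :: nat
 have cl: "closed (E k)" for k
  unfolding E_def by (intro closed_Collect_all closed_Collect_le continuous_intros)
 have un: "(\<Union>k. E k) = UNIV"
 proof -
  have "\<exists>k. w \<in> E k" for w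
  proof -
   have "Bseq (%n. V n \<bullet> w)" using V unfolding weak_lim_def by (intro convergent_imp_Bseq convergentI) blast
   then obtain K where "!!n. norm (V n \<bullet> w) <= K" unfolding Bseq_def by blast
   moreover obtain k :: nat where "K <= real k" using real_arch_simple by blast
   ultimately have "w \<in> E k" unfolding E_def by (auto intro: order_trans)
   then show ?thesis by blast
  qed
  then show ?thesis by blast
 qed
 have "\<exists>k. interior (E k) ~= {}"
 proof (rule ccontr)
  assume "\<not> (\<exists>k. interior (E k) ~= {})"
  then have "euclidean interior_of \<Union>(range E) = {}"
   using cl completely_metrizable_space_euclidean
   by (intro Baire_category_alt) (auto simp: closed_closedin[symmetric])
  then show False using un by simp
 qed
 then obtain k x where "x \<in> interior (E k)" by blast
 then obtain e where e: "0 < e" "ball x e \<subseteq> E k" using mem_interior by blast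
 have "norm (V n) <= 4 * real k / e" for n
 proof (cases "V n = 0")
  case False
  define w where "w = x + (e / 2 / norm (V n)) *\<^sub>R V n"
  have "w \<in> ball x e" using e False by (simp add: w_def dist_norm)
  then have 1: "abs (V n \<bullet> w) <= real k" using e unfolding E_def by blast
  have "x \<in> ball x e" using e by simp
  then have 2: "abs (V n \<bullet> x) <= real k" using e unfolding E_def by blast
  have "V n \<bullet> w - V n \<bullet> x = (e / 2) * norm (V n)"
   using False by (simp add: w_def inner_add_right dot_square_norm power2_eq_square)
  then have "(e / 2) * norm (V n) <= 2 * real k" using 1 2 by linarith
  then show ?thesis using e by (simp add: le_divide_eq mult.commute)
 qed (use e in simp)
 then show ?thesis by blast
qed

lemma sw_test_inner:
 fixes G :: "'x::{real_inner, polish_space} => 'x"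
 assumes G: "continuous_on UNIV G" and bd: "!!x. norm (G x) <= B"
 shows "(%(x, v). G x \<bullet> v) \<in> sw_test"
 unfolding sw_test_def
proof (intro CollectI conjI allI impI)
 fix X V :: "nat => 'x" and x v assume X: "X ----> x" and V: "weak_lim V v"
 have GX: "(%n. G (X n)) ----> G x" by (rule continuous_on_tendsto_compose[OF G X]) auto
 have "\<exists>K. \<forall>n. norm (V n) <= K" by (rule weakly_convergent_bounded[OF V])
 then obtain K where K: "!!n. norm (V n) <= K" by blast
 have "(%n. (G (X n) - G x) \<bullet> V n) ----> 0"
 proof (rule Lim_null_comparison)
  show "\<forall>\<^sub>F n in sequentially. norm ((G (X n) - G x) \<bullet> V n) <= norm (G (X n) - G x) * K"
   using K by (intro always_eventually allI) (metis Cauchy_Schwarz_ineq2 mult_left_mono norm_ge_zero order_trans real_norm_def)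
  have "(%n. norm (G (X n) - G x) * K) ----> norm (G x - G x) * K" by (intro tendsto_intros GX)
  then show "(%n. norm (G (X n) - G x) * K) ----> 0" by simp
 qed
 moreover have "(%n. V n \<bullet> G x) ----> v \<bullet> G x" using V unfolding weak_lim_def by blast
 ultimately have "(%n. (G (X n) - G x) \<bullet> V n + V n \<bullet> G x) ----> 0 + v \<bullet> G x" by (rule tendsto_add)
 moreover have "(G (X n) - G x) \<bullet> V n + V n \<bullet> G x = G (X n) \<bullet> V n" for n
  by (simp add: inner_diff_left inner_commute[of "V n"])
 ultimately have "(%n. G (X n) \<bullet> V n) ----> G x \<bullet> v" by (simp add: inner_commute[of v])
 then show "(%n. case (X n, V n) of (x, v) => G x \<bullet> v) ----> (case (x, v) of (x, v) => G x \<bullet> v)"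
  by simp
next
 fix \<epsilon> :: real assume e: "0 < \<epsilon>"
 have "abs (G x \<bullet> v) <= (B^2 / \<epsilon>) * (1 + (norm x)^2) + \<epsilon> * (norm v)^2" for x v
 proof -
  have "abs (G x \<bullet> v) <= norm (G x) * norm v" by (rule Cauchy_Schwarz_ineq2)
  also have "\<dots> <= B * norm v" by (intro mult_right_mono bd) simp
  also have "\<dots> <= B^2 / \<epsilon> + \<epsilon> * (norm v)^2"
  proof -
   have "0 <= (B - \<epsilon> * norm v)^2 + B^2 + (\<epsilon> * norm v)^2" by simp
   then have "(B * norm v) * \<epsilon> <= B^2 + (\<epsilon> * norm v)^2" by (simp add: power2_eq_square algebra_simps)
   then have "(B * norm v) <= (B^2 + (\<epsilon> * norm v)^2) / \<epsilon>" using e by (simp add: le_divide_eq)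
   also have "\<dots> = B^2 / \<epsilon> + \<epsilon> * (norm v)^2" using e by (simp add: field_simps power2_eq_square)
   finally show ?thesis .
  qed
  also have "\<dots> <= (B^2 / \<epsilon>) * (1 + (norm x)^2) + \<epsilon> * (norm v)^2"
   using e by (simp add: algebra_simps)
  finally show ?thesis .
 qed
 then show "\<exists>A\<ge>0. \<forall>x v. abs (case (x, v) of (x, v) => G x \<bullet> v) <= A * (1 + (norm x)^2) + \<epsilon> * (norm v)^2"
  using e by (intro exI[of _ "B^2 / \<epsilon>"]) auto
qed

lemma eventually_const_of_bool_limit:
 assumes "(%n. of_bool (P n) :: real) ----> y"
 shows "(y ~= 0 \<and> (\<forall>\<^sub>F n in sequentially. P n)) \<or> (y = 0 \<and> (\<forall>\<^sub>F n in sequentially. \<not> P n))"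
proof (cases "y = 0")
 case True
 from order_tendstoD(2)[OF assms, of 1] True have "\<forall>\<^sub>F n in sequentially. (of_bool (P n) :: real) < 1" by simp
 then have "\<forall>\<^sub>F n in sequentially. \<not> P n" by eventually_elim auto
 with True show ?thesis by simp
next
 case False
 from tendsto_imp_eventually_ne[OF assms False] have "\<forall>\<^sub>F n in sequentially. P n" by eventually_elim auto
 with False show ?thesis by simp
qed

section \<open>Compactness for the strong-weak topology\<close>

text \<open>
 A Skorohod representation for countably many events: the codes of the random points lie in a compact interval,
 so that a subsequence converges in law and, on another space, almost surely. Digits are continuous, hence
 almost surely every event is eventually true or eventually false.
\<close>
lemma skorohod_events:
 fixes \<Phi> :: "nat => 'z::topological_space measure" and E :: "nat => 'z => bool"
 assumes P: "!!n. prob_space (\<Phi> n)" and sP: "!!n. sets (\<Phi> n) = sets borel"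
  and E [measurable]: "!!m. Measurable.pred borel (E m)"
  and R [measurable]: "R \<in> borel_measurable borel" and RE: "!!z. R (tern_code E z) = z"
 obtains k :: "nat => nat" and \<Omega> :: "real measure" and Z :: "nat => real => 'z" and D :: "nat => real => real"
 where "strict_mono k" "prob_space \<Omega>" "!!n. Z n \<in> borel_measurable \<Omega>" "!!n. distr \<Omega> borel (Z n) = \<Phi> (k n)"
  "!!m. D m \<in> borel_measurable \<Omega>"
  "AE w in \<Omega>. \<forall>m. (%n. of_bool (E m (Z n w)) :: real) ----> D m w"
proof -
 define p where "p n = distr (\<Phi> n) borel (tern_code E)" for n
 have tm: "tern_code E \<in> borel_measurable (\<Phi> n)" for n
  unfolding measurable_cong_sets[OF sP refl] by measurable
 have rd: "real_distribution (p n)" for n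
  unfolding p_def by (rule prob_space.real_distribution_distr[OF P tm])
 have "tight p" unfolding tight_def
 proof (intro conjI allI impI)
  fix \<epsilon> :: real assume e: "0 < \<epsilon>"
  have "measure (p n) {-1<..2} = 1" for n
  proof -
   interpret prob_space "\<Phi> n" by (rule P)
   have "tern_code E -` {-1<..2} = UNIV"
   proof -
    have "-1 < tern_code E z \<and> tern_code E z <= 2" for z
     using tern_code_nonneg[of E z] tern_code_le_1[of E z] by linarith
    then show ?thesis by auto
   qed
   then show ?thesis unfolding p_def by (subst measure_distr[OF tm]) (auto simp: prob_space)
  qed
  then show "\<exists>a b. a < b \<and> (\<forall>n. 1 - \<epsilon> < measure (p n) {a<..b})"
   using e by (intro exI[of _ "-1"] exI[of _ 2]) auto
 qed (rule rd)
 then obtain k M0 where k: "strict_mono k" "real_distribution M0" "weak_conv_m (p \<circ> id \<circ> k) M0"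
  using tight_imp_convergent_subsubsequence[of p id] by (auto simp: strict_mono_def)
 have w: "weak_conv_m (%n. p (k n)) M0" using k(3) by (simp add: comp_def)
 obtain \<Omega> :: "real measure" and Ys :: "nat => real => real" and Y :: "real => real" where \<Omega>: "prob_space \<Omega>"
  and Ys': "\<forall>n. Ys n \<in> measurable \<Omega> borel" and Yd': "\<forall>n. distr \<Omega> borel (Ys n) = p (k n)"
  and Y: "Y \<in> measurable \<Omega> lborel" and lim': "\<forall>x \<in> space \<Omega>. (%n. Ys n x) ----> Y x"
  using Skorohod[OF rd k(2) w] by blast
 have Ys [measurable]: "Ys n \<in> borel_measurable \<Omega>" and Yd: "distr \<Omega> borel (Ys n) = p (k n)" for n
  using Ys' Yd' by auto
 have lim: "(%n. Ys n x) ----> Y x" if "x \<in> space \<Omega>" for x using lim' that by blast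
 have [measurable]: "Y \<in> borel_measurable \<Omega>" using Y by simp
 define Z where "Z n w = R (Ys n w)" for n w
 have Z [measurable]: "Z n \<in> borel_measurable \<Omega>" for n unfolding Z_def by measurable
 have Zd: "distr \<Omega> borel (Z n) = \<Phi> (k n)" for n
 proof -
  have "distr \<Omega> borel (Z n) = distr (distr \<Omega> borel (Ys n)) borel R"
   unfolding Z_def by (subst distr_distr) (auto simp: comp_def)
  also have "\<dots> = distr (\<Phi> (k n)) borel (%z. z)"
   unfolding Yd p_def by (subst distr_distr[OF R tm]) (simp add: comp_def RE)
  also have "\<dots> = \<Phi> (k n)" by (rule distr_id2) (simp add: sP)
  finally show ?thesis .
 qed
 have "(%y. tern_code E (R y)) \<in> borel_measurable borel"
  by (rule measurable_compose[OF R measurable_tern_code[OF E]])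
 from borel_measurable_eq[OF measurable_ident_sets[OF refl] this]
 have "{y \<in> space borel. y = tern_code E (R y)} \<in> sets borel" .
 then have mset: "{y. y = tern_code E (R y)} \<in> sets borel" by simp
 have ae: "AE w in \<Omega>. Ys n w = tern_code E (Z n w)" for n
 proof -
  have "AE y in distr (\<Phi> (k n)) borel (tern_code E). y = tern_code E (R y)"
   by (subst AE_distr_iff[OF tm]) (auto simp: RE mset)
  then have "AE y in distr \<Omega> borel (Ys n). y = tern_code E (R y)" unfolding Yd p_def .
  then show ?thesis by (subst (asm) AE_distr_iff) (auto simp: Z_def mset)
 qed
 have "AE w in \<Omega>. \<forall>n. Ys n w = tern_code E (Z n w)" using ae by (simp add: AE_all_countable)
 then have "AE w in \<Omega>. \<forall>m. (%n. of_bool (E m (Z n w)) :: real) ----> tern_digit m (Y w)"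
 proof (rule AE_mp, intro AE_I2 impI allI)
  fix w m assume w: "w \<in> space \<Omega>" "\<forall>n. Ys n w = tern_code E (Z n w)"
  have "(%n. tern_digit m (Ys n w)) ----> tern_digit m (Y w)"
   by (rule continuous_on_tendsto_compose[OF continuous_tern_digit lim[OF w(1)]]) auto
  then show "(%n. of_bool (E m (Z n w)) :: real) ----> tern_digit m (Y w)"
   using w(2) by (simp add: tern_digit_code)
 qed
 moreover have "(%w. tern_digit m (Y w)) \<in> borel_measurable \<Omega>" for m by measurable
 ultimately show ?thesis using that[of k \<Omega> Z "%m w. tern_digit m (Y w)"] k(1) \<Omega> Z Zd by blast
qed

text \<open>
 If the first \<open>N\<close> events cover all but little mass for all large \<open>n\<close>, then almost
 surely one of the limit events holds.
\<close>
lemma AE_some_ball_event: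
 fixes D :: "nat => 'a => real"
 assumes \<Omega>: "prob_space \<Omega>" and A [measurable]: "!!i n. Measurable.pred \<Omega> (A i n)"
  and D [measurable]: "!!i. D i \<in> borel_measurable \<Omega>"
  and lim: "AE w in \<Omega>. \<forall>i. (%n. of_bool (A i n w) :: real) ----> D i w"
  and tight: "!!\<delta>. 0 < \<delta> ==> \<exists>N::nat. \<forall>\<^sub>F n in sequentially. measure \<Omega> {w\<in>space \<Omega>. \<forall>i<N. \<not> A i n w} <= \<delta>"
 shows "AE w in \<Omega>. \<exists>i. D i w ~= 0"
proof -
 interpret prob_space \<Omega> by fact
 let ?B = "{w\<in>space \<Omega>. \<forall>i. D i w = 0}"
 have "prob ?B <= \<delta>" if \<delta>: "0 < \<delta>" for \<delta>
 proof -
  obtain N :: nat where N: "\<forall>\<^sub>F n in sequentially. prob {w\<in>space \<Omega>. \<forall>i<N. \<not> A i n w} <= \<delta>" using tight[OF \<delta>] by blast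
  define f where "f n w = (\<Prod>i<N. 1 - of_bool (A i n w) :: real)" for n w
  have [measurable]: "f n \<in> borel_measurable \<Omega>" for n unfolding f_def[abs_def] by measurable
  have fi: "f n w = indicator {w\<in>space \<Omega>. \<forall>i<N. \<not> A i n w} w" if "w \<in> space \<Omega>" for n w
   using that by (auto simp: f_def split: split_indicator)
  have fl: "(%n. expectation (f n)) ----> expectation (%w. \<Prod>i<N. 1 - D i w)"
  proof (rule integral_dominated_convergence[where w="%_. 1"])
   show "AE w in \<Omega>. (%n. f n w) ----> (\<Prod>i<N. 1 - D i w)"
    using lim by eventually_elim (auto simp: f_def intro!: tendsto_prod tendsto_diff)
   show "AE w in \<Omega>. norm (f n w) <= 1" for n using fi by (intro AE_I2) (simp split: split_indicator)
  qed auto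
  have "expectation (f n) = prob {w\<in>space \<Omega>. \<forall>i<N. \<not> A i n w}" for n
  proof -
   have "expectation (f n) = expectation (indicator {w\<in>space \<Omega>. \<forall>i<N. \<not> A i n w})"
    by (intro Bochner_Integration.integral_cong fi) auto
   then show ?thesis by simp
  qed
  then have "expectation (%w. \<Prod>i<N. 1 - D i w) <= \<delta>" using fl N by (intro tendsto_upperbound[OF fl]) auto
  moreover have "prob ?B <= expectation (%w. \<Prod>i<N. 1 - D i w)"
  proof -
   have Db: "AE w in \<Omega>. \<forall>i. 0 <= D i w \<and> D i w <= 1"
    using lim
   proof eventually_elim
    fix w assume l: "\<forall>i. (%n. of_bool (A i n w) :: real) ----> D i w"
    show "\<forall>i. 0 <= D i w \<and> D i w <= 1"
    proof (intro allI conjI)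
     fix i
     show "0 <= D i w" by (rule tendsto_lowerbound[OF spec[OF l, of i]]) auto
     show "D i w <= 1" by (rule tendsto_upperbound[OF spec[OF l, of i]]) auto
    qed
   qed
   have "prob ?B = expectation (indicator ?B)" by simp
   also have "\<dots> <= expectation (%w. \<Prod>i<N. 1 - D i w)"
   proof (rule integral_mono_AE)
    have "AE w in \<Omega>. norm (\<Prod>i<N. 1 - D i w) <= 1" using Db
     by eventually_elim (auto simp: abs_prod intro!: prod_le_1)
    then show "integrable \<Omega> (%w. \<Prod>i<N. 1 - D i w)" by (rule integrable_const_bound) measurable
    show "AE w in \<Omega>. indicator ?B w <= (\<Prod>i<N. 1 - D i w)" using Db
     by eventually_elim (auto split: split_indicator intro!: prod_nonneg)
    show "integrable \<Omega> (indicator ?B :: 'a => real)"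
     by (rule integrable_const_bound[where B=1]) (auto split: split_indicator)
   qed
   finally show ?thesis .
  qed
  ultimately show ?thesis by simp
 qed
 then have "prob ?B <= 0" by (rule field_le_epsilon[of _ 0, simplified]) 
 then have "prob ?B = 0" using measure_nonneg by (simp add: antisym)
 then have "AE w in \<Omega>. w \<notin> ?B" by (intro AE_not_in) (auto simp: null_sets_def emeasure_eq_measure)
 then show ?thesis by (rule AE_mp) auto
qed

lemma measure_uncovered_tendsto_0:
 fixes q :: "nat => 'x::{real_inner, polish_space}"
 assumes q: "dense_seq q" and \<mu>: "prob_space \<mu>" "sets \<mu> = sets borel" and \<rho>: "0 < \<rho>" and \<delta>: "0 < \<delta>"
 shows "\<exists>N. measure \<mu> {x. \<forall>i<N. \<rho> <= dist (q i) x} <= \<delta>"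
proof -
 interpret prob_space \<mu> by fact
 have sp: "space \<mu> = UNIV" using sets_eq_imp_space_eq[OF \<mu>(2)] by simp
 note [measurable_cong] = \<mu>(2)
 let ?A = "%N::nat. {x. \<forall>i<N. \<rho> <= dist (q i) x}"
 have "(%N. prob (?A N)) ----> prob (\<Inter>N. ?A N)"
 proof (rule finite_Lim_measure_decseq)
  have "{x\<in>space \<mu>. \<forall>i<N. \<rho> <= dist (q i) x} \<in> events" for N by measurable
  then show "range ?A \<subseteq> events" by (auto simp: sp)
  show "decseq ?A" by (auto simp: decseq_def)
 qed
 moreover have "(\<Inter>N. ?A N) = {}"
 proof -
  have "\<exists>N. x \<notin> ?A N" for x
  proof -
   obtain i where "dist (q i) x < \<rho>" using q \<rho> unfolding dense_seq_def by blast
   then show ?thesis by (intro exI[of _ "Suc i"]) (auto simp: not_le)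
  qed
  then show ?thesis by blast
 qed
 ultimately have "(%N. prob (?A N)) ----> 0" by simp
 from order_tendstoD(2)[OF this \<delta>] obtain N where "prob (?A N) < \<delta>" by (auto simp: eventually_sequentially)
 then show ?thesis by (intro exI[of _ N]) simp
qed

lemma distr_pushforward_integral:
 fixes f :: "'x::{real_inner, polish_space} => real"
 assumes \<Phi>: "sets \<Phi> = sets borel" and b: "base \<Phi> = distr \<mu> borel T" and \<mu>: "sets \<mu> = sets borel"
  and T: "T \<in> borel_measurable borel" and f: "f \<in> borel_measurable borel"
 shows "(LINT z|\<Phi>. f (fst z)) = (LINT x|\<mu>. f (T x))"
proof -
 note [measurable_cong] = \<Phi> \<mu> and [measurable] = T f
 have "(LINT z|\<Phi>. f (fst z)) = (LINT x|base \<Phi>. f x)"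
  unfolding base_def by (subst integral_distr) auto
 also have "\<dots> = (LINT x|\<mu>. f (T x))" unfolding b by (subst integral_distr) auto
 finally show ?thesis .
qed

lemma base_limit:
 fixes \<Phi> :: "nat => ('x::{real_inner, polish_space} \<times> 'x) measure"
 assumes TP: "!!n. \<Phi> n \<in> TP2" and \<mu>: "\<mu> \<in> P2" and T [measurable]: "!!n. T n \<in> borel_measurable borel"
  and b: "!!n. base (\<Phi> n) = distr \<mu> borel (T n)" and lim: "!!x. (%n. T n x) ----> x"
  and L: "limitin sw_topology \<Phi> \<Psi> sequentially"
 shows "base \<Psi> = \<mu>"
proof (rule measure_eqI_continuous)
 have \<Psi>: "\<Psi> \<in> TP2" and LI: "!!\<zeta>. \<zeta> \<in> sw_test ==> (%n. integral\<^sup>L (\<Phi> n) \<zeta>) ----> integral\<^sup>L \<Psi> \<zeta>"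
  using L unfolding limitin_sw_iff[OF TP] by auto
 show "prob_space (base \<Psi>)" "sets (base \<Psi>) = sets borel" using base_P2[OF \<Psi>] P2D by auto
 show "prob_space \<mu>" and s\<mu> [measurable_cong]: "sets \<mu> = sets borel" using P2D[OF \<mu>] by auto
 interpret \<mu>: prob_space \<mu> by fact
 fix f :: "'x => real" assume f: "continuous_on UNIV f" and fb: "!!x. abs (f x) <= 1"
 have [measurable]: "f \<in> borel_measurable borel" by (rule borel_measurable_continuous_onI[OF f])
 have [measurable_cong]: "sets \<Psi> = sets borel" using TP2D[OF \<Psi>] by auto
 have "(%z. f (fst z)) \<in> sw_test" unfolding sw_test_def
 proof (intro CollectI conjI allI impI)
  fix X V :: "nat => 'x" and x v assume "X ----> x"
  from continuous_on_tendsto_compose[OF f this] show "(%n. f (fst (X n, V n))) ----> f (fst (x, v))" by simp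
 next
  fix \<epsilon> :: real assume e: "0 < \<epsilon>"
  show "\<exists>A\<ge>0. \<forall>x v. abs (f (fst (x, v))) <= A * (1 + (norm x)^2) + \<epsilon> * (norm (v::'x))^2"
  proof (intro exI[of _ 1] conjI allI)
   fix x v :: 'x
   have "0 <= (norm x)^2" "0 <= \<epsilon> * (norm v)^2" using e by auto
   then show "abs (f (fst (x, v))) <= 1 * (1 + (norm x)^2) + \<epsilon> * (norm v)^2" using fb[of x] unfolding fst_conv mult_1 by linarith
  qed simp
 qed
 from LI[OF this] have "(%n. \<integral>z. f (fst z) \<partial>\<Phi> n) ----> (LINT z|\<Psi>. f (fst z))" .
 moreover have "(LINT z|\<Phi> n. f (fst z)) = (LINT x|\<mu>. f (T n x))" for n
  by (rule distr_pushforward_integral[OF TP2D(2)[OF TP] b s\<mu>]) auto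
 moreover have "(%n. \<integral>x. f (T n x) \<partial>\<mu>) ----> (LINT x|\<mu>. f x)"
 proof (rule integral_dominated_convergence[where w="%_. 1"])
  show "AE x in \<mu>. (%n. f (T n x)) ----> f x"
   by (intro AE_I2 continuous_on_tendsto_compose[OF f lim]) auto
 qed (use fb in auto)
 ultimately have "(LINT z|\<Psi>. f (fst z)) = (LINT x|\<mu>. f x)" using LIMSEQ_unique by simp blast
 moreover have "(LINT z|\<Psi>. f (fst z)) = integral\<^sup>L (base \<Psi>) f"
  unfolding base_def by (subst integral_distr) auto
 ultimately show "integral\<^sup>L (base \<Psi>) f = integral\<^sup>L \<mu> f" by simp
qed

text \<open>
 The limit is taken almost surely on one probability space: positions converge in norm because the bases
 converge to \<open>\<mu>\<close>, and velocities converge weakly along almost every path. Fatou for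
 \<open>\<zeta> + A (1 + \<bar>x\<bar>\<^sup>2) + \<epsilon> \<bar>v\<bar>\<^sup>2 \<ge> 0\<close> and for
 \<open>- \<zeta>\<close> then gives convergence of the integral of every test function \<open>\<zeta>\<close>.
\<close>
theorem sw_compactness:
 fixes \<Phi> :: "nat => ('x::{real_inner, polish_space} \<times> 'x) measure"
 assumes TP: "!!n. \<Phi> n \<in> TP2" and \<mu>: "\<mu> \<in> P2" and T [measurable]: "!!n. T n \<in> borel_measurable borel"
  and b: "!!n. base (\<Phi> n) = distr \<mu> borel (T n)"
  and T\<delta>: "!!n x. norm (T n x - x) <= \<delta> n" and \<delta>: "\<delta> ----> 0"
  and vel: "!!n. vel_norm (\<Phi> n) <= M"
 shows "\<exists>k \<Psi>. strict_mono (k :: nat => nat) \<and> limitin sw_topology (%n. \<Phi> (k n)) \<Psi> sequentially \<and> base \<Psi> = \<mu> \<and> vel_norm \<Psi> <= M"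
proof -
 note TD = TP2D[OF TP]
 note sm = P2D(2)[OF \<mu>]
 interpret \<mu>: prob_space \<mu> by (rule P2D[OF \<mu>])
 note [measurable_cong] = sm TD(2)
 have Tlim: "(%n. T n x) ----> x" for x
 proof -
  have "(%n. T n x - x) ----> 0" by (rule Lim_null_comparison[OF _ \<delta>]) (simp add: T\<delta>)
  then show ?thesis by (simp add: LIM_zero_iff)
 qed
 obtain q :: "nat => 'x" where q: "dense_seq q" using dense_seq_exists by blast
 define rat where "rat = from_nat_into (\<rat> :: real set)"
 have rat: "range rat = \<rat>" unfolding rat_def by (rule range_from_nat_into) (auto simp: countable_rat)
 define code where "code t i p = prod_encode (t, prod_encode (i, p))" for t i p :: nat
 define E where "E m z = (case prod_decode m of (t, j) => case prod_decode j of (i, p) =>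
  if t = 0 then dist (q i) (fst z) < 1 / 2 ^ p else if t = 1 then dist (q i) (snd z) < 1 / 2 ^ p
  else if t = 2 then snd z \<bullet> q i < rat p else norm (snd z) < rat p)" for m and z :: "'x \<times> 'x"
 have E0: "E (code 0 i p) z \<longleftrightarrow> dist (q i) (fst z) < 1 / 2 ^ p"
  and E1: "E (code 1 i p) z \<longleftrightarrow> dist (q i) (snd z) < 1 / 2 ^ p"
  and E2: "E (code 2 i p) z \<longleftrightarrow> snd z \<bullet> q i < rat p"
  and E3: "E (code 3 i p) z \<longleftrightarrow> norm (snd z) < rat p" for i p z
  by (simp_all add: E_def code_def)
 have E [measurable]: "Measurable.pred borel (E m)" for m
  unfolding E_def[abs_def] split_beta' by measurable
 define R where "R y = (ball_point q (%i p. 1/2 < tern_digit (code 0 i p) y), ball_point q (%i p. 1/2 < tern_digit (code 1 i p) y))" for y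
 have RE: "R (tern_code E z) = z" for z
 proof -
  have "ball_point q (%i p. 1/2 < tern_digit (code 0 i p) (tern_code E z)) = fst z"
   by (rule ball_point_eq[OF q]) (simp add: tern_digit_code E0)
  moreover have "ball_point q (%i p. 1/2 < tern_digit (code 1 i p) (tern_code E z)) = snd z"
   by (rule ball_point_eq[OF q]) (simp add: tern_digit_code E1[unfolded One_nat_def])
  ultimately show ?thesis by (simp add: R_def)
 qed
 have R: "R \<in> borel_measurable borel" unfolding R_def
  by (intro borel_measurable_Pair measurable_ball_point) measurable
 obtain k :: "nat => nat" and \<Omega> :: "real measure" and Z :: "nat => real => 'x \<times> 'x" and D :: "nat => real => real"
  where k: "strict_mono k" and \<Omega>: "prob_space \<Omega>" and Z [measurable]: "!!n. Z n \<in> borel_measurable \<Omega>"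
   and Zd: "!!n. distr \<Omega> borel (Z n) = \<Phi> (k n)" and D [measurable]: "!!m. D m \<in> borel_measurable \<Omega>"
   and ED: "AE w in \<Omega>. \<forall>m. (%n. of_bool (E m (Z n w)) :: real) ----> D m w"
  by (rule skorohod_events[OF TD(1,2) E R RE]) (rule that)
 interpret \<Omega>: prob_space \<Omega> by fact
 define X where "X n w = fst (Z n w)" for n w
 define V where "V n w = snd (Z n w)" for n w
 have [measurable]: "X n \<in> borel_measurable \<Omega>" "V n \<in> borel_measurable \<Omega>" for n
  unfolding X_def V_def by measurable
 have law: "(LINT z|\<Phi> (k n). f z) = \<Omega>.expectation (%w. f (X n w, V n w))"
  and lawi: "integrable (\<Phi> (k n)) f \<longleftrightarrow> integrable \<Omega> (%w. f (X n w, V n w))"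
  if [measurable]: "f \<in> borel_measurable borel" for n and f :: "'x \<times> 'x => real"
  unfolding Zd[symmetric] X_def V_def by (subst integral_distr; simp) (subst integrable_distr_eq; simp)
 \<comment> \<open>Balls of radius \<open>2\<^sup>-\<^sup>p\<close> around finitely many \<open>q i\<close> carry most of the mass of all but finitely many bases.\<close>
  have Xball: "AE w in \<Omega>. \<exists>i. D (code 0 i p) w ~= 0" for p
 proof (rule AE_some_ball_event[OF \<Omega>, where A="%i n w. E (code 0 i p) (Z n w)"])
  show "AE w in \<Omega>. \<forall>i. (%n. of_bool (E (code 0 i p) (Z n w)) :: real) ----> D (code 0 i p) w"
   using ED by eventually_elim blast
  fix \<eta> :: real assume \<eta>: "0 < \<eta>"
  have p2: "0 < (1 / 2 ^ p / 2 :: real)" by simp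
  obtain N where N: "\<mu>.prob {x. \<forall>i<N. 1 / 2 ^ p / 2 <= dist (q i) x} <= \<eta>"
   using measure_uncovered_tendsto_0[OF q P2D(1,2)[OF \<mu>] p2 \<eta>] by blast
  have "(%n. \<delta> (k n)) ----> 0" using LIMSEQ_subseq_LIMSEQ[OF \<delta> k] by (simp add: comp_def)
  then have ev: "\<forall>\<^sub>F n in sequentially. \<delta> (k n) < 1 / 2 ^ p / 2" using p2 by (rule order_tendstoD)
  have "\<forall>\<^sub>F n in sequentially. measure \<Omega> {w\<in>space \<Omega>. \<forall>i<N. \<not> E (code 0 i p) (Z n w)} <= \<eta>"
   using ev
  proof eventually_elim
   fix n assume n: "\<delta> (k n) < 1 / 2 ^ p / 2"
   define C where "C = {x::'x. \<forall>i<N. \<not> dist (q i) x < 1 / 2 ^ p}"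
   have "{x \<in> space borel. \<forall>i<N. \<not> dist (q i) x < 1 / 2 ^ p} \<in> sets borel" by measurable
   then have [measurable]: "C \<in> sets borel" by (simp add: C_def)
   have "measure \<Omega> {w\<in>space \<Omega>. \<forall>i<N. \<not> E (code 0 i p) (Z n w)} = measure \<Omega> (X n -` C \<inter> space \<Omega>)"
    by (intro arg_cong[where f="measure \<Omega>"]) (auto simp: C_def E0 X_def)
   also have "\<dots> = measure (distr \<Omega> borel (%w. fst (Z n w))) C"
    by (subst measure_distr) (auto simp: X_def[abs_def])
   also have "distr \<Omega> borel (%w. fst (Z n w)) = base (\<Phi> (k n))"
    unfolding base_def Zd[symmetric] by (subst distr_distr) (auto simp: comp_def)
   also have "measure (base (\<Phi> (k n))) C = \<mu>.prob (T (k n) -` C \<inter> space \<mu>)"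
    unfolding b by (subst measure_distr) auto
   also have "\<dots> <= \<mu>.prob {x. \<forall>i<N. 1 / 2 ^ p / 2 <= dist (q i) x}"
   proof (rule \<mu>.finite_measure_mono)
    have "{x \<in> space borel. \<forall>i<N. 1 / 2 ^ p / 2 <= dist (q i) x} \<in> sets borel" by measurable
    then show "{x. \<forall>i<N. 1 / 2 ^ p / 2 <= dist (q i) x} \<in> \<mu>.events" by (simp add: sm)
    show "T (k n) -` C \<inter> space \<mu> \<subseteq> {x. \<forall>i<N. 1 / 2 ^ p / 2 <= dist (q i) x}"
    proof (intro subsetI CollectI allI impI)
     fix x i assume x: "x \<in> T (k n) -` C \<inter> space \<mu>" and i: "i < N"
     have "1 / 2 ^ p <= dist (q i) (T (k n) x)" using x i by (auto simp: C_def not_less)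
     also have "\<dots> <= dist (q i) x + dist x (T (k n) x)" by (rule dist_triangle)
     also have "dist x (T (k n) x) <= \<delta> (k n)" using T\<delta>[of "k n" x] by (simp add: dist_norm norm_minus_commute)
     finally show "1 / 2 ^ p / 2 <= dist (q i) x" using n by simp
    qed
   qed
   also have "\<dots> <= \<eta>" by (rule N)
   finally show "measure \<Omega> {w\<in>space \<Omega>. \<forall>i<N. \<not> E (code 0 i p) (Z n w)} <= \<eta>" .
  qed
  then show "\<exists>N. \<forall>\<^sub>F n in sequentially. measure \<Omega> {w\<in>space \<Omega>. \<forall>i<N. \<not> E (code 0 i p) (Z n w)} <= \<eta>" by blast
 qed measurable
 have Xconv: "AE w in \<Omega>. convergent (%n. X n w)"
 proof -
  have "AE w in \<Omega>. \<forall>p. \<exists>i. D (code 0 i p) w ~= 0" using Xball by (simp add: AE_all_countable)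
  with ED show ?thesis
  proof eventually_elim
   fix w assume l: "\<forall>m. (%n. of_bool (E m (Z n w)) :: real) ----> D m w" and e: "\<forall>p. \<exists>i. D (code 0 i p) w ~= 0"
   have "Cauchy (%n. X n w)"
   proof (rule metric_CauchyI)
    fix \<epsilon> :: real assume \<epsilon>: "0 < \<epsilon>"
    obtain p where p: "(1/2::real) ^ p < \<epsilon> / 2" using real_arch_pow_inv[of "\<epsilon>/2" "1/2"] \<epsilon> by auto
    obtain i where i: "D (code 0 i p) w ~= 0" using e by blast
    have "\<forall>\<^sub>F n in sequentially. E (code 0 i p) (Z n w)"
     using eventually_const_of_bool_limit[OF spec[OF l, of "code 0 i p"]] i by blast
    then obtain N where N: "!!n. n \<ge> N ==> dist (q i) (X n w) < (1/2) ^ p"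
     unfolding eventually_sequentially E0 X_def by (auto simp: power_one_over)
    have "dist (X m w) (X n w) < \<epsilon>" if "m \<ge> N" "n \<ge> N" for m n
     using dist_triangle3[of "X m w" "X n w" "q i"] N[OF that(1)] N[OF that(2)] p by (simp add: dist_commute)
    then show "\<exists>M. \<forall>m\<ge>M. \<forall>n\<ge>M. dist (X m w) (X n w) < \<epsilon>" by blast
   qed
   then show "convergent (%n. X n w)" by (simp add: Cauchy_convergent_iff)
  qed
 qed
 \<comment> \<open>By Fatou some subsequence of \<open>V\<close> is bounded along almost every path; the events \<open>norm (snd z) < rat p\<close> then bound the whole path.\<close>
  have M0: "0 <= M" using vel[of 0] vel_norm_nonneg[of "\<Phi> 0"] by simp
 have Vi: "integrable \<Omega> (%w. (norm (V n w))^2)" for n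
  using lawi[of "%z. (norm (snd z))^2" n] TD(5) by simp
 have VM: "\<Omega>.expectation (%w. (norm (V n w))^2) <= M^2" for n
 proof -
  have "(vel_norm (\<Phi> (k n)))^2 <= M^2" by (intro power_mono vel vel_norm_nonneg)
  then show ?thesis using law[of "%z. (norm (snd z))^2" n] by (simp add: vel_norm_sq)
 qed
 have Vfreq: "AE w in \<Omega>. \<exists>C. \<exists>\<^sub>F n in sequentially. norm (V n w) <= C"
 proof -
  have "(nn_integral \<Omega> (%w. liminf (%n. ennreal ((norm (V n w))^2)))) <= liminf (%n. \<integral>\<^sup>+w. ennreal ((norm (V n w))^2) \<partial>\<Omega>)"
   by (rule nn_integral_liminf) measurable
  also have "\<dots> <= liminf (%n. ennreal (M^2))"
   by (intro Liminf_mono always_eventually allI) (subst nn_integral_eq_integral[OF Vi]; simp add: VM ennreal_leI)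
  also have "\<dots> < \<infinity>" by (simp add: Liminf_const)
  finally have "AE w in \<Omega>. liminf (%n. ennreal ((norm (V n w))^2)) ~= \<infinity>"
   by (intro nn_integral_PInf_AE) auto
  then show ?thesis
  proof eventually_elim
   fix w assume fin: "liminf (%n. ennreal ((norm (V n w))^2)) ~= \<infinity>"
   then obtain l where l: "liminf (%n. ennreal ((norm (V n w))^2)) = ennreal l" "0 <= l"
    by (cases "liminf (%n. ennreal ((norm (V n w))^2))") auto
   define c where "c = l + 1"
   have c: "liminf (%n. ennreal ((norm (V n w))^2)) < ennreal c" "0 <= c"
    unfolding l(1) using l(2) by (auto simp: c_def ennreal_less_iff)
   have "\<exists>\<^sub>F n in sequentially. norm (V n w) <= sqrt c"
   proof (rule ccontr)
    assume "\<not> ?thesis"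
    then have "\<forall>\<^sub>F n in sequentially. sqrt c < norm (V n w)" by (simp add: frequently_def not_le)
    then have "\<forall>\<^sub>F n in sequentially. ennreal c <= ennreal ((norm (V n w))^2)"
    proof eventually_elim
     fix n assume "sqrt c < norm (V n w)"
     then have "(sqrt c)^2 <= (norm (V n w))^2" using c by (intro power_mono) auto
     then show "ennreal c <= ennreal ((norm (V n w))^2)" using c by (intro ennreal_leI) simp
    qed
    then have "ennreal c <= liminf (%n. ennreal ((norm (V n w))^2))" by (rule Liminf_bounded)
    with c show False by simp
   qed
   then show "\<exists>C. \<exists>\<^sub>F n in sequentially. norm (V n w) <= C" by blast
  qed
 qed
 have Vconv: "AE w in \<Omega>. \<exists>v. weak_lim (%n. V n w) v"
  using ED Vfreq
 proof eventually_elim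
  fix w assume l: "\<forall>m. (%n. of_bool (E m (Z n w)) :: real) ----> D m w" and "\<exists>C. \<exists>\<^sub>F n in sequentially. norm (V n w) <= C"
  then obtain C where C: "\<exists>\<^sub>F n in sequentially. norm (V n w) <= C" by blast
  have ev: "(\<forall>\<^sub>F n in sequentially. E m (Z n w)) \<or> (\<forall>\<^sub>F n in sequentially. \<not> E m (Z n w))" for m
   using eventually_const_of_bool_limit[OF spec[OF l, of m]] by blast
  have rp: "\<exists>p. r = rat p" if "r \<in> \<rat>" for r using that rat by (metis imageE)
  obtain r where r: "r \<in> \<rat>" "C < r" using Rats_dense_in_real[of C "C + 1"] by auto
  obtain p where p: "r = rat p" using rp[OF r(1)] by blast
  have "\<not> (\<forall>\<^sub>F n in sequentially. \<not> norm (V n w) < r)"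
  proof
   assume "\<forall>\<^sub>F n in sequentially. \<not> norm (V n w) < r"
   then have "\<forall>\<^sub>F n in sequentially. \<not> norm (V n w) <= C" by eventually_elim (use r in auto)
   with C show False by (simp add: frequently_def)
  qed
  then have Vr: "\<forall>\<^sub>F n in sequentially. norm (V n w) < r" using ev[of "code 3 0 p"] unfolding E3 p V_def by blast
  then obtain N where "!!n. N <= n ==> norm (V n w) < r" unfolding eventually_sequentially by blast
  then have N: "norm (V (n + N) w) <= r" for n by (simp add: less_imp_le)
  have "\<exists>l. (%n. V n w \<bullet> q i) ----> l" for i
  proof (rule limit_from_thresholds)
   fix s' s :: real assume "s \<in> \<rat>" and lt: "s' < s"
   then obtain p where s: "s = rat p" using rp by blast
   show "(\<forall>\<^sub>F n in sequentially. V n w \<bullet> q i <= s) \<or> (\<forall>\<^sub>F n in sequentially. s' <= V n w \<bullet> q i)"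
    using ev[of "code 2 i p"] unfolding E2 V_def s[symmetric]
    by (elim disj_forward eventually_mono) (use lt in linarith)+
  next
   show "\<forall>\<^sub>F n in sequentially. abs (V n w \<bullet> q i) <= r * norm (q i)"
    using Vr by eventually_elim (meson Cauchy_Schwarz_ineq2 less_imp_le mult_right_mono norm_ge_zero order_trans)
  qed simp
  then have "convergent (%n. V n w \<bullet> q i)" for i by (auto simp: convergent_def)
  then have "\<exists>v. weak_lim (%n. V (n + N) w) v"
   by (intro bounded_weak_limit[OF q N]) (simp add: convergent_ignore_initial_segment[of "%n. V n w \<bullet> _" N])
  then show "\<exists>v. weak_lim (%n. V n w) v" unfolding weak_lim_def by (blast intro: LIMSEQ_offset)
 qed
 from Xconv Vconv have "AE w in \<Omega>. convergent (%n. X n w) \<and> (\<exists>v. weak_lim (%n. V n w) v)" by eventually_elim blast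
 then obtain N0 where N0: "N0 \<in> null_sets \<Omega>"
  "!!w. w \<in> space \<Omega> - N0 ==> convergent (%n. X n w) \<and> (\<exists>v. weak_lim (%n. V n w) v)"
  by (auto elim!: AE_E3)
 define G where "G = space \<Omega> - N0"
 have [measurable]: "G \<in> sets \<Omega>" using N0 by (auto simp: G_def)
 have aeG: "AE w in \<Omega>. w \<in> G" using AE_not_in[OF N0(1)] by (rule AE_mp) (auto simp: G_def)
 define XL where "XL w = (if w \<in> G then lim (%n. X n w) else 0)" for w
 define VL where "VL w = (if w \<in> G then (SOME v. weak_lim (%n. V n w) v) else 0)" for w
 have XL: "(%n. X n w) ----> XL w" if "w \<in> G" for w
  using N0(2)[of w] that by (simp add: XL_def G_def convergent_LIMSEQ_iff)
 have VL: "weak_lim (%n. V n w) (VL w)" if "w \<in> G" for w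
  using someI_ex[of "weak_lim (%n. V n w)"] N0(2)[of w] that by (simp add: VL_def G_def)
 have XLm [measurable]: "XL \<in> borel_measurable \<Omega>"
 proof (rule borel_measurable_LIMSEQ_metric)
  show "(%w. if w \<in> G then X n w else 0) \<in> borel_measurable \<Omega>" for n by measurable
  show "(%n. if w \<in> G then X n w else 0) ----> XL w" for w using XL[of w] by (auto simp: XL_def)
 qed
 have VLm [measurable]: "VL \<in> borel_measurable \<Omega>"
 proof (rule measurable_weakly[OF q], rule borel_measurable_LIMSEQ_metric)
  show "(%w. if w \<in> G then V n w \<bullet> q i else 0) \<in> borel_measurable \<Omega>" for n i by measurable
  show "(%n. if w \<in> G then V n w \<bullet> q i else 0) ----> VL w \<bullet> q i" for w i using VL[of w] by (cases "w \<in> G") (auto simp: weak_lim_def, simp add: VL_def)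
 qed
 have fatou: "(nn_integral \<Omega> (%w. ennreal (f w))) <= liminf (%n. \<integral>\<^sup>+w. ennreal (h n w) \<partial>\<Omega>)"
  if h: "!!n. h n \<in> borel_measurable \<Omega>"
   and g: "!!n w. g n w <= h n w" "!!w. w \<in> G ==> (%n. g n w) ----> f w" for f :: "real => real" and g h :: "nat => real => real"
 proof -
  note [measurable] = h
  have "ennreal (f w) <= liminf (%n. ennreal (h n w))" if w: "w \<in> G" for w
  proof -
   have "ennreal (f w) = liminf (%n. ennreal (g n w))"
    by (intro lim_imp_Liminf[symmetric] tendsto_ennrealI g(2) w) simp
   also have "\<dots> <= liminf (%n. ennreal (h n w))" by (intro Liminf_mono always_eventually allI ennreal_leI g(1))
   finally show ?thesis .
  qed
  then have "(nn_integral \<Omega> (%w. ennreal (f w))) <= (nn_integral \<Omega> (%w. liminf (%n. ennreal (h n w))))"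
   using aeG by (intro nn_integral_mono_AE) (auto elim!: eventually_mono)
  also have "\<dots> <= liminf (%n. \<integral>\<^sup>+w. ennreal (h n w) \<partial>\<Omega>)" by (rule nn_integral_liminf) measurable
  finally show ?thesis .
 qed
 \<comment> \<open>The limit has base \<open>\<mu>\<close>; second moments of positions converge, while those of velocities can only drop.\<close>
  have XLlaw: "distr \<Omega> borel XL = \<mu>"
 proof (rule measure_eqI_continuous)
  show "prob_space (distr \<Omega> borel XL)" by (rule \<Omega>.prob_space_distr) simp
  show "prob_space \<mu>" "sets \<mu> = sets borel" by (rule P2D[OF \<mu>])+
  fix f :: "'x => real" assume f: "continuous_on UNIV f" and fb: "!!x. abs (f x) <= 1"
  have [measurable]: "f \<in> borel_measurable borel" by (rule borel_measurable_continuous_onI[OF f])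
  have "(%n. \<Omega>.expectation (%w. f (X n w))) ----> \<Omega>.expectation (%w. f (XL w))"
  proof (rule integral_dominated_convergence[where w="%_. 1"])
   show "AE w in \<Omega>. (%n. f (X n w)) ----> f (XL w)"
    using aeG by eventually_elim (rule continuous_on_tendsto_compose[OF f XL]; simp)
  qed (use fb in auto)
  moreover have "\<Omega>.expectation (%w. f (X n w)) = (LINT x|\<mu>. f (T (k n) x))" for n
   using law[of "%z. f (fst z)" n] distr_pushforward_integral[OF TD(2) b sm, of "k n" f] by simp
  moreover have "(%n. \<integral>x. f (T (k n) x) \<partial>\<mu>) ----> (LINT x|\<mu>. f x)"
  proof (rule integral_dominated_convergence[where w="%_. 1"])
   have "(%n. T (k n) x) ----> x" for x using LIMSEQ_subseq_LIMSEQ[OF Tlim k] by (simp add: comp_def)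
   then show "AE x in \<mu>. (%n. f (T (k n) x)) ----> f x"
    by (intro AE_I2 continuous_on_tendsto_compose[OF f]) auto
  qed (use fb in auto)
  ultimately have "\<Omega>.expectation (%w. f (XL w)) = (LINT x|\<mu>. f x)" using LIMSEQ_unique by simp blast
  then show "integral\<^sup>L (distr \<Omega> borel XL) f = integral\<^sup>L \<mu> f" by (subst integral_distr) auto
 qed simp
 have XLi: "integrable \<Omega> (%w. (norm (XL w))^2)" by (rule P2_random[OF XLlaw \<mu>]) simp
 have Xi: "integrable \<Omega> (%w. (norm (X n w))^2)" for n
  using lawi[of "%z. (norm (fst z))^2" n] TD(4) by simp
 have X2: "(%n. \<Omega>.expectation (%w. (norm (X n w))^2)) ----> \<Omega>.expectation (%w. (norm (XL w))^2)"
 proof -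
  have "\<Omega>.expectation (%w. (norm (X n w))^2) = (LINT x|\<mu>. (norm (T (k n) x))^2)" for n
   using law[of "%z. (norm (fst z))^2" n] distr_pushforward_integral[OF TD(2) b sm, of "k n" "%x. (norm x)^2"] by simp
  moreover have "(%n. \<integral>x. (norm (T (k n) x))^2 \<partial>\<mu>) ----> (LINT x|\<mu>. (norm x)^2)"
  proof -
   have "Bseq \<delta>" using \<delta> by (intro convergent_imp_Bseq convergentI)
   then obtain B where B: "!!n. norm (\<delta> n) <= B" unfolding Bseq_def by blast
   show ?thesis
   proof (rule integral_dominated_convergence[where w="%x. 2 * B^2 + 2 * (norm x)^2"])
    have "(%n. T (k n) x) ----> x" for x using LIMSEQ_subseq_LIMSEQ[OF Tlim k] by (simp add: comp_def)
    then show "AE x in \<mu>. (%n. (norm (T (k n) x))^2) ----> (norm x)^2"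
     by (intro AE_I2 tendsto_power tendsto_norm) blast
    have "(norm (T n x))^2 <= 2 * B^2 + 2 * (norm x)^2" for n x
    proof -
     have "norm (T n x - x) <= B" using T\<delta>[of n x] B[of n] by simp
     then have "(norm (T n x - x))^2 <= B^2" by (intro power_mono) auto
     then show ?thesis using norm_sum_sq_bound[of "T n x - x" x] by simp
    qed
    then show "AE x in \<mu>. norm ((norm (T (k n) x))^2) <= 2 * B^2 + 2 * (norm x)^2" for n by simp
   qed (use P2D(4)[OF \<mu>] in auto)
  qed
  moreover have "\<Omega>.expectation (%w. (norm (XL w))^2) = (LINT x|\<mu>. (norm x)^2)"
   unfolding XLlaw[symmetric] by (subst integral_distr) auto
  ultimately show ?thesis by simp
 qed
 have VL2: "(nn_integral \<Omega> (%w. ennreal ((norm (VL w))^2))) <= ennreal (M^2)"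
 proof -
  have "(nn_integral \<Omega> (%w. ennreal ((norm (VL w))^2))) <= liminf (%n. \<integral>\<^sup>+w. ennreal ((norm (V n w))^2) \<partial>\<Omega>)"
  proof (rule fatou[of _ "%n w. 2 * (V n w \<bullet> VL w) - (norm (VL w))^2"])
   fix n w
   have "0 <= (norm (V n w - VL w))^2" by simp
   then show "2 * (V n w \<bullet> VL w) - (norm (VL w))^2 <= (norm (V n w))^2"
    by (simp add: power2_norm_eq_inner inner_diff inner_commute)
  next
   fix w assume "w \<in> G"
   then have "(%n. V n w \<bullet> VL w) ----> VL w \<bullet> VL w" using VL unfolding weak_lim_def by blast
   from tendsto_diff[OF tendsto_mult_left[OF this, of 2] tendsto_const[of "(norm (VL w))^2"]]
   show "(%n. 2 * (V n w \<bullet> VL w) - (norm (VL w))^2) ----> (norm (VL w))^2" by (simp add: power2_norm_eq_inner)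
  qed measurable
  also have "\<dots> <= liminf (%n. ennreal (M^2))"
   by (intro Liminf_mono always_eventually allI) (subst nn_integral_eq_integral[OF Vi]; simp add: VM ennreal_leI)
  finally show ?thesis by (simp add: Liminf_const)
 qed
 have VLi: "integrable \<Omega> (%w. (norm (VL w))^2)"
  by (rule integrableI_bounded) (use VL2 in "auto intro: le_less_trans")
 have VLM: "\<Omega>.expectation (%w. (norm (VL w))^2) <= M^2"
  using VL2 by (subst (asm) nn_integral_eq_integral[OF VLi]) auto
 define \<Psi> where "\<Psi> = distr \<Omega> borel (%w. (XL w, VL w))"
 have \<Psi>I: "integral\<^sup>L \<Psi> f = \<Omega>.expectation (%w. f (XL w, VL w))" if [measurable]: "f \<in> borel_measurable borel" for f :: "'x \<times> 'x => real"
  unfolding \<Psi>_def by (subst integral_distr) auto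
 have \<Psi>TP: "\<Psi> \<in> TP2" unfolding TP2_def
 proof (intro CollectI conjI)
  show "prob_space \<Psi>" unfolding \<Psi>_def by (rule \<Omega>.prob_space_distr) simp
  show "sets \<Psi> = sets borel" by (simp add: \<Psi>_def)
  show "integrable \<Psi> (%(x, v). (norm x)^2 + (norm v)^2)"
   unfolding \<Psi>_def split_beta' by (subst integrable_distr_eq) (use XLi VLi in auto)
 qed
 have \<Psi>vel: "vel_norm \<Psi> <= M"
 proof (rule power2_le_imp_le)
  show "(vel_norm \<Psi>)^2 <= M^2" unfolding vel_norm_sq using VLM by (subst \<Psi>I) auto
 qed (rule M0)
 have low: "\<forall>\<^sub>F n in sequentially. integral\<^sup>L \<Psi> \<zeta> - \<eta> < integral\<^sup>L (\<Phi> (k n)) \<zeta>"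
  if z: "\<zeta> \<in> sw_test" and \<eta>: "0 < \<eta>" for \<zeta> \<eta>
 proof -
  have [measurable]: "\<zeta> \<in> borel_measurable borel" by (rule sw_test_measurable[OF z])
  define \<epsilon> where "\<epsilon> = \<eta> / (4 * (M^2 + 1))"
  have m1: "0 < M^2 + 1" by (simp add: add_nonneg_pos)
  have \<epsilon>: "0 < \<epsilon>" using \<eta> m1 by (simp add: \<epsilon>_def)
  have \<epsilon>M: "\<epsilon> * M^2 <= \<eta> / 4"
  proof -
   have "\<epsilon> * M^2 <= \<epsilon> * (M^2 + 1)" using \<epsilon> by (intro mult_left_mono) auto
   also have "\<dots> = \<eta> / 4"
   proof -
    have "\<eta> / (4 * K) * K = \<eta> / 4" if "0 < K" for K :: real using that by simp
    from this[OF m1] show ?thesis by (simp only: \<epsilon>_def)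
   qed
   finally show ?thesis .
  qed
  obtain A where A: "0 <= A" "!!z. abs (\<zeta> z) <= A * (1 + (norm (fst z))^2) + \<epsilon> * (norm (snd z))^2"
   using sw_test_growth[OF z \<epsilon>] by blast
  have zi: "integrable \<Omega> (%w. \<zeta> (X n w, V n w))" for n
   using lawi[of \<zeta> n] sw_test_integrable[OF z TP] by simp
  have zLi: "integrable \<Omega> (%w. \<zeta> (XL w, VL w))"
   using sw_test_integrable[OF z \<Psi>TP] unfolding \<Psi>_def by (subst (asm) integrable_distr_eq) auto
  define h where "h n w = A * (1 + (norm (X n w))^2) + \<epsilon> * (norm (V n w))^2 + \<zeta> (X n w, V n w)" for n w
  define hL where "hL w = A * (1 + (norm (XL w))^2) + \<zeta> (XL w, VL w)" for w
  have h0: "0 <= h n w" for n w using A(2)[of "(X n w, V n w)"] by (simp add: h_def)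
  have hi: "integrable \<Omega> (h n)" and he: "\<Omega>.expectation (h n) = A * (1 + \<Omega>.expectation (%w. (norm (X n w))^2)) + \<epsilon> * \<Omega>.expectation (%w. (norm (V n w))^2) + integral\<^sup>L (\<Phi> (k n)) \<zeta>" for n
   unfolding h_def[abs_def] using Xi Vi zi by (auto simp: law \<Omega>.prob_space)
  have hLi: "integrable \<Omega> hL" and hLe: "\<Omega>.expectation hL = A * (1 + \<Omega>.expectation (%w. (norm (XL w))^2)) + integral\<^sup>L \<Psi> \<zeta>"
   unfolding hL_def[abs_def] using XLi zLi by (auto simp: \<Psi>I \<Omega>.prob_space)
  have "ennreal (\<Omega>.expectation hL) <= ennreal (enn2real (nn_integral \<Omega> (%w. ennreal (hL w))))"
   unfolding real_lebesgue_integral_def[OF hLi] by (rule ennreal_leI) simp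
  also have "\<dots> = (nn_integral \<Omega> (%w. ennreal (hL w)))" using hLi by (simp add: real_integrable_def less_top)
  also have "\<dots> <= liminf (%n. \<integral>\<^sup>+w. ennreal (h n w) \<partial>\<Omega>)"
  proof (rule fatou[of _ "%n w. A * (1 + (norm (X n w))^2) + \<zeta> (X n w, V n w)"])
   show "h n \<in> borel_measurable \<Omega>" for n using hi by (rule borel_measurable_integrable)
   show "A * (1 + (norm (X n w))^2) + \<zeta> (X n w, V n w) <= h n w" for n w using \<epsilon> by (simp add: h_def)
   fix w assume w: "w \<in> G"
   have "(%n. \<zeta> (X n w, V n w)) ----> \<zeta> (XL w, VL w)" using z XL[OF w] VL[OF w] unfolding sw_test_def by blast
   then show "(%n. A * (1 + (norm (X n w))^2) + \<zeta> (X n w, V n w)) ----> hL w"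
    unfolding hL_def by (intro tendsto_intros XL w)
  qed
  finally have hle: "ennreal (\<Omega>.expectation hL) <= liminf (%n. ennreal (\<Omega>.expectation (h n)))"
   by (simp add: nn_integral_eq_integral hi h0)
  have ev1: "\<forall>\<^sub>F n in sequentially. \<Omega>.expectation hL - \<eta> / 4 < \<Omega>.expectation (h n)"
  proof (cases "\<Omega>.expectation hL - \<eta> / 4 < 0")
   case True
   have "0 <= \<Omega>.expectation (h n)" for n by (intro integral_nonneg_AE) (simp add: h0)
   then show ?thesis using True by (intro always_eventually allI) (meson less_le_trans)
  next
   case False
   have "ennreal (\<Omega>.expectation hL - \<eta> / 4) < liminf (%n. ennreal (\<Omega>.expectation (h n)))"
    by (rule less_le_trans[OF _ hle]) (use False \<eta> in "simp add: ennreal_less_iff")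
   then have "\<forall>\<^sub>F n in sequentially. ennreal (\<Omega>.expectation hL - \<eta> / 4) < ennreal (\<Omega>.expectation (h n))"
    by (rule less_LiminfD)
   then show ?thesis by eventually_elim (use False in "simp add: ennreal_less_iff")
  qed
  have "(%n. A * (1 + \<Omega>.expectation (%w. (norm (X n w))^2))) ----> A * (1 + \<Omega>.expectation (%w. (norm (XL w))^2))"
   by (intro tendsto_intros X2)
  then have ev2: "\<forall>\<^sub>F n in sequentially. A * (1 + \<Omega>.expectation (%w. (norm (X n w))^2)) < A * (1 + \<Omega>.expectation (%w. (norm (XL w))^2)) + \<eta> / 4"
   by (rule order_tendstoD) (use \<eta> in simp)
  from ev1 ev2 show ?thesis
  proof eventually_elim
   fix n assume 1: "\<Omega>.expectation hL - \<eta> / 4 < \<Omega>.expectation (h n)"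
    and 2: "A * (1 + \<Omega>.expectation (%w. (norm (X n w))^2)) < A * (1 + \<Omega>.expectation (%w. (norm (XL w))^2)) + \<eta> / 4"
   have "\<epsilon> * \<Omega>.expectation (%w. (norm (V n w))^2) <= \<epsilon> * M^2" by (intro mult_left_mono VM) (use \<epsilon> in simp)
   then show "integral\<^sup>L \<Psi> \<zeta> - \<eta> < integral\<^sup>L (\<Phi> (k n)) \<zeta>"
    using 1 2 \<epsilon>M \<eta> unfolding he hLe by linarith
  qed
 qed
 have "limitin sw_topology (%n. \<Phi> (k n)) \<Psi> sequentially"
  unfolding limitin_sw_iff[OF TP]
 proof (intro conjI ballI \<Psi>TP)
  fix \<zeta> :: "'x \<times> 'x => real" assume z: "\<zeta> \<in> sw_test"
  show "(%n. integral\<^sup>L (\<Phi> (k n)) \<zeta>) ----> integral\<^sup>L \<Psi> \<zeta>"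
  proof (rule order_tendstoI)
   fix a assume "a < integral\<^sup>L \<Psi> \<zeta>"
   then show "\<forall>\<^sub>F n in sequentially. a < integral\<^sup>L (\<Phi> (k n)) \<zeta>" using low[OF z, of "integral\<^sup>L \<Psi> \<zeta> - a"] by simp
  next
   fix a assume "integral\<^sup>L \<Psi> \<zeta> < a"
   then show "\<forall>\<^sub>F n in sequentially. integral\<^sup>L (\<Phi> (k n)) \<zeta> < a"
    using low[OF sw_test_uminus[OF z], of "a - integral\<^sup>L \<Psi> \<zeta>"] by simp
  qed
 qed
 moreover have "base \<Psi> = \<mu>" unfolding base_def \<Psi>_def XLlaw[symmetric]
  by (subst distr_distr) (auto simp: comp_def)
 ultimately show ?thesis using k \<Psi>vel by blast
qed

section \<open>From the distributional inequality to one-sided slopes\<close>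

lemma smooth_step_DERIV_affine:
 "((%t. smooth_step ((t - a) / \<delta>)) has_real_derivative bump ((t - a) / \<delta>) / bump_mass / \<delta>) (at t)"
proof -
 have "((%t. smooth_step ((t - a) / \<delta>)) has_real_derivative bump ((t - a) / \<delta>) / bump_mass * (1 / \<delta>)) (at t)"
  by (rule DERIV_chain'[where g=smooth_step, OF _ DERIV_smooth_step]) (auto intro!: derivative_eq_intros simp: divide_inverse)
 then show ?thesis by simp
qed

lemma bump_average_bounds:
 fixes f :: "real => real"
 assumes \<delta>: "0 < \<delta>" and J: "{a..a + \<delta>} \<subseteq> J" and f: "continuous_on J f"
  and e: "!!t. t \<in> {a..a + \<delta>} ==> abs (f t - f a) <= e"
 shows "integrable lborel (%t. indicator J t * (f t * (bump ((t - a) / \<delta>) / bump_mass / \<delta>)))"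
  and "abs ((LBINT t:J. f t * (bump ((t - a) / \<delta>) / bump_mass / \<delta>)) - f a) <= e"
proof -
 define k where "k t = bump ((t - a) / \<delta>) / bump_mass / \<delta>" for t
 have k0: "0 <= k t" for t unfolding k_def using bump_nonneg bump_mass_pos \<delta> by (intro divide_nonneg_pos) auto
 have kz: "k t = 0" if "t \<notin> {a..a + \<delta>}" for t
 proof -
  have "(t - a) / \<delta> <= 0 \<or> 1 <= (t - a) / \<delta>" using that \<delta> by (auto simp: divide_le_0_iff le_divide_eq)
  then show ?thesis by (simp add: k_def bump_zero)
 qed
 have kc: "continuous_on S k" for S
  unfolding k_def using \<delta> bump_mass_pos
  by (intro continuous_on_divide continuous_on_compose2[OF continuous_bump[of UNIV]] continuous_intros) auto
 have kI: "integrable lborel (%t. indicator {a..a + \<delta>} t * k t)"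
  using borel_integrable_compact[OF compact_Icc kc, of a "a + \<delta>"] by (simp add: mult.commute)
 have k1: "(LINT t|lborel. indicator {a..a + \<delta>} t * k t) = 1"
 proof -
  have "(LINT t|lborel. k t * indicator {a..a + \<delta>} t) = smooth_step ((a + \<delta> - a) / \<delta>) - smooth_step ((a - a) / \<delta>)"
  proof (rule integral_FTC_Icc_real)
   show "((%t. smooth_step ((t - a) / \<delta>)) has_real_derivative k t) (at t)" for t
    unfolding k_def by (rule smooth_step_DERIV_affine)
   show "isCont k t" for t using kc[of UNIV] by (simp add: continuous_on_eq_continuous_at)
  qed (use \<delta> in auto)
  then show ?thesis using \<delta> by (simp add: smooth_step_eq_0 smooth_step_eq_1 mult.commute)
 qed
 have eq: "indicator J t * (f t * k t) = indicator {a..a + \<delta>} t * (f t * k t)" for t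
  using kz[of t] J by (auto split: split_indicator)
 have fc: "continuous_on {a..a + \<delta>} f" by (rule continuous_on_subset[OF f J])
 have fkI: "integrable lborel (%t. indicator {a..a + \<delta>} t * (f t * k t))"
  using borel_integrable_compact[OF compact_Icc continuous_on_mult[OF fc kc]] by (simp add: mult.commute)
 then show "integrable lborel (%t. indicator J t * (f t * (bump ((t - a) / \<delta>) / bump_mass / \<delta>)))"
  unfolding k_def[symmetric] eq .
 have "(LBINT t:J. f t * k t) - f a = (LINT t|lborel. indicator {a..a + \<delta>} t * (f t * k t)) - f a * (LINT t|lborel. indicator {a..a + \<delta>} t * k t)"
  unfolding set_lebesgue_integral_def real_scaleR_def eq k1 by simp
 also have "\<dots> = (LINT t|lborel. indicator {a..a + \<delta>} t * ((f t - f a) * k t))"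
  using fkI kI by (simp add: algebra_simps)
 also have "abs \<dots> <= (LINT t|lborel. e * (indicator {a..a + \<delta>} t * k t))"
 proof (rule integral_abs_bound[THEN order_trans], rule integral_mono)
  show "integrable lborel (%t. abs (indicator {a..a + \<delta>} t * ((f t - f a) * k t)))"
   using fkI kI by (intro integrable_abs) (simp add: algebra_simps)
  show "integrable lborel (%t. e * (indicator {a..a + \<delta>} t * k t))" using kI by simp
  show "abs (indicator {a..a + \<delta>} t * ((f t - f a) * k t)) <= e * (indicator {a..a + \<delta>} t * k t)" for t
   using e[of t] k0[of t] by (auto simp: abs_mult mult_right_mono split: split_indicator)
 qed
 also have "\<dots> = e" using k1 by simp
 finally show "abs ((LBINT t:J. f t * (bump ((t - a) / \<delta>) / bump_mass / \<delta>)) - f a) <= e" unfolding k_def .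
qed

lemma trapezoid_integral:
 assumes ab: "a <= b" and \<delta>: "0 < \<delta>" and J: "{a..b + \<delta>} \<subseteq> J"
 shows "abs ((LBINT t:J. smooth_step ((t - a) / \<delta>) - smooth_step ((t - b) / \<delta>)) - (b - a)) <= \<delta>"
proof -
 let ?\<eta> = "%t. smooth_step ((t - a) / \<delta>) - smooth_step ((t - b) / \<delta>)"
 have \<eta>z: "?\<eta> t = 0" if "t \<notin> {a..b + \<delta>}" for t
 proof (cases "t < a")
  case True
  then show ?thesis using assms by (simp add: smooth_step_eq_0 divide_nonpos_pos)
 next
  case False
  then have "b + \<delta> < t" using that by auto
  then show ?thesis using assms by (simp add: smooth_step_eq_1 le_divide_eq)
 qed
 have \<eta>0: "0 <= ?\<eta> t" for t using ab \<delta> by (auto intro!: smooth_step_mono divide_right_mono)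
 have \<eta>1: "?\<eta> t <= 1" for t using smooth_step_bounds[of "(t - a) / \<delta>"] smooth_step_bounds[of "(t - b) / \<delta>"] by linarith
 have \<eta>one: "?\<eta> t = 1" if "a + \<delta> <= t" "t <= b" for t
  using that \<delta> by (simp add: smooth_step_eq_0 smooth_step_eq_1 le_divide_eq divide_nonpos_pos)
 have c: "continuous_on S ?\<eta>" for S
 proof -
  have s: "continuous_on UNIV smooth_step"
   using DERIV_smooth_step by (meson DERIV_continuous continuous_at_imp_continuous_on)
  show ?thesis using \<delta> by (intro continuous_intros continuous_on_compose2[OF s]) auto
 qed
 have eq: "indicator J t * ?\<eta> t = indicator {a..b + \<delta>} t * ?\<eta> t" for t
  using \<eta>z[of t] J by (auto split: split_indicator)
 have I: "integrable lborel (%t. indicator {a..b + \<delta>} t * ?\<eta> t)"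
  using borel_integrable_compact[OF compact_Icc c] by (simp add: mult.commute)
 have e: "(LBINT t:J. ?\<eta> t) = (LINT t|lborel. indicator {a..b + \<delta>} t * ?\<eta> t)"
  unfolding set_lebesgue_integral_def real_scaleR_def eq ..
 have "(LINT t|lborel. indicator {a..b + \<delta>} t * ?\<eta> t) <= (LINT t|lborel. indicator {a..b + \<delta>} t)"
 proof (rule integral_mono[OF I])
  show "integrable lborel (indicator {a..b + \<delta>} :: real => real)" by (rule integrable_real_indicator) (auto simp: emeasure_lborel_Icc_eq)
  show "indicator {a..b + \<delta>} t * ?\<eta> t <= indicator {a..b + \<delta>} t" for t
   using \<eta>1[of t] by (auto split: split_indicator)
 qed
 also have "\<dots> = b + \<delta> - a" using ab \<delta> by simp
 finally have u: "(LBINT t:J. ?\<eta> t) <= b - a + \<delta>" unfolding e by simp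
 have l: "b - a - \<delta> <= (LBINT t:J. ?\<eta> t)"
 proof (cases "a + \<delta> <= b")
  case True
  have "b - a - \<delta> = (LINT t|lborel. indicator {a + \<delta>..b} t)" using True by simp
  also have "\<dots> <= (LINT t|lborel. indicator {a..b + \<delta>} t * ?\<eta> t)"
  proof (rule integral_mono[OF _ I])
   show "integrable lborel (indicator {a + \<delta>..b} :: real => real)" by (rule integrable_real_indicator) (auto simp: emeasure_lborel_Icc_eq)
   show "indicator {a + \<delta>..b} t <= indicator {a..b + \<delta>} t * ?\<eta> t" for t
    using \<eta>one[of t] \<eta>0[of t] \<delta> by (auto split: split_indicator)
  qed
  finally show ?thesis unfolding e .
 next
  case False
  have "0 <= (LBINT t:J. ?\<eta> t)" unfolding e using \<eta>0 by (intro integral_nonneg_AE AE_I2) (auto split: split_indicator)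
  then show ?thesis using False by simp
 qed
 show ?thesis using u l by simp
qed

text \<open>
 Smooth trapezoids are the test functions; as their flanks shrink, the left side tends to an increment of
 \<open>f\<close>.
\<close>
lemma distributional_slope:
 fixes f :: "real => real"
 assumes f: "continuous_on J f" and N: "open N" "N \<subseteq> J" and ab: "a < b" "{a..b} \<subseteq> N"
  and dist: "!!\<eta>. \<eta> \<in> test_fun J ==> (!!t. 0 <= \<eta> t) ==> (!!t. \<eta> t ~= 0 ==> t \<in> N) ==>
   - (LBINT t:J. f t * deriv \<eta> t) <= c * (LBINT t:J. \<eta> t)"
 shows "f b - f a <= c * (b - a)"
proof (rule field_le_epsilon)
 fix e :: real assume e: "0 < e"
 have "a \<in> N" "b \<in> N" using ab by auto
 have fN: "continuous_on N f" by (rule continuous_on_subset[OF f N(2)])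
 obtain r where r: "0 < r" "!!t. abs (t - b) < r ==> t \<in> N"
  using N(1) \<open>b \<in> N\<close> unfolding open_dist by (auto simp: dist_real_def)
 obtain da where da: "0 < da" "!!t. t \<in> N ==> abs (t - a) < da ==> abs (f t - f a) < e / 3"
 proof -
  have "0 < e / 3" using e by simp
  then show ?thesis using fN \<open>a \<in> N\<close> that unfolding continuous_on_iff dist_real_def by blast
 qed
 obtain db where db: "0 < db" "!!t. t \<in> N ==> abs (t - b) < db ==> abs (f t - f b) < e / 3"
 proof -
  have "0 < e / 3" using e by simp
  then show ?thesis using fN \<open>b \<in> N\<close> that unfolding continuous_on_iff dist_real_def by blast
 qed
 define \<delta> where "\<delta> = min (min (r / 2) (min (da / 2) (db / 2))) (min (b - a) (e / (3 * (abs c + 1))))"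
 have "0 < e / (3 * (abs c + 1))" using e by (intro divide_pos_pos) auto
 then have \<delta>: "0 < \<delta>" "\<delta> < r" "\<delta> < da" "\<delta> < db" "\<delta> <= b - a" "\<delta> <= e / (3 * (abs c + 1))"
  using r(1) da(1) db(1) ab(1) unfolding \<delta>_def by linarith+
 have sub: "{a..b + \<delta>} \<subseteq> N"
 proof
  fix t assume "t \<in> {a..b + \<delta>}"
  then show "t \<in> N" using ab(2) r(2)[of t] \<delta> by (cases "t <= b") auto
 qed
 then have subJ: "{a..b + \<delta>} \<subseteq> J" using N by blast
 let ?\<eta> = "%t. smooth_step ((t - a) / \<delta>) - smooth_step ((t - b) / \<delta>)"
 let ?k = "%a t. bump ((t - a) / \<delta>) / bump_mass / \<delta>"
 have \<eta>: "?\<eta> \<in> test_fun J" by (rule trapezoid_test_fun) (use ab \<delta> subJ in auto)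
 have \<eta>N: "?\<eta> \<in> test_fun N" by (rule trapezoid_test_fun) (use ab \<delta> sub in auto)
 have d: "deriv ?\<eta> t = ?k a t - ?k b t" for t
  by (rule DERIV_imp_deriv) (intro DERIV_diff smooth_step_DERIV_affine)
 have subA: "{a..a + \<delta>} \<subseteq> J" and subB: "{b..b + \<delta>} \<subseteq> J" using subJ ab by auto
 have ea: "abs (f t - f a) <= e / 3" if "t \<in> {a..a + \<delta>}" for t
 proof -
  have "t \<in> N" using that sub ab by auto
  then show ?thesis using da(2)[of t] that \<delta> by auto
 qed
 have eb: "abs (f t - f b) <= e / 3" if "t \<in> {b..b + \<delta>}" for t
 proof -
  have "t \<in> N" using that sub ab by auto
  then show ?thesis using db(2)[of t] that \<delta> by auto
 qed
 note Aa = bump_average_bounds[OF \<delta>(1) subA f ea] and Ab = bump_average_bounds[OF \<delta>(1) subB f eb]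
 have "- (LBINT t:J. f t * deriv ?\<eta> t) = (LBINT t:J. f t * ?k b t) - (LBINT t:J. f t * ?k a t)"
  unfolding d using Aa(1) Ab(1) by (simp add: set_lebesgue_integral_def right_diff_distrib)
 moreover have "- (LBINT t:J. f t * deriv ?\<eta> t) <= c * (LBINT t:J. ?\<eta> t)"
 proof (rule dist[OF \<eta>])
  show "0 <= ?\<eta> t" for t using ab \<delta> by (auto intro!: smooth_step_mono divide_right_mono)
  show "t \<in> N" if "?\<eta> t ~= 0" for t using \<eta>N that unfolding test_fun_def by blast
 qed
 moreover have "c * (LBINT t:J. ?\<eta> t) <= c * (b - a) + e / 3"
 proof -
  have "abs ((LBINT t:J. ?\<eta> t) - (b - a)) <= \<delta>" by (rule trapezoid_integral) (use ab \<delta> subJ in auto)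
  then have "abs c * abs ((LBINT t:J. ?\<eta> t) - (b - a)) <= abs c * (e / (3 * (abs c + 1)))"
   using \<delta> by (intro mult_left_mono) auto
  also have "\<dots> <= (abs c + 1) * (e / (3 * (abs c + 1)))" using e by (intro mult_right_mono) auto
  also have "\<dots> = e / 3"
  proof -
   have "K * (e / (3 * K)) = e / 3" if "0 < K" for K :: real using that by simp
   from this[of "abs c + 1"] show ?thesis by simp
  qed
  finally have "abs (c * ((LBINT t:J. ?\<eta> t) - (b - a))) <= e / 3" unfolding abs_mult .
  then have "c * ((LBINT t:J. ?\<eta> t) - (b - a)) <= e / 3" by linarith
  then show ?thesis unfolding right_diff_distrib by linarith
 qed
 ultimately show "f b - f a <= c * (b - a) + e" using Aa(2) Ab(2) by linarith
qed

section \<open>The evolution variational inequality along the curve\<close>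

lemma W2_diff_le:
 assumes "\<mu> \<in> P2" "\<mu>' \<in> P2" "\<nu> \<in> P2"
 shows "abs (W2 \<mu> \<nu> - W2 \<mu>' \<nu>) <= W2 \<mu> \<mu>'"
 using W2_triangle[of \<mu> \<mu>' \<nu>] W2_triangle[of \<mu>' \<mu> \<nu>] assms W2_commute[of \<mu> \<mu>'] by auto

lemma W2_continuous_to:
 assumes c: "W2_continuous I \<mu>" and P: "\<mu> ` I \<subseteq> P2" and \<nu>: "\<nu> \<in> P2"
 shows "continuous_on I (%t. W2 (\<mu> t) \<nu>)"
 unfolding continuous_on_def
proof
 fix t assume t: "t \<in> I"
 have l: "((%s. W2 (\<mu> s) (\<mu> t)) ---> 0) (at t within I)" using c t by (simp add: W2_continuous_def)
 have "((%s. W2 (\<mu> s) \<nu> - W2 (\<mu> t) \<nu>) ---> 0) (at t within I)"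
 proof (rule Lim_null_comparison[OF _ l])
  show "\<forall>\<^sub>F s in at t within I. norm (W2 (\<mu> s) \<nu> - W2 (\<mu> t) \<nu>) <= W2 (\<mu> s) (\<mu> t)"
  proof -
   have "abs (W2 (\<mu> s) \<nu> - W2 (\<mu> t) \<nu>) <= W2 (\<mu> s) (\<mu> t)" if "s \<in> I" for s
    by (rule W2_diff_le) (use P t \<nu> that in auto)
   then show ?thesis unfolding eventually_at_filter by (intro always_eventually) auto
  qed
 qed
 then show "((%s. W2 (\<mu> s) \<nu>) ---> W2 (\<mu> t) \<nu>) (at t within I)" by (simp add: LIM_zero_iff)
qed

lemma exp_slope_continuous:
 assumes c: "W2_continuous I \<mu>" and P: "\<mu> ` I \<subseteq> P2" and \<Phi>: "\<Phi> \<in> TP2"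
 shows "continuous_on I (%t. exp_slope s \<Phi> (\<mu> t))"
 unfolding exp_slope_def W2_commute[of "push_exp s \<Phi>"] W2_commute[of "base \<Phi>"] divide_inverse
 by (intro continuous_intros W2_continuous_to[OF c P] push_exp_P2 base_P2 \<Phi>)

text \<open>
 An upper bound for the right side of the evolution variational inequality that is continuous along the curve,
 since the corrected quotient replaces the pairing.
\<close>
definition evi_bound :: "real => real => ('x::{real_inner, polish_space} \<times> 'x) measure => 'x measure => real" where
 "evi_bound lam s \<Phi> \<nu> = lam * (W2 \<nu> (base \<Phi>))^2 - exp_slope s \<Phi> \<nu>"

lemma evi_bound_continuous:
 assumes c: "W2_continuous I \<mu>" and P: "\<mu> ` I \<subseteq> P2" and \<Phi>: "\<Phi> \<in> TP2"
 shows "continuous_on I (%t. evi_bound lam s \<Phi> (\<mu> t))"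
 unfolding evi_bound_def
 by (intro continuous_intros W2_continuous_to[OF c P] exp_slope_continuous[OF c P \<Phi>] base_P2 \<Phi>)

text \<open>
 Integrated form of the inequality on \<open>[l, u]\<close>; the ends of \<open>I\<close> are reached by
 continuity.
\<close>
lemma EVI_slope:
 assumes E: "EVI_solution lam F I \<mu>" and I: "is_interval I" and P: "\<mu> ` I \<subseteq> P2"
  and \<Phi>F: "\<Phi> \<in> F" and \<Phi>: "\<Phi> \<in> TP2" and s: "0 < s"
  and N: "!!t. t \<in> I ==> l <= t ==> t <= u ==> evi_bound lam s \<Phi> (\<mu> t) <= c"
  and lu: "l \<in> I" "u \<in> I" "l < u"
 shows "(1/2) * (W2 (\<mu> u) (base \<Phi>))^2 - (1/2) * (W2 (\<mu> l) (base \<Phi>))^2 <= c * (u - l)"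
proof -
 have cont: "W2_continuous I \<mu>" using E by (simp add: EVI_solution_def)
 define f where "f t = (1/2) * (W2 (\<mu> t) (base \<Phi>))^2" for t
 have fc: "continuous_on I f" unfolding f_def by (intro continuous_intros W2_continuous_to[OF cont P base_P2[OF \<Phi>]])
 define J where "J = interior I"
 have JI: "J \<subseteq> I" unfolding J_def by (rule interior_subset)
 have sub: "{l<..<u} \<subseteq> J"
 proof -
  have "{l<..<u} \<subseteq> I" using mem_is_interval_1_I[OF I lu(1,2)] by auto
  then show ?thesis unfolding J_def by (rule interior_maximal) simp
 qed
 define p where "p t = pairing_meas \<Phi> (\<mu> t)" for t
 have pP: "\<mu> t \<in> P2" if "t \<in> J" for t using that JI P by auto
 have pm: "(%t. indicator J t * p t) \<in> borel_measurable borel"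
 proof (rule borel_measurable_LIMSEQ_real)
  have "continuous_on J (%t. exp_slope (1 / real (Suc n)) \<Phi> (\<mu> t))" for n
   by (rule continuous_on_subset[OF exp_slope_continuous[OF cont P \<Phi>] JI])
  from borel_measurable_continuous_on_indicator[OF _ this]
  show "(%t. indicator J t *\<^sub>R exp_slope (1 / real (Suc n)) \<Phi> (\<mu> t)) \<in> borel_measurable borel" for n by (simp add: J_def)
  fix t
  have "filterlim (%n. 1 / real (Suc n)) (at_right 0) sequentially"
   unfolding filterlim_at by (rule conjI[OF _ LIMSEQ_Suc[OF lim_1_over_n]]) auto
  from filterlim_compose[OF exp_slope_pairing_meas(1)[OF \<Phi>, of "\<mu> t"] this]
  show "(%n. indicator J t *\<^sub>R exp_slope (1 / real (Suc n)) \<Phi> (\<mu> t)) ----> indicator J t * p t"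
   using pP[of t] by (auto simp: p_def split: split_indicator)
 qed
 have slope: "f b - f a <= c * (b - a)" if ab: "l < a" "a < b" "b < u" for a b
 proof (rule distributional_slope[OF continuous_on_subset[OF fc JI], of "{l<..<u}"])
  fix \<eta> assume \<eta>: "\<eta> \<in> test_fun J" and \<eta>0: "!!t. 0 <= \<eta> t" and \<eta>N: "!!t. \<eta> t ~= 0 ==> t \<in> {l<..<u}"
  obtain K where K: "compact K" "K \<subseteq> J" "!!t. \<eta> t ~= 0 ==> t \<in> K" using \<eta> unfolding test_fun_def by blast
  have "\<eta> field_differentiable at t" for t using \<eta> unfolding test_fun_def by (auto dest!: spec[of _ "0::nat"])
  then have \<eta>c: "continuous_on S \<eta>" for S
   using field_differentiable_imp_continuous_at continuous_at_imp_continuous_on by blast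
  have [measurable]: "\<eta> \<in> borel_measurable borel" by (rule borel_measurable_continuous_onI[OF \<eta>c])
  have Kb: "K \<in> sets borel" using K by (intro borel_compact)
  define w where "w t = lam * (W2 (\<mu> t) (base \<Phi>))^2 - p t" for t
  have wm: "(%t. indicator J t * w t) \<in> borel_measurable borel"
  proof -
   have "(%t. indicator J t *\<^sub>R (lam * (W2 (\<mu> t) (base \<Phi>))^2)) \<in> borel_measurable borel"
    by (intro borel_measurable_continuous_on_indicator continuous_intros continuous_on_subset[OF W2_continuous_to[OF cont P] JI] base_P2 \<Phi>)
     (simp add: J_def)
   from borel_measurable_diff[OF this pm] show ?thesis by (simp add: w_def right_diff_distrib)
  qed
  have wc: "w t <= c" if "t \<in> I" "l <= t" "t <= u" for t
   using N[OF that] exp_slope_pairing_meas(2)[OF \<Phi> _ s, of "\<mu> t"] P that(1)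
   unfolding w_def p_def evi_bound_def by auto
  define d where "d t = abs (evi_bound lam 1 \<Phi> (\<mu> t)) + abs (lam * (W2 (\<mu> t) (base \<Phi>))^2 - vel_norm \<Phi> * W2 (\<mu> t) (base \<Phi>))" for t
  have dc: "continuous_on K d"
   unfolding d_def using K JI
   by (intro continuous_on_subset[of I _ K] continuous_intros evi_bound_continuous[OF cont P \<Phi>] W2_continuous_to[OF cont P base_P2[OF \<Phi>]]) auto
  have wB: "abs (w t) <= d t" if t: "t \<in> K" for t
  proof -
   have t': "\<mu> t \<in> P2" using t K pP by blast
   have "w t <= evi_bound lam 1 \<Phi> (\<mu> t)"
    using exp_slope_pairing_meas(2)[OF \<Phi> t' zero_less_one] unfolding w_def p_def evi_bound_def by auto
   moreover have "lam * (W2 (\<mu> t) (base \<Phi>))^2 - vel_norm \<Phi> * W2 (\<mu> t) (base \<Phi>) <= w t"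
    using exp_slope_pairing_meas(3)[OF \<Phi> t'] unfolding w_def p_def by (simp add: W2_commute[of "\<mu> t"])
   ultimately show ?thesis unfolding d_def by linarith
  qed
  have \<eta>I: "integrable lborel (%t. indicator K t * \<eta> t)"
   using borel_integrable_compact[OF K(1) \<eta>c] by (simp add: mult.commute)
  have supp: "indicator J t * (x * \<eta> t) = indicator K t * (x * \<eta> t)" for t x
   using K(2) K(3)[of t] by (auto split: split_indicator)
  have w\<eta>I: "integrable lborel (%t. indicator J t * (w t * \<eta> t))"
  proof (rule Bochner_Integration.integrable_bound)
   show "integrable lborel (%t. indicator K t * (d t * \<eta> t))"
    using borel_integrable_compact[OF K(1) continuous_on_mult[OF dc \<eta>c]] by (simp add: mult.commute)
   have "(%t. indicator J t * w t * \<eta> t) \<in> borel_measurable borel" using wm by measurable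
   then show "(%t. indicator J t * (w t * \<eta> t)) \<in> borel_measurable lborel" by (simp add: mult.assoc)
   show "AE t in lborel. norm (indicator J t * (w t * \<eta> t)) <= norm (indicator K t * (d t * \<eta> t))"
   proof (rule AE_I2)
    fix t
    show "norm (indicator J t * (w t * \<eta> t)) <= norm (indicator K t * (d t * \<eta> t))"
     unfolding supp using wB[of t] abs_ge_self[of "d t"]
     by (auto simp: abs_mult intro!: mult_right_mono split: split_indicator)
   qed
  qed
  have "- (LBINT t:J. f t * deriv \<eta> t) <= (LBINT t:J. w t * \<eta> t)"
   using E \<Phi>F \<eta> \<eta>0 unfolding EVI_solution_def J_def f_def w_def p_def by blast
  also have "\<dots> <= (LBINT t:J. c * \<eta> t)"
   unfolding set_lebesgue_integral_def real_scaleR_def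
  proof (rule integral_mono[OF w\<eta>I])
   show "integrable lborel (%t. indicator J t * (c * \<eta> t))" unfolding supp using \<eta>I by (simp add: mult.left_commute)
   show "indicator J t * (w t * \<eta> t) <= indicator J t * (c * \<eta> t)" for t
   proof (cases "\<eta> t = 0")
    case False
    have "t \<in> I" using K False JI by blast
    then have "w t <= c" using \<eta>N[OF False] by (intro wc) auto
    then show ?thesis using \<eta>0[of t] by (auto split: split_indicator intro: mult_right_mono)
   qed simp
  qed
  also have "\<dots> = c * (LBINT t:J. \<eta> t)" by simp
  finally show "- (LBINT t:J. f t * deriv \<eta> t) <= c * (LBINT t:J. \<eta> t)" .
 qed (use ab sub in auto)
 define h where "h n = (u - l) / real (n + 3)" for n
 have h0: "h ----> 0"
 proof -
  have "(%n. (u - l) * (1 / real (n + 3))) ----> (u - l) * 0"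
   by (rule tendsto_mult_left[OF LIMSEQ_ignore_initial_segment[OF lim_1_over_n]])
  then show ?thesis by (simp only: h_def[abs_def] mult_zero_right times_divide_eq_right mult_1_right)
 qed
 have hp: "0 < h n" "2 * h n < u - l" for n
 proof -
  show "0 < h n" using lu by (simp add: h_def)
  have "(u - l) * 2 < (u - l) * real (n + 3)" using lu by (intro mult_strict_left_mono) auto
  then show "2 * h n < u - l" by (simp only: h_def times_divide_eq_right pos_divide_less_eq of_nat_0_less_iff mult.commute)
 qed
 have lim1: "(%n. f (l + h n)) ----> f l"
 proof (rule continuous_on_tendsto_compose[OF fc _ lu(1)])
  have "(%n. l + h n) ----> l + 0" by (intro tendsto_intros h0)
  then show "(%n. l + h n) ----> l" by simp
  have "l + h n \<in> {l<..<u}" for n using hp[of n] by auto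
  then show "\<forall>\<^sub>F n in sequentially. l + h n \<in> I" using sub JI by (intro always_eventually) blast
 qed
 have lim2: "(%n. f (u - h n)) ----> f u"
 proof (rule continuous_on_tendsto_compose[OF fc _ lu(2)])
  have "(%n. u - h n) ----> u - 0" by (intro tendsto_intros h0)
  then show "(%n. u - h n) ----> u" by simp
  have "u - h n \<in> {l<..<u}" for n using hp[of n] by auto
  then show "\<forall>\<^sub>F n in sequentially. u - h n \<in> I" using sub JI by (intro always_eventually) blast
 qed
 have "f u - f l <= c * ((u - 0) - (l + 0))"
 proof (rule tendsto_le[OF trivial_limit_sequentially])
  show "(%n. f (u - h n) - f (l + h n)) ----> f u - f l" by (intro tendsto_diff lim1 lim2)
  show "(%n. c * ((u - h n) - (l + h n))) ----> c * ((u - 0) - (l + 0))" by (intro tendsto_intros h0)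
  show "\<forall>\<^sub>F n in sequentially. f (u - h n) - f (l + h n) <= c * ((u - h n) - (l + h n))"
   using hp by (intro always_eventually allI slope) (auto simp: algebra_simps)
 qed
 then show ?thesis by (simp add: f_def)
qed

section \<open>Disintegration and barycenters\<close>

text \<open>
 The integrals of approximating simple functions form a Cauchy sequence, which converges by completeness.
\<close>
lemma integrable_of_finite_norm:
 fixes f :: "'a => 'x::{real_inner, polish_space}"
 assumes f [measurable]: "f \<in> borel_measurable M" and fin: "(nn_integral M (%x. norm (f x))) < \<infinity>"
 shows "integrable M f"
proof -
 obtain s where s: "!!i. simple_function M (s i)" "!!x. x \<in> space M ==> (%i. s i x) ----> f x"
   "!!i x. x \<in> space M ==> dist (s i x) 0 <= 2 * dist (f x) 0"
  using borel_measurable_implies_sequence_metric[OF f, of 0] by blast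
 have sm [measurable]: "s i \<in> borel_measurable M" for i by (rule borel_measurable_simple_function[OF s(1)])
 have fin2: "(nn_integral M (%x. ennreal (2 * norm (f x)))) < \<infinity>"
  using fin by (simp add: ennreal_mult nn_integral_cmult ennreal_mult_less_top)
 have sI: "Bochner_Integration.simple_bochner_integrable M (s i)" for i
 proof (rule simple_bochner_integrableI_bounded[OF s(1)])
  have "(nn_integral M (%x. ennreal (norm (s i x)))) <= (nn_integral M (%x. ennreal (2 * norm (f x))))"
   using s(3) by (intro nn_integral_mono ennreal_leI) auto
  then show "(nn_integral M (%x. ennreal (norm (s i x)))) < \<infinity>" using fin2 by (rule le_less_trans)
 qed
 have lim: "(%i. \<integral>\<^sup>+x. norm (f x - s i x) \<partial>M) ----> 0"
 proof (rule nn_integral_dominated_convergence_norm[where w = "%x. 2 * norm (f x)"])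
  show "AE x in M. norm (s j x) <= 2 * norm (f x)" for j using s(3) by (intro AE_I2) auto
  show "AE x in M. (%i. s i x) ----> f x" using s(2) by (intro AE_I2) auto
 qed (use fin2 in auto)
 let ?s = "%n. Bochner_Integration.simple_bochner_integral M (s n)" and ?S = "%i. \<integral>\<^sup>+x. norm (f x - s i x) \<partial>M"
 have "Cauchy ?s"
 proof (rule metric_CauchyI)
  fix e :: real assume "0 < e"
  then have "0 < ennreal (e / 2)" by auto
  from order_tendstoD(2)[OF lim this]
  obtain N where N: "!!n. N <= n ==> ?S n < e / 2" by (auto simp: eventually_sequentially)
  show "\<exists>N. \<forall>m\<ge>N. \<forall>n\<ge>N. dist (?s m) (?s n) < e"
  proof (intro exI allI impI)
   fix m n assume m: "N <= m" and n: "N <= n"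
   have "ennreal (norm (?s m - ?s n)) <= ?S m + ?S n" by (intro simple_bochner_integral_bounded sI f)
   also have "\<dots> < ennreal (e / 2) + e / 2" by (intro add_strict_mono N m n)
   also have "\<dots> = e" using \<open>0 < e\<close> by (simp flip: ennreal_plus)
   finally show "dist (?s m) (?s n) < e" using \<open>0 < e\<close> by (simp add: dist_norm ennreal_less_iff)
  qed
 qed
 then have "convergent ?s" by (rule Cauchy_convergent)
 then obtain x where "?s ----> x" unfolding convergent_def ..
 from has_bochner_integral.intros[OF f sI lim this] show ?thesis by (auto simp: integrable.simps)
qed

text \<open>
 The conditional law of the second coordinate is the law of the noise representation with the first coordinate
 fixed.
\<close>
lemma disintegration_exists:
 assumes \<Phi>: "\<Phi> \<in> TP2"
 shows "\<exists>\<kappa>. is_disintegration \<Phi> \<kappa>"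
proof -
 note TD = TP2D[OF \<Phi>]
 note [measurable_cong] = TD(2)
 interpret prob_space \<Phi> by (rule TD)
 interpret unif: prob_space unif by (rule prob_space_unif)
 have "sets \<Phi> = sets (borel \<Otimes>\<^sub>M borel)" unfolding borel_prod by (rule TD(2))
 from noise_outsourcing[OF TD(1) this]
 obtain Q where Q [measurable]: "Q \<in> borel_measurable (borel \<Otimes>\<^sub>M borel)"
  and eq: "\<Phi> = distr (noised (base \<Phi>)) (borel \<Otimes>\<^sub>M borel) (%(y, u). (y, Q (y, u)))"
  unfolding base_def by blast
 have sb [measurable_cong]: "sets (base \<Phi>) = sets borel" by (simp add: base_def)
 define \<kappa> where "\<kappa> x = distr unif borel (%u. Q (x, u))" for x
 have su: "sets unif = sets borel" by simp
 have Qx: "(%u. Q (x, u)) \<in> borel_measurable unif" for x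
  using measurable_compose[OF measurable_Pair1' Q, of x] by (simp add: measurable_cong_sets[OF su refl])
 have \<kappa>m: "\<kappa> \<in> borel \<rightarrow>\<^sub>M prob_algebra borel"
  unfolding \<kappa>_def[abs_def]
 proof (rule measurable_distr_prob_space2)
  show "(%x. unif) \<in> borel \<rightarrow>\<^sub>M prob_algebra borel"
   by (rule measurable_const) (simp add: space_prob_algebra prob_space_unif)
  show "(%(x, u). Q (x, u)) \<in> borel \<Otimes>\<^sub>M borel \<rightarrow>\<^sub>M borel" using Q by simp
 qed
 have "emeasure \<Phi> (A \<times> B) = (\<integral>\<^sup>+x\<in>A. emeasure (\<kappa> x) B \<partial>base \<Phi>)" if [measurable]: "A \<in> sets borel" "B \<in> sets borel" for A B
 proof -
  have "emeasure \<Phi> (A \<times> B) = emeasure (noised (base \<Phi>)) {z \<in> space (noised (base \<Phi>)). fst z \<in> A \<and> Q z \<in> B}"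
   by (subst eq, subst emeasure_distr) (auto intro!: arg_cong2[where f=emeasure])
  also have "\<dots> = (nn_integral (base \<Phi>) (%x. nn_integral unif (%u. indicator {z \<in> space (noised (base \<Phi>)). fst z \<in> A \<and> Q z \<in> B} (x, u))))"
   by (rule unif.emeasure_pair_measure) measurable
  also have "\<dots> = (\<integral>\<^sup>+x\<in>A. emeasure (\<kappa> x) B \<partial>base \<Phi>)"
  proof (rule nn_integral_cong)
   fix x
   have "emeasure (\<kappa> x) B = emeasure unif ((%u. Q (x, u)) -` B \<inter> space unif)"
    unfolding \<kappa>_def by (rule emeasure_distr[OF Qx]) simp
   also have "\<dots> = (nn_integral unif (%u. indicator ((%u. Q (x, u)) -` B \<inter> space unif) u))"
    using measurable_sets[OF Qx, of B x] by simp
   finally have "emeasure (\<kappa> x) B * indicator A x = (nn_integral unif (%u. indicator ((%u. Q (x, u)) -` B \<inter> space unif) u)) * indicator A x" by simp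
   moreover have "(nn_integral unif (%u. indicator {z \<in> space (noised (base \<Phi>)). fst z \<in> A \<and> Q z \<in> B} (x, u)))
     = (nn_integral unif (%u. indicator ((%u. Q (x, u)) -` B \<inter> space unif) u)) * indicator A x"
    using sets_eq_imp_space_eq[OF sb]
    by (cases "x \<in> A") (auto intro!: nn_integral_cong simp: space_pair_measure split: split_indicator)
   ultimately show "(nn_integral unif (%u. indicator {z \<in> space (noised (base \<Phi>)). fst z \<in> A \<and> Q z \<in> B} (x, u)))
     = emeasure (\<kappa> x) B * indicator A x" by simp
  qed
  finally show ?thesis .
 qed
 then show ?thesis using \<kappa>m unfolding is_disintegration_def by blast
qed

lemma disintegration_nn_integral:
 fixes \<Phi> :: "('x::{real_inner, polish_space} \<times> 'x) measure"
 assumes \<Phi>: "\<Phi> \<in> TP2" and dis: "is_disintegration \<Phi> \<kappa>" and f: "f \<in> borel_measurable borel"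
 shows "(nn_integral \<Phi> (%z. f z)) = (nn_integral (base \<Phi>) (%x. nn_integral (\<kappa> x) (%v. f (x, v))))"
proof -
 note TD = TP2D[OF \<Phi>]
 interpret prob_space \<Phi> by (rule TD)
 have sb [measurable_cong]: "sets (base \<Phi>) = sets borel" and spb: "space (base \<Phi>) = UNIV" by (simp_all add: base_def)
 have \<kappa> [measurable]: "\<kappa> \<in> borel \<rightarrow>\<^sub>M prob_algebra borel"
  and \<kappa>e: "!!A B. A \<in> sets borel ==> B \<in> sets borel ==> emeasure \<Phi> (A \<times> B) = (\<integral>\<^sup>+x\<in>A. emeasure (\<kappa> x) B \<partial>base \<Phi>)"
  using dis by (auto simp: is_disintegration_def)
 have \<kappa>s: "\<kappa> \<in> base \<Phi> \<rightarrow>\<^sub>M subprob_algebra borel"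
  using measurable_prob_algebraD[OF \<kappa>] by (simp add: measurable_cong_sets[OF sb refl])
 have s\<kappa> [measurable_cong]: "sets (\<kappa> x) = sets borel" for x
  using sets_kernel[OF \<kappa>s, of x] spb by auto
 have sp\<kappa>: "space (\<kappa> x) = UNIV" for x using sets_eq_imp_space_eq[OF s\<kappa>, of x] by simp
 define L where "L x = distr (\<kappa> x) (borel \<Otimes>\<^sub>M borel) (Pair x)" for x
 have Lm: "L \<in> base \<Phi> \<rightarrow>\<^sub>M subprob_algebra (borel \<Otimes>\<^sub>M borel)"
  unfolding L_def[abs_def] by (rule measurable_distr2[OF _ \<kappa>s]) simp
 have Px: "Pair x \<in> \<kappa> x \<rightarrow>\<^sub>M borel \<Otimes>\<^sub>M borel" for x by measurable
 let ?E = "{A \<times> B | A B. A \<in> sets (borel::'x measure) \<and> B \<in> sets (borel::'x measure)}"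
 have "\<Phi> = base \<Phi> \<bind> L"
 proof (rule measure_eqI_generator_eq[OF Int_stable_pair_measure_generator[of borel borel], where \<Omega>=UNIV and A="%_. UNIV"])
  show "?E \<subseteq> Pow UNIV" by simp
  show "sets \<Phi> = sigma_sets UNIV ?E" unfolding TD(2) using sets_pair_measure[of "borel::'x measure" "borel::'x measure"] by (simp only: borel_prod space_borel UNIV_Times_UNIV)
  show "sets (base \<Phi> \<bind> L) = sigma_sets UNIV ?E"
   using sets_bind[OF sets_kernel[OF Lm], of "base \<Phi>"] spb sets_pair_measure[of "borel::'x measure" "borel::'x measure"] by simp
  have UE: "(UNIV :: ('x \<times> 'x) set) \<in> ?E" by (intro CollectI exI[of _ UNIV] conjI) auto
  show "range (%_. UNIV) \<subseteq> ?E" by (rule image_subsetI) (rule UE)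
  show "emeasure \<Phi> UNIV ~= \<infinity>" using emeasure_space_1 TD(3) by simp
  fix X assume "X \<in> ?E"
  then obtain A B where X: "X = A \<times> B" and [measurable]: "A \<in> sets borel" "B \<in> sets borel" by blast
  have "emeasure (base \<Phi> \<bind> L) X = (nn_integral (base \<Phi>) (%x. emeasure (L x) X))"
   by (rule emeasure_bind[OF _ Lm]) (auto simp: spb X)
  also have "\<dots> = (\<integral>\<^sup>+x\<in>A. emeasure (\<kappa> x) B \<partial>base \<Phi>)"
  proof (rule nn_integral_cong)
   fix x
   have "emeasure (L x) X = emeasure (\<kappa> x) (Pair x -` (A \<times> B))"
    unfolding L_def X by (subst emeasure_distr[OF Px]) (auto simp: sp\<kappa>)
   then show "emeasure (L x) X = emeasure (\<kappa> x) B * indicator A x"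
    by (cases "x \<in> A") (auto simp: vimage_def)
  qed
  finally show "emeasure \<Phi> X = emeasure (base \<Phi> \<bind> L) X" using \<kappa>e[of A B] X by simp
 qed simp
 then have "(nn_integral \<Phi> (%z. f z)) = (\<integral>\<^sup>+z. f z \<partial>(base \<Phi> \<bind> L))" by simp
 also have "\<dots> = (nn_integral (base \<Phi>) (%x. nn_integral (L x) (%z. f z)))"
  by (rule nn_integral_bind[OF _ Lm]) (use f in "simp add: borel_prod")
 also have "\<dots> = (nn_integral (base \<Phi>) (%x. nn_integral (\<kappa> x) (%v. f (x, v))))"
  unfolding L_def using f by (subst nn_integral_distr[OF Px]) (auto simp: borel_prod)
 finally show ?thesis .
qed

lemma disintegration_integral_nonneg:
 fixes \<Phi> :: "('x::{real_inner, polish_space} \<times> 'x) measure" and f :: "'x \<times> 'x => real"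
 assumes \<Phi>: "\<Phi> \<in> TP2" and dis: "is_disintegration \<Phi> \<kappa>" and f0: "!!z. 0 <= f z" and fI: "integrable \<Phi> f"
  and h: "h \<in> borel_measurable borel" and ae: "AE x in base \<Phi>. has_bochner_integral (\<kappa> x) (%v. f (x, v)) (h x)"
 shows "has_bochner_integral (base \<Phi>) h (LINT z|\<Phi>. f z)"
proof (rule has_bochner_integral_nn_integral)
 have f: "f \<in> borel_measurable borel"
  using borel_measurable_integrable[OF fI] by (simp add: measurable_cong_sets[OF TP2D(2)[OF \<Phi>] refl])
 have "(nn_integral (base \<Phi>) (%x. ennreal (h x))) = (nn_integral (base \<Phi>) (%x. nn_integral (\<kappa> x) (%v. ennreal (f (x, v)))))"
  by (intro nn_integral_cong_AE, rule eventually_mono[OF ae]) (auto simp: nn_integral_eq_integral f0 has_bochner_integral_iff)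
 also have "\<dots> = ennreal (LINT z|\<Phi>. f z)"
  using f by (subst disintegration_nn_integral[OF \<Phi> dis, symmetric]) (auto simp: nn_integral_eq_integral fI f0)
 finally show "(nn_integral (base \<Phi>) (%x. ennreal (h x))) = ennreal (LINT z|\<Phi>. f z)" .
 show "h \<in> borel_measurable (base \<Phi>)" using h by (simp add: base_def)
 show "AE x in base \<Phi>. 0 <= h x"
  by (rule eventually_mono[OF ae]) (auto dest!: has_bochner_integral_integral_eq[symmetric] simp: f0)
qed (simp add: f0)

lemma barycenter_inner:
 fixes \<Phi> :: "('x::{real_inner, polish_space} \<times> 'x) measure"
 assumes \<Phi>: "\<Phi> \<in> TP2"
 shows "barycenter \<Phi> \<in> L2_fields (base \<Phi>)"
  and "\<xi> \<in> L2_fields (base \<Phi>) ==> (LINT x|base \<Phi>. barycenter \<Phi> x \<bullet> \<xi> x) = (LINT z|\<Phi>. \<xi> (fst z) \<bullet> snd z)"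
proof -
 note TD = TP2D[OF \<Phi>]
 interpret prob_space \<Phi> by (rule TD)
 have sb [measurable_cong]: "sets (base \<Phi>) = sets borel" by (simp add: base_def)
 have s\<Phi> [measurable_cong]: "sets \<Phi> = sets borel" by (rule TD)
 define \<kappa> where "\<kappa> = (SOME \<kappa>. is_disintegration \<Phi> \<kappa>)"
 have dis: "is_disintegration \<Phi> \<kappa>" unfolding \<kappa>_def by (rule someI_ex[OF disintegration_exists[OF \<Phi>]])
 have b: "barycenter \<Phi> x = (LINT v|\<kappa> x. v)" for x by (simp add: barycenter_def \<kappa>_def)
 have \<kappa>p: "\<kappa> \<in> borel \<rightarrow>\<^sub>M prob_algebra borel" using dis by (simp add: is_disintegration_def)
 have \<kappa> [measurable]: "\<kappa> \<in> borel \<rightarrow>\<^sub>M subprob_algebra borel" using \<kappa>p by (rule measurable_prob_algebraD)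
 have s\<kappa> [measurable_cong]: "sets (\<kappa> x) = sets borel" for x using sets_kernel[OF \<kappa>, of x] by simp
 have p\<kappa>: "prob_space (\<kappa> x)" for x using measurable_space[OF \<kappa>p, of x] by (simp add: space_prob_algebra)
 define G where "G = {x. (nn_integral (\<kappa> x) (%v. ennreal (norm v))) < \<infinity>}"
 have nm: "(%x. \<integral>\<^sup>+v. ennreal (norm v) \<partial>\<kappa> x) \<in> borel_measurable borel"
  by (rule nn_integral_measurable_subprob_algebra2[OF _ \<kappa>]) measurable
 have nm2: "(%x. \<integral>\<^sup>+v. ennreal ((norm v)^2) \<partial>\<kappa> x) \<in> borel_measurable borel"
  by (rule nn_integral_measurable_subprob_algebra2[OF _ \<kappa>]) measurable
 have Gm: "G \<in> sets borel" unfolding G_def using nm by measurable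
 have good: "integrable (\<kappa> x) (%v. v)" if "x \<in> G" for x
  by (rule integrable_of_finite_norm) (use that in "auto simp: G_def measurable_cong_sets[OF s\<kappa> refl]")
 have bad: "barycenter \<Phi> x = 0" if "x \<notin> G" for x
 proof -
  have "\<not> integrable (\<kappa> x) (%v. v)"
  proof
   assume "integrable (\<kappa> x) (%v. v)"
   then have "has_bochner_integral (\<kappa> x) (%v. v) (integral\<^sup>L (\<kappa> x) (%v. v))" by (rule has_bochner_integral_integrable)
   from has_bochner_integral_implies_finite_norm[OF this] show False using that by (simp add: G_def)
  qed
  then show ?thesis unfolding b by (rule not_integrable_integral_eq)
 qed
 have binner: "barycenter \<Phi> x \<bullet> w = indicator G x * (LINT v|\<kappa> x. v \<bullet> w)" for x w
  using good[of x] bad[of x] by (cases "x \<in> G") (auto simp: b)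
 obtain q :: "nat => 'x" where q: "dense_seq q" using dense_seq_exists by blast
 have bm [measurable]: "barycenter \<Phi> \<in> borel_measurable borel"
 proof (rule measurable_weakly[OF q])
  fix i
  have "(%x. \<integral>v. v \<bullet> q i \<partial>\<kappa> x) \<in> borel_measurable borel"
   by (rule measurable_compose[OF \<kappa> integral_measurable_subprob_algebra]) measurable
  then show "(%x. barycenter \<Phi> x \<bullet> q i) \<in> borel_measurable borel"
   unfolding binner using Gm by measurable
 qed
 have jensen: "ennreal ((norm (barycenter \<Phi> x))^2) <= (nn_integral (\<kappa> x) (%v. ennreal ((norm v)^2)))" for x
 proof (cases "(nn_integral (\<kappa> x) (%v. ennreal ((norm v)^2))) < \<infinity> \<and> x \<in> G")
  case True
  interpret \<kappa>: prob_space "\<kappa> x" by (rule p\<kappa>)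
  have i2: "integrable (\<kappa> x) (%v. (norm v)^2)"
   by (rule integrableI_nonneg) (use True in "auto simp: measurable_cong_sets[OF s\<kappa> refl]")
  let ?b = "barycenter \<Phi> x"
  have i1: "integrable (\<kappa> x) (%v. v \<bullet> ?b)" using good True by simp
  have "0 <= (LINT v|\<kappa> x. (norm (v - ?b))^2)" by simp
  also have "\<dots> = (LINT v|\<kappa> x. (norm v)^2 - 2 * (v \<bullet> ?b) + (norm ?b)^2)"
   by (simp add: power2_norm_eq_inner inner_diff inner_commute algebra_simps)
  also have "\<dots> = (LINT v|\<kappa> x. (norm v)^2) - 2 * (LINT v|\<kappa> x. v \<bullet> ?b) + (norm ?b)^2"
   using i1 i2 by (simp add: \<kappa>.prob_space)
  also have "(LINT v|\<kappa> x. v \<bullet> ?b) = (norm ?b)^2" using binner[of x ?b] True by (simp add: power2_norm_eq_inner)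
  finally have "(norm ?b)^2 <= (LINT v|\<kappa> x. (norm v)^2)" by simp
  then show ?thesis using i2 by (simp add: nn_integral_eq_integral)
 next
  case False
  then show ?thesis using bad[of x] by (cases "x \<in> G") (auto simp: not_less_iff_gr_or_eq top.not_eq_extremum[symmetric])
 qed
 have "(nn_integral (base \<Phi>) (%x. ennreal ((norm (barycenter \<Phi> x))^2))) <= (nn_integral (base \<Phi>) (%x. nn_integral (\<kappa> x) (%v. ennreal ((norm v)^2))))"
  by (intro nn_integral_mono jensen)
 also have veq: "\<dots> = (nn_integral \<Phi> (%z. ennreal ((norm (snd z))^2)))"
  by (subst disintegration_nn_integral[OF \<Phi> dis]) auto
 also have vfin: "\<dots> < \<infinity>" using TD(5) by (simp add: nn_integral_eq_integral)
 finally have fin: "(nn_integral (base \<Phi>) (%x. ennreal ((norm (barycenter \<Phi> x))^2))) < \<infinity>" .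
 show L2: "barycenter \<Phi> \<in> L2_fields (base \<Phi>)"
  unfolding L2_fields_def using fin by (auto intro!: integrableI_nonneg)
 assume "\<xi> \<in> L2_fields (base \<Phi>)"
 then have [measurable]: "\<xi> \<in> borel_measurable borel" and \<xi>2: "integrable (base \<Phi>) (%x. (norm (\<xi> x))^2)"
  by (auto simp: L2_fields_def)
 have \<xi>3: "has_bochner_integral \<Phi> (%z. (norm (\<xi> (fst z)))^2) (LINT x|base \<Phi>. (norm (\<xi> x))^2)"
  using \<xi>2 unfolding base_def by (subst (asm) integrable_distr_eq) (auto simp: has_bochner_integral_iff integral_distr)
 have \<xi>v: "integrable \<Phi> (%z. \<xi> (fst z) \<bullet> snd z)"
  by (rule inner_cauchy_schwarz_integral(1)) (use \<xi>3 TD(5) in "auto simp: has_bochner_integral_iff")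
 have b\<xi>: "integrable (base \<Phi>) (%x. barycenter \<Phi> x \<bullet> \<xi> x)"
  by (rule inner_cauchy_schwarz_integral(1)) (use L2 \<xi>2 in "auto simp: L2_fields_def")
 define m where "m x = enn2real (nn_integral (\<kappa> x) (%v. ennreal ((norm v)^2)))" for x
 have mm [measurable]: "m \<in> borel_measurable borel" unfolding m_def using nm2 by measurable
 have "(nn_integral (base \<Phi>) (%x. nn_integral (\<kappa> x) (%v. ennreal ((norm v)^2)))) ~= \<infinity>"
  using vfin unfolding veq by simp
 then have "AE x in base \<Phi>. (nn_integral (\<kappa> x) (%v. ennreal ((norm v)^2))) ~= \<infinity>"
  using nm2 by (intro nn_integral_noteq_infinite) (simp_all add: base_def)
 then have ae: "AE x in base \<Phi>. has_bochner_integral (\<kappa> x) (%v. (norm v)^2) (m x)"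
 proof (rule eventually_mono)
  fix x assume "(nn_integral (\<kappa> x) (%v. ennreal ((norm v)^2))) ~= \<infinity>"
  then show "has_bochner_integral (\<kappa> x) (%v. (norm v)^2) (m x)"
   by (intro has_bochner_integral_nn_integral) (auto simp: m_def measurable_cong_sets[OF s\<kappa> refl] less_top)
 qed
 have mI: "has_bochner_integral (base \<Phi>) m (LINT z|\<Phi>. (norm (snd z))^2)"
  by (rule disintegration_integral_nonneg[OF \<Phi> dis _ TD(5) mm]) (use ae in auto)
 \<comment> \<open>Polarization: the integrals of \<open>\<bar>\<xi> x + v\<bar>\<^sup>2\<close> over \<open>\<Phi>\<close> and over the fibres agree.\<close>
  have "has_bochner_integral (base \<Phi>) (%x. (norm (\<xi> x))^2 + 2 * (barycenter \<Phi> x \<bullet> \<xi> x) + m x) (LINT z|\<Phi>. (norm (\<xi> (fst z) + snd z))^2)"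
 proof (rule disintegration_integral_nonneg[OF \<Phi> dis])
  show "integrable \<Phi> (%z. (norm (\<xi> (fst z) + snd z))^2)"
   by (rule integrable_norm_add_sq) (use \<xi>3 TD(5) in "auto simp: has_bochner_integral_iff")
  show "AE x in base \<Phi>. has_bochner_integral (\<kappa> x) (%v. (norm (\<xi> (fst (x, v)) + snd (x, v)))^2)
    ((norm (\<xi> x))^2 + 2 * (barycenter \<Phi> x \<bullet> \<xi> x) + m x)"
   using ae
  proof (rule eventually_mono)
   fix x assume v2: "has_bochner_integral (\<kappa> x) (%v. (norm v)^2) (m x)"
   interpret \<kappa>: prob_space "\<kappa> x" by (rule p\<kappa>)
   have "integrable (\<kappa> x) norm"
    using \<kappa>.square_integrable_imp_integrable[of norm] v2 by (auto simp: has_bochner_integral_iff measurable_cong_sets[OF s\<kappa> refl])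
   then have "x \<in> G" by (simp add: G_def nn_integral_eq_integral)
   then have "has_bochner_integral (\<kappa> x) (%v. v \<bullet> \<xi> x) (barycenter \<Phi> x \<bullet> \<xi> x)"
    using good[of x] by (simp add: has_bochner_integral_iff binner)
   then have "has_bochner_integral (\<kappa> x) (%v. (norm (\<xi> x))^2 + 2 * (v \<bullet> \<xi> x) + (norm v)^2)
     ((norm (\<xi> x))^2 + 2 * (barycenter \<Phi> x \<bullet> \<xi> x) + m x)"
    using v2 by (auto simp: has_bochner_integral_iff \<kappa>.prob_space)
   then show "has_bochner_integral (\<kappa> x) (%v. (norm (\<xi> (fst (x, v)) + snd (x, v)))^2)
     ((norm (\<xi> x))^2 + 2 * (barycenter \<Phi> x \<bullet> \<xi> x) + m x)"
    by (simp add: power2_norm_eq_inner inner_add inner_commute algebra_simps)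
  qed
 qed auto
 then have "(LINT z|\<Phi>. (norm (\<xi> (fst z) + snd z))^2)
   = (LINT x|base \<Phi>. (norm (\<xi> x))^2) + 2 * (LINT x|base \<Phi>. barycenter \<Phi> x \<bullet> \<xi> x) + (LINT z|\<Phi>. (norm (snd z))^2)"
  using \<xi>2 b\<xi> mI by (simp add: has_bochner_integral_iff)
 moreover have "(LINT z|\<Phi>. (norm (\<xi> (fst z) + snd z))^2)
   = (LINT z|\<Phi>. (norm (\<xi> (fst z)))^2 + 2 * (\<xi> (fst z) \<bullet> snd z) + (norm (snd z))^2)"
  by (simp add: power2_norm_eq_inner inner_add inner_commute algebra_simps)
 ultimately show "(LINT x|base \<Phi>. barycenter \<Phi> x \<bullet> \<xi> x) = (LINT z|\<Phi>. \<xi> (fst z) \<bullet> snd z)"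
  using \<xi>3 \<xi>v TD(5) by (simp add: has_bochner_integral_iff)
qed

abbreviation (input) tested :: "('x::real_inner => real) => ('x \<times> 'x) measure => real" where
 "tested \<phi> \<Phi> \<equiv> (LINT z|\<Phi>. grad \<phi> (fst z) \<bullet> snd z)"

abbreviation (input) L2norm :: "'x::real_inner measure => ('x => 'x) => real" where
 "L2norm \<mu> f \<equiv> sqrt (LINT x|\<mu>. (norm (f x))^2)"

abbreviation (input) shifted :: "'x::real_inner measure => real => ('x => 'x) => 'x measure" where
 "shifted \<mu> r v \<equiv> distr \<mu> borel (%x. x + r *\<^sub>R v x)"

abbreviation (input) grad_diff :: "('x::real_inner => real) => nat => (nat => real) => (nat => 'x => real) => 'x => 'x" where
 "grad_diff \<psi> n a \<phi> x \<equiv> grad \<psi> x - (\<Sum>k<n. a k *\<^sub>R grad (\<phi> k) x)"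

abbreviation (input) grad_approx :: "('x::real_inner => real) set => ('x => real) => bool" where
 "grad_approx D \<phi> \<equiv> \<exists>\<Phi> K. (\<forall>n. \<Phi> n \<in> D) \<and> (\<forall>n x. norm (grad (\<Phi> n) x) <= K) \<and> (\<forall>x. (%n. grad (\<Phi> n) x) ----> grad \<phi> x)"

text \<open>
 \<open>L\<close> is linear and bounded as a function of the gradient. The combination of functions is never
 formed, because it need not be cylindrical.
\<close>
abbreviation (input) L2_continuous_linear :: "'x::{real_inner, polish_space} measure => real => (('x => real) => real) => bool" where
 "L2_continuous_linear \<mu> C L \<equiv> \<forall>(n::nat) a \<phi> \<psi>. (\<forall>k. \<phi> k \<in> Cyl) --> \<psi> \<in> Cyl -->
   \<bar>L \<psi> - (\<Sum>k<n. a k * L (\<phi> k))\<bar> <= C * L2norm \<mu> (grad_diff \<psi> n a \<phi>)"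

lemma L2_inner_diff:
 assumes \<mu>: "\<mu> \<in> P2" and f: "f \<in> L2_fields \<mu>" and g: "g \<in> L2_fields \<mu>"
 shows "(%x. f x - g x) \<in> L2_fields \<mu>" "integrable \<mu> (%x. f x \<bullet> g x)"
  "abs (LINT x|\<mu>. f x \<bullet> g x) <= L2norm \<mu> f * L2norm \<mu> g"
proof -
 have fm: "f \<in> borel_measurable \<mu>" and gm: "g \<in> borel_measurable \<mu>" and [measurable]: "f \<in> borel_measurable borel" "g \<in> borel_measurable borel"
  using f g by (auto simp: L2_fields_def measurable_cong_sets[OF P2D(2)[OF \<mu>] refl])
 have i: "integrable \<mu> (%x. (norm (f x))^2)" "integrable \<mu> (%x. (norm (g x))^2)" using f g by (auto simp: L2_fields_def)
 show "(%x. f x - g x) \<in> L2_fields \<mu>" unfolding L2_fields_def using integrable_norm_diff_sq[OF fm gm i] by simp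
 show "integrable \<mu> (%x. f x \<bullet> g x)"
  "abs (LINT x|\<mu>. f x \<bullet> g x) <= L2norm \<mu> f * L2norm \<mu> g"
  by (rule inner_cauchy_schwarz_integral[OF fm gm i])+
qed

lemma Cyl_grad_L2:
 assumes \<mu>: "\<mu> \<in> P2" and \<phi>: "\<phi> \<in> Cyl"
 shows "grad \<phi> \<in> L2_fields \<mu>"
proof -
 interpret prob_space \<mu> by (rule P2D[OF \<mu>])
 obtain B where B: "c11_bound B \<phi>" using Cyl_c11_bound[OF \<phi>] by blast
 have m: "grad \<phi> \<in> borel_measurable borel" by (rule borel_measurable_continuous_onI[OF c11_continuous_grad[OF B]])
 then have m': "grad \<phi> \<in> borel_measurable \<mu>" by (simp add: measurable_cong_sets[OF P2D(2)[OF \<mu>] refl])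
 have "integrable \<mu> (%x. (norm (grad \<phi> x))^2)"
  by (rule integrable_const_bound[of _ "B^2"]) (use m' B in "auto simp: c11_bound_def intro!: power_mono")
 with m show ?thesis by (simp add: L2_fields_def)
qed

text \<open>
 The hypothesis says that \<open>barycenter \<Phi> - v\<close> is orthogonal to all gradients. Orthogonality
 determines the tangential part almost everywhere, so that the arbitrary choice in \<open>tan_proj\<close> is
 harmless.
\<close>
lemma tan_proj_barycenter:
 assumes \<Phi>: "\<Phi> \<in> TP2" and b\<Phi>: "base \<Phi> = \<mu>" and v: "v \<in> Tan \<mu>"
  and eq: "!!\<phi>. \<phi> \<in> Cyl ==> tested \<phi> \<Phi> = (LINT x|\<mu>. v x \<bullet> grad \<phi> x)"
 shows "AE x in \<mu>. v x = tan_proj \<mu> (barycenter \<Phi>) x"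
proof -
 have \<mu>: "\<mu> \<in> P2" using base_P2[OF \<Phi>] b\<Phi> by simp
 let ?b = "barycenter \<Phi>"
 have b: "?b \<in> L2_fields \<mu>" using barycenter_inner(1)[OF \<Phi>] b\<Phi> by simp
 have TL: "f \<in> Tan \<mu> ==> f \<in> L2_fields \<mu>" for f by (simp add: Tan_def)
 note D = L2_inner_diff[OF \<mu>]
 have orth: "(LINT x|\<mu>. (?b x - v x) \<bullet> \<xi> x) = 0" if \<xi>: "\<xi> \<in> Tan \<mu>" for \<xi>
 proof -
  define w where "w x = ?b x - v x" for x
  have w: "w \<in> L2_fields \<mu>" unfolding w_def by (rule D(1)[OF b TL[OF v]])
  define K where "K = L2norm \<mu> w"
  have K0: "0 <= K" by (simp add: K_def)
  have "abs (LINT x|\<mu>. w x \<bullet> \<xi> x) <= 0 + e" if e: "0 < e" for e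
  proof -
   have "0 < e / (K + 1)" using e K0 by simp
   then obtain \<phi> where \<phi>: "\<phi> \<in> Cyl" and close: "L2norm \<mu> (%x. \<xi> x - grad \<phi> x) < e / (K + 1)"
    using \<xi> unfolding Tan_def by blast
   have gL: "grad \<phi> \<in> L2_fields \<mu>" by (rule Cyl_grad_L2[OF \<mu> \<phi>])
   have "(LINT x|\<mu>. w x \<bullet> grad \<phi> x) = (LINT x|\<mu>. ?b x \<bullet> grad \<phi> x) - (LINT x|\<mu>. v x \<bullet> grad \<phi> x)"
    unfolding w_def inner_diff_left by (rule Bochner_Integration.integral_diff) (intro D(2) b gL TL v)+
   also have "\<dots> = 0" using eq[OF \<phi>] barycenter_inner(2)[OF \<Phi>, of "grad \<phi>"] gL b\<Phi> by simp
   finally have "(LINT x|\<mu>. w x \<bullet> \<xi> x) = (LINT x|\<mu>. w x \<bullet> (\<xi> x - grad \<phi> x))"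
    using D(2)[OF w TL[OF \<xi>]] D(2)[OF w gL] by (simp add: inner_diff_right)
   then have "abs (LINT x|\<mu>. w x \<bullet> \<xi> x) <= K * L2norm \<mu> (%x. \<xi> x - grad \<phi> x)"
    using D(3)[OF w D(1)[OF TL[OF \<xi>] gL]] by (simp add: K_def)
   also have "\<dots> <= (K + 1) * (e / (K + 1))" using close K0 by (intro mult_mono) auto
   also have "\<dots> = e" using K0 by simp
   finally show ?thesis by simp
  qed
  then have "abs (LINT x|\<mu>. w x \<bullet> \<xi> x) <= 0" by (rule field_le_epsilon)
  then show ?thesis by (simp add: w_def)
 qed
 define u where "u = tan_proj \<mu> ?b"
 have "u \<in> Tan \<mu> \<and> (\<forall>\<xi>\<in>Tan \<mu>. (LINT x|\<mu>. (?b x - u x) \<bullet> \<xi> x) = 0)"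
  unfolding u_def tan_proj_def by (rule someI[of _ v]) (use v orth in blast)
 then have u: "u \<in> Tan \<mu>" and uorth: "!!\<xi>. \<xi> \<in> Tan \<mu> ==> (LINT x|\<mu>. (?b x - u x) \<bullet> \<xi> x) = 0" by auto
 have bv: "(%x. ?b x - v x) \<in> L2_fields \<mu>" and bu: "(%x. ?b x - u x) \<in> L2_fields \<mu>"
  by (intro D(1) b TL u v)+
 have "(LINT x|\<mu>. (norm (u x - v x))^2) = (LINT x|\<mu>. (?b x - v x) \<bullet> u x - (?b x - v x) \<bullet> v x - ((?b x - u x) \<bullet> u x - (?b x - u x) \<bullet> v x))"
  by (rule Bochner_Integration.integral_cong) (auto simp: power2_norm_eq_inner inner_diff inner_commute)
 also have "\<dots> = 0"
  using D(2)[OF bv TL[OF u]] D(2)[OF bv TL[OF v]] D(2)[OF bu TL[OF u]] D(2)[OF bu TL[OF v]]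
   orth[OF u] orth[OF v] uorth[OF u] uorth[OF v] by simp
 finally have z: "(LINT x|\<mu>. (norm (u x - v x))^2) = 0" .
 have i: "integrable \<mu> (%x. (norm (u x - v x))^2)" using D(1)[OF TL[OF u] TL[OF v]] by (simp add: L2_fields_def)
 have "AE x in \<mu>. (norm (u x - v x))^2 = 0"
  using integral_nonneg_eq_0_iff_AE[OF i] z by simp
 then show ?thesis unfolding u_def[symmetric] by (rule eventually_mono) simp
qed

section \<open>The Moreau envelope as a Kantorovich potential\<close>

definition moreau :: "real => ('x::real_inner => real) => 'x => real" where
 "moreau r \<phi> y = (INF x. (norm (x - y))^2 / 2 + r * \<phi> x)"

lemma c11D:
 assumes "c11_bound B \<phi>"
 shows "0 < B" "abs (\<phi> x) <= B" "norm (grad \<phi> x) <= B" "norm (grad \<phi> y - grad \<phi> x) <= B * norm (y - x)"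
  "abs (\<phi> y - \<phi> x - grad \<phi> x \<bullet> (y - x)) <= B * (norm (y - x))^2"
 using assms unfolding c11_bound_def by blast+

lemma moreau_bdd:
 assumes B: "c11_bound B \<phi>" and r: "0 < r"
 shows "- (r * B) <= (norm (x - y))^2 / 2 + r * \<phi> x"
proof -
 have "r * abs (\<phi> x) <= r * B" using c11D(2)[OF B, of x] r by (intro mult_left_mono) auto
 moreover have "r * abs (\<phi> x) = abs (r * \<phi> x)" using r by (simp add: abs_mult)
 moreover have "0 <= (norm (x - y))^2 / 2" by simp
 ultimately show ?thesis by linarith
qed

lemma moreau_bdd_below:
 assumes B: "c11_bound B \<phi>" and r: "0 < r"
 shows "bdd_below (range (%x. (norm (x - y))^2 / 2 + r * \<phi> x))"
 using moreau_bdd[OF B r] by (intro bdd_belowI[of _ "- (r * B)"]) auto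

lemma moreau_le:
 assumes B: "c11_bound B \<phi>" and r: "0 < r"
 shows "moreau r \<phi> y <= (norm (x - y))^2 / 2 + r * \<phi> x"
 unfolding moreau_def by (rule cINF_lower[OF moreau_bdd_below[OF B r]]) simp

lemma moreau_ge: "(!!x. K <= (norm (x - y))^2 / 2 + r * \<phi> x) ==> K <= moreau r \<phi> y"
 unfolding moreau_def by (rule cINF_greatest) auto

lemma moreau_bounded:
 assumes B: "c11_bound B \<phi>" and r: "0 < r"
 shows "abs (moreau r \<phi> y) <= r * B"
proof -
 have "moreau r \<phi> y <= r * \<phi> y" using moreau_le[OF B r, of y y] by simp
 also have "\<dots> <= r * B" using c11D(2)[OF B, of y] r by (intro mult_left_mono) auto
 finally have "moreau r \<phi> y <= r * B" .
 moreover have "- (r * B) <= moreau r \<phi> y" by (rule moreau_ge, rule moreau_bdd[OF B r])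
 ultimately show ?thesis by linarith
qed

lemma moreau_measurable:
 fixes \<phi> :: "'x::{real_inner, polish_space} => real"
 assumes B: "c11_bound B \<phi>" and r: "0 < r"
 shows "moreau r \<phi> \<in> borel_measurable borel"
proof (rule borel_measurable_iff_less[THEN iffD2], rule allI)
 fix c
 have "{y \<in> space borel. moreau r \<phi> y < c} = (\<Union>x. {y. (norm (x - y))^2 / 2 + r * \<phi> x < c})"
  unfolding moreau_def using cINF_less_iff[OF _ moreau_bdd_below[OF B r]] by auto
 moreover have "open \<dots>" by (intro open_UN ballI open_Collect_less continuous_intros) auto
 ultimately show "{y \<in> space borel. moreau r \<phi> y < c} \<in> sets borel" by simp
qed

text \<open>
 For \<open>4 r B \<le> 1\<close> the quadratic term absorbs the second-order error of \<open>r \<phi>\<close>,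
 so that the infimum defining the envelope near \<open>x + r \<nabla>\<phi>(x)\<close> is controlled by its
 value at \<open>x\<close>.
\<close>
lemma moreau_above:
 fixes \<phi> :: "'x::real_inner => real"
 assumes B: "c11_bound B \<phi>" and r: "0 < r" "4 * r * B <= 1"
 shows "(norm (r *\<^sub>R grad \<phi> x))^2 / 2 + r * \<phi> x + r * (grad \<phi> x \<bullet> w) - (norm w)^2 / 2
  <= moreau r \<phi> (x + r *\<^sub>R grad \<phi> x + w)"
proof (rule moreau_ge)
 fix z
 define h where "h = z - x"
 have "\<phi> z - \<phi> x - grad \<phi> x \<bullet> h \<ge> - (B * (norm h)^2)" using c11D(5)[OF B, of z x] unfolding h_def by linarith
 then have "r * (\<phi> z - \<phi> x - grad \<phi> x \<bullet> h) \<ge> r * - (B * (norm h)^2)" using r by (intro mult_left_mono) auto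
 moreover have "r * B * (norm h)^2 <= 1 / 4 * (norm h)^2" using r by (intro mult_right_mono) auto
 ultimately have 1: "r * \<phi> z \<ge> r * \<phi> x + r * (grad \<phi> x \<bullet> h) - (norm h)^2 / 4" by (simp add: algebra_simps)
 have 2: "(norm (z - (x + r *\<^sub>R grad \<phi> x + w)))^2
   = (norm h)^2 + (norm (r *\<^sub>R grad \<phi> x))^2 + (norm w)^2 - 2 * r * (grad \<phi> x \<bullet> h) - 2 * (h \<bullet> w) + 2 * r * (grad \<phi> x \<bullet> w)"
  unfolding h_def power2_norm_eq_inner by (simp add: inner_diff inner_add inner_commute algebra_simps)
 have "0 <= (norm (h - 2 *\<^sub>R w))^2" by simp
 also have "\<dots> = (norm h)^2 + 4 * (norm w)^2 - 4 * (h \<bullet> w)"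
  by (simp add: power2_norm_eq_inner inner_diff inner_commute algebra_simps)
 finally have "h \<bullet> w <= (norm h)^2 / 4 + (norm w)^2" by linarith
 with 1 show "(norm (r *\<^sub>R grad \<phi> x))^2 / 2 + r * \<phi> x + r * (grad \<phi> x \<bullet> w) - (norm w)^2 / 2
   <= (norm (z - (x + r *\<^sub>R grad \<phi> x + w)))^2 / 2 + r * \<phi> z"
  unfolding 2 by argo
qed

lemma moreau_at_image:
 fixes \<phi> :: "'x::real_inner => real"
 assumes B: "c11_bound B \<phi>" and r: "0 < r" "4 * r * B <= 1"
 shows "moreau r \<phi> (x + r *\<^sub>R grad \<phi> x) = (norm (r *\<^sub>R grad \<phi> x))^2 / 2 + r * \<phi> x"
 using moreau_above[OF B r, of x 0] moreau_le[OF B r(1), of "x + r *\<^sub>R grad \<phi> x" x] by simp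

text \<open>
 By the contraction principle every \<open>y\<close> has the form \<open>x + r \<nabla>\<phi>(x)\<close>; there
 the lower bound for the envelope has slope \<open>r \<nabla>\<phi>(x)\<close>, which differs from \<open>r
 \<nabla>\<phi>(y)\<close> by \<open>r\<^sup>2 B\<^sup>2\<close> at most.
\<close>
lemma moreau_slope:
 fixes \<phi> :: "'x::{real_inner, complete_space} => real"
 assumes B: "c11_bound B \<phi>" and r: "0 < r" "4 * r * B <= 1"
 shows "moreau r \<phi> y + r * (grad \<phi> y \<bullet> w) - r^2 * B^2 * norm w - (norm w)^2 / 2 <= moreau r \<phi> (y + w)"
proof -
 have "\<exists>!x. y - r *\<^sub>R grad \<phi> x = x"
 proof (rule banach_fix_type[where c = "1/4"])
  show "\<forall>u v. dist (y - r *\<^sub>R grad \<phi> u) (y - r *\<^sub>R grad \<phi> v) <= 1 / 4 * dist u v"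
  proof (intro allI)
   fix u v
   have "dist (y - r *\<^sub>R grad \<phi> u) (y - r *\<^sub>R grad \<phi> v) = norm (r *\<^sub>R (grad \<phi> v - grad \<phi> u))"
    by (simp add: dist_norm algebra_simps)
   also have "\<dots> = r * norm (grad \<phi> v - grad \<phi> u)" using r by simp
   also have "\<dots> <= r * (B * norm (v - u))" using c11D(4)[OF B, of v u] r by (intro mult_left_mono) auto
   also have "\<dots> = (r * B) * norm (v - u)" by simp
   also have "\<dots> <= 1 / 4 * norm (v - u)" using r by (intro mult_right_mono) auto
   finally show "dist (y - r *\<^sub>R grad \<phi> u) (y - r *\<^sub>R grad \<phi> v) <= 1 / 4 * dist u v"
    by (simp add: dist_norm norm_minus_commute)
  qed
 qed auto
 then obtain x where "y - r *\<^sub>R grad \<phi> x = x" by blast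
 then have x: "x + r *\<^sub>R grad \<phi> x = y" by (simp add: diff_eq_eq)
 have "norm (grad \<phi> y - grad \<phi> x) <= B * norm (y - x)" by (rule c11D(4)[OF B])
 also have "y - x = r *\<^sub>R grad \<phi> x" using x by (simp add: algebra_simps)
 also have "B * norm (r *\<^sub>R grad \<phi> x) = B * r * norm (grad \<phi> x)" using r by simp
 also have "\<dots> <= B * r * B" using c11D(1,3)[OF B] r by (intro mult_left_mono) auto
 finally have "norm (grad \<phi> y - grad \<phi> x) * norm w <= B * r * B * norm w" by (rule mult_right_mono) simp
 then have "(grad \<phi> y - grad \<phi> x) \<bullet> w <= B * r * B * norm w"
  using norm_cauchy_schwarz[of "grad \<phi> y - grad \<phi> x" w] by linarith
 then have "r * ((grad \<phi> y - grad \<phi> x) \<bullet> w) <= r * (B * r * B * norm w)" using r by (intro mult_left_mono) auto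
 then have "r * (grad \<phi> y \<bullet> w) <= r * (grad \<phi> x \<bullet> w) + r^2 * B^2 * norm w"
  by (simp add: inner_diff_left algebra_simps power2_eq_square)
 then show ?thesis using moreau_above[OF B r, of x w] moreau_at_image[OF B r, of x] unfolding x by linarith
qed

lemma integrable_bounded_P2:
 fixes f :: "'x::{real_inner, polish_space} => real"
 assumes \<mu>: "\<mu> \<in> P2" and f: "f \<in> borel_measurable borel" and b: "!!x. abs (f x) <= C"
 shows "integrable \<mu> f"
proof -
 interpret prob_space \<mu> by (rule P2D[OF \<mu>])
 show ?thesis by (rule integrable_const_bound[of _ C]) (use f b in "auto simp: measurable_cong_sets[OF P2D(2)[OF \<mu>] refl]")
qed

text \<open>The easy half of Kantorovich duality, for the envelope and \<open>r \<phi>\<close>.\<close>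
lemma moreau_kantorovich:
 assumes B: "c11_bound B \<phi>" and r: "0 < r" and \<mu>: "\<mu> \<in> P2" and \<nu>: "\<nu> \<in> P2"
 shows "(LINT y|\<nu>. moreau r \<phi> y) - r * (LINT x|\<mu>. \<phi> x) <= (W2 \<mu> \<nu>)^2 / 2"
proof (rule field_le_epsilon)
 fix e :: real assume "0 < e"
 note [measurable_cong] = P2D(2)[OF \<mu>]
 have \<phi> [measurable]: "\<phi> \<in> borel_measurable borel" by (rule borel_measurable_continuous_onI[OF c11_continuous[OF B]])
 have gm [measurable]: "moreau r \<phi> \<in> borel_measurable borel" by (rule moreau_measurable[OF B r])
 interpret \<mu>: prob_space \<mu> by (rule P2D[OF \<mu>])
 have id: "distr \<mu> borel (%x. x) = \<mu>" by (rule distr_id2) (simp add: P2D[OF \<mu>])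
 obtain b where b [measurable]: "b \<in> borel_measurable (noised \<mu>)" and db: "distr (noised \<mu>) borel b = \<nu>"
  and near: "(LINT w|(noised \<mu>). (norm (fst w - b w))^2) < (W2 \<mu> \<nu>)^2 + e"
  using W2_near_optimal[OF \<mu>.prob_space_axioms _ id \<mu> \<nu> \<open>0 < e\<close>] by (auto simp: measurable_ident_sets[OF P2D(2)[OF \<mu>]])
 let ?P = "noised \<mu>"
 interpret P: prob_space ?P by (rule prob_space_noise[OF \<mu>.prob_space_axioms])
 have m1: "moreau r \<phi> \<in> borel_measurable \<mu>" "\<phi> \<in> borel_measurable \<mu>" by measurable
 have I1: "integrable ?P (%w. moreau r \<phi> (b w))"
  by (rule P.integrable_const_bound[of _ "r * B"]) (use moreau_bounded[OF B r] in auto)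
 have I2: "integrable ?P (%w. \<phi> (fst w))"
  by (rule P.integrable_const_bound[of _ B]) (use c11D(2)[OF B] in auto)
 have sq: "integrable ?P (%w. (norm (fst w))^2)" "integrable ?P (%w. (norm (b w))^2)"
  using P2_random[OF db \<nu> b] noise_integral_fst(2)[OF \<mu>.prob_space_axioms, of "%x. (norm x)^2"] P2D(4)[OF \<mu>] by auto
 have I3: "integrable ?P (%w. (norm (fst w - b w))^2)"
  by (rule integrable_norm_diff_sq) (use sq in auto)
 have "(LINT y|\<nu>. moreau r \<phi> y) - r * (LINT x|\<mu>. \<phi> x) = (LINT w|?P. moreau r \<phi> (b w)) - r * (LINT w|?P. \<phi> (fst w))"
  unfolding db[symmetric] noise_integral_fst(1)[OF \<mu>.prob_space_axioms m1(2)] by (subst integral_distr) auto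
 also have "\<dots> = (LINT w|?P. moreau r \<phi> (b w) - r * \<phi> (fst w))" using I1 I2 by simp
 also have "\<dots> <= (LINT w|?P. (norm (fst w - b w))^2 / 2)"
 proof (rule integral_mono)
  show "moreau r \<phi> (b w) - r * \<phi> (fst w) <= (norm (fst w - b w))^2 / 2" for w
   using moreau_le[OF B r, of "b w" "fst w"] by linarith
 qed (use I1 I2 I3 in auto)
 also have "\<dots> <= (W2 \<mu> \<nu>)^2 / 2 + e" using near \<open>0 < e\<close> by simp
 finally show "(LINT y|\<nu>. moreau r \<phi> y) - r * (LINT x|\<mu>. \<phi> x) <= (W2 \<mu> \<nu>)^2 / 2 + e" .
qed

text \<open>
 Equality in the duality: \<open>x \<mapsto> x + r \<nabla>\<phi>(x)\<close> is optimal, since its cost equals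
 the value of the potentials.
\<close>
lemma moreau_kantorovich_eq:
 assumes B: "c11_bound B \<phi>" and r: "0 < r" "4 * r * B <= 1" and \<mu>: "\<mu> \<in> P2"
 defines "\<nu> \<equiv> shifted \<mu> r (grad \<phi>)"
 shows "\<nu> \<in> P2" "(W2 \<mu> \<nu>)^2 = r^2 * (LINT x|\<mu>. (norm (grad \<phi> x))^2)"
  "(W2 \<mu> \<nu>)^2 / 2 = (LINT y|\<nu>. moreau r \<phi> y) - r * (LINT x|\<mu>. \<phi> x)"
proof -
 note [measurable_cong] = P2D(2)[OF \<mu>]
 have \<phi> [measurable]: "\<phi> \<in> borel_measurable borel" by (rule borel_measurable_continuous_onI[OF c11_continuous[OF B]])
 have g [measurable]: "grad \<phi> \<in> borel_measurable borel" by (rule borel_measurable_continuous_onI[OF c11_continuous_grad[OF B]])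
 have gm [measurable]: "moreau r \<phi> \<in> borel_measurable borel" by (rule moreau_measurable[OF B r(1)])
 interpret \<mu>: prob_space \<mu> by (rule P2D[OF \<mu>])
 have id: "distr \<mu> borel (%x. x) = \<mu>" by (rule distr_id2) (simp add: P2D[OF \<mu>])
 have i2: "integrable \<mu> (%x. (norm (grad \<phi> x))^2)"
  by (rule integrable_bounded_P2[OF \<mu>, of _ "B^2"]) (use c11D(3)[OF B] in "auto intro!: power_mono")
 have i1: "integrable \<mu> \<phi>" by (rule integrable_bounded_P2[OF \<mu> \<phi>]) (rule c11D(2)[OF B])
 have T [measurable]: "(%x. x + r *\<^sub>R grad \<phi> x) \<in> borel_measurable \<mu>" by measurable
 show \<nu>: "\<nu> \<in> P2"
  unfolding \<nu>_def
 proof (rule P2_distr[OF \<mu>.prob_space_axioms T], rule integrable_norm_add_sq)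
  show "integrable \<mu> (%x. (norm (r *\<^sub>R grad \<phi> x))^2)" using i2 by (simp add: power_mult_distrib)
 qed (use P2D(4)[OF \<mu>] in auto)
 have "(W2 \<mu> \<nu>)^2 <= (LINT x|\<mu>. (norm (x - (x + r *\<^sub>R grad \<phi> x)))^2)"
  by (rule W2_sq_le[OF \<mu>.prob_space_axioms _ T id _ \<mu> \<nu>]) (auto simp: \<nu>_def)
 also have "\<dots> = r^2 * (LINT x|\<mu>. (norm (grad \<phi> x))^2)" by (simp add: power_mult_distrib)
 finally have up: "(W2 \<mu> \<nu>)^2 <= r^2 * (LINT x|\<mu>. (norm (grad \<phi> x))^2)" .
 have "(LINT y|\<nu>. moreau r \<phi> y) = (LINT x|\<mu>. moreau r \<phi> (x + r *\<^sub>R grad \<phi> x))"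
  unfolding \<nu>_def by (rule integral_distr) auto
 also have "\<dots> = (LINT x|\<mu>. r^2 / 2 * (norm (grad \<phi> x))^2 + r * \<phi> x)"
  unfolding moreau_at_image[OF B r] by (simp add: power_mult_distrib)
 also have "\<dots> = r^2 / 2 * (LINT x|\<mu>. (norm (grad \<phi> x))^2) + r * (LINT x|\<mu>. \<phi> x)" using i1 i2 by simp
 finally have eq: "(LINT y|\<nu>. moreau r \<phi> y) - r * (LINT x|\<mu>. \<phi> x) = r^2 / 2 * (LINT x|\<mu>. (norm (grad \<phi> x))^2)" by simp
 have "r^2 / 2 * (LINT x|\<mu>. (norm (grad \<phi> x))^2) <= (W2 \<mu> \<nu>)^2 / 2"
  using moreau_kantorovich[OF B r(1) \<mu> \<nu>] eq by simp
 with up show W: "(W2 \<mu> \<nu>)^2 = r^2 * (LINT x|\<mu>. (norm (grad \<phi> x))^2)" by simp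
 show "(W2 \<mu> \<nu>)^2 / 2 = (LINT y|\<nu>. moreau r \<phi> y) - r * (LINT x|\<mu>. \<phi> x)" unfolding W eq by simp
qed

lemma vel_norm_first_moment:
 assumes "\<Phi> \<in> TP2"
 shows "integrable \<Phi> (%z. norm (snd z))" "(LINT z|\<Phi>. norm (snd z)) <= vel_norm \<Phi>"
proof -
 note TD = TP2D[OF assms]
 note [measurable_cong] = TD(2)
 interpret prob_space \<Phi> by (rule TD)
 show "integrable \<Phi> (%z. norm (snd z))" using square_integrable_imp_integrable[of "%z. norm (snd z)"] TD(5) by simp
 have "abs (LINT z|\<Phi>. norm (snd z) * 1) <= sqrt (LINT z|\<Phi>. (norm (snd z))^2) * sqrt (LINT z|\<Phi>. 1^2)"
  by (rule integral_cauchy_schwarz) (use TD(5) in auto)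
 then show "(LINT z|\<Phi>. norm (snd z)) <= vel_norm \<Phi>"
  by (simp add: prob_space vel_norm_def split_beta')
qed

lemma grad_velocity_integrable:
 assumes "\<Phi> \<in> TP2" "G \<in> L2_fields (base \<Phi>)"
 shows "integrable \<Phi> (%z. G (fst z) \<bullet> snd z)"
  "abs (LINT z|\<Phi>. G (fst z) \<bullet> snd z) <= L2norm (base \<Phi>) G * vel_norm \<Phi>"
proof -
 note TD = TP2D[OF assms(1)]
 have s [measurable_cong]: "sets \<Phi> = sets borel" by (rule TD)
 have G [measurable]: "G \<in> borel_measurable borel" and G2: "integrable (base \<Phi>) (%x. (norm (G x))^2)"
  using assms(2) by (auto simp: L2_fields_def)
 have G3: "integrable \<Phi> (%z. (norm (G (fst z)))^2)"
  using G2 unfolding base_def by (subst (asm) integrable_distr_eq) auto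
 have e: "(LINT x|base \<Phi>. (norm (G x))^2) = (LINT z|\<Phi>. (norm (G (fst z)))^2)"
  unfolding base_def by (rule integral_distr) auto
 show "integrable \<Phi> (%z. G (fst z) \<bullet> snd z)"
  by (rule inner_cauchy_schwarz_integral(1)) (use G3 TD(5) in auto)
 have "abs (LINT z|\<Phi>. G (fst z) \<bullet> snd z) <= sqrt (LINT z|\<Phi>. (norm (G (fst z)))^2) * sqrt (LINT z|\<Phi>. (norm (snd z))^2)"
  by (rule inner_cauchy_schwarz_integral(2)) (use G3 TD(5) in auto)
 then show "abs (LINT z|\<Phi>. G (fst z) \<bullet> snd z) <= L2norm (base \<Phi>) G * vel_norm \<Phi>"
  unfolding e by (simp add: vel_norm_def split_beta')
qed

text \<open>
 The potentials are exact for the base of \<open>\<Phi>\<close> and still admissible after the move by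
 \<open>exp\<^sup>s\<close>; their difference is a lower bound for the increment of the squared distance.
\<close>
lemma exp_slope_moreau_bound:
 fixes \<mu> :: "'x::{real_inner, polish_space} measure"
 assumes \<phi>: "\<phi> \<in> Cyl" and B: "c11_bound B \<phi>" and r: "0 < r" "4 * r * B <= 1" and \<mu>: "\<mu> \<in> P2"
  and \<Phi>: "\<Phi> \<in> TP2" and b: "base \<Phi> = shifted \<mu> r (grad \<phi>)" and s: "0 < s"
 shows "r * tested \<phi> \<Phi> - r\<^sup>2 * B^2 * vel_norm \<Phi> - s * (vel_norm \<Phi>)^2 <= exp_slope s \<Phi> \<mu>"
proof -
 note TD = TP2D[OF \<Phi>]
 have st [measurable_cong]: "sets \<Phi> = sets borel" by (rule TD)
 interpret prob_space \<Phi> by (rule TD)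
 let ?g = "moreau r \<phi>"
 have gm [measurable]: "?g \<in> borel_measurable borel" by (rule moreau_measurable[OF B r(1)])
 have g1: "integrable \<Phi> (%z. ?g (fst z))"
  by (rule integrable_const_bound[of _ "r * B"]) (use moreau_bounded[OF B r(1)] in auto)
 have g2: "integrable \<Phi> (%z. ?g (fst z + s *\<^sub>R snd z))"
  by (rule integrable_const_bound[of _ "r * B"]) (use moreau_bounded[OF B r(1)] in auto)
 have gL: "integrable \<Phi> (%z. grad \<phi> (fst z) \<bullet> snd z)"
  by (rule grad_velocity_integrable(1)[OF \<Phi> Cyl_grad_L2[OF base_P2[OF \<Phi>] \<phi>]])
 note v1 = vel_norm_first_moment[OF \<Phi>]
 have 1: "(LINT y|push_exp s \<Phi>. ?g y) - r * (LINT x|\<mu>. \<phi> x) <= (W2 (push_exp s \<Phi>) \<mu>)^2 / 2"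
  using moreau_kantorovich[OF B r(1) \<mu> push_exp_P2[OF \<Phi>]] by (simp add: W2_commute[of \<mu>])
 have 2: "(W2 (base \<Phi>) \<mu>)^2 / 2 = (LINT y|base \<Phi>. ?g y) - r * (LINT x|\<mu>. \<phi> x)"
  using moreau_kantorovich_eq(3)[OF B r \<mu>] unfolding b by (simp add: W2_commute[of \<mu>])
 have 3: "(LINT y|push_exp s \<Phi>. ?g y) = (LINT z|\<Phi>. ?g (fst z + s *\<^sub>R snd z))"
  unfolding push_exp_alt by (rule integral_distr) auto
 have 4: "(LINT y|base \<Phi>. ?g y) = (LINT z|\<Phi>. ?g (fst z))"
  unfolding base_def by (rule integral_distr) auto
 let ?J = "%z. s * r * (grad \<phi> (fst z) \<bullet> snd z) - s * r^2 * B^2 * norm (snd z) - s^2 / 2 * (norm (snd z))^2"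
 have iL: "integrable \<Phi> ?J"
  using gL v1(1) TD(5) by auto
 have "integral\<^sup>L \<Phi> ?J
   <= (LINT z|\<Phi>. ?g (fst z + s *\<^sub>R snd z) - ?g (fst z))"
 proof (rule integral_mono[OF iL])
  fix z :: "'x \<times> 'x"
  show "?J z
    <= ?g (fst z + s *\<^sub>R snd z) - ?g (fst z)"
   using moreau_slope[OF B r, of "fst z" "s *\<^sub>R snd z"] s by (simp add: power_mult_distrib algebra_simps)
 qed (use g1 g2 in auto)
 also have "integral\<^sup>L \<Phi> ?J
   = s * r * tested \<phi> \<Phi> - s * r^2 * B^2 * (LINT z|\<Phi>. norm (snd z)) - s^2 / 2 * (vel_norm \<Phi>)^2"
  unfolding vel_norm_sq using gL v1(1) TD(5) by simp
 finally have "s * r * tested \<phi> \<Phi> - s * r^2 * B^2 * (LINT z|\<Phi>. norm (snd z)) - s^2 / 2 * (vel_norm \<Phi>)^2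
   <= (W2 (push_exp s \<Phi>) \<mu>)^2 / 2 - (W2 (base \<Phi>) \<mu>)^2 / 2"
  using 1 2 unfolding Bochner_Integration.integral_diff[OF g2 g1] 3 4 by linarith
 moreover have "s * r^2 * B^2 * (LINT z|\<Phi>. norm (snd z)) <= s * r^2 * B^2 * vel_norm \<Phi>"
  using v1(2) s by (intro mult_left_mono) auto
 ultimately have "s * (r * tested \<phi> \<Phi> - r\<^sup>2 * B^2 * vel_norm \<Phi> - s * (vel_norm \<Phi>)^2 / 2)
   <= ((W2 (push_exp s \<Phi>) \<mu>)^2 - (W2 (base \<Phi>) \<mu>)^2) / 2"
  by (simp add: algebra_simps power2_eq_square diff_divide_distrib)
 then show ?thesis using s unfolding exp_slope_def by (simp add: field_simps)
qed

section \<open>Velocities in the directional closure\<close>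

abbreviation (input) diff_quot :: "('x => real) => (real => 'x measure) => real => real => real" where
 "diff_quot \<phi> \<mu> t h \<equiv> ((LINT x|\<mu> (t + h). \<phi> x) - (LINT x|\<mu> t. \<phi> x)) / h"

text \<open>
 Secants around \<open>t\<close> of the squared distance to \<open>\<nu>\<close>, of nearly slope
 \<open>c\<close> and arbitrarily short. As one end may be \<open>t\<close> itself, this also makes sense at an
 end of \<open>I\<close>.
\<close>
definition slope_ge :: "real set => (real => 'x::{real_inner, polish_space} measure) => real => 'x measure => real => bool" where
 "slope_ge I \<mu> t \<nu> c \<longleftrightarrow> (\<forall>\<delta>>0. \<forall>e>0. \<exists>l\<in>I. \<exists>u\<in>I. t - \<delta> < l \<and> l <= t \<and> t <= u \<and> u < t + \<delta> \<and> l < u \<and>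
   (c - e) * (u - l) <= (W2 (\<mu> u) \<nu>)^2 / 2 - (W2 (\<mu> l) \<nu>)^2 / 2)"

lemma slope_geI:
 assumes F: "F ~= bot" "F <= at 0" and t: "t \<in> I" and ev: "\<forall>\<^sub>F h in F. t + h \<in> I" and g: "(g ---> c) F"
  and le: "\<forall>\<^sub>F h in F. g h <= ((W2 (\<mu> (t + h)) \<nu>)^2 / 2 - (W2 (\<mu> t) \<nu>)^2 / 2) / h"
 shows "slope_ge I \<mu> t \<nu> c"
 unfolding slope_ge_def
proof (intro allI impI)
 fix \<delta> e :: real assume \<delta>: "0 < \<delta>" and e: "0 < e"
 have "\<forall>\<^sub>F h in at 0. h ~= 0 \<and> abs h < \<delta>" using \<delta> unfolding eventually_at by (intro exI[of _ \<delta>]) (auto simp: dist_real_def)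
 then have "\<forall>\<^sub>F h in F. h ~= 0 \<and> abs h < \<delta>" by (rule filter_leD[OF F(2)])
 moreover have "\<forall>\<^sub>F h in F. c - e < g h" using order_tendstoD(1)[OF g] e by simp
 ultimately have "\<forall>\<^sub>F h in F. h ~= 0 \<and> abs h < \<delta> \<and> c - e < g h \<and> t + h \<in> I
   \<and> g h <= ((W2 (\<mu> (t + h)) \<nu>)^2 / 2 - (W2 (\<mu> t) \<nu>)^2 / 2) / h"
  using ev le by eventually_elim auto
 from eventually_happens'[OF F(1) this] obtain h where h: "h ~= 0" "abs h < \<delta>" "t + h \<in> I"
  and q: "c - e <= ((W2 (\<mu> (t + h)) \<nu>)^2 / 2 - (W2 (\<mu> t) \<nu>)^2 / 2) / h" by force
 show "\<exists>l\<in>I. \<exists>u\<in>I. t - \<delta> < l \<and> l <= t \<and> t <= u \<and> u < t + \<delta> \<and> l < u \<and>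
   (c - e) * (u - l) <= (W2 (\<mu> u) \<nu>)^2 / 2 - (W2 (\<mu> l) \<nu>)^2 / 2"
 proof (cases "0 < h")
  case True
  then show ?thesis using h q t \<delta> by (intro bexI[of _ t] bexI[of _ "t + h"]) (auto simp: pos_le_divide_eq)
 next
  case False
  then have "h < 0" using h by simp
  then show ?thesis using h q t \<delta> by (intro bexI[of _ "t + h"] bexI[of _ t]) (auto simp: neg_le_divide_eq)
 qed
qed

text \<open>
 The slope is at most \<open>evi_bound\<close>, and the potentials bound \<open>evi_bound\<close> from above by
 \<open>- r \<integral>\<langle>\<nabla>\<phi>(x), v\<rangle> d\<Phi> + O(r\<^sup>2)\<close>.
\<close>
lemma velocity_bound_from_EVI:
 assumes E: "EVI_solution lam F I \<mu>" and I: "is_interval I" and P: "\<mu> ` I \<subseteq> P2" and t: "t \<in> I"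
  and \<phi>: "\<phi> \<in> Cyl" and B: "c11_bound B \<phi>" and r: "0 < r" "4 * r * B <= 1"
  and \<Phi>F: "\<Phi> \<in> F" and \<Phi>: "\<Phi> \<in> TP2" and b: "base \<Phi> = shifted (\<mu> t) r (grad \<phi>)"
  and M: "vel_norm \<Phi> <= M"
  and wit: "slope_ge I \<mu> t (base \<Phi>) (- (r * L))"
 shows "tested \<phi> \<Phi> <= L + r * (abs lam * B^2 + B^2 * M)"
proof -
 have \<mu>: "\<mu> t \<in> P2" using P t by auto
 have cont: "W2_continuous I \<mu>" using E by (simp add: EVI_solution_def)
 define V where "V = vel_norm \<Phi>"
 define A where "A = tested \<phi> \<Phi>"
 have slope: "- (r * L) <= evi_bound lam s \<Phi> (\<mu> t)" if s: "0 < s" for s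
 proof (rule field_le_epsilon)
  fix e :: real assume e: "0 < e"
  then have e2: "0 < e / 2" by simp
  obtain \<delta> where \<delta>: "0 < \<delta>" "!!t'. t' \<in> I ==> abs (t' - t) < \<delta> ==> abs (evi_bound lam s \<Phi> (\<mu> t') - evi_bound lam s \<Phi> (\<mu> t)) < e / 2"
   using evi_bound_continuous[OF cont P \<Phi>, of lam s] t e2 unfolding continuous_on_iff dist_real_def by blast
  obtain l u where lu: "l \<in> I" "u \<in> I" "t - \<delta> < l" "l <= t" "t <= u" "u < t + \<delta>" "l < u"
   and w: "(- (r * L) - e / 2) * (u - l) <= (W2 (\<mu> u) (base \<Phi>))^2 / 2 - (W2 (\<mu> l) (base \<Phi>))^2 / 2"
   using wit \<delta>(1) e2 unfolding slope_ge_def by blast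
  have "(1/2) * (W2 (\<mu> u) (base \<Phi>))^2 - (1/2) * (W2 (\<mu> l) (base \<Phi>))^2 <= (evi_bound lam s \<Phi> (\<mu> t) + e / 2) * (u - l)"
  proof (rule EVI_slope[OF E I P \<Phi>F \<Phi> s _ lu(1,2,7)])
   fix t' assume "t' \<in> I" "l <= t'" "t' <= u"
   then have "abs (evi_bound lam s \<Phi> (\<mu> t') - evi_bound lam s \<Phi> (\<mu> t)) < e / 2" using lu by (intro \<delta>(2)) auto
   then show "evi_bound lam s \<Phi> (\<mu> t') <= evi_bound lam s \<Phi> (\<mu> t) + e / 2" by linarith
  qed
  with w have "(- (r * L) - e / 2) * (u - l) <= (evi_bound lam s \<Phi> (\<mu> t) + e / 2) * (u - l)" by linarith
  then have "- (r * L) - e / 2 <= evi_bound lam s \<Phi> (\<mu> t) + e / 2" using lu(7) by (simp add: mult_le_cancel_right)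
  then show "- (r * L) <= evi_bound lam s \<Phi> (\<mu> t) + e" by linarith
 qed
 have G: "(LINT x|\<mu> t. (norm (grad \<phi> x))^2) <= B^2"
 proof -
  interpret \<mu>: prob_space "\<mu> t" by (rule P2D[OF \<mu>])
  have "(LINT x|\<mu> t. (norm (grad \<phi> x))^2) <= (LINT x|\<mu> t. B^2)"
   using Cyl_grad_L2[OF \<mu> \<phi>] c11D(3)[OF B] by (intro integral_mono) (auto simp: L2_fields_def intro!: power_mono)
  then show ?thesis by (simp add: \<mu>.prob_space)
 qed
 have W: "lam * (W2 (\<mu> t) (base \<Phi>))^2 <= abs lam * (r^2 * B^2)"
 proof -
  have "(W2 (\<mu> t) (base \<Phi>))^2 <= r^2 * B^2"
   unfolding b moreau_kantorovich_eq(2)[OF B r \<mu>] by (intro mult_left_mono G) simp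
  then have "abs lam * (W2 (\<mu> t) (base \<Phi>))^2 <= abs lam * (r^2 * B^2)" by (intro mult_left_mono) auto
  moreover have "lam * (W2 (\<mu> t) (base \<Phi>))^2 <= abs lam * (W2 (\<mu> t) (base \<Phi>))^2" by (intro mult_right_mono) auto
  ultimately show ?thesis by linarith
 qed
 have "r * A <= r * L + abs lam * (r^2 * B^2) + r^2 * B^2 * V"
 proof (rule field_le_epsilon)
  fix e :: real assume e: "0 < e"
  have V1: "0 < V^2 + 1" by (simp add: add_nonneg_pos)
  define s where "s = e / (V^2 + 1)"
  have s: "0 < s" using e V1 by (simp add: s_def)
  have "s * V^2 <= s * (V^2 + 1)" using s by (intro mult_left_mono) auto
  also have "\<dots> = e" using V1 by (simp add: s_def)
  finally have "s * V^2 <= e" .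
  then show "r * A <= r * L + abs lam * (r^2 * B^2) + r^2 * B^2 * V + e"
   using slope[OF s] exp_slope_moreau_bound[OF \<phi> B r \<mu> \<Phi> b s] W
   unfolding evi_bound_def A_def[symmetric] V_def[symmetric] by linarith
 qed
 also have "\<dots> <= r * (L + r * (abs lam * B^2 + B^2 * M))"
 proof -
  have "r^2 * B^2 * V <= r^2 * B^2 * M" using M by (intro mult_left_mono) (auto simp: V_def)
  then show ?thesis by (simp add: algebra_simps power2_eq_square)
 qed
 finally show ?thesis using r unfolding A_def[symmetric] by simp
qed

text \<open>Forward in time a lower bound of the distance is needed, and the potentials provide it.\<close>
lemma slope_from_right_quotient:
 assumes P: "\<mu> ` I \<subseteq> P2" and t: "t \<in> I" and B: "c11_bound B \<phi>" and r: "0 < r" "4 * r * B <= 1"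
  and ev: "\<forall>\<^sub>F h in at_right 0. t + h \<in> I"
  and q: "((%h. diff_quot \<phi> \<mu> t h) ---> L) (at_right 0)"
 shows "slope_ge I \<mu> t (shifted (\<mu> t) r (grad \<phi>)) (- (r * L))"
proof (rule slope_geI[OF _ at_le t ev])
 let ?\<nu> = "shifted (\<mu> t) r (grad \<phi>)" and ?f = "%h. (LINT x|\<mu> (t + h). \<phi> x)"
 have \<mu>: "\<mu> t \<in> P2" using P t by auto
 show "((%h. - (r * ((?f h - (LINT x|\<mu> t. \<phi> x)) / h))) ---> - (r * L)) (at_right 0)" by (intro tendsto_intros q)
 show "\<forall>\<^sub>F h in at_right 0. - (r * ((?f h - (LINT x|\<mu> t. \<phi> x)) / h))
   <= ((W2 (\<mu> (t + h)) ?\<nu>)^2 / 2 - (W2 (\<mu> t) ?\<nu>)^2 / 2) / h"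
  using ev eventually_at_right_less
 proof eventually_elim
  case (elim h)
  have "\<mu> (t + h) \<in> P2" using P elim by blast
  from moreau_kantorovich[OF B r(1) this moreau_kantorovich_eq(1)[OF B r \<mu>]] moreau_kantorovich_eq(3)[OF B r \<mu>]
  have "- (r * (?f h - (LINT x|\<mu> t. \<phi> x))) <= (W2 (\<mu> (t + h)) ?\<nu>)^2 / 2 - (W2 (\<mu> t) ?\<nu>)^2 / 2"
   by (simp add: algebra_simps)
  from divide_right_mono[OF this, of h] show ?case using elim(2) by simp
 qed
qed (use trivial_limit_at_right_real in auto)

lemma L2_shift:
 assumes \<mu>: "\<mu> \<in> P2" and v: "v \<in> L2_fields \<mu>"
 shows "(%x. x + h *\<^sub>R v x) \<in> borel_measurable \<mu>" "shifted \<mu> h v \<in> P2"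
proof -
 note [measurable_cong] = P2D(2)[OF \<mu>]
 have [measurable]: "v \<in> borel_measurable borel" and v2: "integrable \<mu> (%x. (norm (v x))^2)" using v by (auto simp: L2_fields_def)
 show m: "(%x. x + h *\<^sub>R v x) \<in> borel_measurable \<mu>" by measurable
 show "shifted \<mu> h v \<in> P2"
 proof (rule P2_distr[OF P2D(1)[OF \<mu>] m], rule integrable_norm_add_sq)
  show "integrable \<mu> (%x. (norm (h *\<^sub>R v x))^2)" using v2 by (simp add: power_mult_distrib)
 qed (use P2D(4)[OF \<mu>] in auto)
qed

text \<open>
 Backward in time an upper bound of the distance is needed; it comes from the coupling of \<open>x + h
 v(x)\<close> with \<open>x + r \<nabla>\<phi>(x)\<close>.
\<close>
lemma slope_from_left_velocity:
 assumes P: "\<mu> ` I \<subseteq> P2" and t: "t \<in> I" and \<phi>: "\<phi> \<in> Cyl" and B: "c11_bound B \<phi>" and r: "0 < r" "4 * r * B <= 1"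
  and ev: "\<forall>\<^sub>F h in at_left 0. t + h \<in> I" and v: "v \<in> L2_fields (\<mu> t)"
  and q: "((%h. W2 (shifted (\<mu> t) h v) (\<mu> (t + h)) / abs h) ---> 0) (at_left 0)"
 shows "slope_ge I \<mu> t (shifted (\<mu> t) r (grad \<phi>)) (- (r * (LINT x|\<mu> t. v x \<bullet> grad \<phi> x)))"
proof (rule slope_geI[OF _ at_le t ev])
 define L V G where "L = (LINT x|\<mu> t. v x \<bullet> grad \<phi> x)" and "V = (LINT x|\<mu> t. (norm (v x))^2)"
  and "G = (LINT x|\<mu> t. (norm (grad \<phi> x))^2)"
 define \<nu> where "\<nu> = shifted (\<mu> t) r (grad \<phi>)"
 define W where "W h = W2 (shifted (\<mu> t) h v) (\<mu> (t + h)) / abs h" for h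
 define S where "S h = h^2 * V - 2 * h * r * L + r^2 * G" for h
 define g where "g h = - (r * L) + h * V / 2 - W h * (sqrt (S h) + W h * abs h / 2)" for h
 have "(g ---> - (r * L) + 0 * V / 2 - 0 * (sqrt (S 0) + 0 * abs 0 / 2)) (at_left 0)"
  unfolding g_def[abs_def] S_def by (intro tendsto_intros q[folded W_def]) simp_all
 then show "(g ---> - (r * (LINT x|\<mu> t. v x \<bullet> grad \<phi> x))) (at_left 0)" by (simp add: L_def)
 have \<mu>: "\<mu> t \<in> P2" using P t by auto
 have gL: "grad \<phi> \<in> L2_fields (\<mu> t)" by (rule Cyl_grad_L2[OF \<mu> \<phi>])
 have i: "integrable (\<mu> t) (%x. (norm (v x))^2)" "integrable (\<mu> t) (%x. (norm (grad \<phi> x))^2)"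
  "integrable (\<mu> t) (%x. v x \<bullet> grad \<phi> x)"
  using v gL L2_inner_diff(2)[OF \<mu> v gL] by (auto simp: L2_fields_def)
 have \<nu>: "\<nu> \<in> P2" "(W2 (\<mu> t) \<nu>)^2 = r^2 * G" unfolding \<nu>_def G_def by (rule moreau_kantorovich_eq[OF B r \<mu>])+
 have neg: "\<forall>\<^sub>F h in at_left 0. h < (0::real)" by (auto simp: eventually_at_filter)
 show "\<forall>\<^sub>F h in at_left 0. g h <= ((W2 (\<mu> (t + h)) (shifted (\<mu> t) r (grad \<phi>)))^2 / 2 - (W2 (\<mu> t) (shifted (\<mu> t) r (grad \<phi>)))^2 / 2) / h"
  using ev neg unfolding \<nu>_def[symmetric]
 proof eventually_elim
  case (elim h)
  have \<mu>h: "\<mu> (t + h) \<in> P2" using P elim by blast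
  let ?\<eta> = "shifted (\<mu> t) h v"
  have \<eta>: "?\<eta> \<in> P2" by (rule L2_shift(2)[OF \<mu> v])
  define a w where "a = W2 (\<mu> (t + h)) ?\<eta>" and "w = W2 ?\<eta> \<nu>"
  have a: "a = W h * - h" "0 <= a" using elim(2) W2_nonneg[OF \<mu>h \<eta>] by (auto simp: a_def W_def W2_commute)
  have "w^2 <= (LINT x|\<mu> t. (norm ((x + h *\<^sub>R v x) - (x + r *\<^sub>R grad \<phi> x)))^2)"
   unfolding w_def by (rule W2_sq_le[OF P2D(1)[OF \<mu>] L2_shift(1)[OF \<mu> v] L2_shift(1)[OF \<mu> gL] _ _ \<eta> \<nu>(1)]) (simp_all add: \<nu>_def)
  also have "\<dots> = (LINT x|\<mu> t. h^2 * (norm (v x))^2 - 2 * h * r * (v x \<bullet> grad \<phi> x) + r^2 * (norm (grad \<phi> x))^2)"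
   unfolding power2_norm_eq_inner by (simp add: inner_diff inner_commute algebra_simps power2_eq_square)
  also have "\<dots> = S h" unfolding S_def V_def L_def G_def using i by simp
  finally have wS: "w^2 <= S h" .
  then have "0 <= S h" using zero_le_power2[of w] by linarith
  then have s: "(sqrt (S h))^2 = S h" by simp
  have "W2 (\<mu> (t + h)) \<nu> <= a + w" unfolding a_def w_def by (rule W2_triangle[OF \<mu>h \<eta> \<nu>(1)])
  also have "\<dots> <= a + sqrt (S h)" using real_le_rsqrt[OF wS] by simp
  finally have "(W2 (\<mu> (t + h)) \<nu>)^2 <= (a + sqrt (S h))^2" using W2_nonneg[OF \<mu>h \<nu>(1)] by (rule power_mono)
  also have "\<dots> = a^2 + 2 * a * sqrt (S h) + S h" using s by (simp add: power2_sum)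
  also have "\<dots> = r^2 * G + 2 * (g h * h)"
   using elim(2) unfolding a(1) g_def by (simp add: S_def[of h] algebra_simps power2_eq_square)
  finally show ?case using elim(2) by (simp add: \<nu>(2) neg_le_divide_eq)
 qed
qed (use trivial_limit_at_left_real in auto)

lemma velocity_difference_quotient:
 assumes P: "\<mu> ` I \<subseteq> P2" and t: "t \<in> I" and \<phi>C: "\<phi> \<in> Cyl" and B: "c11_bound B \<phi>"
  and v: "v \<in> L2_fields (\<mu> t)"
  and q: "((%h. W2 (shifted (\<mu> t) h v) (\<mu> (t + h)) / abs h) ---> 0) (at 0 within {h. t + h \<in> I})"
 shows "((%h. diff_quot \<phi> \<mu> t h) ---> (LINT x|\<mu> t. v x \<bullet> grad \<phi> x)) (at 0 within {h. t + h \<in> I})"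
proof -
 define L where "L = (LINT x|\<mu> t. v x \<bullet> grad \<phi> x)"
 define V where "V = (LINT x|\<mu> t. (norm (v x))^2)"
 define W where "W h = W2 (shifted (\<mu> t) h v) (\<mu> (t + h))" for h
 let ?F = "at 0 within {h. t + h \<in> I}"
 have \<mu>: "\<mu> t \<in> P2" using P t by auto
 note [measurable_cong] = P2D(2)[OF \<mu>]
 interpret \<mu>: prob_space "\<mu> t" by (rule P2D[OF \<mu>])
 have \<phi> [measurable]: "\<phi> \<in> borel_measurable borel" by (rule borel_measurable_continuous_onI[OF c11_continuous[OF B]])
 have gL: "grad \<phi> \<in> L2_fields (\<mu> t)" by (rule Cyl_grad_L2[OF \<mu> \<phi>C])
 have [measurable]: "v \<in> borel_measurable borel" and v2: "integrable (\<mu> t) (%x. (norm (v x))^2)"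
  using v by (auto simp: L2_fields_def)
 have vg: "integrable (\<mu> t) (%x. v x \<bullet> grad \<phi> x)" by (rule L2_inner_diff(2)[OF \<mu> v gL])
 have [measurable]: "grad \<phi> \<in> borel_measurable borel" using gL by (auto simp: L2_fields_def)
 have \<phi>I: "integrable \<nu> \<phi>" if "\<nu> \<in> P2" for \<nu> by (rule integrable_bounded_P2[OF that \<phi>]) (rule c11D(2)[OF B])
 have bound: "abs (diff_quot \<phi> \<mu> t h - L) <= B * (W h / abs h) + B * V * abs h" if hI: "t + h \<in> I" and h0: "h ~= 0" for h
 proof -
  have \<mu>h: "\<mu> (t + h) \<in> P2" using P hI by auto
  let ?\<eta> = "shifted (\<mu> t) h v"
  have \<eta>: "?\<eta> \<in> P2" by (rule L2_shift(2)[OF \<mu> v])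
  interpret \<eta>: prob_space ?\<eta> by (rule P2D[OF \<eta>])
  have "abs ((LINT x|\<mu> (t + h). \<phi> x) - (LINT x|?\<eta>. \<phi> x)) <= sqrt (LINT x|?\<eta>. B^2) * W2 ?\<eta> (\<mu> (t + h)) + 0 * (W2 ?\<eta> (\<mu> (t + h)))^2"
   by (rule integral_diff_le_W2[OF \<eta> \<mu>h]) (use \<phi>I \<eta> \<mu>h c11_lipschitz[OF B] in auto)
  then have 1: "abs ((LINT x|\<mu> (t + h). \<phi> x) - (LINT x|?\<eta>. \<phi> x)) <= B * W h"
   using c11D(1)[OF B] \<eta>.prob_space by (simp add: W_def)
  have i1: "integrable (\<mu> t) (%x. \<phi> (x + h *\<^sub>R v x))"
   by (rule \<mu>.integrable_const_bound[of _ B]) (use c11D(2)[OF B] in auto)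
  have e: "(LINT x|?\<eta>. \<phi> x) = (LINT x|\<mu> t. \<phi> (x + h *\<^sub>R v x))" by (rule integral_distr) auto
  have "abs ((LINT x|?\<eta>. \<phi> x) - (LINT x|\<mu> t. \<phi> x) - h * L) = abs (LINT x|\<mu> t. \<phi> (x + h *\<^sub>R v x) - \<phi> x - h * (v x \<bullet> grad \<phi> x))"
   unfolding e L_def using i1 \<phi>I[OF \<mu>] vg by simp
  also have "\<dots> <= (LINT x|\<mu> t. B * h^2 * (norm (v x))^2)"
  proof (rule integral_abs_bound[THEN order_trans], rule integral_mono)
   show "abs (\<phi> (x + h *\<^sub>R v x) - \<phi> x - h * (v x \<bullet> grad \<phi> x)) <= B * h^2 * (norm (v x))^2" for x
    using c11D(5)[OF B, of "x + h *\<^sub>R v x" x] by (simp add: inner_commute power_mult_distrib mult.assoc)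
  qed (use i1 \<phi>I[OF \<mu>] vg v2 in auto)
  also have "\<dots> = B * h^2 * V" by (simp add: V_def)
  finally have "abs ((LINT x|\<mu> (t + h). \<phi> x) - (LINT x|\<mu> t. \<phi> x) - h * L) <= B * W h + B * h^2 * V" using 1 by linarith
  then have "abs ((LINT x|\<mu> (t + h). \<phi> x) - (LINT x|\<mu> t. \<phi> x) - h * L) / abs h <= (B * W h + B * h^2 * V) / abs h"
   by (rule divide_right_mono) simp
  moreover have "(B * W h + B * h^2 * V) / abs h = B * (W h / abs h) + B * V * abs h"
   using h0 by (simp add: add_divide_distrib power2_eq_square abs_if)
  moreover have "abs ((LINT x|\<mu> (t + h). \<phi> x) - (LINT x|\<mu> t. \<phi> x) - h * L) / abs h = abs (diff_quot \<phi> \<mu> t h - L)"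
   unfolding abs_divide[symmetric] using h0 by (simp add: diff_divide_distrib)
  ultimately show ?thesis by simp
 qed
 have lim: "((%h. B * (W h / abs h) + B * V * abs h) ---> B * 0 + B * V * abs 0) ?F"
  using q unfolding W_def by (intro tendsto_add tendsto_mult tendsto_const tendsto_rabs tendsto_ident_at)
 have "((%h. diff_quot \<phi> \<mu> t h - L) ---> 0) ?F"
 proof (rule Lim_null_comparison)
  show "\<forall>\<^sub>F h in ?F. norm (diff_quot \<phi> \<mu> t h - L) <= B * (W h / abs h) + B * V * abs h"
   unfolding eventually_at_filter real_norm_def by (intro always_eventually allI impI bound) simp_all
  show "((%h. B * (W h / abs h) + B * V * abs h) ---> 0) ?F" using lim by simp
 qed
 then show ?thesis unfolding L_def[symmetric] by (simp add: LIM_zero_iff)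
qed

text \<open>
 Along \<open>r n \<rightarrow> 0\<close>, the bound on the velocity norms gives compactness, and the error of
 order \<open>r\<close> disappears in the limit.
\<close>
lemma dir_closure_velocity:
 assumes E: "EVI_solution lam F I \<mu>" and I: "is_interval I" and P: "\<mu> ` I \<subseteq> P2" and t: "t \<in> I" and F: "F \<subseteq> TP2"
  and \<epsilon>: "0 < \<epsilon>" and dom: "!!\<phi>. \<phi> \<in> Cyl ==> (!!x. norm (grad \<phi> x) <= \<epsilon>) ==>
     distr (\<mu> t) borel (exp_cyl \<phi>) \<in> mpvf_dom F \<and> mpvf_norm F (distr (\<mu> t) borel (exp_cyl \<phi>)) < M"
  and \<phi>: "\<phi> \<in> Cyl" and B: "c11_bound B \<phi>"
  and wit: "!!r. 0 < r ==> 4 * r * B <= 1 ==> slope_ge I \<mu> t (shifted (\<mu> t) r (grad \<phi>)) (- (r * L))"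
 shows "\<exists>\<Phi>\<in>dir_closure_at F (\<mu> t). base \<Phi> = \<mu> t \<and> vel_norm \<Phi> <= M \<and> tested \<phi> \<Phi> <= L"
proof -
 have \<mu>: "\<mu> t \<in> P2" using P t by auto
 have B0: "0 < B" by (rule c11D(1)[OF B])
 define r0 where "r0 = min (\<epsilon> / B) (1 / (4 * B))"
 have r0: "0 < r0" "r0 * B <= \<epsilon>" "4 * r0 * B <= 1"
 proof -
  show "0 < r0" using \<epsilon> B0 by (simp add: r0_def)
  have "r0 * B <= \<epsilon> / B * B" "r0 * B <= 1 / (4 * B) * B" unfolding r0_def using B0 by (intro mult_right_mono; simp)+
  then show "r0 * B <= \<epsilon>" "4 * r0 * B <= 1" using B0 by (auto simp: divide_simps)
 qed
 define r where "r n = r0 / real (Suc n)" for n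
 have r: "0 < r n" "r n <= r0" for n using r0 by (auto simp: r_def divide_le_eq mult_le_cancel_left1)
 have rB: "4 * r n * B <= 1" for n
 proof -
  have "4 * r n * B <= 4 * r0 * B" using r[of n] B0 by (intro mult_right_mono) auto
  then show ?thesis using r0(3) by linarith
 qed
 have rlim: "r ----> 0"
 proof -
  have "(%n. r0 * (1 / real (Suc n))) ----> r0 * 0" by (rule tendsto_mult_left[OF LIMSEQ_Suc[OF lim_1_over_n]])
  then show ?thesis by (simp only: r_def[abs_def] mult_zero_right times_divide_eq_right mult_1_right)
 qed
 have rdec: "decseq r" unfolding r_def[abs_def] decseq_def using r0 by (auto intro!: divide_left_mono)
 define T where "T n x = x + r n *\<^sub>R grad \<phi> x" for n x
 have Te: "exp_cyl (%x. r n * \<phi> x) = T n" for n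
  by (rule ext) (simp add: exp_cyl_def Cyl_scale(2)[OF \<phi>] T_def)
 have "\<exists>\<Phi>. \<Phi> \<in> mpvf_section F (distr (\<mu> t) borel (T n)) \<and> vel_norm \<Phi> < M" for n
 proof -
  have "norm (grad (%x. r n * \<phi> x) x) <= \<epsilon>" for x
  proof -
   have "norm (grad (%x. r n * \<phi> x) x) = r n * norm (grad \<phi> x)" using r[of n] by (simp add: Cyl_scale(2)[OF \<phi>])
   also have "\<dots> <= r0 * B" using r[of n] c11D(3)[OF B, of x] r0 by (intro mult_mono) auto
   finally show ?thesis using r0(2) by linarith
  qed
  from dom[OF Cyl_scale(1)[OF \<phi>, of "r n"] this]
  have d: "distr (\<mu> t) borel (T n) \<in> mpvf_dom F" "mpvf_norm F (distr (\<mu> t) borel (T n)) < M" unfolding Te by auto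
  have "vel_norm ` mpvf_section F (distr (\<mu> t) borel (T n)) ~= {}" using d(1) unfolding mpvf_dom_def mpvf_section_def by auto
  from cInf_lessD[OF this d(2)[unfolded mpvf_norm_def]] show ?thesis by blast
 qed
 then obtain \<Psi> where \<Psi>: "!!n. \<Psi> n \<in> mpvf_section F (distr (\<mu> t) borel (T n))" "!!n. vel_norm (\<Psi> n) < M" by metis
 have \<Psi>F: "\<Psi> n \<in> F" and \<Psi>b: "base (\<Psi> n) = distr (\<mu> t) borel (T n)" for n using \<Psi>(1)[of n] by (auto simp: mpvf_section_def)
 have \<Psi>T: "\<Psi> n \<in> TP2" for n using \<Psi>F F by blast
 have gm: "grad \<phi> \<in> borel_measurable borel" by (rule Cyl_grad_measurable[OF \<phi>])
 have "\<exists>k \<Phi>. strict_mono (k :: nat => nat) \<and> limitin sw_topology (%n. \<Psi> (k n)) \<Phi> sequentially \<and> base \<Phi> = \<mu> t \<and> vel_norm \<Phi> <= M"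
 proof (rule sw_compactness[OF \<Psi>T \<mu> _ \<Psi>b])
  show "T n \<in> borel_measurable borel" for n unfolding T_def[abs_def] using gm by measurable
  show "norm (T n x - x) <= r n * B" for n x
   using r[of n] c11D(3)[OF B, of x] by (simp add: T_def mult_left_mono)
  show "(%n. r n * B) ----> 0" using tendsto_mult_right[OF rlim, of B] by simp
  show "vel_norm (\<Psi> n) <= M" for n using \<Psi>(2)[of n] by simp
 qed
 then obtain k \<Phi> where k: "strict_mono (k :: nat => nat)" and lim: "limitin sw_topology (%n. \<Psi> (k n)) \<Phi> sequentially"
  and \<Phi>: "base \<Phi> = \<mu> t" "vel_norm \<Phi> <= M" by blast
 have L: "\<Phi> \<in> TP2" "!!\<zeta>. \<zeta> \<in> sw_test ==> (%n. integral\<^sup>L (\<Psi> (k n)) \<zeta>) ----> integral\<^sup>L \<Phi> \<zeta>"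
  using lim unfolding limitin_sw_iff[OF \<Psi>T] by auto
 have rk: "(%n. r (k n)) ----> 0" using LIMSEQ_subseq_LIMSEQ[OF rlim k] by (simp add: comp_def)
 have "\<Phi> \<in> dir_closure_at F (\<mu> t)"
  unfolding dir_closure_at_def
 proof (intro CollectI conjI L(1) bexI[OF _ \<phi>] exI[of _ "%n. r (k n)"] exI[of _ "%n. \<Psi> (k n)"] allI)
  show "0 <= r (k n)" for n using r(1)[of "k n"] by simp
  show "decseq (%n. r (k n))" using rdec k unfolding decseq_def strict_mono_def by (meson k strict_mono_leD)
  show "\<Psi> (k n) \<in> mpvf_section F (distr (\<mu> t) borel (exp_cyl (%x. r (k n) * \<phi> x)))" for n
   unfolding Te by (rule \<Psi>(1))
 qed (fact rk lim)+
 moreover have "tested \<phi> \<Phi> <= L"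
 proof -
  have "(%(x, v). grad \<phi> x \<bullet> v) \<in> sw_test" by (rule sw_test_inner[OF c11_continuous_grad[OF B] c11D(3)[OF B]])
  from L(2)[OF this] have 1: "(%n. tested \<phi> (\<Psi> (k n))) ----> tested \<phi> \<Phi>"
   by (simp add: split_beta')
  have 2: "(%n. L + r (k n) * (abs lam * B^2 + B^2 * M)) ----> L + 0 * (abs lam * B^2 + B^2 * M)" by (intro tendsto_intros rk)
  have "tested \<phi> (\<Psi> n) <= L + r n * (abs lam * B^2 + B^2 * M)" for n
  proof (rule velocity_bound_from_EVI[OF E I P t \<phi> B r(1) rB \<Psi>F \<Psi>T])
   show "base (\<Psi> n) = shifted (\<mu> t) (r n) (grad \<phi>)" unfolding \<Psi>b T_def[abs_def] ..
   show "vel_norm (\<Psi> n) <= M" using \<Psi>(2)[of n] by simp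
  qed (unfold \<Psi>b T_def[abs_def], rule wit[OF r(1) rB])
  then have "tested \<phi> \<Phi> <= L + 0 * (abs lam * B^2 + B^2 * M)"
   by (intro tendsto_le[OF trivial_limit_sequentially 2 1] always_eventually) auto
  then show ?thesis by simp
 qed
 ultimately show ?thesis using \<Phi> by blast
qed

section \<open>Mixtures of measures\<close>

text \<open>
 Through the probability monad, integrals against mixtures follow from those against \<open>bind\<close>.
\<close>
lemma mix_eq_bind:
 assumes M: "prob_space M" and N: "prob_space N" and s: "sets N = sets M" and t: "0 <= t" "t <= 1"
 shows "mix t M N = measure_pmf (bernoulli_pmf t) \<bind> (%b. if b then N else M)"
  and "(%b. if b then N else M) \<in> measure_pmf (bernoulli_pmf t) \<rightarrow>\<^sub>M subprob_algebra M"
proof -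
 have sp: "space N = space M" by (rule sets_eq_imp_space_eq[OF s])
 show k: "(%b. if b then N else M) \<in> measure_pmf (bernoulli_pmf t) \<rightarrow>\<^sub>M subprob_algebra M"
  unfolding measurable_pmf_measure1 using M N s by (auto simp: space_subprob_algebra prob_space_imp_subprob_space)
 have sm: "sets (mix t M N) = sets M" unfolding mix_def by (simp add: sets.sets_measure_of_eq)
 show "mix t M N = measure_pmf (bernoulli_pmf t) \<bind> (%b. if b then N else M)"
 proof (rule measure_eqI)
  show "sets (mix t M N) = sets (measure_pmf (bernoulli_pmf t) \<bind> (%b. if b then N else M))"
   unfolding sm by (rule sets_bind[OF sets_kernel[OF k], symmetric]) auto
  fix A assume "A \<in> sets (mix t M N)"
  then have A: "A \<in> sets M" by (simp add: sm)
  show "emeasure (mix t M N) A = emeasure (measure_pmf (bernoulli_pmf t) \<bind> (%b. if b then N else M)) A"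
   unfolding emeasure_mix[OF s[symmetric] A] emeasure_bind[OF _ k A, simplified]
   using t by (simp add: mult.commute add.commute ennreal_minus)
 qed
qed

lemma mix_integral:
 assumes M: "prob_space M" and N: "prob_space N" and s: "sets N = sets M" and t: "0 <= t" "t <= 1"
 shows "prob_space (mix t M N)" "sets (mix t M N) = sets M"
  and "integrable M f ==> integrable N f ==>
   has_bochner_integral (mix t M N) f ((1 - t) * (LINT x|M. f x) + t * (LINT x|N. f x) :: real)"
proof -
 note eq = mix_eq_bind[OF M N s t]
 show sm: "sets (mix t M N) = sets M" unfolding mix_def by (simp add: sets.sets_measure_of_eq)
 have nn: "(nn_integral (mix t M N) (%x. g x)) = (1 - t) * (nn_integral M (%x. g x)) + t * (nn_integral N (%x. g x))" if "g \<in> borel_measurable M" for g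
  unfolding eq(1) nn_integral_bind[OF that eq(2)] using t by (simp add: mult.commute add.commute ennreal_minus)
 have "emeasure (mix t M N) (space (mix t M N)) = ennreal (1 - t) * emeasure M (space M) + ennreal t * emeasure N (space N)"
  unfolding sets_eq_imp_space_eq[OF sm] using emeasure_mix[OF s[symmetric] sets.top] sets_eq_imp_space_eq[OF s] by simp
 also have "\<dots> = 1" using t M N by (simp add: prob_space.emeasure_space_1 flip: ennreal_plus)
 finally show "prob_space (mix t M N)" by (rule prob_spaceI)
 have pos: "has_bochner_integral (mix t M N) g ((1 - t) * (LINT x|M. g x) + t * (LINT x|N. g x))"
  if gM: "integrable M g" and gN: "integrable N g" and g0: "!!x. 0 <= g x" for g :: "_ => real"
 proof (rule has_bochner_integral_nn_integral)
  have gm: "g \<in> borel_measurable M" using gM by (rule borel_measurable_integrable)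
  then show "g \<in> borel_measurable (mix t M N)" by (simp add: measurable_cong_sets[OF sm refl])
  have i0: "0 <= (LINT x|M. g x)" "0 <= (LINT x|N. g x)" using g0 by (auto intro!: integral_nonneg_AE)
  then show "0 <= (1 - t) * (LINT x|M. g x) + t * (LINT x|N. g x)" using t by simp
  have "(nn_integral (mix t M N) (%x. ennreal (g x))) = (1 - t) * (nn_integral M (%x. g x)) + t * (nn_integral N (%x. g x))" by (rule nn) (use gm in measurable)
  also have "\<dots> = ennreal ((1 - t) * (LINT x|M. g x) + t * (LINT x|N. g x))"
   using t i0 g0 gM gN by (simp add: nn_integral_eq_integral ennreal_mult ennreal_plus)
  finally show "(nn_integral (mix t M N) (%x. ennreal (g x))) = ennreal ((1 - t) * (LINT x|M. g x) + t * (LINT x|N. g x))" .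
 qed (use g0 in auto)
 assume fM: "integrable M f" and fN: "integrable N f"
 let ?p = "%x. max 0 (f x)" and ?n = "%x. max 0 (- f x)"
 have i: "integrable M ?p" "integrable N ?p" "integrable M ?n" "integrable N ?n"
  using fM fN by (auto intro!: integrable_max)
 have pn: "(%x. ?p x - ?n x) = f" by (rule ext) auto
 have "(1 - t) * (LINT x|M. f x) + t * (LINT x|N. f x) =
   ((1 - t) * (LINT x|M. ?p x) + t * (LINT x|N. ?p x)) - ((1 - t) * (LINT x|M. ?n x) + t * (LINT x|N. ?n x))"
  unfolding Bochner_Integration.integral_diff[OF i(1,3), unfolded pn] Bochner_Integration.integral_diff[OF i(2,4), unfolded pn]
  by (simp add: algebra_simps)
 then show "has_bochner_integral (mix t M N) f ((1 - t) * (LINT x|M. f x) + t * (LINT x|N. f x))"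
  using has_bochner_integral_diff[OF pos[OF i(1,2)] pos[OF i(3,4)]] unfolding pn by simp
qed

lemma mix_velocity_plan:
 fixes M N :: "('x::{real_inner, polish_space} \<times> 'x) measure"
 assumes M: "M \<in> TP2" "base M = \<mu>" "vel_norm M <= K" and N: "N \<in> TP2" "base N = \<mu>" "vel_norm N <= K" and t: "0 <= t" "t <= 1"
 shows "mix t M N \<in> TP2" "base (mix t M N) = \<mu>" "vel_norm (mix t M N) <= K"
proof -
 note DM = TP2D[OF M(1)] and DN = TP2D[OF N(1)]
 have s: "sets N = sets M" using DM DN by simp
 note mi = mix_integral[OF DM(1) DN(1) s t]
 have sm [measurable_cong]: "sets (mix t M N) = sets borel" using mi(2) DM(2) by simp
 have "integrable (mix t M N) (%z. (norm (fst z))^2)" using mi(3)[OF DM(4) DN(4)] by (rule integrable.intros)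
 moreover have v: "has_bochner_integral (mix t M N) (%z. (norm (snd z))^2) ((1 - t) * (vel_norm M)^2 + t * (vel_norm N)^2)"
  unfolding vel_norm_sq by (rule mi(3)[OF DM(5) DN(5)])
 then have "integrable (mix t M N) (%z. (norm (snd z))^2)" by (rule integrable.intros)
 ultimately show "mix t M N \<in> TP2" using mi(1) sm by (auto simp: TP2_def split_beta')
 have K: "0 <= K" using vel_norm_nonneg[of M] M(3) by linarith
 have "(vel_norm (mix t M N))^2 = (1 - t) * (vel_norm M)^2 + t * (vel_norm N)^2"
  unfolding vel_norm_sq[of "mix t M N"] by (rule has_bochner_integral_integral_eq[OF v])
 also have "\<dots> <= (1 - t) * K^2 + t * K^2"
  using M(3) N(3) t vel_norm_nonneg by (intro add_mono mult_left_mono power_mono) auto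
 also have "\<dots> = K^2" by (simp add: algebra_simps)
 finally show "vel_norm (mix t M N) <= K" using K by (rule power2_le_imp_le)
 show "base (mix t M N) = \<mu>"
 proof (rule measure_eqI)
  have sb: "sets (base Q) = sets borel" for Q :: "('x \<times> 'x) measure" by (simp add: base_def)
  show "sets (base (mix t M N)) = sets \<mu>" unfolding sb M(2)[symmetric] ..
  fix A assume "A \<in> sets (base (mix t M N))"
  then have [measurable]: "A \<in> sets borel" by (simp add: sb)
  have A': "A \<times> UNIV \<in> sets M" using DM(2) by (simp add: borel_Times)
  have e: "emeasure (base Q) A = emeasure Q (A \<times> UNIV)" if "sets Q = sets borel" for Q :: "('x \<times> 'x) measure"
  proof -
   have "fst \<in> Q \<rightarrow>\<^sub>M borel" by (simp add: measurable_cong_sets[OF that refl])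
   moreover have "fst -` A \<inter> space Q = A \<times> UNIV" using sets_eq_imp_space_eq[OF that] by auto
   ultimately show ?thesis unfolding base_def by (simp add: emeasure_distr)
  qed
  have "emeasure (base (mix t M N)) A = ennreal (1 - t) * emeasure (base M) A + ennreal t * emeasure (base N) A"
   unfolding e[OF sm] e[OF DM(2)] e[OF DN(2)] by (rule emeasure_mix[OF s[symmetric] A'])
  also have "\<dots> = (ennreal (1 - t) + ennreal t) * emeasure \<mu> A" unfolding M(2) N(2) by (simp add: distrib_right)
  also have "ennreal (1 - t) + ennreal t = 1" using t by (simp flip: ennreal_plus)
  finally show "emeasure (base (mix t M N)) A = emeasure \<mu> A" by simp
 qed
qed

lemma convex_measures_hull: "convex_measures (convex_measures hull S)"
 by (rule hull_in) (auto simp: convex_measures_def)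

section \<open>From one-sided bounds to equality\<close>

text \<open>
 If the squared distance of \<open>Y\<close> to \<open>L\<close> had a positive infimum, then moving from a
 nearly closest point \<open>y\<close> towards a point \<open>z\<close> of \<open>Y\<close>, for which \<open>z
 - L\<close> has almost no positive component along \<open>y - L\<close>, would decrease it below the infimum.
\<close>
lemma convex_family_attains:
 fixes Y :: "(nat => real) set" and n :: nat
 assumes conv: "!!y z t. y \<in> Y ==> z \<in> Y ==> 0 <= t ==> t <= 1 ==> \<exists>w\<in>Y. \<forall>k<n. w k = (1 - t) * y k + t * z k"
  and bd: "!!y. y \<in> Y ==> (\<Sum>k<n. (y k - L k)^2) <= K"
  and half: "!!a e. 0 < e ==> \<exists>y\<in>Y. (\<Sum>k<n. a k * (y k - L k)) <= e"
  and e: "0 < e"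
 shows "\<exists>y\<in>Y. (\<Sum>k<n. (y k - L k)^2) < e"
proof (rule ccontr)
 define J where "J y = (\<Sum>k<n. (y k - L k)^2)" for y
 assume "\<not> ?thesis"
 then have Je: "e <= J y" if "y \<in> Y" for y using that unfolding J_def by force
 have Y: "J ` Y ~= {}" using half[of 1] by auto
 define m where "m = Inf (J ` Y)"
 have bdd: "bdd_below (J ` Y)" using Je by (intro bdd_belowI[of _ e]) auto
 have mJ: "m <= J y" if "y \<in> Y" for y unfolding m_def using bdd that by (intro cInf_lower) auto
 have m: "0 < m"
 proof -
  have "e <= m" unfolding m_def using Je Y by (intro cInf_greatest) auto
  then show ?thesis using e by linarith
 qed
 have K: "m <= K" using Y mJ bd unfolding J_def by force
 define t where "t = m / (4 * K)"
 have t: "0 < t" "t <= 1" "t * K = m / 4" using m K by (auto simp: t_def divide_simps)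
 have "Inf (J ` Y) < m + t * m" using m t by (simp add: m_def)
 from cInf_lessD[OF Y this] obtain y where y: "y \<in> Y" "J y < m + t * m" by auto
 obtain z where z: "z \<in> Y" "(\<Sum>k<n. (y k - L k) * (z k - L k)) <= m / 4" using half[of "m / 4" "%k. y k - L k"] m by auto
 obtain w where w: "w \<in> Y" "!!k. k < n ==> w k = (1 - t) * y k + t * z k" using conv[OF y(1) z(1), of t] t by auto
 have "J w = (\<Sum>k<n. (1 - t)^2 * (y k - L k)^2 + 2 * t * (1 - t) * ((y k - L k) * (z k - L k)) + t^2 * (z k - L k)^2)"
  unfolding J_def
 proof (rule sum.cong[OF refl])
  fix k assume "k \<in> {..<n}"
  then have wk: "w k - L k = (1 - t) * (y k - L k) + t * (z k - L k)" using w(2)[of k] by (simp add: algebra_simps)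
  show "(w k - L k)^2 = (1 - t)^2 * (y k - L k)^2 + 2 * t * (1 - t) * ((y k - L k) * (z k - L k)) + t^2 * (z k - L k)^2"
   unfolding wk by (simp add: power2_eq_square algebra_simps)
 qed
 also have "\<dots> = (1 - t)^2 * J y + 2 * t * (1 - t) * (\<Sum>k<n. (y k - L k) * (z k - L k)) + t^2 * J z"
  unfolding J_def by (simp add: sum.distrib sum_distrib_left)
 also have "\<dots> <= (1 - t)^2 * J y + t * m / 2 + t^2 * K"
 proof -
  have "2 * t * (1 - t) * (\<Sum>k<n. (y k - L k) * (z k - L k)) <= 2 * t * (1 - t) * (m / 4)" using t z by (intro mult_left_mono) auto
  also have "\<dots> <= 2 * t * 1 * (m / 4)" using t m by (intro mult_right_mono mult_left_mono) auto
  also have "\<dots> = t * m / 2" by simp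
  finally have "2 * t * (1 - t) * (\<Sum>k<n. (y k - L k) * (z k - L k)) <= t * m / 2" .
  moreover have "t^2 * J z <= t^2 * K" using bd[OF z(1)] by (intro mult_left_mono) (auto simp: J_def)
  ultimately show ?thesis by linarith
 qed
 also have "(1 - t)^2 * J y = J y - 2 * t * J y + t^2 * J y" by (simp add: power2_eq_square algebra_simps)
 also have "\<dots> <= J y - 2 * t * m + t^2 * K"
 proof -
  have "2 * t * m <= 2 * t * J y" using t mJ[OF y(1)] by (intro mult_left_mono) auto
  moreover have "t^2 * J y <= t^2 * K" using bd[OF y(1)] by (intro mult_left_mono) (auto simp: J_def)
  ultimately show ?thesis by linarith
 qed
 also have "t^2 * K = t * m / 4" using t(3) by (simp add: power2_eq_square)
 finally have "J w <= J y - t * m" by (simp add: mult.commute)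
 then show False using y(2) mJ[OF w(1)] by linarith
qed

lemma L2_dominated_limit:
 assumes \<mu>: "\<mu> \<in> P2" and f: "!!n. f n \<in> borel_measurable borel" and g: "g \<in> borel_measurable borel"
  and fK: "!!n x. norm (f n x) <= K" and lim: "!!x. (%n. f n x) ----> g x"
 shows "(%n. L2norm \<mu> (%x. f n x - g x)) ----> 0"
proof -
 note [measurable_cong] = P2D(2)[OF \<mu>]
 note [measurable] = f g
 interpret prob_space \<mu> by (rule P2D[OF \<mu>])
 have gK: "norm (g x) <= K" for x by (rule LIMSEQ_le_const2[OF tendsto_norm[OF lim]]) (use fK in auto)
 have "(%n. \<integral>x. (norm (f n x - g x))^2 \<partial>\<mu>) ----> (LINT x|\<mu>. 0)"
 proof (rule integral_dominated_convergence[where w = "%x. (2 * K)^2"])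
  show "AE x in \<mu>. (%n. (norm (f n x - g x))^2) ----> 0"
  proof (rule AE_I2)
   fix x
   have "(%n. (norm (f n x - g x))^2) ----> (norm (g x - g x))^2" by (intro tendsto_intros lim)
   then show "(%n. (norm (f n x - g x))^2) ----> 0" by simp
  qed
  have "norm (f n x - g x) <= 2 * K" for n x using norm_triangle_ineq4[of "f n x" "g x"] fK[of n x] gK[of x] by linarith
  then have "norm ((norm (f n x - g x))^2) <= (2 * K)^2" for n x
   unfolding real_norm_def abs_power2 by (rule power_mono) simp
  then show "AE x in \<mu>. norm ((norm (f n x - g x))^2) <= (2 * K)^2" for n by simp
 qed auto
 from tendsto_real_sqrt[OF this] show ?thesis by simp
qed

lemma Cyl_zero: "(%_. 0) \<in> Cyl"
proof -
 have z: "foldr pderiv_coord is (%_. 0) = (%_. 0)" for "is" :: "nat list"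
  by (induction "is") (auto simp: pderiv_coord_def)
 have "(%_. 0) \<in> Cc_smooth 0" unfolding Cc_smooth_def by auto
 then show ?thesis unfolding Cyl_def by (auto intro!: exI[of _ "0::nat"] exI[of _ "%_. 0"] simp: orthonormal_upto_def)
qed

lemma gradient_combination_L2:
 assumes \<mu>: "\<mu> \<in> P2" and \<phi>: "!!k. \<phi> k \<in> Cyl" and \<psi>: "\<psi> \<in> Cyl"
 shows "(%x. grad_diff \<psi> n a \<phi> x) \<in> L2_fields \<mu>"
proof (induction n)
 case (Suc n)
 have "(%x. a n *\<^sub>R grad (\<phi> n) x) \<in> L2_fields \<mu>"
  using Cyl_grad_L2[OF \<mu> \<phi>[of n]] by (auto simp: L2_fields_def power_mult_distrib)
 from L2_inner_diff(1)[OF \<mu> Suc.IH this] show ?case by (simp add: algebra_simps)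
qed (simp add: Cyl_grad_L2[OF \<mu> \<psi>])

lemma Cyl_combination_approx:
 assumes \<mu>: "\<mu> \<in> P2" and \<phi>: "!!k. \<phi> k \<in> Cyl"
 shows "0 < \<delta> ==> \<exists>\<psi>\<in>Cyl. L2norm \<mu> (grad_diff \<psi> n a \<phi>) < \<delta>"
proof (induction n arbitrary: \<delta>)
 case 0
 have "grad (%x. 0 * \<phi> 0 x) = (%x. 0)" unfolding Cyl_scale(2)[OF \<phi>] by simp
 then show ?case using 0 by (intro bexI[OF _ Cyl_zero]) simp
next
 case (Suc n)
 note [measurable_cong] = P2D(2)[OF \<mu>]
 have \<delta>2: "0 < \<delta> / 2" using Suc.prems by simp
 define S where "S x = (\<Sum>k<n. a k *\<^sub>R grad (\<phi> k) x)" for x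
 obtain \<psi> where \<psi>: "\<psi> \<in> Cyl" "L2norm \<mu> (%x. grad \<psi> x - S x) < \<delta> / 2"
  using Suc.IH[OF \<delta>2] unfolding S_def by blast
 have c: "(%x. a n * \<phi> n x) \<in> Cyl" by (rule Cyl_scale(1)[OF \<phi>])
 define G where "G x = grad \<psi> x + a n *\<^sub>R grad (\<phi> n) x" for x
 obtain \<Phi> K where \<Phi>: "!!m. \<Phi> m \<in> Cyl" and K: "!!m x. norm (grad (\<Phi> m) x) <= K"
  and ev: "!!x. \<forall>\<^sub>F m in sequentially. grad (\<Phi> m) x = G x"
  using Cyl_add_approx[OF \<psi>(1) c] unfolding Cyl_scale(2)[OF \<phi>] G_def by blast
 note gm = Cyl_grad_measurable
 have [measurable]: "grad (\<phi> k) \<in> borel_measurable borel" "grad \<psi> \<in> borel_measurable borel" "grad (\<Phi> m) \<in> borel_measurable borel" for k m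
  by (intro gm \<phi> \<psi> \<Phi>)+
 have Gm [measurable]: "G \<in> borel_measurable borel" and Sm [measurable]: "S \<in> borel_measurable borel"
  unfolding G_def[abs_def] S_def[abs_def] by measurable
 have "(%m. L2norm \<mu> (%x. grad (\<Phi> m) x - G x)) ----> 0"
  by (rule L2_dominated_limit[OF \<mu> _ Gm K]) (auto intro!: tendsto_eventually ev)
 from order_tendstoD(2)[OF this \<delta>2] obtain m where m: "L2norm \<mu> (%x. grad (\<Phi> m) x - G x) < \<delta> / 2"
  by (auto dest: eventually_happens)
 have L: "grad (\<Phi> m) \<in> L2_fields \<mu>" "grad \<psi> \<in> L2_fields \<mu>" "grad (\<phi> k) \<in> L2_fields \<mu>" for k
  by (intro Cyl_grad_L2 \<mu> \<phi> \<psi> \<Phi>)+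
 have GL: "G \<in> L2_fields \<mu>"
 proof -
  have "(%x. - a n *\<^sub>R grad (\<phi> n) x) \<in> L2_fields \<mu>"
   using L(3)[of n] by (auto simp: L2_fields_def power_mult_distrib)
  from L2_inner_diff(1)[OF \<mu> L(2) this] show ?thesis by (simp add: G_def[abs_def])
 qed
 have PS: "(%x. grad \<psi> x - S x) \<in> L2_fields \<mu>"
  unfolding S_def by (rule gradient_combination_L2[OF \<mu> \<phi> \<psi>(1)])
 have "L2norm \<mu> (%x. (grad (\<Phi> m) x - G x) + (grad \<psi> x - S x))
   <= L2norm \<mu> (%x. grad (\<Phi> m) x - G x) + L2norm \<mu> (%x. grad \<psi> x - S x)"
  by (rule norm_minkowski) (use L2_inner_diff(1)[OF \<mu> L(1) GL] PS in "auto simp: L2_fields_def")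
 moreover have "(grad (\<Phi> m) x - G x) + (grad \<psi> x - S x) = grad (\<Phi> m) x - (\<Sum>k<Suc n. a k *\<^sub>R grad (\<phi> k) x)" for x
  by (simp add: G_def S_def)
 ultimately show ?case using m \<psi>(2) by (intro bexI[OF _ \<Phi>[of m]]) simp
qed

text \<open>
 A linear combination of gradients is nearly the gradient of some \<open>\<psi> \<in> Cyl\<close>. The
 hypothesis for \<open>\<psi>\<close> provides the half-space condition of the convexity argument.
\<close>
lemma velocity_plan_selection:
 fixes S :: "('x::{real_inner, polish_space} \<times> 'x) measure set" and L :: "('x => real) => real"
 assumes \<mu>: "\<mu> \<in> P2" and S: "S \<subseteq> TP2"
  and wit: "!!\<phi>. \<phi> \<in> Cyl ==> \<exists>\<Phi>\<in>S. base \<Phi> = \<mu> \<and> vel_norm \<Phi> <= M \<and> tested \<phi> \<Phi> <= L \<phi>"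
  and lin: "L2_continuous_linear \<mu> C L"
 shows "\<exists>\<Phi>\<in>sw_closed_hull S. \<Phi> \<in> TP2 \<and> base \<Phi> = \<mu> \<and> (\<forall>\<phi>\<in>Cyl. tested \<phi> \<Phi> = L \<phi>)"
proof -
 define A where "A \<phi> \<Phi> = tested \<phi> \<Phi>" for \<phi> and \<Phi> :: "('x \<times> 'x) measure"
 define C' where "C' = {\<Psi> \<in> convex_measures hull S. \<Psi> \<in> TP2 \<and> base \<Psi> = \<mu> \<and> vel_norm \<Psi> <= M}"
 have M0: "0 <= M" using wit[OF Cyl_zero] vel_norm_nonneg order_trans by blast
 have gL: "grad \<phi> \<in> L2_fields \<mu>" if "\<phi> \<in> Cyl" for \<phi> by (rule Cyl_grad_L2[OF \<mu> that])
 have Ai: "integrable \<Phi> (%z. grad \<phi> (fst z) \<bullet> snd z)" if "\<Phi> \<in> C'" "\<phi> \<in> Cyl" for \<phi> \<Phi>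
  using that gL by (intro grad_velocity_integrable(1)) (auto simp: C'_def)
 have Ab: "abs (A \<phi> \<Phi>) <= L2norm \<mu> (grad \<phi>) * M" if "\<Phi> \<in> C'" "\<phi> \<in> Cyl" for \<phi> \<Phi>
 proof -
  have "abs (A \<phi> \<Phi>) <= L2norm (base \<Phi>) (grad \<phi>) * vel_norm \<Phi>"
   unfolding A_def by (rule grad_velocity_integrable(2)) (use that gL in "auto simp: C'_def")
  also have "\<dots> <= L2norm \<mu> (grad \<phi>) * M" using that by (intro mult_mono) (auto simp: C'_def vel_norm_nonneg)
  finally show ?thesis .
 qed
 have Cmix: "mix t \<Phi> \<Psi> \<in> C' \<and> (\<forall>\<phi>\<in>Cyl. A \<phi> (mix t \<Phi> \<Psi>) = (1 - t) * A \<phi> \<Phi> + t * A \<phi> \<Psi>)"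
  if "\<Phi> \<in> C'" "\<Psi> \<in> C'" "0 <= t" "t <= 1" for \<Phi> \<Psi> t
 proof -
  have c: "\<Phi> \<in> TP2" "base \<Phi> = \<mu>" "vel_norm \<Phi> <= M" "\<Psi> \<in> TP2" "base \<Psi> = \<mu>" "vel_norm \<Psi> <= M"
   and h: "\<Phi> \<in> convex_measures hull S" "\<Psi> \<in> convex_measures hull S" using that by (auto simp: C'_def)
  have "mix t \<Phi> \<Psi> \<in> convex_measures hull S" using convex_measures_hull[of S] h that(3,4) unfolding convex_measures_def by blast
  then have "mix t \<Phi> \<Psi> \<in> C'" using mix_velocity_plan[OF c that(3,4)] by (simp add: C'_def)
  moreover have "A \<phi> (mix t \<Phi> \<Psi>) = (1 - t) * A \<phi> \<Phi> + t * A \<phi> \<Psi>" if "\<phi> \<in> Cyl" for \<phi>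
   unfolding A_def
   by (rule has_bochner_integral_integral_eq, rule mix_integral(3))
    (use TP2D[OF c(1)] TP2D[OF c(4)] \<open>0 <= t\<close> \<open>t <= 1\<close> Ai[OF \<open>\<Phi> \<in> C'\<close> that] Ai[OF \<open>\<Psi> \<in> C'\<close> that] in auto)
  ultimately show ?thesis by blast
 qed
 obtain D :: "('x => real) set" where D: "countable D" "D \<subseteq> Cyl"
  and dense: "!!\<phi>. \<phi> \<in> Cyl ==> grad_approx D \<phi>"
  using Cyl_countable_dense by blast
 have "D ~= {}" using dense[OF Cyl_zero] by blast
 define d where "d = from_nat_into D"
 have dC: "d k \<in> Cyl" for k using from_nat_into[OF \<open>D ~= {}\<close>, of k] D by (auto simp: d_def)
 have dD: "\<exists>k. d k = \<phi>" if "\<phi> \<in> D" for \<phi> using from_nat_into_surj[OF D(1) that] by (auto simp: d_def)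
 define R where "R k = L2norm \<mu> (grad (d k))" for k
 have appr: "\<exists>\<Psi>\<in>C'. (\<Sum>k<n. (A (d k) \<Psi> - L (d k))^2) < e" if e: "0 < e" for n e
 proof -
  let ?Y = "(%\<Psi> k. A (d k) \<Psi>) ` C'"
  have "\<exists>y\<in>?Y. (\<Sum>k<n. (y k - L (d k))^2) < e"
  proof (rule convex_family_attains[OF _ _ _ e])
   fix y z :: "nat => real" and t :: real assume yz: "y \<in> ?Y" "z \<in> ?Y" and t: "0 <= t" "t <= 1"
   obtain \<Phi> \<Psi> where \<Phi>\<Psi>: "y = (%k. A (d k) \<Phi>)" "z = (%k. A (d k) \<Psi>)" "\<Phi> \<in> C'" "\<Psi> \<in> C'" using yz by blast
   have "(%k. A (d k) (mix t \<Phi> \<Psi>)) \<in> ?Y" using Cmix[OF \<Phi>\<Psi>(3,4) t] by blast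
   then show "\<exists>w\<in>?Y. \<forall>k<n. w k = (1 - t) * y k + t * z k"
    by (rule bexI[rotated]) (use Cmix[OF \<Phi>\<Psi>(3,4) t] \<Phi>\<Psi> dC in auto)
  next
   fix y assume "y \<in> ?Y"
   then obtain \<Phi> where y: "y = (%k. A (d k) \<Phi>)" "\<Phi> \<in> C'" by blast
   show "(\<Sum>k<n. (y k - L (d k))^2) <= (\<Sum>k<n. (R k * M + abs (L (d k)))^2)"
   proof (rule sum_mono)
    fix k
    have "abs (y k - L (d k)) <= R k * M + abs (L (d k))" using Ab[OF y(2) dC[of k]] unfolding y(1) R_def by linarith
    from power_mono[OF this abs_ge_zero, of 2] show "(y k - L (d k))^2 <= (R k * M + abs (L (d k)))^2" by simp
   qed
  next
   fix a :: "nat => real" and e :: real assume e: "0 < e"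
   define \<delta> where "\<delta> = e / (M + abs C + 1)"
   have MC: "0 < M + abs C + 1" using M0 by linarith
   have \<delta>: "0 < \<delta>" using e MC by (simp add: \<delta>_def)
   have \<delta>e: "\<delta> * (M + abs C) <= e"
   proof -
    have "\<delta> * (M + abs C) <= \<delta> * (M + abs C + 1)" using \<delta> by (intro mult_left_mono) auto
    also have "\<dots> = e" using MC by (simp add: \<delta>_def)
    finally show ?thesis .
   qed
   obtain \<psi> where \<psi>: "\<psi> \<in> Cyl" and close: "L2norm \<mu> (grad_diff \<psi> n a d) < \<delta>"
    using Cyl_combination_approx[where \<phi> = d and n = n and a = a, OF \<mu> dC \<delta>] by blast
   define G where "G x = grad_diff \<psi> n a d x" for x
   obtain \<Phi> where \<Phi>: "\<Phi> \<in> S" "base \<Phi> = \<mu>" "vel_norm \<Phi> <= M" "A \<psi> \<Phi> <= L \<psi>" using wit[OF \<psi>] unfolding A_def by blast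
   have \<Phi>C: "\<Phi> \<in> C'" using \<Phi> S hull_inc[of \<Phi> S convex_measures] by (auto simp: C'_def)
   have GL: "G \<in> L2_fields \<mu>" unfolding G_def[abs_def] by (rule gradient_combination_L2[OF \<mu> dC \<psi>])
   have GA: "(LINT z|\<Phi>. G (fst z) \<bullet> snd z) = A \<psi> \<Phi> - (\<Sum>k<n. a k * A (d k) \<Phi>)"
   proof -
    have "(LINT z|\<Phi>. G (fst z) \<bullet> snd z) = (LINT z|\<Phi>. grad \<psi> (fst z) \<bullet> snd z - (\<Sum>k<n. a k * (grad (d k) (fst z) \<bullet> snd z)))"
     by (simp add: G_def inner_diff_left inner_sum_left)
    also have "\<dots> = A \<psi> \<Phi> - (\<Sum>k<n. a k * A (d k) \<Phi>)"
     unfolding A_def using Ai[OF \<Phi>C \<psi>] Ai[OF \<Phi>C dC] by simp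
    finally show ?thesis .
   qed
   have "abs (LINT z|\<Phi>. G (fst z) \<bullet> snd z) <= L2norm \<mu> G * vel_norm \<Phi>"
    using grad_velocity_integrable(2)[of \<Phi> G] \<Phi> S GL by auto
   also have "\<dots> <= \<delta> * M" using close \<Phi>(3) vel_norm_nonneg[of \<Phi>] \<delta> by (intro mult_mono) (auto simp: G_def)
   finally have 1: "(\<Sum>k<n. a k * A (d k) \<Phi>) <= L \<psi> + \<delta> * M" using GA \<Phi>(4) by linarith
   have "abs (L \<psi> - (\<Sum>k<n. a k * L (d k))) <= C * L2norm \<mu> G"
    unfolding G_def using lin dC \<psi> by blast
   also have "\<dots> <= abs C * \<delta>" using close by (intro mult_mono) (auto simp: G_def)
   finally have "(\<Sum>k<n. a k * A (d k) \<Phi>) - (\<Sum>k<n. a k * L (d k)) <= e" using 1 \<delta>e by (simp add: algebra_simps)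
   then show "\<exists>y\<in>?Y. (\<Sum>k<n. a k * (y k - L (d k))) <= e"
    using \<Phi>C by (intro bexI[of _ "%k. A (d k) \<Phi>"]) (auto simp: right_diff_distrib sum_subtractf)
  qed
  then show ?thesis by blast
 qed
 have "\<forall>n. \<exists>\<Psi>. \<Psi> \<in> C' \<and> (\<Sum>k<n. (A (d k) \<Psi> - L (d k))^2) < 1 / real (Suc n)"
 proof
  fix n
  have "0 < 1 / real (Suc n)" by simp
  from appr[OF this, of n] show "\<exists>\<Psi>. \<Psi> \<in> C' \<and> (\<Sum>k<n. (A (d k) \<Psi> - L (d k))^2) < 1 / real (Suc n)" by blast
 qed
 from choice[OF this] obtain \<Psi> where \<Psi>: "!!n. \<Psi> n \<in> C'"
  and \<Psi>L: "!!n. (\<Sum>k<n. (A (d k) (\<Psi> n) - L (d k))^2) < 1 / real (Suc n)" by blast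
 have \<Psi>T: "\<Psi> n \<in> TP2" "base (\<Psi> n) = \<mu>" "vel_norm (\<Psi> n) <= M" "\<Psi> n \<in> convex_measures hull S" for n using \<Psi>[of n] by (auto simp: C'_def)
 have id: "distr \<mu> borel (%x. x) = \<mu>" by (rule distr_id2) (simp add: P2D[OF \<mu>])
 have "\<exists>k \<Phi>. strict_mono (k :: nat => nat) \<and> limitin sw_topology (%n. \<Psi> (k n)) \<Phi> sequentially \<and> base \<Phi> = \<mu> \<and> vel_norm \<Phi> <= M"
  by (rule sw_compactness[OF \<Psi>T(1) \<mu>, where T = "%_ x. x" and \<delta> = "%_. 0"]) (use \<Psi>T id in auto)
 then obtain k \<Phi> where k: "strict_mono (k :: nat => nat)" and lim: "limitin sw_topology (%n. \<Psi> (k n)) \<Phi> sequentially"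
  and \<Phi>: "base \<Phi> = \<mu>" "vel_norm \<Phi> <= M" by blast
 have \<Phi>T: "\<Phi> \<in> TP2" and \<zeta>lim: "!!\<zeta>. \<zeta> \<in> sw_test ==> (%n. integral\<^sup>L (\<Psi> (k n)) \<zeta>) ----> integral\<^sup>L \<Phi> \<zeta>"
  using lim unfolding limitin_sw_iff[OF \<Psi>T(1)] by auto
 have AD: "A \<phi> \<Phi> = L \<phi>" if \<phi>D: "\<phi> \<in> D" for \<phi>
 proof -
  obtain i where i: "d i = \<phi>" using dD[OF \<phi>D] by blast
  obtain B where B: "c11_bound B \<phi>" using Cyl_c11_bound[OF dC[of i]] i by blast
  have "(%(x, v). grad \<phi> x \<bullet> v) \<in> sw_test" by (rule sw_test_inner[OF c11_continuous_grad[OF B] c11D(3)[OF B]])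
  from \<zeta>lim[OF this] have 1: "(%n. A \<phi> (\<Psi> (k n))) ----> A \<phi> \<Phi>" by (simp add: split_beta' A_def)
  have "(%n. (A \<phi> (\<Psi> n) - L \<phi>)^2) ----> 0"
  proof (rule tendsto_sandwich[OF _ _ tendsto_const LIMSEQ_Suc[OF lim_1_over_n]])
   show "\<forall>\<^sub>F n in sequentially. (A \<phi> (\<Psi> n) - L \<phi>)^2 <= 1 / real (Suc n)"
    using eventually_gt_at_top[of i]
   proof eventually_elim
    case (elim n)
    then have "(A (d i) (\<Psi> n) - L (d i))^2 <= (\<Sum>k<n. (A (d k) (\<Psi> n) - L (d k))^2)" by (intro member_le_sum) auto
    then show ?case using \<Psi>L[of n] i by simp
   qed
  qed simp
  from tendsto_real_sqrt[OF this] have "(%n. abs (A \<phi> (\<Psi> n) - L \<phi>)) ----> 0" by simp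
  then have "(%n. A \<phi> (\<Psi> n) - L \<phi>) ----> 0" by (rule tendsto_rabs_zero_cancel)
  then have "(%n. A \<phi> (\<Psi> n)) ----> L \<phi>" by (rule LIM_zero_cancel)
  from LIMSEQ_subseq_LIMSEQ[OF this k] have "(%n. A \<phi> (\<Psi> (k n))) ----> L \<phi>" by (simp add: comp_def)
  with 1 show ?thesis by (rule LIMSEQ_unique)
 qed
 have "A \<phi> \<Phi> = L \<phi>" if \<phi>: "\<phi> \<in> Cyl" for \<phi>
 proof -
  obtain p K where p: "!!n. p n \<in> D" "!!n x. norm (grad (p n) x) <= K" "!!x. (%n. grad (p n) x) ----> grad \<phi> x"
   using dense[OF \<phi>] by blast
  have pC: "p n \<in> Cyl" for n using p(1) D by blast
  have z: "(%n. L2norm \<mu> (%x. grad (p n) x - grad \<phi> x)) ----> 0"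
   by (rule L2_dominated_limit[OF \<mu> Cyl_grad_measurable[OF pC] Cyl_grad_measurable[OF \<phi>] p(2,3)])
  have "abs (A (p n) \<Phi> - A \<phi> \<Phi>) <= L2norm \<mu> (%x. grad (p n) x - grad \<phi> x) * M" for n
  proof -
   have iA: "integrable \<Phi> (%z. grad \<psi> (fst z) \<bullet> snd z)" if "\<psi> \<in> Cyl" for \<psi>
    by (rule grad_velocity_integrable(1)[OF \<Phi>T]) (use \<Phi> gL[OF that] in auto)
   have GL: "(%x. grad (p n) x - grad \<phi> x) \<in> L2_fields (base \<Phi>)"
    unfolding \<Phi>(1) by (rule L2_inner_diff(1)[OF \<mu> gL[OF pC] gL[OF \<phi>]])
   have "A (p n) \<Phi> - A \<phi> \<Phi> = (LINT z|\<Phi>. (grad (p n) (fst z) - grad \<phi> (fst z)) \<bullet> snd z)"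
    unfolding A_def using iA[OF pC] iA[OF \<phi>] by (simp add: inner_diff_left)
   also have "abs \<dots> <= L2norm \<mu> (%x. grad (p n) x - grad \<phi> x) * vel_norm \<Phi>"
    using grad_velocity_integrable(2)[OF \<Phi>T GL] \<Phi>(1) by simp
   also have "\<dots> <= L2norm \<mu> (%x. grad (p n) x - grad \<phi> x) * M" using \<Phi>(2) by (intro mult_left_mono) auto
   finally show ?thesis .
  qed
  then have "(%n. A (p n) \<Phi> - A \<phi> \<Phi>) ----> 0"
   by (intro Lim_null_comparison[OF _ tendsto_mult_left_zero[OF z]] always_eventually) auto
  then have 1: "(%n. A (p n) \<Phi>) ----> A \<phi> \<Phi>" by (rule LIM_zero_cancel)
  have "abs (L (p n) - L \<phi>) <= C * L2norm \<mu> (%x. grad (p n) x - grad \<phi> x)" for n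
   using lin[rule_format, where \<phi> = "%_. \<phi>" and n = 1 and a = "%_. 1", OF \<phi> pC[of n]] by simp
  then have "(%n. L (p n) - L \<phi>) ----> 0"
   by (intro Lim_null_comparison[OF _ tendsto_mult_right_zero[OF z]] always_eventually) auto
  then have "(%n. L (p n)) ----> L \<phi>" by (rule LIM_zero_cancel)
  with 1 show ?thesis using AD[OF p(1)] by (simp add: LIMSEQ_unique)
 qed
 moreover have "\<Phi> \<in> sw_closed_hull S"
  unfolding sw_closed_hull_def using lim \<Psi>T(4) by (intro CollectI exI[of _ "%n. \<Psi> (k n)"]) auto
 ultimately show ?thesis using \<Phi>T \<Phi>(1) unfolding A_def by blast
qed

section \<open>Velocities along the curve\<close>

abbreviation (input) perturbable :: "('x::{real_inner, polish_space} \<times> 'x) measure set => bool" where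
 "perturbable F \<equiv> \<forall>\<nu>\<in>mpvf_dom F. \<exists>M>0. \<exists>\<epsilon>>0. \<forall>\<phi>\<in>Cyl. (\<forall>x. norm (grad \<phi> x) <= \<epsilon>) -->
     distr \<nu> borel (exp_cyl \<phi>) \<in> mpvf_dom F \<and> mpvf_norm F (distr \<nu> borel (exp_cyl \<phi>)) < M"

lemma evi_velocity_plan:
 assumes F: "mpvf F"
  and dom: "perturbable F"
  and I: "is_interval I" and \<mu>I: "\<mu> ` I \<subseteq> mpvf_dom F" and E: "EVI_solution lam F I \<mu>" and t: "t \<in> I"
  and wit: "!!\<phi> B r. \<phi> \<in> Cyl ==> c11_bound B \<phi> ==> 0 < r ==> 4 * r * B <= 1 ==>
   slope_ge I \<mu> t (shifted (\<mu> t) r (grad \<phi>)) (- (r * L \<phi>))"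
  and lin: "L2_continuous_linear (\<mu> t) C L"
 shows "\<exists>\<Phi>\<in>sw_closed_hull (dir_closure_at F (\<mu> t)). \<Phi> \<in> TP2 \<and> base \<Phi> = \<mu> t \<and>
   (\<forall>\<phi>\<in>Cyl. tested \<phi> \<Phi> = L \<phi>)"
proof -
 have FT: "F \<subseteq> TP2" using F by (simp add: mpvf_def)
 have dP: "mpvf_dom F \<subseteq> P2" using FT base_P2 unfolding mpvf_dom_def by blast
 have P: "\<mu> ` I \<subseteq> P2" using \<mu>I dP by blast
 have \<mu>t: "\<mu> t \<in> mpvf_dom F" using \<mu>I t by blast
 obtain M \<epsilon> where \<epsilon>: "0 < \<epsilon>" and d: "!!\<phi>. \<phi> \<in> Cyl ==> (!!x. norm (grad \<phi> x) <= \<epsilon>) ==>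
   distr (\<mu> t) borel (exp_cyl \<phi>) \<in> mpvf_dom F \<and> mpvf_norm F (distr (\<mu> t) borel (exp_cyl \<phi>)) < M"
  using dom \<mu>t by meson
 show ?thesis
 proof (rule velocity_plan_selection[where M = M and C = C])
  show "\<mu> t \<in> P2" using \<mu>t dP by blast
  show "dir_closure_at F (\<mu> t) \<subseteq> TP2" unfolding dir_closure_at_def by blast
  show "\<exists>\<Phi>\<in>dir_closure_at F (\<mu> t). base \<Phi> = \<mu> t \<and> vel_norm \<Phi> <= M \<and> tested \<phi> \<Phi> <= L \<phi>"
   if \<phi>: "\<phi> \<in> Cyl" for \<phi>
  proof -
   obtain B where B: "c11_bound B \<phi>" using Cyl_c11_bound[OF \<phi>] by blast
   show ?thesis by (rule dir_closure_velocity[OF E I P t FT \<epsilon> d \<phi> B wit[OF \<phi> B]]) blast+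
  qed
 qed (rule lin)
qed

text \<open>At an end of \<open>I\<close> only one direction of time is available.\<close>
lemma interval_one_sided:
 fixes I :: "real set"
 assumes I: "is_interval I" and t: "t \<in> I" "t islimpt I"
 shows "(\<exists>\<delta>>0. \<forall>h\<in>{0<..<\<delta>}. t + h \<in> I) \<or> (\<exists>\<delta>>0. \<forall>h\<in>{-\<delta><..<0}. t + h \<in> I)"
proof -
 obtain x where x: "x \<in> I" "x ~= t" using t(2) islimpt_def by (metis UNIV_I open_UNIV)
 show ?thesis
 proof (cases "t < x")
  case True
  have "t + h \<in> I" if "h \<in> {0<..<x - t}" for h using mem_is_interval_1_I[OF I t(1) x(1), of "t + h"] that by auto
  then show ?thesis using True by (intro disjI1 exI[of _ "x - t"]) auto
 next
  case False
  then have l: "x < t" using x by auto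
  have "t + h \<in> I" if "h \<in> {- (t - x)<..<0}" for h using mem_is_interval_1_I[OF I x(1) t(1), of "t + h"] that by auto
  then show ?thesis using l by (intro disjI2 exI[of _ "t - x"]) auto
 qed
qed

lemma velocity_field_selection:
 fixes F :: "('x::{real_inner, polish_space} \<times> 'x) measure set"
 assumes F: "mpvf F"
  and dom: "perturbable F"
  and I: "is_interval I" and \<mu>I: "\<mu> ` I \<subseteq> mpvf_dom F" and E: "EVI_solution lam F I \<mu>"
  and vf: "velocity_field I \<mu> v A" and tA: "t \<in> A"
 shows "\<exists>\<Phi>\<in>sw_closed_hull (dir_closure_at F (\<mu> t)). AE x in \<mu> t. v t x = tan_proj (\<mu> t) (barycenter \<Phi>) x"
proof -
 have t: "t \<in> I" and tl: "t islimpt I" and vT: "v t \<in> Tan (\<mu> t)"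
  and q: "((%h. W2 (shifted (\<mu> t) h (v t)) (\<mu> (t + h)) / abs h) ---> 0) (at 0 within {h. t + h \<in> I})"
  using vf tA unfolding velocity_field_def by auto
 have vL: "v t \<in> L2_fields (\<mu> t)" using vT by (simp add: Tan_def)
 have "mpvf_dom F \<subseteq> P2" using F base_P2 unfolding mpvf_def mpvf_dom_def by blast
 then have P: "\<mu> ` I \<subseteq> P2" using \<mu>I by blast
 have \<mu>: "\<mu> t \<in> P2" using P t by blast
 define L where "L \<phi> = (LINT x|\<mu> t. v t x \<bullet> grad \<phi> x)" for \<phi>
 have "\<exists>\<Phi>\<in>sw_closed_hull (dir_closure_at F (\<mu> t)). \<Phi> \<in> TP2 \<and> base \<Phi> = \<mu> t \<and>
   (\<forall>\<phi>\<in>Cyl. tested \<phi> \<Phi> = L \<phi>)"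
 proof (rule evi_velocity_plan[OF F dom I \<mu>I E t])
  fix \<phi> :: "'x => real" and B r :: real assume \<phi>: "\<phi> \<in> Cyl" and B: "c11_bound B \<phi>" and r: "0 < r" "4 * r * B <= 1"
  from interval_one_sided[OF I t tl]
  show "slope_ge I \<mu> t (shifted (\<mu> t) r (grad \<phi>)) (- (r * L \<phi>))"
  proof
   assume "\<exists>\<delta>>0. \<forall>h\<in>{0<..<\<delta>}. t + h \<in> I"
   then obtain d where d: "0 < d" "!!h. h \<in> {0<..<d} ==> t + h \<in> I" by blast
   have ev: "\<forall>\<^sub>F h in at_right 0. t + h \<in> I" using eventually_at_right_real[OF d(1)] by (rule eventually_mono) (use d(2) in blast)
   have "{0<..<d} \<subseteq> {h. t + h \<in> I}" using d(2) by blast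
   from tendsto_within_subset[OF velocity_difference_quotient[OF P t \<phi> B vL q] this]
   have "((%h. diff_quot \<phi> \<mu> t h) ---> L \<phi>) (at_right 0)"
    unfolding L_def by (subst (asm) at_within_nhd[of 0 "{-d<..<d}" _ "{0<..}"]) (use d(1) in auto)
   from slope_from_right_quotient[OF P t B r ev this] show ?thesis .
  next
   assume "\<exists>\<delta>>0. \<forall>h\<in>{-\<delta><..<0}. t + h \<in> I"
   then obtain d where d: "0 < d" "!!h. h \<in> {-d<..<0} ==> t + h \<in> I" by blast
   have d': "- d < 0" using d by simp
   have ev: "\<forall>\<^sub>F h in at_left 0. t + h \<in> I" using eventually_at_left_real[OF d'] by (rule eventually_mono) (use d(2) in blast)
   have "{-d<..<0} \<subseteq> {h. t + h \<in> I}" using d(2) by blast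
   from tendsto_within_subset[OF q this]
   have "((%h. W2 (shifted (\<mu> t) h (v t)) (\<mu> (t + h)) / abs h) ---> 0) (at_left 0)"
    by (subst (asm) at_within_nhd[of 0 "{-d<..<d}" _ "{..<0}"]) (use d(1) in auto)
   from slope_from_left_velocity[OF P t \<phi> B r ev vL this] show ?thesis unfolding L_def .
  qed
 next
  show "L2_continuous_linear (\<mu> t) (L2norm (\<mu> t) (v t)) L"
  proof (intro allI impI)
  fix n :: nat and a :: "nat => real" and \<phi> :: "nat => 'x => real" and \<psi> :: "'x => real"
  assume "\<forall>k. \<phi> k \<in> Cyl" and \<psi>: "\<psi> \<in> Cyl"
  then have \<phi>: "\<phi> k \<in> Cyl" for k by blast
  note c = gradient_combination_L2[where \<phi> = \<phi> and n = n and a = a, OF \<mu> \<phi> \<psi>]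
  have "(LINT x|\<mu> t. v t x \<bullet> (grad_diff \<psi> n a \<phi> x))
    = (LINT x|\<mu> t. v t x \<bullet> grad \<psi> x - (\<Sum>k<n. a k * (v t x \<bullet> grad (\<phi> k) x)))"
   by (simp add: inner_diff_right inner_sum_right)
  also have "\<dots> = L \<psi> - (\<Sum>k<n. a k * L (\<phi> k))"
   unfolding L_def using L2_inner_diff(2)[OF \<mu> vL Cyl_grad_L2[OF \<mu> \<psi>]] L2_inner_diff(2)[OF \<mu> vL Cyl_grad_L2[OF \<mu> \<phi>]] by simp
  finally show "abs (L \<psi> - (\<Sum>k<n. a k * L (\<phi> k))) <= L2norm (\<mu> t) (v t)
    * L2norm (\<mu> t) (grad_diff \<psi> n a \<phi>)"
   using L2_inner_diff(3)[OF \<mu> vL c] by simp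
  qed
 qed
 then obtain \<Phi> where \<Phi>: "\<Phi> \<in> sw_closed_hull (dir_closure_at F (\<mu> t))" "\<Phi> \<in> TP2" "base \<Phi> = \<mu> t"
  and eq: "!!\<phi>. \<phi> \<in> Cyl ==> tested \<phi> \<Phi> = L \<phi>" by blast
 have "AE x in \<mu> t. v t x = tan_proj (\<mu> t) (barycenter \<Phi>) x"
  by (rule tan_proj_barycenter[OF \<Phi>(2,3) vT]) (simp add: eq L_def)
 then show ?thesis using \<Phi>(1) by blast
qed

section \<open>Differentiability of cylindrical observables\<close>

lemma Cyl_combination_diff_le_W2:
 fixes \<phi> :: "nat => 'x::{real_inner, polish_space} => real"
 assumes \<mu>: "\<mu> \<in> P2" and \<phi>: "!!k. \<phi> k \<in> Cyl" and \<psi>: "\<psi> \<in> Cyl"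
 shows "\<exists>K\<ge>0. \<forall>\<nu>\<in>P2. abs (((LINT x|\<nu>. \<psi> x) - (\<Sum>k<n. a k * (LINT x|\<nu>. \<phi> k x))) - ((LINT x|\<mu>. \<psi> x) - (\<Sum>k<n. a k * (LINT x|\<mu>. \<phi> k x))))
  <= L2norm \<mu> (grad_diff \<psi> n a \<phi>) * W2 \<mu> \<nu> + K * (W2 \<mu> \<nu>)^2"
proof -
 have "\<forall>k. \<exists>B. c11_bound B (\<phi> k)" using Cyl_c11_bound \<phi> by blast
 from choice[OF this] obtain b where b: "!!k. c11_bound (b k) (\<phi> k)" by blast
 obtain B where B: "c11_bound B \<psi>" using Cyl_c11_bound[OF \<psi>] by blast
 define f where "f x = \<psi> x - (\<Sum>k<n. a k * \<phi> k x)" for x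
 define G where "G x = grad_diff \<psi> n a \<phi> x" for x
 define K where "K = B + (\<Sum>k<n. abs (a k) * b k)"
 have K: "0 <= K" unfolding K_def using c11D(1)[OF B] c11D(1)[OF b] by (intro add_nonneg_nonneg sum_nonneg mult_nonneg_nonneg) (auto intro: less_imp_le)
 have [measurable]: "\<phi> k \<in> borel_measurable borel" "\<psi> \<in> borel_measurable borel" for k by (intro Cyl_measurable \<phi> \<psi>)+
 have fm: "f \<in> borel_measurable borel" unfolding f_def[abs_def] by measurable
 have iC: "integrable \<nu> g" if "\<nu> \<in> P2" "g \<in> Cyl" for \<nu> :: "'x measure" and g :: "'x => real"
  using integrable_bounded_P2[OF that(1) Cyl_measurable[OF that(2)]] Cyl_c11_bound[OF that(2)] c11D(2) by blast
 have GL: "G \<in> L2_fields \<mu>" unfolding G_def[abs_def] by (rule gradient_combination_L2[OF \<mu> \<phi> \<psi>])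
 have fe: "integrable \<nu> f \<and> (LINT x|\<nu>. f x) = (LINT x|\<nu>. \<psi> x) - (\<Sum>k<n. a k * (LINT x|\<nu>. \<phi> k x))" if "\<nu> \<in> P2" for \<nu>
  unfolding f_def[abs_def] using iC[OF that \<psi>] iC[OF that \<phi>] by simp
 have tay: "abs (f y - f x) <= norm (G x) * norm (y - x) + K * (norm (y - x))^2" for x y
 proof -
  define w where "w = y - x"
  have e: "f y - f x = G x \<bullet> w + (\<psi> y - \<psi> x - grad \<psi> x \<bullet> w) - (\<Sum>k<n. a k * (\<phi> k y - \<phi> k x - grad (\<phi> k) x \<bullet> w))"
   by (simp add: f_def G_def inner_diff_left inner_sum_left right_diff_distrib sum_subtractf)
  have "abs (\<Sum>k<n. a k * (\<phi> k y - \<phi> k x - grad (\<phi> k) x \<bullet> w)) <= (\<Sum>k<n. abs (a k) * b k * (norm w)^2)"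
  proof (rule sum_abs[THEN order_trans], rule sum_mono)
   fix k
   show "abs (a k * (\<phi> k y - \<phi> k x - grad (\<phi> k) x \<bullet> w)) <= abs (a k) * b k * (norm w)^2"
    using mult_left_mono[OF c11D(5)[OF b[of k], of y x], of "abs (a k)"] by (simp add: abs_mult w_def mult.assoc)
  qed
  also have "\<dots> = (\<Sum>k<n. abs (a k) * b k) * (norm w)^2" by (rule sum_distrib_right[symmetric])
  finally have 1: "abs (\<Sum>k<n. a k * (\<phi> k y - \<phi> k x - grad (\<phi> k) x \<bullet> w)) <= (\<Sum>k<n. abs (a k) * b k) * (norm w)^2" .
  have 2: "abs (\<psi> y - \<psi> x - grad \<psi> x \<bullet> w) <= B * (norm w)^2" unfolding w_def by (rule c11D(5)[OF B])
  have 3: "abs (G x \<bullet> w) <= norm (G x) * norm w" by (rule Cauchy_Schwarz_ineq2)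
  have "abs (f y - f x) <= norm (G x) * norm w + B * (norm w)^2 + (\<Sum>k<n. abs (a k) * b k) * (norm w)^2"
   unfolding e using 1 2 3 by linarith
  then show ?thesis unfolding K_def w_def by (simp add: algebra_simps)
 qed
 have Gm: "(%x. norm (G x)) \<in> borel_measurable borel" and G2: "integrable \<mu> (%x. (norm (G x))^2)" using GL by (auto simp: L2_fields_def)
 have "abs ((LINT x|\<nu>. f x) - (LINT x|\<mu>. f x)) <= L2norm \<mu> G * W2 \<mu> \<nu> + K * (W2 \<mu> \<nu>)^2" if "\<nu> \<in> P2" for \<nu>
  by (rule integral_diff_le_W2[OF \<mu> that fm Gm _ _ G2 tay K]) (use fe[OF \<mu>] fe[OF that] in auto)
 then show ?thesis using K fe \<mu> unfolding G_def by (intro exI[of _ K]) auto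
qed

lemma limit_exists_from_approximations:
 fixes f :: "'a => real"
 assumes F: "F ~= bot" and ap: "!!e. 0 < e ==> \<exists>g l. (g ---> l) F \<and> (\<forall>\<^sub>F x in F. abs (f x - g x) <= e)"
 shows "\<exists>l. (f ---> l) F"
proof -
 have "cauchy_filter (filtermap f F)"
  unfolding cauchy_filter_metric_filtermap
 proof (intro allI impI)
  fix e :: real assume e: "0 < e"
  then have e5: "0 < e / 5" by simp
  obtain g l where g: "(g ---> l) F" "\<forall>\<^sub>F x in F. abs (f x - g x) <= e / 5" using ap[OF e5] by blast
  have "\<forall>\<^sub>F x in F. abs (f x - g x) <= e / 5 \<and> dist (g x) l < e / 5" by (rule eventually_conj[OF g(2) tendstoD[OF g(1) e5]])
  moreover have "dist (f x) (f y) < e" if "abs (f x - g x) <= e / 5 \<and> dist (g x) l < e / 5" "abs (f y - g y) <= e / 5 \<and> dist (g y) l < e / 5" for x y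
   using that unfolding dist_real_def by linarith
  ultimately show "\<exists>P. eventually P F \<and> (\<forall>x y. P x \<and> P y --> dist (f x) (f y) < e)" by blast
 qed
 from cauchy_filter_complete_converges[OF this complete_UNIV]
 obtain c where "filtermap f F <= nhds c" using F by (auto simp: filtermap_bot_iff)
 then show ?thesis unfolding filterlim_def by blast
qed

text \<open>
 Difference quotients are bounded by the \<open>L\<^sup>2\<close> norm of the gradient, up to
 \<open>O(h)\<close>; hence their convergence extends from a family with dense gradients to all cylindrical
 functions.
\<close>
lemma Cyl_observables_derivative:
 fixes \<mu> :: "real => 'x::{real_inner, polish_space} measure"
 assumes P: "\<mu> ` I \<subseteq> P2" and t: "t \<in> interior I"
  and lip: "\<forall>\<^sub>F h in at 0. W2 (\<mu> t) (\<mu> (t + h)) <= C * abs h"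
  and D: "D \<subseteq> Cyl" and dense: "!!\<phi>. \<phi> \<in> Cyl ==> grad_approx D \<phi>"
  and diff: "!!\<phi>. \<phi> \<in> D ==> \<exists>d. ((%s. \<integral>x. \<phi> x \<partial>\<mu> s) has_real_derivative d) (at t)"
 shows "\<exists>L. (\<forall>\<phi>\<in>Cyl. ((%s. \<integral>x. \<phi> x \<partial>\<mu> s) has_real_derivative L \<phi>) (at t)) \<and> L2_continuous_linear (\<mu> t) \<bar>C\<bar> L"
proof -
 have tI: "t \<in> I" using t interior_subset by blast
 have \<mu>: "\<mu> t \<in> P2" using P tI by blast
 define q where "q \<phi> h = diff_quot \<phi> \<mu> t h" for \<phi> :: "'x => real" and h
 have evI: "\<forall>\<^sub>F h in at 0. t + h \<in> I"
 proof -
  obtain e where e: "0 < e" "ball t e \<subseteq> I" using t unfolding mem_interior by blast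
  then show ?thesis unfolding eventually_at by (intro exI[of _ e]) (auto simp: subset_eq dist_real_def)
 qed
 have bound: "\<exists>K\<ge>0. \<forall>\<^sub>F h in at 0. abs (q \<psi> h - (\<Sum>k<n. a k * q (\<phi> k) h))
   <= abs C * L2norm (\<mu> t) (grad_diff \<psi> n a \<phi>) + K * abs h"
  if \<phi>: "!!k. \<phi> k \<in> Cyl" and \<psi>: "\<psi> \<in> Cyl" for n :: nat and a :: "nat => real" and \<phi> :: "nat => 'x => real" and \<psi> :: "'x => real"
 proof -
  define N where "N = L2norm (\<mu> t) (grad_diff \<psi> n a \<phi>)"
  define f where "f \<nu> = (LINT x|\<nu>. \<psi> x) - (\<Sum>k<n. a k * (LINT x|\<nu>. \<phi> k x))" for \<nu>
  obtain K where K: "0 <= K" "!!\<nu>. \<nu> \<in> P2 ==> abs (f \<nu> - f (\<mu> t)) <= N * W2 (\<mu> t) \<nu> + K * (W2 (\<mu> t) \<nu>)^2"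
   using Cyl_combination_diff_le_W2[where \<phi> = \<phi> and n = n and a = a, OF \<mu> \<phi> \<psi>] unfolding f_def N_def by blast
  have N0: "0 <= N" by (simp add: N_def)
  have "\<forall>\<^sub>F h in at 0. abs (q \<psi> h - (\<Sum>k<n. a k * q (\<phi> k) h)) <= abs C * N + K * C^2 * abs h"
   using lip evI eventually_neq_at_within[of 0 0 UNIV]
  proof eventually_elim
   case (elim h)
   have \<mu>h: "\<mu> (t + h) \<in> P2" using P elim(2) by blast
   let ?w = "W2 (\<mu> t) (\<mu> (t + h))"
   have w0: "0 <= ?w" by (rule W2_nonneg[OF \<mu> \<mu>h])
   have wC: "?w <= abs C * abs h" using elim(1) mult_right_mono[OF abs_ge_self[of C] abs_ge_zero[of h]] by linarith
   have "?w^2 <= (abs C * abs h)^2" by (rule power_mono[OF wC w0])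
   then have w2: "?w^2 <= C^2 * abs h * abs h" by (simp add: power2_eq_square abs_mult algebra_simps)
   have "abs (f (\<mu> (t + h)) - f (\<mu> t)) <= N * (abs C * abs h) + K * (C^2 * abs h * abs h)"
    using K(2)[OF \<mu>h] mult_left_mono[OF wC N0] mult_left_mono[OF w2 K(1)] by linarith
   also have "\<dots> = (abs C * N + K * C^2 * abs h) * abs h" by (simp add: algebra_simps)
   finally have fh: "abs (f (\<mu> (t + h)) - f (\<mu> t)) <= (abs C * N + K * C^2 * abs h) * abs h" .
   have hp: "0 < abs h" using elim(3) by simp
   have "abs (f (\<mu> (t + h)) - f (\<mu> t)) / abs h <= abs C * N + K * C^2 * abs h"
    by (rule pos_divide_le_eq[OF hp, THEN iffD2, OF fh])
   moreover have "q \<psi> h - (\<Sum>k<n. a k * q (\<phi> k) h) = (f (\<mu> (t + h)) - f (\<mu> t)) / h"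
    unfolding q_def f_def
    by (simp add: diff_divide_distrib sum_divide_distrib sum_subtractf right_diff_distrib)
   ultimately show ?case by (simp add: abs_divide)
  qed
  then show ?thesis unfolding N_def using K(1) by (intro exI[of _ "K * C^2"]) auto
 qed
 have der: "((%s. \<integral>x. \<phi> x \<partial>\<mu> s) has_real_derivative d) (at t) \<longleftrightarrow> (q \<phi> ---> d) (at 0)" for \<phi> d
  unfolding DERIV_def q_def[abs_def] ..
 have ex: "\<exists>d. (q \<phi> ---> d) (at 0)" if \<phi>: "\<phi> \<in> Cyl" for \<phi>
 proof (rule limit_exists_from_approximations)
  fix e :: real assume e: "0 < e"
  obtain p K where p: "!!n. p n \<in> D" "!!n x. norm (grad (p n) x) <= K" "!!x. (%n. grad (p n) x) ----> grad \<phi> x"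
   using dense[OF \<phi>] by blast
  have pC: "p n \<in> Cyl" for n using p(1) D by blast
  have "(%n. L2norm (\<mu> t) (%x. grad (p n) x - grad \<phi> x)) ----> 0"
   by (rule L2_dominated_limit[OF \<mu> Cyl_grad_measurable[OF pC] Cyl_grad_measurable[OF \<phi>] p(2,3)])
  from tendsto_mult_right_zero[OF this, of "abs C"]
  have z: "(%n. abs C * L2norm (\<mu> t) (%x. grad (p n) x - grad \<phi> x)) ----> 0" .
  have e2: "0 < e / 2" using e by simp
  obtain n where n: "abs C * L2norm (\<mu> t) (%x. grad (p n) x - grad \<phi> x) < e / 2"
   using order_tendstoD(2)[OF z e2] by (auto dest: eventually_happens)
  obtain d where d: "(q (p n) ---> d) (at 0)" using diff[OF p(1)[of n]] unfolding der by blast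
  obtain K' where K': "0 <= K'" "\<forall>\<^sub>F h in at 0. abs (q (p n) h - (\<Sum>k<(1::nat). 1 * q \<phi> h))
    <= abs C * L2norm (\<mu> t) (%x. grad (p n) x - (\<Sum>k<(1::nat). 1 *\<^sub>R grad \<phi> x)) + K' * abs h"
   using bound[where \<phi> = "%_. \<phi>" and n = 1 and a = "%_. 1", OF \<phi> pC[of n]] by blast
  have "((%h. K' * abs h) ---> K' * abs 0) (at 0)" by (intro tendsto_intros)
  then have "((%h. K' * abs h) ---> 0) (at 0)" by simp
  from order_tendstoD(2)[OF this e2] have "\<forall>\<^sub>F h in at 0. K' * abs h < e / 2" .
  with K'(2) have "\<forall>\<^sub>F h in at 0. abs (q \<phi> h - q (p n) h) <= e"
  proof eventually_elim
   case (elim h)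
   then have "abs (q (p n) h - q \<phi> h) <= abs C * L2norm (\<mu> t) (%x. grad (p n) x - grad \<phi> x) + K' * abs h" by simp
   then show ?case using n elim(2) by linarith
  qed
  then show "\<exists>g l. (g ---> l) (at 0) \<and> (\<forall>\<^sub>F h in at 0. abs (q \<phi> h - g h) <= e)" using d by blast
 qed simp
 define L where "L \<phi> = (SOME d. (q \<phi> ---> d) (at 0))" for \<phi>
 have L: "(q \<phi> ---> L \<phi>) (at 0)" if "\<phi> \<in> Cyl" for \<phi> unfolding L_def by (rule someI_ex[OF ex[OF that]])
 have lin: "abs (L \<psi> - (\<Sum>k<n. a k * L (\<phi> k))) <= abs C * L2norm (\<mu> t) (grad_diff \<psi> n a \<phi>)"
  if \<phi>: "!!k. \<phi> k \<in> Cyl" and \<psi>: "\<psi> \<in> Cyl" for n :: nat and a :: "nat => real" and \<phi> :: "nat => 'x => real" and \<psi> :: "'x => real"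
 proof -
  let ?N = "abs C * L2norm (\<mu> t) (grad_diff \<psi> n a \<phi>)"
  obtain K where K: "\<forall>\<^sub>F h in at 0. abs (q \<psi> h - (\<Sum>k<n. a k * q (\<phi> k) h)) <= ?N + K * abs h"
   using bound[where \<phi> = \<phi> and n = n and a = a, OF \<phi> \<psi>] by blast
  have 1: "((%h. abs (q \<psi> h - (\<Sum>k<n. a k * q (\<phi> k) h))) ---> abs (L \<psi> - (\<Sum>k<n. a k * L (\<phi> k)))) (at 0)"
   by (intro tendsto_rabs tendsto_diff tendsto_sum tendsto_mult tendsto_const L \<phi> \<psi>)
  have "((%h. ?N + K * abs h) ---> ?N + K * abs 0) (at 0)" by (intro tendsto_intros)
  from tendsto_le[OF _ this 1 K] show ?thesis by simp
 qed
 show ?thesis using L lin der by (intro exI[of _ L]) blast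
qed

lemma AE_interval_interior:
 assumes "is_interval I" shows "AE t in lborel. t \<in> I --> t \<in> interior I"
proof -
 have "negligible (frontier I)" using assms by (simp add: negligible_convex_frontier is_interval_convex)
 then have "frontier I \<in> null_sets lborel" by (simp add: negligible_iff_null_lborel)
 then have "AE t in lborel. t \<notin> frontier I" by (rule AE_not_in)
 then show ?thesis by (rule eventually_mono) (use closure_subset in "auto simp: frontier_def")
qed

lemma relaxed_barycentric:
 fixes F :: "('x::{real_inner, polish_space} \<times> 'x) measure set"
 assumes F: "mpvf F"
  and dom: "perturbable F"
  and I: "is_interval I" and \<mu>I: "\<mu> ` I \<subseteq> mpvf_dom F" and ac: "loc_abs_cont I \<mu>" and E: "EVI_solution lam F I \<mu>"
 shows "barycentric (%\<nu>. sw_closed_hull (dir_closure_at F \<nu>)) I \<mu>"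
proof -
 have P: "\<mu> ` I \<subseteq> P2" using ac by (simp add: loc_abs_cont_def)
 obtain m where m: "!!a b. a \<in> I ==> b \<in> I ==> a <= b ==> set_integrable lborel {a..b} m"
  and mW: "!!a b. a \<in> I ==> b \<in> I ==> a <= b ==> W2 (\<mu> a) (\<mu> b) <= (LBINT t:{a..b}. m t)"
  using ac unfolding loc_abs_cont_def by blast
 have PI: "\<mu> a \<in> P2" if "a \<in> I" for a using P that by blast
 obtain D :: "('x => real) set" where D: "countable D" "D \<subseteq> Cyl"
  and dense: "!!\<phi>. \<phi> \<in> Cyl ==> grad_approx D \<phi>"
  using Cyl_countable_dense by blast
 have ae1: "AE t in lborel. t \<in> interior I --> (\<exists>d. ((%s. \<integral>x. \<phi> x \<partial>\<mu> s) has_real_derivative d) (at t))" if \<phi>: "\<phi> \<in> Cyl" for \<phi>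
 proof -
  obtain B where B: "c11_bound B \<phi>" using Cyl_c11_bound[OF \<phi>] by blast
  show ?thesis
  proof (rule AE_interior_differentiable[where m = "%t. B * m t", OF _ _ I])
   fix a b assume ab: "a \<in> I" "b \<in> I" "a <= b"
   show "set_integrable lborel {a..b} (%t. B * m t)" using m[OF ab] by simp
   interpret prob_space "\<mu> a" by (rule P2D[OF PI[OF ab(1)]])
   have \<phi>I: "integrable (\<mu> s) \<phi>" if "s \<in> I" for s
    by (rule integrable_bounded_P2[OF PI[OF that] Cyl_measurable[OF \<phi>]]) (rule c11D(2)[OF B])
   have "abs ((LINT x|\<mu> b. \<phi> x) - (LINT x|\<mu> a. \<phi> x)) <= sqrt (LINT x|\<mu> a. B^2) * W2 (\<mu> a) (\<mu> b) + 0 * (W2 (\<mu> a) (\<mu> b))^2"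
    by (rule integral_diff_le_W2[OF PI[OF ab(1)] PI[OF ab(2)] Cyl_measurable[OF \<phi>] _ \<phi>I[OF ab(1)] \<phi>I[OF ab(2)]])
     (use c11_lipschitz[OF B] in auto)
   also have "\<dots> = B * W2 (\<mu> a) (\<mu> b)" using c11D(1)[OF B] by (simp add: prob_space)
   also have "\<dots> <= B * (LBINT t:{a..b}. m t)" using mW[OF ab] c11D(1)[OF B] by (intro mult_left_mono) auto
   finally show "abs ((LINT x|\<mu> b. \<phi> x) - (LINT x|\<mu> a. \<phi> x)) <= (LBINT t:{a..b}. B * m t)" by simp
  qed
 qed
 have ae2: "AE t in lborel. \<forall>\<phi>\<in>D. t \<in> interior I --> (\<exists>d. ((%s. \<integral>x. \<phi> x \<partial>\<mu> s) has_real_derivative d) (at t))"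
  using D(2) by (intro AE_ball_countable[THEN iffD2] D(1) ballI ae1) auto
 have ae3: "AE t in lborel. t \<in> interior I --> (\<exists>C. \<forall>\<^sub>F h in at 0. W2 (\<mu> t) (\<mu> (t + h)) <= C * abs h)"
  by (rule AE_interior_quotient_bounded[OF m _ I]) (use W2_nonneg PI W2_commute mW in blast)+
 show ?thesis
  unfolding barycentric_def using ae2 ae3 AE_interval_interior[OF I]
 proof eventually_elim
  case (elim t)
  show ?case
  proof
   assume tI: "t \<in> I"
   then have t: "t \<in> interior I" using elim(3) by blast
   obtain C where C: "\<forall>\<^sub>F h in at 0. W2 (\<mu> t) (\<mu> (t + h)) <= C * abs h" using elim(2) t by blast
   have diff: "\<exists>d. ((%s. \<integral>x. \<phi> x \<partial>\<mu> s) has_real_derivative d) (at t)" if "\<phi> \<in> D" for \<phi> using elim(1) t that by blast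
   obtain L where L: "!!\<phi>. \<phi> \<in> Cyl ==> ((%s. \<integral>x. \<phi> x \<partial>\<mu> s) has_real_derivative L \<phi>) (at t)"
    and lin: "L2_continuous_linear (\<mu> t) \<bar>C\<bar> L"
    using Cyl_observables_derivative[OF P t C D(2) dense diff] by blast
   have "\<exists>\<Phi>\<in>sw_closed_hull (dir_closure_at F (\<mu> t)). \<Phi> \<in> TP2 \<and> base \<Phi> = \<mu> t \<and>
     (\<forall>\<phi>\<in>Cyl. tested \<phi> \<Phi> = L \<phi>)"
   proof (rule evi_velocity_plan[OF F dom I \<mu>I E tI])
    fix \<phi> :: "'x => real" and B r :: real assume \<phi>: "\<phi> \<in> Cyl" and B: "c11_bound B \<phi>" and r: "0 < r" "4 * r * B <= 1"
    obtain d where d: "0 < d" "ball t d \<subseteq> I" using t unfolding mem_interior by blast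
    have ev: "\<forall>\<^sub>F h in at_right 0. t + h \<in> I"
     using eventually_at_right_real[OF d(1)] by (rule eventually_mono) (use d(2) in "auto simp: subset_eq dist_real_def")
    have "((%h. diff_quot \<phi> \<mu> t h) ---> L \<phi>) (at_right 0)"
     using L[OF \<phi>] unfolding DERIV_def by (rule tendsto_within_subset) simp
    from slope_from_right_quotient[OF P tI B r ev this]
    show "slope_ge I \<mu> t (shifted (\<mu> t) r (grad \<phi>)) (- (r * L \<phi>))" .
   qed (rule lin)
   then obtain \<Phi> where \<Phi>: "\<Phi> \<in> sw_closed_hull (dir_closure_at F (\<mu> t))"
    and eq: "!!\<phi>. \<phi> \<in> Cyl ==> tested \<phi> \<Phi> = L \<phi>" by blast
   show "\<exists>\<Phi>\<in>sw_closed_hull (dir_closure_at F (\<mu> t)). \<forall>\<phi>\<in>Cyl.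
     ((%s. \<integral>x. \<phi> x \<partial>\<mu> s) has_real_derivative (LINT (x, v)|\<Phi>. grad \<phi> x \<bullet> v)) (at t within I)"
    using eq L by (intro bexI[OF _ \<Phi>] ballI) (auto simp: split_beta' intro: has_field_derivative_at_within)
  qed
 qed
qed

text \<open>
 A convergent sequence in the section is a directional approximation along the zero function, so that
 directional closedness makes the section closed.
\<close>
lemma closed_hull_subset_section:
 fixes F :: "('x::{real_inner, polish_space} \<times> 'x) measure set"
 assumes F: "mpvf F" and cl: "dir_closure F = F" and \<nu>: "\<nu> \<in> mpvf_dom F" and conv: "convex_measures (mpvf_section F \<nu>)"
 shows "sw_closed_hull (dir_closure_at F \<nu>) \<subseteq> mpvf_section F \<nu>"
proof -
 have FT: "F \<subseteq> TP2" using F by (simp add: mpvf_def)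
 have \<nu>P: "\<nu> \<in> P2" using \<nu> FT base_P2 unfolding mpvf_dom_def by blast
 have sub: "dir_closure_at F \<nu> \<subseteq> mpvf_section F \<nu>"
 proof
  fix \<Phi> assume \<Phi>: "\<Phi> \<in> dir_closure_at F \<nu>"
  then have "\<Phi> \<in> F" using cl \<nu>P unfolding dir_closure_def by blast
  moreover have "base \<Phi> = \<nu>"
  proof -
   obtain \<phi> r \<Psi> where \<phi>: "\<phi> \<in> Cyl" and r: "r ----> 0"
    and \<Psi>: "!!n. \<Psi> n \<in> mpvf_section F (distr \<nu> borel (exp_cyl (%x. r n * \<phi> x)))"
    and lim: "limitin sw_topology \<Psi> \<Phi> sequentially"
    using \<Phi> unfolding dir_closure_at_def by blast
   have e: "exp_cyl (%x. r n * \<phi> x) = (%x. x + r n *\<^sub>R grad \<phi> x)" for n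
    by (rule ext) (simp add: exp_cyl_def Cyl_scale(2)[OF \<phi>])
   show ?thesis
   proof (rule base_limit[OF _ \<nu>P _ _ _ lim])
    show "\<Psi> n \<in> TP2" for n using \<Psi>[of n] FT by (auto simp: mpvf_section_def)
    show "(%x. x + r n *\<^sub>R grad \<phi> x) \<in> borel_measurable borel" for n using Cyl_grad_measurable[OF \<phi>] by measurable
    show "base (\<Psi> n) = shifted \<nu> (r n) (grad \<phi>)" for n using \<Psi>[of n] unfolding e by (simp add: mpvf_section_def)
    show "(%n. x + r n *\<^sub>R grad \<phi> x) ----> x" for x
    proof -
     have "(%n. x + r n *\<^sub>R grad \<phi> x) ----> x + 0 *\<^sub>R grad \<phi> x" by (intro tendsto_intros r)
     then show ?thesis by simp
    qed
   qed
  qed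
  ultimately show "\<Phi> \<in> mpvf_section F \<nu>" by (simp add: mpvf_section_def)
 qed
 have hull: "convex_measures hull dir_closure_at F \<nu> \<subseteq> mpvf_section F \<nu>" by (rule hull_minimal[where S = convex_measures, OF sub conv])
 show ?thesis
 proof
  fix \<Phi> assume "\<Phi> \<in> sw_closed_hull (dir_closure_at F \<nu>)"
  then obtain \<Psi> where \<Psi>: "!!n. \<Psi> n \<in> mpvf_section F \<nu>" and lim: "limitin sw_topology \<Psi> \<Phi> sequentially"
   using hull unfolding sw_closed_hull_def by blast
  have e: "exp_cyl (%x. 0 * 0) = (%x::'x. x)"
   by (rule ext) (simp only: exp_cyl_def Cyl_scale(2)[OF Cyl_zero] scaleR_zero_left add_0_right)
  have id: "distr \<nu> borel (exp_cyl (%x. 0 * 0)) = \<nu>" unfolding e by (rule distr_id2) (simp add: P2D[OF \<nu>P])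
  have "\<Phi> \<in> dir_closure_at F \<nu>"
   unfolding dir_closure_at_def
  proof (intro CollectI conjI bexI[OF _ Cyl_zero] exI[of _ "%_. 0"] exI[of _ \<Psi>] allI)
   show "\<Phi> \<in> TP2" using lim unfolding limitin_def by simp
   show "\<Psi> n \<in> mpvf_section F (distr \<nu> borel (exp_cyl (%x. 0 * 0)))" for n unfolding id by (rule \<Psi>)
  qed (use lim in auto)
  then show "\<Phi> \<in> mpvf_section F \<nu>" using sub by blast
 qed
qed

theorem theorem6p27:
  fixes F :: "('x::{real_inner, polish_space} \<times> 'x) measure set"
    and lam :: real
    and I :: "real set"
    and \<mu> :: "real \<Rightarrow> 'x measure"
  assumes "mpvf F"
    and "dissipative lam F"
    and "\<forall>\<nu>\<in>mpvf_dom F. \<exists>M>0. \<exists>\<epsilon>>0. \<forall>\<phi>\<in>Cyl. (\<forall>x. norm (grad \<phi> x) \<le> \<epsilon>) \<longrightarrow>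
           distr \<nu> borel (exp_cyl \<phi>) \<in> mpvf_dom F \<and>
           mpvf_norm F (distr \<nu> borel (exp_cyl \<phi>)) < M"
    and "is_interval I"
    and "\<mu> ` I \<subseteq> mpvf_dom F"
    and "loc_abs_cont I \<mu>"
    and "EVI_solution lam F I \<mu>"
  shows "(\<forall>v A. velocity_field I \<mu> v A \<longrightarrow>
            (\<forall>t\<in>A. \<exists>\<Phi>\<in>sw_closed_hull (dir_closure_at F (\<mu> t)).
               AE x in \<mu> t. v t x = tan_proj (\<mu> t) (barycenter \<Phi>) x))
       \<and> barycentric (\<lambda>\<nu>. sw_closed_hull (dir_closure_at F \<nu>)) I \<mu>
       \<and> (dir_closure F = F \<and> (\<forall>\<nu>\<in>mpvf_dom F. convex_measures (mpvf_section F \<nu>))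
            \<longrightarrow> barycentric (mpvf_section F) I \<mu>)"
proof (intro conjI allI impI ballI)
 show rel: "barycentric (%\<nu>. sw_closed_hull (dir_closure_at F \<nu>)) I \<mu>"
  by (rule relaxed_barycentric[OF assms(1,3-7)])
 show "\<exists>\<Phi>\<in>sw_closed_hull (dir_closure_at F (\<mu> t)). AE x in \<mu> t. v t x = tan_proj (\<mu> t) (barycenter \<Phi>) x"
  if "velocity_field I \<mu> v A" "t \<in> A" for v A t
  by (rule velocity_field_selection[OF assms(1,3-5,7) that])
 assume c: "dir_closure F = F \<and> (\<forall>\<nu>\<in>mpvf_dom F. convex_measures (mpvf_section F \<nu>))"
 have "sw_closed_hull (dir_closure_at F (\<mu> t)) \<subseteq> mpvf_section F (\<mu> t)" if "t \<in> I" for t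
  using closed_hull_subset_section[OF assms(1)] c assms(5) that by blast
 then show "barycentric (mpvf_section F) I \<mu>"
  using rel unfolding barycentric_def by (auto elim!: eventually_mono)
qed

end
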